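(* Let $G$ be a finitely generated group. (1) $\Delta^G=0$ if and only if $\mathbb{T}_G^0\subset\mathcal{V}_1(G)$. In this case, $\mathcal{W}_1(G)=\emptyset$. (2) If $b_1(G)\ge1$ and $\Delta^G\ne0$, then $\mathcal{W}_1(G)=V(\Delta^G)$ if $b_1(G)>1$, and $\mathcal{W}_1(G)=V(\Delta^G)\coprod\{1\}$ (disjoint union) if $b_1(G)=1$. (3) If $b_1(G)\ge2$, then $\mathcal{W}_1(G)=\emptyset$ if and only if $\Delta^G\doteq\mathrm{const}$.
   Context: Let $G$ be a finitely generated group, $n=b_1(G)$, and $G_{\mathrm{abf}}=G_{\mathrm{ab}}/\mathrm{Torsion}\cong\mathbb{Z}^n$. Identify $\mathbb{Z}[G_{\mathrm{abf}}]$ with $\Lambda_n=\mathbb{Z}[t_1^{\pm1},\dots,t_n^{\pm1}]$. Let $\mathbb{T}_G=\mathrm{Hom}(G,\mathbb{C}^* )$, with identity component $\mathbb{T}_G^0=\mathrm{Hom}(G_{\mathrm{abf}},\mathbb{C}^* )\cong(\mathbb{C}^* )^n$, whose coordinate ring is $\mathbb{C}[G_{\mathrm{abf}}]$. For $\rho\in\mathbb{T}_G$, let $\mathbb{C}_\rho$ be the corresponding rank one local system, and let $\mathcal{V}_1(G)=\{\rho\in\mathbb{T}_G\mid\dim_{\mathbb{C}}H_1(G;\mathbb{C}_\rho)\ge1\}$. Denote by $\mathcal{W}_1(G)$ the union of all codimension-one irreducible components of $\mathcal{V}_1(G)$ which are contained in $\mathbb{T}_G^0$. The Alexander module is $A_G=\mathbb{Z}[G_{\mathrm{abf}}]\otimes_{\mathbb{Z}[G]}I_G$,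 where $I_G$ is the augmentation ideal of $\mathbb{Z}[G]$. If $\Lambda_n^h\to\Lambda_n^m\to A_G\to0$ is a presentation, $\mathcal{E}_1(A_G)$ is the ideal generated by the minors of size $m-1$ of the presentation matrix (equal to $\Lambda_n$ if $m\le1$, and to $0$ if $m-1>h$). The Alexander polynomial $\Delta^G\in\Lambda_n$ is the greatest common divisor of all elements of $\mathcal{E}_1(A_G)$, well defined up to units of $\Lambda_n$; $\doteq$ denotes equality up to units of $\Lambda_n$. One writes $\Delta\doteq\mathrm{const}$ if $\Delta\doteq c$ for some $c\in\mathbb{Z}$ (including $c=0$). $V(\Delta^G)$ is the zero set of $\Delta^G$ in $\mathbb{T}_G^0=(\mathbb{C}^* )^n$. *)

theory Defs
  imports
    "HOL-Analysis.Abstract_Topology"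
    "HOL-Library.Extended_Nat"
    "HOL-Algebra.Algebra"
    "Jordan_Normal_Form.VS_Connect"
begin

section \<open>Abelianizations\<close>

definition finitely_generated :: "('a, 'b) monoid_scheme \<Rightarrow> bool" where
  "finitely_generated G \<longleftrightarrow> (\<exists>S \<subseteq> carrier G. finite S \<and> generate G S = carrier G)"

definition abelianization :: "('a, 'b) monoid_scheme \<Rightarrow> 'a set monoid" where
  "abelianization G = G Mod derived G (carrier G)"

definition torsion_elements :: "('a, 'b) monoid_scheme \<Rightarrow> 'a set" where
  "torsion_elements A = {x \<in> carrier A. \<exists>n::nat. n > 0 \<and> x [^]\<^bsub>A\<^esub> n = \<one>\<^bsub>A\<^esub>}"

definition abf :: "('a, 'b) monoid_scheme \<Rightarrow> 'a set set monoid" where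
  "abf G = abelianization G Mod torsion_elements (abelianization G)"

definition abf_proj :: "('a, 'b) monoid_scheme \<Rightarrow> 'a \<Rightarrow> 'a set set" where
  "abf_proj G x =
     torsion_elements (abelianization G) #>\<^bsub>abelianization G\<^esub> (derived G (carrier G) #>\<^bsub>G\<^esub> x)"

text \<open>The rank of the free abelian group \<open>abf G\<close>; meaningful when \<open>G\<close> is finitely generated.\<close>

definition b1 :: "('a, 'b) monoid_scheme \<Rightarrow> nat" where
  "b1 G = (THE n. abf G \<cong> free_Abelian_group {..<n})"


section \<open>Group rings\<close>

definition group_ring :: "('g, 'b) monoid_scheme \<Rightarrow> ('g \<Rightarrow>\<^sub>0 'r::comm_ring_1) ring" where
  "group_ring G =
     \<lparr>carrier = {f. Poly_Mapping.keys f \<subseteq> carrier G},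
      monoid.mult = (\<lambda>f g. \<Sum>x\<in>Poly_Mapping.keys f. \<Sum>y\<in>Poly_Mapping.keys g.
        Poly_Mapping.single (x \<otimes>\<^bsub>G\<^esub> y) (Poly_Mapping.lookup f x * Poly_Mapping.lookup g y)),
      one = Poly_Mapping.single \<one>\<^bsub>G\<^esub> 1,
      ring.zero = 0,
      ring.add = (+)\<rparr>"

abbreviation int_group_ring :: "('g, 'b) monoid_scheme \<Rightarrow> ('g \<Rightarrow>\<^sub>0 int) ring" where
  "int_group_ring \<equiv> group_ring"

text \<open>
  \<open>int_group_ring (abf G)\<close> plays the role of the ring of Laurent polynomials in \<open>b1 G\<close> variables;
  no basis of \<open>abf G\<close> is chosen.
\<close>

abbreviation Lambda :: "('a, 'b) monoid_scheme \<Rightarrow> ('a set set \<Rightarrow>\<^sub>0 int) ring" where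
  "Lambda G \<equiv> int_group_ring (abf G)"

definition group_ring_map :: "('g \<Rightarrow> 'h) \<Rightarrow> ('g \<Rightarrow>\<^sub>0 int) \<Rightarrow> ('h \<Rightarrow>\<^sub>0 int)" where
  "group_ring_map p = frag_extend (\<lambda>x. frag_of (p x))"

definition augmentation :: "('g \<Rightarrow>\<^sub>0 int) \<Rightarrow> int" where
  "augmentation f = (\<Sum>x\<in>Poly_Mapping.keys f. Poly_Mapping.lookup f x)"

text \<open>
  The record type \<open>module\<close> is also used for left modules over noncommutative rings. Its ring
  fields \<open>mult\<close> and \<open>one\<close> play no role for modules and are left undefined.
\<close>

definition augmentation_ideal ::
    "('g, 'b) monoid_scheme \<Rightarrow> ('g \<Rightarrow>\<^sub>0 int, 'g \<Rightarrow>\<^sub>0 int) module" where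
  "augmentation_ideal G =
     \<lparr>carrier = {f \<in> carrier (int_group_ring G). augmentation f = 0},
      monoid.mult = undefined, one = undefined, ring.zero = 0, ring.add = (+),
      module.smult = (\<lambda>r f. r \<otimes>\<^bsub>int_group_ring G\<^esub> f)\<rparr>"


section \<open>Quotient modules and extension of scalars\<close>

definition quotient_module :: "('r, 'm, 'x) module_scheme \<Rightarrow> 'm set \<Rightarrow> ('r, 'm set) module" where
  "quotient_module M N =
     \<lparr>carrier = a_rcosets\<^bsub>M\<^esub> N, monoid.mult = undefined, one = undefined, ring.zero = N,
      ring.add = set_add M,
      module.smult = (\<lambda>r K. \<Union>x\<in>K. N +>\<^bsub>M\<^esub> (r \<odot>\<^bsub>M\<^esub> x))\<rparr>"

text \<open>
  For a ring homomorphism \<open>\<phi>\<close> from \<open>R\<close> to \<open>B\<close> and a left \<open>R\<close>-module \<open>M\<close>, \<open>base_change R B \<phi> M\<close> is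
  the left \<open>B\<close>-module \<open>B \<otimes>\<^sub>R M\<close>, where \<open>R\<close> acts on \<open>B\<close> from the right through \<open>\<phi>\<close>. It is the free
  abelian group on the symbols \<open>(b, x)\<close> modulo the usual relations.
\<close>

definition base_change_relations ::
    "('r, 'p) ring_scheme \<Rightarrow> ('b, 'q) ring_scheme \<Rightarrow> ('r \<Rightarrow> 'b) \<Rightarrow> ('r, 'm, 'x) module_scheme \<Rightarrow>
     ('b \<times> 'm \<Rightarrow>\<^sub>0 int) set" where
  "base_change_relations R B \<phi> M =
     {frag_of (b \<oplus>\<^bsub>B\<^esub> b', x) - frag_of (b, x) - frag_of (b', x) | b b' x.
        b \<in> carrier B \<and> b' \<in> carrier B \<and> x \<in> carrier M} \<union>
     {frag_of (b, x \<oplus>\<^bsub>M\<^esub> x') - frag_of (b, x) - frag_of (b, x') | b x x'.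
        b \<in> carrier B \<and> x \<in> carrier M \<and> x' \<in> carrier M} \<union>
     {frag_of (b \<otimes>\<^bsub>B\<^esub> \<phi> r, x) - frag_of (b, r \<odot>\<^bsub>M\<^esub> x) | b r x.
        b \<in> carrier B \<and> r \<in> carrier R \<and> x \<in> carrier M}"

definition base_change ::
    "('r, 'p) ring_scheme \<Rightarrow> ('b, 'q) ring_scheme \<Rightarrow> ('r \<Rightarrow> 'b) \<Rightarrow> ('r, 'm, 'x) module_scheme \<Rightarrow>
     ('b, ('b \<times> 'm \<Rightarrow>\<^sub>0 int) set) module" where
  "base_change R B \<phi> M =
     (let F = free_Abelian_group (carrier B \<times> carrier M)
      in quotient_module
           \<lparr>carrier = carrier F, monoid.mult = undefined, one = undefined, ring.zero = 0, ring.add = (+),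
            module.smult = (\<lambda>b. frag_extend (\<lambda>(b', x). frag_of (b \<otimes>\<^bsub>B\<^esub> b', x)))\<rparr>
           (generate F (base_change_relations R B \<phi> M)))"


section \<open>The Alexander polynomial\<close>

definition alexander_module ::
    "('a, 'b) monoid_scheme \<Rightarrow>
     ('a set set \<Rightarrow>\<^sub>0 int, (('a set set \<Rightarrow>\<^sub>0 int) \<times> ('a \<Rightarrow>\<^sub>0 int) \<Rightarrow>\<^sub>0 int) set) module" where
  "alexander_module G =
     base_change (int_group_ring G) (Lambda G) (group_ring_map (abf_proj G)) (augmentation_ideal G)"

text \<open>
  \<open>is_presentation R M m h P\<close> says that there is an exact sequence
  \<open>R\<^sup>h \<rightarrow> R\<^sup>m \<rightarrow> M \<rightarrow> 0\<close> in which the first map sends the \<open>i\<close>-th basis vector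
  to the \<open>i\<close>-th row of \<open>P\<close> (\<open>i < h\<close>), and the second map sends the \<open>j\<close>-th basis vector to \<open>x j\<close>
  (\<open>j < m\<close>).
\<close>

definition is_presentation ::
    "('r, 'p) ring_scheme \<Rightarrow> ('r, 'm, 'x) module_scheme \<Rightarrow> nat \<Rightarrow> nat \<Rightarrow> (nat \<Rightarrow> nat \<Rightarrow> 'r) \<Rightarrow> bool" where
  "is_presentation R M m h P \<longleftrightarrow>
     (\<forall>i<h. \<forall>j<m. P i j \<in> carrier R) \<and>
     (\<exists>x \<in> {..<m} \<rightarrow> carrier M.
        (\<forall>y \<in> carrier M. \<exists>c \<in> {..<m} \<rightarrow> carrier R. y = (\<Oplus>\<^bsub>M\<^esub>j\<in>{..<m}. c j \<odot>\<^bsub>M\<^esub> x j)) \<and>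
        (\<forall>c \<in> {..<m} \<rightarrow> carrier R.
           (\<Oplus>\<^bsub>M\<^esub>j\<in>{..<m}. c j \<odot>\<^bsub>M\<^esub> x j) = \<zero>\<^bsub>M\<^esub> \<longleftrightarrow>
           (\<exists>d \<in> {..<h} \<rightarrow> carrier R. \<forall>j<m. c j = (\<Oplus>\<^bsub>R\<^esub>i\<in>{..<h}. d i \<otimes>\<^bsub>R\<^esub> P i j))))"

definition ring_det :: "('r, 'p) ring_scheme \<Rightarrow> nat \<Rightarrow> (nat \<Rightarrow> nat \<Rightarrow> 'r) \<Rightarrow> 'r" where
  "ring_det R k A =
     (\<Oplus>\<^bsub>R\<^esub>\<sigma>\<in>{\<sigma>. \<sigma> permutes {..<k}}.
        (if evenperm \<sigma> then \<one>\<^bsub>R\<^esub> else \<ominus>\<^bsub>R\<^esub> \<one>\<^bsub>R\<^esub>) \<otimes>\<^bsub>R\<^esub> (\<Otimes>\<^bsub>R\<^esub>i\<in>{..<k}. A i (\<sigma> i)))"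

definition minors ::
    "('r, 'p) ring_scheme \<Rightarrow> nat \<Rightarrow> nat \<Rightarrow> nat \<Rightarrow> (nat \<Rightarrow> nat \<Rightarrow> 'r) \<Rightarrow> 'r set" where
  "minors R k h m P =
     {ring_det R k (\<lambda>i j. P (r i) (c j)) | r c.
        strict_mono_on {..<k} r \<and> r ` {..<k} \<subseteq> {..<h} \<and>
        strict_mono_on {..<k} c \<and> c ` {..<k} \<subseteq> {..<m}}"

text \<open>
  For \<open>m \<le> 1\<close> the truncated difference is \<open>0\<close>, the only minor is the empty determinant \<open>1\<close>, and the
  ideal is the whole ring. For \<open>m - 1 > h\<close> there are no minors and the ideal is zero.
\<close>

definition elementary_ideal1 ::
    "('r, 'p) ring_scheme \<Rightarrow> nat \<Rightarrow> nat \<Rightarrow> (nat \<Rightarrow> nat \<Rightarrow> 'r) \<Rightarrow> 'r set" where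
  "elementary_ideal1 R h m P = Idl\<^bsub>R\<^esub> (minors R (m - 1) h m P)"

definition is_gcd_of_set :: "('r, 'p) monoid_scheme \<Rightarrow> 'r set \<Rightarrow> 'r \<Rightarrow> bool" where
  "is_gcd_of_set R S d \<longleftrightarrow>
     d \<in> carrier R \<and> (\<forall>a\<in>S. d divides\<^bsub>R\<^esub> a) \<and>
     (\<forall>e\<in>carrier R. (\<forall>a\<in>S. e divides\<^bsub>R\<^esub> a) \<longrightarrow> e divides\<^bsub>R\<^esub> d)"

text \<open>
  The Alexander polynomial is only defined up to units (and through an arbitrary presentation),
  hence it is rendered as a predicate satisfied by all its representatives.
\<close>

definition is_alexander_polynomial ::
    "('a, 'b) monoid_scheme \<Rightarrow> ('a set set \<Rightarrow>\<^sub>0 int) \<Rightarrow> bool" where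
  "is_alexander_polynomial G \<Delta> \<longleftrightarrow>
     (\<exists>m h P. is_presentation (Lambda G) (alexander_module G) m h P \<and>
              is_gcd_of_set (Lambda G) (elementary_ideal1 (Lambda G) h m P) \<Delta>)"

definition const_up_to_units :: "('g, 'b) monoid_scheme \<Rightarrow> ('g \<Rightarrow>\<^sub>0 int) \<Rightarrow> bool" where
  "const_up_to_units A f \<longleftrightarrow>
     (\<exists>u \<in> Units (int_group_ring A). \<exists>c::int.
        f = u \<otimes>\<^bsub>int_group_ring A\<^esub> Poly_Mapping.single \<one>\<^bsub>A\<^esub> c)"


section \<open>Character tori\<close>

definition nonzero_complex :: "complex monoid" where
  "nonzero_complex = \<lparr>carrier = - {0}, monoid.mult = (*), one = 1\<rparr>"

text \<open>Characters are made extensional, so that equality of functions is equality of characters.\<close>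

definition char_torus :: "('g, 'b) monoid_scheme \<Rightarrow> ('g \<Rightarrow> complex) set" where
  "char_torus G = hom G nonzero_complex \<inter> extensional (carrier G)"

definition trivial_char :: "('g, 'b) monoid_scheme \<Rightarrow> 'g \<Rightarrow> complex" where
  "trivial_char G = (\<lambda>x\<in>carrier G. 1)"

definition char_eval :: "('g \<Rightarrow> complex) \<Rightarrow> ('g \<Rightarrow>\<^sub>0 complex) \<Rightarrow> complex" where
  "char_eval \<rho> f = (\<Sum>x\<in>Poly_Mapping.keys f. Poly_Mapping.lookup f x * \<rho> x)"

definition pullback_char :: "('a, 'b) monoid_scheme \<Rightarrow> ('a set set \<Rightarrow> complex) \<Rightarrow> 'a \<Rightarrow> complex" where
  "pullback_char G \<chi> = (\<lambda>x\<in>carrier G. \<chi> (abf_proj G x))"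

text \<open>The identity component of \<open>char_torus G\<close>, that is \<open>Hom(abf G, \<complex>\<^sup>*)\<close> inside \<open>Hom(G, \<complex>\<^sup>*)\<close>.\<close>

definition char_torus0 :: "('a, 'b) monoid_scheme \<Rightarrow> ('a \<Rightarrow> complex) set" where
  "char_torus0 G = pullback_char G ` char_torus (abf G)"

definition zero_locus :: "('a, 'b) monoid_scheme \<Rightarrow> ('a set set \<Rightarrow>\<^sub>0 int) \<Rightarrow> ('a \<Rightarrow> complex) set" where
  "zero_locus G f =
     pullback_char G ` {\<chi> \<in> char_torus (abf G). char_eval \<chi> (Poly_Mapping.map of_int f) = 0}"

text \<open>
  The sets where a regular function does not vanish form a basis of the Zariski topology. The
  regular functions on \<open>char_torus G\<close> are those given by elements of \<open>\<complex>[G]\<close>; they factor through the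
  coordinate ring, which is the group ring of the abelianization.
\<close>

definition zariski :: "('g, 'b) monoid_scheme \<Rightarrow> ('g \<Rightarrow> complex) topology" where
  "zariski G = topology_generated_by
     {{\<rho> \<in> char_torus G. char_eval \<rho> f \<noteq> 0} | f. f \<in> carrier (group_ring G)}"

definition irreducible_in :: "'t topology \<Rightarrow> 't set \<Rightarrow> bool" where
  "irreducible_in T S \<longleftrightarrow>
     S \<subseteq> topspace T \<and> S \<noteq> {} \<and>
     (\<forall>C D. closedin T C \<and> closedin T D \<and> S \<subseteq> C \<union> D \<longrightarrow> S \<subseteq> C \<or> S \<subseteq> D)"

definition irreducible_components :: "'t topology \<Rightarrow> 't set \<Rightarrow> 't set set" where
  "irreducible_components T V =
     {Z. irreducible_in T Z \<and> Z \<subseteq> V \<and>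
         (\<forall>Z'. irreducible_in T Z' \<and> Z \<subseteq> Z' \<and> Z' \<subseteq> V \<longrightarrow> Z' = Z)}"

definition codimension :: "'t topology \<Rightarrow> 't set \<Rightarrow> enat" where
  "codimension T Z =
     Sup {enat k | k. \<exists>C. C 0 = Z \<and> (\<forall>i\<le>k. irreducible_in T (C i) \<and> closedin T (C i)) \<and>
                         (\<forall>i<k. C i \<subset> C (Suc i))}"


section \<open>Homology with coefficients in a rank one local system\<close>

text \<open>
  The complex \<open>\<complex>\<^sub>\<rho> \<otimes>\<^bsub>\<int>[G]\<^esub> B\<close>, where \<open>B\<close> is the (unnormalized, inhomogeneous) bar resolution of
  \<open>\<int>\<close> by free left \<open>\<int>[G]\<close>-modules and \<open>g \<in> G\<close> acts on the right of \<open>\<complex>\<^sub>\<rho> = \<complex>\<close> as multiplication by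
  \<open>\<rho> g\<close>. In degree \<open>q\<close> it has the basis of all bar symbols, here lists, of length \<open>q\<close>.
\<close>

definition bar_chains :: "('g, 'b) monoid_scheme \<Rightarrow> nat \<Rightarrow> (complex, 'g list \<Rightarrow>\<^sub>0 complex) module" where
  "bar_chains G q =
     \<lparr>carrier = {c. Poly_Mapping.keys c \<subseteq> {xs. length xs = q \<and> set xs \<subseteq> carrier G}},
      monoid.mult = undefined, one = undefined, ring.zero = 0, ring.add = (+),
      module.smult = (\<lambda>a. Poly_Mapping.map ((*) a))\<rparr>"

fun bar_boundary_symbol ::
    "('g, 'b) monoid_scheme \<Rightarrow> ('g \<Rightarrow> complex) \<Rightarrow> 'g list \<Rightarrow> ('g list \<Rightarrow>\<^sub>0 complex)" where
  "bar_boundary_symbol G \<rho> [] = 0"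
| "bar_boundary_symbol G \<rho> (x # xs) =
     Poly_Mapping.single xs (\<rho> x) +
     (\<Sum>i<length xs. Poly_Mapping.single
        (take i (x # xs) @ [(x # xs) ! i \<otimes>\<^bsub>G\<^esub> (x # xs) ! Suc i] @ drop (i + 2) (x # xs))
        ((-1) ^ Suc i)) +
     Poly_Mapping.single (butlast (x # xs)) ((-1) ^ length (x # xs))"

definition bar_boundary ::
    "('g, 'b) monoid_scheme \<Rightarrow> ('g \<Rightarrow> complex) \<Rightarrow> ('g list \<Rightarrow>\<^sub>0 complex) \<Rightarrow> ('g list \<Rightarrow>\<^sub>0 complex)" where
  "bar_boundary G \<rho> c =
     (\<Sum>xs\<in>Poly_Mapping.keys c.
        Poly_Mapping.map ((*) (Poly_Mapping.lookup c xs)) (bar_boundary_symbol G \<rho> xs))"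

definition group_homology ::
    "nat \<Rightarrow> ('g, 'b) monoid_scheme \<Rightarrow> ('g \<Rightarrow> complex) \<Rightarrow> (complex, ('g list \<Rightarrow>\<^sub>0 complex) set) module" where
  "group_homology q G \<rho> =
     quotient_module
       ((bar_chains G q)\<lparr>carrier := {c \<in> carrier (bar_chains G q). bar_boundary G \<rho> c = 0}\<rparr>)
       (bar_boundary G \<rho> ` carrier (bar_chains G (Suc q)))"

definition V1 :: "('g, 'b) monoid_scheme \<Rightarrow> ('g \<Rightarrow> complex) set" where
  "V1 G = {\<rho> \<in> char_torus G. vectorspace.dim class_ring (group_homology 1 G \<rho>) \<ge> 1}"

definition W1 :: "('a, 'b) monoid_scheme \<Rightarrow> ('a \<Rightarrow> complex) set" where
  "W1 G = \<Union>{Z \<in> irreducible_components (zariski G) (V1 G).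
              codimension (zariski G) Z = 1 \<and> Z \<subseteq> char_torus0 G}"

end

theory Submission
  imports Defs "HOL-Computational_Algebra.Fundamental_Theorem_Algebra"
begin

text \<open>
  For \<open>\<rho>\<close> in the identity component, the linear maps from the Alexander module to \<open>\<complex>\<^sub>\<rho>\<close> are the crossed
  homomorphisms \<open>f (x y) = f x + \<rho> x * f y\<close>; in terms of a presentation they form the kernel of the
  presentation matrix evaluated at \<open>\<rho>\<close>. On the other hand, \<open>H\<^sub>1(G; \<complex>\<^sub>\<rho>) \<noteq> 0\<close> if and only if some crossed
  homomorphism is not a multiple of \<open>\<rho> - 1\<close>. For \<open>\<rho> \<noteq> 1\<close> this means that the kernel has dimension at
  least two, that is, all minors of size \<open>m - 1\<close> vanish at \<open>\<rho>\<close>; for \<open>\<rho> = 1\<close> the kernel is \<open>Hom(G, \<complex>)\<close>, of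
  dimension \<open>b1 G\<close>. So on the identity component the characteristic variety is the common zero set of
  the minors, together with \<open>1\<close> if \<open>b1 G \<ge> 1\<close>.

  Dividing the minors by \<open>\<Delta>\<close> gives elements without a common prime factor over \<open>\<int>\<close>, hence, by a descent
  argument, over \<open>\<complex>\<close>. Their common zeros contain no closed irreducible set of codimension one, and
  the components of codimension one are those of \<open>V(\<Delta>)\<close>. For \<open>b1 G = 1\<close> the minors do not all
  vanish at \<open>1\<close>, so \<open>1\<close> is an additional component.
\<close>


section \<open>Unique factorization in polynomial rings over subrings\<close>

text \<open>Two steps that the overview names would usually rest on heavier theory. The passage
  between zero sets and divisors is commonly taken from the Nullstellensatz and dimension theory.
  Here it comes down to one statement: a prime Laurent polynomial divides everything that vanishes
  on its zero set. It follows by elimination of a variable and the fundamental theorem of algebra,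
  and with unique factorization it decides which chains of irreducible closed sets exist above a
  hypersurface. Elimination compares rings with different sets of variables inside one type, so
  divisibility is always taken relative to a subset of an integral domain. The relation between
  homology and crossed homomorphisms is linear duality: a functional on 1-chains kills the
  boundaries exactly if its values on bar symbols form a crossed homomorphism, and a cycle that is
  no boundary is detected by such a functional. As the presentation of the Alexander module is
  arbitrary, Fox derivatives do not appear; kernel vectors of the evaluated matrix are matched with
  crossed homomorphisms through linear maps on the module itself.\<close>

locale sub_idom =
  fixes S :: "'a::idom set"
  assumes zero_in [simp, intro]: "0 \<in> S"
    and one_in [simp, intro]: "1 \<in> S"
    and add_in [simp, intro]: "\<lbrakk>a \<in> S; b \<in> S\<rbrakk> \<Longrightarrow> a + b \<in> S"
    and mult_in [simp, intro]: "\<lbrakk>a \<in> S; b \<in> S\<rbrakk> \<Longrightarrow> a * b \<in> S"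
    and uminus_in [simp, intro]: "a \<in> S \<Longrightarrow> - a \<in> S"
begin

lemma diff_in [simp, intro]: "\<lbrakk>a \<in> S; b \<in> S\<rbrakk> \<Longrightarrow> a - b \<in> S"
  using add_in uminus_in by fastforce

lemma sum_in: "(\<And>i. i \<in> I \<Longrightarrow> f i \<in> S) \<Longrightarrow> sum f I \<in> S"
  by (induction I rule: infinite_finite_induct) auto

lemma power_in [simp, intro]: "a \<in> S \<Longrightarrow> a ^ n \<in> S"
  by (induction n) auto

end

section \<open>Divisibility, units and primes inside a subring\<close>

definition dvd_in :: "'a::idom set \<Rightarrow> 'a \<Rightarrow> 'a \<Rightarrow> bool" where
  "dvd_in S a b \<longleftrightarrow> (\<exists>c\<in>S. b = a * c)"

definition unit_in :: "'a::idom set \<Rightarrow> 'a \<Rightarrow> bool" where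
  "unit_in S u \<longleftrightarrow> u \<in> S \<and> (\<exists>v\<in>S. u * v = 1)"

definition prime_in :: "'a::idom set \<Rightarrow> 'a \<Rightarrow> bool" where
  "prime_in S p \<longleftrightarrow> p \<in> S \<and> p \<noteq> 0 \<and> \<not> unit_in S p \<and>
     (\<forall>a\<in>S. \<forall>b\<in>S. dvd_in S p (a * b) \<longrightarrow> dvd_in S p a \<or> dvd_in S p b)"

text \<open>The index counts the prime factors with multiplicity; it is the measure that decreases
  when a content is extracted.\<close>

inductive prime_prod :: "'a::idom set \<Rightarrow> nat \<Rightarrow> 'a \<Rightarrow> bool" for S where
  unit: "unit_in S u \<Longrightarrow> prime_prod S 0 u"
| mult: "prime_in S p \<Longrightarrow> prime_prod S n f \<Longrightarrow> prime_prod S (Suc n) (p * f)"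

text \<open>The factors are prime rather than merely irreducible, so uniqueness of the factorization
  is automatic.\<close>

definition ufd :: "'a::idom set \<Rightarrow> bool" where
  "ufd S \<longleftrightarrow> sub_idom S \<and> (\<forall>f\<in>S. f \<noteq> 0 \<longrightarrow> (\<exists>n. prime_prod S n f))"

lemma prime_inD:
  assumes "prime_in S p"
  shows "p \<in> S" "p \<noteq> 0" "\<not> unit_in S p"
    and "\<And>a b. \<lbrakk>a \<in> S; b \<in> S; dvd_in S p (a * b)\<rbrakk> \<Longrightarrow> dvd_in S p a \<or> dvd_in S p b"
  using assms by (auto simp: prime_in_def)

context sub_idom
begin

lemma dvd_in_refl [simp]: "dvd_in S a a"
  unfolding dvd_in_def by (rule bexI[of _ 1]) auto

lemma dvd_in_zero [simp]: "dvd_in S a 0"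
  unfolding dvd_in_def by (rule bexI[of _ 0]) auto

lemma dvd_in_trans: "\<lbrakk>dvd_in S a b; dvd_in S b c\<rbrakk> \<Longrightarrow> dvd_in S a c"
  unfolding dvd_in_def by (metis mult.assoc mult_in)

lemma dvd_in_mult_left: "\<lbrakk>dvd_in S a b; c \<in> S\<rbrakk> \<Longrightarrow> dvd_in S a (c * b)"
  unfolding dvd_in_def by (metis mult.left_commute mult_in)

lemma dvd_in_mult_right: "\<lbrakk>dvd_in S a b; c \<in> S\<rbrakk> \<Longrightarrow> dvd_in S a (b * c)"
  using dvd_in_mult_left by (simp add: mult.commute)

lemma dvd_in_add: "\<lbrakk>dvd_in S a b; dvd_in S a c\<rbrakk> \<Longrightarrow> dvd_in S a (b + c)"
  unfolding dvd_in_def by (metis distrib_left add_in)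

lemma dvd_in_diff: "\<lbrakk>dvd_in S a b; dvd_in S a c\<rbrakk> \<Longrightarrow> dvd_in S a (b - c)"
  unfolding dvd_in_def by (metis right_diff_distrib diff_in)

lemma dvd_in_sum: "(\<And>i. i \<in> I \<Longrightarrow> dvd_in S a (f i)) \<Longrightarrow> dvd_in S a (sum f I)"
  by (induction I rule: infinite_finite_induct) (auto intro: dvd_in_add)

lemma dvd_in_mult_cancel: "c \<noteq> 0 \<Longrightarrow> dvd_in S (c * a) (c * b) \<longleftrightarrow> dvd_in S a b"
  unfolding dvd_in_def by (auto simp: mult.assoc)

lemma unit_in_one [simp]: "unit_in S 1"
  unfolding unit_in_def by auto

lemma unit_in_mult: "\<lbrakk>unit_in S u; unit_in S v\<rbrakk> \<Longrightarrow> unit_in S (u * v)"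
  unfolding unit_in_def
  by (metis (no_types, opaque_lifting) mult.assoc mult.commute mult.right_neutral mult_in)

lemma unit_in_dvd: "unit_in S u \<Longrightarrow> a \<in> S \<Longrightarrow> dvd_in S u a"
  unfolding unit_in_def dvd_in_def by (metis mult.assoc mult.left_neutral mult_in)

lemma dvd_in_unit: "\<lbrakk>dvd_in S a u; unit_in S u; a \<in> S\<rbrakk> \<Longrightarrow> unit_in S a"
  unfolding unit_in_def dvd_in_def by (metis mult.assoc mult_in)

lemma unit_in_mult_iff: "\<lbrakk>a \<in> S; b \<in> S\<rbrakk> \<Longrightarrow> unit_in S (a * b) \<longleftrightarrow> unit_in S a \<and> unit_in S b"
  by (metis dvd_in_def dvd_in_unit mult.commute unit_in_mult)

lemma prime_not_dvd_unit: "\<lbrakk>prime_in S p; unit_in S u\<rbrakk> \<Longrightarrow> \<not> dvd_in S p u"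
  using dvd_in_unit prime_inD by blast

lemma prime_prod_in: "prime_prod S n f \<Longrightarrow> f \<in> S"
  by (induction rule: prime_prod.induct) (auto simp: unit_in_def prime_in_def)

lemma prime_prod_nonzero: "prime_prod S n f \<Longrightarrow> f \<noteq> 0"
  by (induction rule: prime_prod.induct) (auto simp: unit_in_def prime_in_def)

lemma prime_prod_unit: "\<lbrakk>prime_prod S n f; unit_in S u\<rbrakk> \<Longrightarrow> prime_prod S n (u * f)"
proof (induction rule: prime_prod.induct)
  case (unit v)
  then show ?case by (auto intro!: prime_prod.unit unit_in_mult)
next
  case (mult p n f)
  then have "prime_prod S (Suc n) (p * (u * f))" by (auto intro: prime_prod.mult)
  then show ?case by (simp add: mult.left_commute)
qed

lemma prime_prod_mult: "\<lbrakk>prime_prod S n f; prime_prod S m g\<rbrakk> \<Longrightarrow> prime_prod S (n + m) (f * g)"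
proof (induction rule: prime_prod.induct)
  case (unit v)
  then show ?case by (auto intro!: prime_prod_unit)
next
  case (mult p n f)
  then have "prime_prod S (Suc (n + m)) (p * (f * g))" by (auto intro: prime_prod.mult)
  then show ?case by (simp add: mult.assoc)
qed

lemma prime_prod_of_prime: "prime_in S p \<Longrightarrow> prime_prod S 1 p"
  using prime_prod.mult[of S p 0 1] by (simp add: prime_prod.unit)

text \<open>Write \<open>q = p * w\<close>. As \<open>q\<close> is prime it divides \<open>p\<close>
  or \<open>w\<close>; the second case would make \<open>p\<close> a unit, and in the first the two
  primes are associated.\<close>

lemma prime_dvd_prime:
  assumes "prime_in S p" "prime_in S q" "dvd_in S p q"
  shows "\<exists>u. unit_in S u \<and> q = p * u"
proof -
  obtain w where w: "w \<in> S" "q = p * w" using assms by (auto simp: dvd_in_def)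
  then have "dvd_in S q p \<or> dvd_in S q w"
    using prime_inD[OF assms(2)] prime_inD(1)[OF assms(1)] by (metis dvd_in_refl)
  moreover have "\<not> dvd_in S q w"
  proof
    assume "dvd_in S q w"
    then obtain c where c: "c \<in> S" "w = q * c" by (auto simp: dvd_in_def)
    then have "w * 1 = w * (p * c)" using w by (metis mult.commute mult.left_commute mult.right_neutral)
    moreover have "w \<noteq> 0" using w prime_inD(2)[OF assms(2)] by auto
    ultimately have "p * c = 1" by (metis mult_left_cancel)
    then show False using prime_inD[OF assms(1)] c by (auto simp: unit_in_def)
  qed
  ultimately obtain c where c: "c \<in> S" "p = q * c" by (auto simp: dvd_in_def)
  then have "p * 1 = p * (w * c)" using w by (metis mult.assoc mult.right_neutral)
  then have "w * c = 1" using prime_inD(2)[OF assms(1)] by (metis mult_left_cancel)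
  then show ?thesis using w c by (auto simp: unit_in_def)
qed

text \<open>The prime \<open>p\<close> is associated to one of the factors of \<open>f\<close>, so
  cancelling it lowers the number of factors by exactly one.\<close>

lemma prime_prod_cancel:
  "\<lbrakk>prime_prod S n f; prime_in S p; g \<in> S; f = p * g\<rbrakk> \<Longrightarrow> \<exists>k. n = Suc k \<and> prime_prod S k g"
proof (induction arbitrary: g rule: prime_prod.induct)
  case (unit u)
  then have "dvd_in S p u" by (auto simp: dvd_in_def)
  then show ?case using unit prime_not_dvd_unit by blast
next
  case (mult q n f)
  note p = prime_inD[OF \<open>prime_in S p\<close>] and q = prime_inD[OF \<open>prime_in S q\<close>]
  have f: "f \<in> S" by (rule prime_prod_in[OF mult.hyps(2)])
  have "dvd_in S p (q * f)" using mult by (auto simp: dvd_in_def)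
  then consider "dvd_in S p q" | "dvd_in S p f"
    using p(4)[OF q(1) f] by blast
  then show ?case
  proof cases
    case 1
    then obtain u where u: "unit_in S u" "q = p * u" using prime_dvd_prime[OF mult.prems(1) mult.hyps(1)] by blast
    then have "p * (u * f) = p * g" using mult by (simp add: mult.assoc)
    then have "g = u * f" using p by simp
    then show ?thesis using prime_prod_unit[OF mult.hyps(2) u(1)] by blast
  next
    case 2
    then obtain g' where g': "g' \<in> S" "f = p * g'" by (auto simp: dvd_in_def)
    then obtain k where k: "n = Suc k" "prime_prod S k g'" using mult.IH[OF mult.prems(1)] by blast
    have "p * (q * g') = p * g" using mult g' by (simp add: mult.left_commute)
    then have "g = q * g'" using p by simp
    then show ?thesis using k prime_prod.mult[OF mult.hyps(1) k(2)] by blast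
  qed
qed

lemma prime_prod_has_prime:
  assumes "prime_prod S n f" "\<not> unit_in S f"
  shows "\<exists>p. prime_in S p \<and> dvd_in S p f"
  using assms(1)
proof cases
  case (mult p n f')
  then show ?thesis using prime_prod_in by (auto simp: dvd_in_def)
qed (use assms in auto)

end

text \<open>Euclid's lemma for a family without common prime factor. The primes of \<open>g\<close>
  are peeled off one at a time: each of them misses some \<open>f\<close> of the family and hence
  divides \<open>b\<close>.\<close>

lemma (in sub_idom) prime_prod_dvd_family:
  assumes "prime_prod S n g"
    and F: "F \<subseteq> S" "\<And>p. prime_in S p \<Longrightarrow> \<exists>f\<in>F. \<not> dvd_in S p f"
  shows "\<lbrakk>b \<in> S; \<And>f. f \<in> F \<Longrightarrow> dvd_in S g (b * f)\<rbrakk> \<Longrightarrow> dvd_in S g b"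
  using assms(1)
proof (induction arbitrary: b rule: prime_prod.induct)
  case (unit u)
  then show ?case by (simp add: unit_in_dvd)
next
  case (mult p n g)
  note p = prime_inD[OF \<open>prime_in S p\<close>]
  have g: "g \<in> S" by (rule prime_prod_in[OF mult.hyps(2)])
  obtain f where f: "f \<in> F" "\<not> dvd_in S p f" using F(2)[OF mult.hyps(1)] by blast
  have "dvd_in S p (p * g)" using g by (auto simp: dvd_in_def)
  then have "dvd_in S p (b * f)" using mult.prems(2)[OF f(1)] dvd_in_trans by blast
  then have "dvd_in S p b" using p(4)[of b f] f F mult.prems by blast
  then obtain b' where b': "b' \<in> S" "b = p * b'" by (auto simp: dvd_in_def)
  have "dvd_in S g (b' * f)" if "f \<in> F" for f
    using mult.prems(2)[OF that] p(2) by (simp add: b' mult.assoc dvd_in_mult_cancel)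
  then have "dvd_in S g b'" using mult.IH[OF b'(1)] by blast
  then show ?case using p(2) by (simp add: b' dvd_in_mult_cancel)
qed

section \<open>Content, pseudo-division and Gauss's theorem for polynomials\<close>

definition poly_set :: "'a::idom set \<Rightarrow> 'a poly set" where
  "poly_set S = {P. \<forall>i. Polynomial.coeff P i \<in> S}"

context sub_idom
begin

lemma sub_idom_poly_set: "sub_idom (poly_set S)"
proof
  fix P Q assume "P \<in> poly_set S" "Q \<in> poly_set S"
  then show "P * Q \<in> poly_set S" by (auto simp: poly_set_def coeff_mult intro!: sum_in)
qed (auto simp: poly_set_def Polynomial.coeff_1)

interpretation P: sub_idom "poly_set S"
  by (rule sub_idom_poly_set)

lemma const_in_poly_set [simp]: "[:a:] \<in> poly_set S \<longleftrightarrow> a \<in> S"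
proof
  assume "a \<in> S" then show "[:a:] \<in> poly_set S"
    by (auto simp: poly_set_def coeff_pCons split: nat.split)
qed (auto simp: poly_set_def dest: spec[of _ 0])

lemma monom_in_poly_set [simp]: "Polynomial.monom a n \<in> poly_set S \<longleftrightarrow> a \<in> S"
  by (auto simp: poly_set_def)

lemma coeff_in: "P \<in> poly_set S \<Longrightarrow> Polynomial.coeff P i \<in> S"
  by (simp add: poly_set_def)

lemma smult_in [simp, intro]: "\<lbrakk>a \<in> S; P \<in> poly_set S\<rbrakk> \<Longrightarrow> Polynomial.smult a P \<in> poly_set S"
  by (auto simp: poly_set_def)

lemma dvd_in_const_poly:
  "dvd_in (poly_set S) [:a:] P \<longleftrightarrow> (\<forall>i. dvd_in S a (Polynomial.coeff P i))"
proof
  assume "dvd_in (poly_set S) [:a:] P"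
  then show "\<forall>i. dvd_in S a (Polynomial.coeff P i)"
    by (auto simp: dvd_in_def intro: coeff_in)
next
  assume *: "\<forall>i. dvd_in S a (Polynomial.coeff P i)"
  show "dvd_in (poly_set S) [:a:] P"
  proof (cases "a = 0")
    case True
    then have "P = 0" using * by (auto simp: dvd_in_def poly_eq_iff)
    then show ?thesis by simp
  next
    case False
    \<comment> \<open>For \<open>a\<close> nonzero the quotient of a zero coefficient is zero, so
      almost all \<open>c i\<close> vanish and \<open>c\<close> is the coefficient function of a
      polynomial.\<close>
    define c where "c i = (SOME c. c \<in> S \<and> Polynomial.coeff P i = a * c)" for i
    have c: "c i \<in> S \<and> Polynomial.coeff P i = a * c i" for i
      unfolding c_def using * by (rule someI_ex[OF allE]) (auto simp: dvd_in_def)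
    have "\<forall>\<^sub>\<infinity>i. Polynomial.coeff P i = 0" by (rule MOST_coeff_eq_0)
    then have "\<forall>\<^sub>\<infinity>i. c i = 0" using c False by (elim MOST_mono) auto
    then have cc: "Polynomial.coeff (Abs_poly c) = c" by (simp add: Abs_poly_inverse)
    have "P = [:a:] * Abs_poly c" by (rule poly_eqI) (simp add: cc c)
    then show ?thesis unfolding dvd_in_def
      by (rule bexI) (auto simp: poly_set_def cc c)
  qed
qed

lemma unit_in_const_poly [simp]: "unit_in (poly_set S) [:a:] \<longleftrightarrow> unit_in S a"
proof
  assume "unit_in (poly_set S) [:a:]"
  then obtain v where "a \<in> S" "v \<in> poly_set S" "[:a:] * v = 1" by (auto simp: unit_in_def)
  then have "a * Polynomial.coeff v 0 = 1" by (metis coeff_mult_0 coeff_pCons_0 one_pCons)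
  then show "unit_in S a" using \<open>a \<in> S\<close> coeff_in[OF \<open>v \<in> _\<close>] by (auto simp: unit_in_def)
next
  assume "unit_in S a"
  then obtain v where "a \<in> S" "v \<in> S" "a * v = 1" by (auto simp: unit_in_def)
  then have "[:a:] * [:v:] = 1" by (simp add: one_pCons mult.commute)
  then show "unit_in (poly_set S) [:a:]" using \<open>a \<in> S\<close> \<open>v \<in> S\<close>
    unfolding unit_in_def by (metis const_in_poly_set)
qed

text \<open>Gauss's lemma. Let \<open>i\<close> and \<open>j\<close> be the lowest indices at which
  \<open>p\<close> divides neither the coefficient of \<open>F\<close> nor that of \<open>G\<close>,
  respectively. In the coefficient of \<open>F * G\<close> at \<open>i + j\<close> every term except
  the product of these two is divisible by \<open>p\<close>.\<close>

lemma prime_in_const_poly: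
  assumes p: "prime_in S p"
  shows "prime_in (poly_set S) [:p:]"
  unfolding prime_in_def
proof (intro conjI ballI impI)
  note p = prime_inD[OF p]
  show "[:p:] \<in> poly_set S" "[:p:] \<noteq> 0" "\<not> unit_in (poly_set S) [:p:]"
    using p by auto
  fix F G assume F: "F \<in> poly_set S" and G: "G \<in> poly_set S"
    and FG: "dvd_in (poly_set S) [:p:] (F * G)"
  show "dvd_in (poly_set S) [:p:] F \<or> dvd_in (poly_set S) [:p:] G"
  proof (rule ccontr)
    let ?c = Polynomial.coeff
    define i where "i = (LEAST i. \<not> dvd_in S p (?c F i))"
    define j where "j = (LEAST j. \<not> dvd_in S p (?c G j))"
    assume "\<not> ?thesis"
    then have ex: "\<exists>i. \<not> dvd_in S p (?c F i)" "\<exists>i. \<not> dvd_in S p (?c G i)"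
      by (auto simp: dvd_in_const_poly)
    have i: "\<not> dvd_in S p (?c F i)" "\<And>k. k < i \<Longrightarrow> dvd_in S p (?c F k)"
      using LeastI_ex[OF ex(1)] not_less_Least unfolding i_def by blast+
    have j: "\<not> dvd_in S p (?c G j)" "\<And>k. k < j \<Longrightarrow> dvd_in S p (?c G k)"
      using LeastI_ex[OF ex(2)] not_less_Least unfolding j_def by blast+
    have "?c (F * G) (i + j) = (\<Sum>k\<le>i+j. ?c F k * ?c G (i + j - k))" by (simp add: coeff_mult)
    also have "\<dots> = ?c F i * ?c G j + (\<Sum>k\<in>{..i+j}-{i}. ?c F k * ?c G (i + j - k))"
      by (subst sum.remove[of _ i]) auto
    finally have eq: "?c F i * ?c G j = ?c (F * G) (i + j) - (\<Sum>k\<in>{..i+j}-{i}. ?c F k * ?c G (i + j - k))"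
      by simp
    have "dvd_in S p (\<Sum>k\<in>{..i+j}-{i}. ?c F k * ?c G (i + j - k))"
    proof (rule dvd_in_sum)
      fix k assume k: "k \<in> {..i+j}-{i}"
      show "dvd_in S p (?c F k * ?c G (i + j - k))"
      proof (cases "k < i")
        case True
        then show ?thesis using i G by (auto intro!: dvd_in_mult_right coeff_in)
      next
        case False
        then have "i + j - k < j" using k by auto
        then show ?thesis using j F by (auto intro!: dvd_in_mult_left coeff_in)
      qed
    qed
    then have "dvd_in S p (?c F i * ?c G j)"
      unfolding eq using FG by (intro dvd_in_diff) (auto simp: dvd_in_const_poly)
    then show False using p(4)[of "?c F i" "?c G j"] i j F G coeff_in by blast
  qed
qed

lemma prime_prod_const_poly: "prime_prod S n a \<Longrightarrow> prime_prod (poly_set S) n [:a:]"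
proof (induction rule: prime_prod.induct)
  case (mult p n f)
  then have "prime_prod (poly_set S) (Suc n) ([:p:] * [:f:])"
    by (intro prime_prod.mult prime_in_const_poly)
  then show ?case by (simp add: mult.commute)
qed (auto intro: prime_prod.unit)

text \<open>Testing prime constants only expresses that the content is trivial without using
  greatest common divisors of coefficients.\<close>

definition primitive_in :: "'a poly \<Rightarrow> bool" where
  "primitive_in F \<longleftrightarrow> F \<in> poly_set S \<and> F \<noteq> 0 \<and> (\<forall>p. prime_in S p \<longrightarrow> \<not> dvd_in (poly_set S) [:p:] F)"

text \<open>The leading coefficient of \<open>D\<close> cannot be inverted in \<open>S\<close>. Each
  reduction step therefore multiplies \<open>F\<close> by it, and \<open>c\<close> collects these
  multipliers.\<close>

lemma pseudo_division:
  assumes D: "D \<in> poly_set S" "D \<noteq> 0"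
  shows "F \<in> poly_set S \<Longrightarrow> \<exists>c\<in>S. \<exists>Q\<in>poly_set S. \<exists>R\<in>poly_set S. c \<noteq> 0 \<and> [:c:] * F = Q * D + R \<and>
      (R = 0 \<or> Polynomial.degree R < Polynomial.degree D)"
proof (induction "Polynomial.degree F" arbitrary: F rule: less_induct)
  case less
  let ?deg = Polynomial.degree
  show ?case
  proof (cases "F = 0 \<or> ?deg F < ?deg D")
    case True
    then show ?thesis using less.prems
      by (intro bexI[of _ 1] bexI[of _ 0] bexI[of _ F]) (auto simp: one_pCons[symmetric])
  next
    case False
    define d where "d = Polynomial.lead_coeff D"
    define M where "M = Polynomial.monom (Polynomial.lead_coeff F) (?deg F - ?deg D)"
    define F' where "F' = [:d:] * F - M * D"
    have d: "d \<in> S" "d \<noteq> 0" using D coeff_in by (auto simp: d_def)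
    have M: "M \<in> poly_set S" using less.prems coeff_in by (auto simp: M_def)
    have F': "F' \<in> poly_set S" using d M D less.prems unfolding F'_def by auto
    have small: "F' = 0 \<or> ?deg F' < ?deg F"
    proof -
      have "?deg F' \<le> ?deg F" unfolding F'_def M_def
      proof (rule degree_diff_le)
        show "?deg ([:d:] * F) \<le> ?deg F" using d by simp
        have "?deg (Polynomial.monom (Polynomial.lead_coeff F) (?deg F - ?deg D) * D)
          \<le> (?deg F - ?deg D) + ?deg D"
          by (rule order.trans[OF degree_mult_le]) (auto intro: degree_monom_le)
        then show "?deg (Polynomial.monom (Polynomial.lead_coeff F) (?deg F - ?deg D) * D) \<le> ?deg F"
          using False by simp
      qed
      moreover have "Polynomial.coeff F' (?deg F) = 0"
        using False by (simp add: F'_def M_def d_def coeff_monom_mult)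
      ultimately show ?thesis by (metis eq_zero_or_degree_less)
    qed
    have "\<exists>c\<in>S. \<exists>Q\<in>poly_set S. \<exists>R\<in>poly_set S. c \<noteq> 0 \<and> [:c:] * F' = Q * D + R \<and>
      (R = 0 \<or> ?deg R < ?deg D)"
    proof (cases "F' = 0")
      case True
      then show ?thesis by (intro bexI[of _ 1] bexI[of _ 0]) auto
    next
      case F'0: False
      then show ?thesis using small less.hyps[of F'] F' by blast
    qed
    then obtain c Q R where c: "c \<in> S" "c \<noteq> 0" "Q \<in> poly_set S" "R \<in> poly_set S"
      "[:c:] * F' = Q * D + R" "R = 0 \<or> ?deg R < ?deg D" by blast
    have "[:c * d:] * F = ([:c:] * M + Q) * D + R"
    proof -
      have "[:c * d:] * F = [:c:] * ([:d:] * F)" by (simp add: mult.commute)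
      also have "\<dots> = [:c:] * F' + [:c:] * M * D" unfolding F'_def by (simp add: algebra_simps)
      finally show ?thesis using c by (simp add: algebra_simps)
    qed
    moreover have "[:c:] * M + Q \<in> poly_set S" using c M by auto
    ultimately show ?thesis using c d
      by (intro bexI[of _ "c * d"] bexI[of _ "[:c:] * M + Q"] bexI[of _ R]) auto
  qed
qed

text \<open>The primes of \<open>c\<close> are cancelled one at a time: each divides
  \<open>Q * D\<close>, and by Gauss's lemma it divides \<open>Q\<close>, because \<open>D\<close>
  is primitive.\<close>

lemma primitive_cancel:
  assumes "prime_prod S n c" and D: "primitive_in D"
  shows "\<lbrakk>F \<in> poly_set S; Q \<in> poly_set S; [:c:] * F = Q * D\<rbrakk> \<Longrightarrow> dvd_in (poly_set S) D F"
  using assms(1)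
proof (induction arbitrary: Q rule: prime_prod.induct)
  case (unit u)
  then obtain v where v: "v \<in> S" "u * v = 1" by (auto simp: unit_in_def)
  have "F = [:v:] * ([:u:] * F)" using v by (simp add: mult.commute)
  also have "\<dots> = D * ([:v:] * Q)" unfolding unit by (simp add: algebra_simps)
  finally show ?case unfolding dvd_in_def
    by (rule bexI) (use v unit in auto)
next
  case (mult p n c)
  have D': "D \<in> poly_set S" "\<not> dvd_in (poly_set S) [:p:] D"
    using D mult by (auto simp: primitive_in_def)
  have c: "c \<in> S" by (rule prime_prod_in[OF mult.hyps(2)])
  have eq: "[:p:] * ([:c:] * F) = Q * D" using mult by (simp add: mult.commute)
  then have "dvd_in (poly_set S) [:p:] (Q * D)" using c mult
    unfolding dvd_in_def by (metis P.mult_in const_in_poly_set)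
  then have "dvd_in (poly_set S) [:p:] Q"
    using prime_inD(4)[OF prime_in_const_poly[OF mult.hyps(1)] mult.prems(2) D'(1)] D'(2) by blast
  then obtain Q' where Q': "Q' \<in> poly_set S" "Q = [:p:] * Q'" by (auto simp: dvd_in_def)
  have "[:p:] * ([:c:] * F) = [:p:] * (Q' * D)" using eq Q' by (simp add: mult.assoc)
  moreover have "[:p:] \<noteq> 0" using prime_inD mult by auto
  ultimately have "[:c:] * F = Q' * D" by (metis mult_left_cancel)
  then show ?case using mult.IH[OF mult.prems(1) Q'(1)] by blast
qed

text \<open>Every prime constant that is split off also divides the leading coefficient, whose
  number of prime factors bounds the process.\<close>

lemma extract_content:
  "\<lbrakk>prime_prod S n (Polynomial.lead_coeff F); F \<in> poly_set S\<rbrakk> \<Longrightarrow>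
   \<exists>m c F'. prime_prod S m c \<and> primitive_in F' \<and> F = [:c:] * F'"
proof (induction n arbitrary: F rule: less_induct)
  case (less n)
  have F0: "F \<noteq> 0" using less prime_prod_nonzero by fastforce
  show ?case
  proof (cases "primitive_in F")
    case True
    then show ?thesis using prime_prod.unit[of S 1]
      by (intro exI[of _ 0] exI[of _ 1] exI[of _ F]) (auto simp: one_pCons[symmetric])
  next
    case False
    then obtain p where p: "prime_in S p" "dvd_in (poly_set S) [:p:] F"
      using less F0 by (auto simp: primitive_in_def)
    then obtain F1 where F1: "F1 \<in> poly_set S" "F = [:p:] * F1" by (auto simp: dvd_in_def)
    have "Polynomial.lead_coeff F = p * Polynomial.lead_coeff F1"
      using F1 by (simp only: lead_coeff_mult) simp
    then obtain k where "n = Suc k" "prime_prod S k (Polynomial.lead_coeff F1)"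
      using prime_prod_cancel[OF less.prems(1) p(1)] F1 coeff_in by blast
    then obtain m c F' where *: "prime_prod S m c" "primitive_in F'" "F1 = [:c:] * F'"
      using less.IH[of k F1] F1 by auto
    have "F = [:p * c:] * F'" using F1 * by (simp add: mult.commute)
    moreover have "prime_prod S (Suc m) (p * c)" using p * by (auto intro: prime_prod.mult)
    ultimately show ?thesis using * by blast
  qed
qed

end

lemma (in sub_idom) primitive_dvd:
  "\<lbrakk>primitive_in F; dvd_in (poly_set S) G F; G \<in> poly_set S\<rbrakk> \<Longrightarrow> primitive_in G"
  unfolding primitive_in_def
  by (metis dvd_in_def mult_zero_left sub_idom.dvd_in_trans sub_idom_poly_set)

text \<open>This avoids the fraction field of \<open>S\<close>. Suppose that \<open>F\<close> does
  not divide \<open>H\<close>. An element of least degree in the ideal of \<open>F\<close> and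
  \<open>H\<close> has a primitive part dividing both, and irreducibility makes this part constant.
  So a nonzero constant of \<open>S\<close> is a combination of \<open>F\<close> and
  \<open>H\<close>; multiplied by \<open>G\<close>, it shows that \<open>F\<close> divides a
  constant multiple of \<open>G\<close>, and hence \<open>G\<close>.\<close>

lemma primitive_irreducible_imp_prime:
  assumes "ufd S" and F: "sub_idom.primitive_in S F" "0 < Polynomial.degree F"
    and irr: "\<And>G H. \<lbrakk>G \<in> poly_set S; H \<in> poly_set S; F = G * H\<rbrakk> \<Longrightarrow>
       Polynomial.degree G = 0 \<or> Polynomial.degree H = 0"
  shows "prime_in (poly_set S) F"
proof -
  interpret sub_idom S using assms by (simp add: ufd_def)
  interpret P: sub_idom "poly_set S" by (rule sub_idom_poly_set)
  let ?deg = Polynomial.degree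
  have fact: "\<exists>n. prime_prod S n f" if "f \<in> S" "f \<noteq> 0" for f
    using assms that by (auto simp: ufd_def)
  have FS: "F \<in> poly_set S" "F \<noteq> 0" using F by (auto simp: primitive_in_def)
  \<comment> \<open>A constant divisor of \<open>F\<close> has no prime factor, since such a factor
    would divide the primitive \<open>F\<close>.\<close>
  have const_unit: "unit_in (poly_set S) G"
    if "G \<in> poly_set S" "?deg G = 0" "dvd_in (poly_set S) G F" for G
  proof -
    obtain a where a: "G = [:a:]" using \<open>?deg G = 0\<close> by (metis degree_eq_zeroE)
    have "G \<noteq> 0" using that FS by (auto simp: dvd_in_def)
    then have "a \<in> S" "a \<noteq> 0" using that a by auto
    then obtain n where n: "prime_prod S n a" using fact by blast
    have "unit_in S a"
    proof (rule ccontr)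
      assume "\<not> unit_in S a"
      then obtain p where p: "prime_in S p" "dvd_in S p a" using prime_prod_has_prime n by blast
      then have "dvd_in (poly_set S) [:p:] G"
        by (auto simp: a dvd_in_const_poly coeff_pCons split: nat.split)
      then show False using F p that P.dvd_in_trans by (auto simp: primitive_in_def)
    qed
    then show ?thesis using a by simp
  qed
  show ?thesis unfolding prime_in_def
  proof (intro conjI ballI impI)
    show "F \<in> poly_set S" "F \<noteq> 0" using FS .
    show "\<not> unit_in (poly_set S) F"
    proof
      assume "unit_in (poly_set S) F"
      then obtain v where "F * v = 1" by (auto simp: unit_in_def)
      moreover have "v \<noteq> 0" using calculation by auto
      ultimately have "?deg F + ?deg v = 0" using FS by (metis degree_mult_eq degree_1)
      then show False using F(2) by simp
    qed
    fix G H assume G: "G \<in> poly_set S" and H: "H \<in> poly_set S"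
      and GH: "dvd_in (poly_set S) F (G * H)"
    show "dvd_in (poly_set S) F G \<or> dvd_in (poly_set S) F H"
    proof (rule disjCI)
      assume nH: "\<not> dvd_in (poly_set S) F H"
      \<comment> \<open>Over a field \<open>J\<close> would be generated by \<open>D\<close>.
        Pseudo-division gives this up to constants, and \<open>primitive_cancel\<close> removes the
        constants.\<close>
      define J where "J = {A * F + B * H | A B. A \<in> poly_set S \<and> B \<in> poly_set S}"
      have JS: "J \<subseteq> poly_set S" using FS H by (auto simp: J_def)
      have "F = 1 * F + 0 * H" "H = 0 * F + 1 * H" by auto
      then have FJ: "F \<in> J" and HJ: "H \<in> J"
        unfolding J_def using P.zero_in P.one_in by blast+
      obtain D where D: "D \<in> J - {0}" "\<And>E. E \<in> J - {0} \<Longrightarrow> ?deg D \<le> ?deg E"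
        using ex_has_least_nat[of "\<lambda>E. E \<in> J - {0}" F ?deg] FJ FS by auto
      have DS: "D \<in> poly_set S" "D \<noteq> 0" using D JS by auto
      obtain A B where AB: "A \<in> poly_set S" "B \<in> poly_set S" "D = A * F + B * H"
        using D by (auto simp: J_def)
      obtain n where "prime_prod S n (Polynomial.lead_coeff D)" using fact DS coeff_in by fastforce
      then obtain m d D' where D': "prime_prod S m d" "primitive_in D'" "D = [:d:] * D'"
        using extract_content DS by blast
      have D'S: "D' \<in> poly_set S" using D' by (auto simp: primitive_in_def)
      have dS: "d \<in> S" "d \<noteq> 0" using prime_prod_in[OF D'(1)] prime_prod_nonzero[OF D'(1)] by auto
      have div: "dvd_in (poly_set S) D' E" if E: "E \<in> J" for E
      proof -
        obtain c Q R where c: "c \<in> S" "c \<noteq> 0" "Q \<in> poly_set S" "R \<in> poly_set S"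
          "[:c:] * E = Q * D + R" "R = 0 \<or> ?deg R < ?deg D"
          using pseudo_division[OF DS] E JS by blast
        obtain A' B' where AB': "A' \<in> poly_set S" "B' \<in> poly_set S" "E = A' * F + B' * H"
          using E by (auto simp: J_def)
        have "R = ([:c:] * A' - Q * A) * F + ([:c:] * B' - Q * B) * H"
          using c(5) unfolding AB AB' by (simp add: algebra_simps)
        moreover have "[:c:] * A' - Q * A \<in> poly_set S" "[:c:] * B' - Q * B \<in> poly_set S"
          using c AB AB' by auto
        ultimately have "R \<in> J" unfolding J_def by blast
        then have "R = 0" using c(6) D(2)[of R] by fastforce
        then have "[:c:] * E = (Q * [:d:]) * D'" using c D' by (simp add: mult.assoc)
        moreover obtain k where "prime_prod S k c" using fact c by blast
        moreover have "Q * [:d:] \<in> poly_set S" using c dS by auto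
        ultimately show ?thesis using primitive_cancel[OF _ D'(2)] E JS by blast
      qed
      obtain E where E: "E \<in> poly_set S" "F = D' * E" using div[OF FJ] by (auto simp: dvd_in_def)
      \<comment> \<open>A constant cofactor would be a unit; then \<open>F\<close> would be
        associated to \<open>D'\<close> and would divide \<open>H\<close>.\<close>
      have "?deg E \<noteq> 0"
      proof
        assume "?deg E = 0"
        moreover have "dvd_in (poly_set S) E F" using E D'S by (auto simp: dvd_in_def mult.commute)
        ultimately have "unit_in (poly_set S) E" using const_unit E by blast
        then obtain v where v: "v \<in> poly_set S" "E * v = 1" by (auto simp: unit_in_def)
        then have "D' = F * v" using E by (simp add: mult.assoc)
        then have "dvd_in (poly_set S) F D'" using v by (auto simp: dvd_in_def)
        then show False using nH div[OF HJ] P.dvd_in_trans by blast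
      qed
      then have "?deg D' = 0" using irr[OF D'S E] by simp
      then obtain e where "D' = [:e:]" by (metis degree_eq_zeroE)
      then have Dc: "D = [:d * e:]" using D' by simp
      then have de: "d * e \<in> S" "d * e \<noteq> 0" using DS by auto
      have "D * G = F * (A * G) + B * (G * H)" unfolding AB by (simp add: algebra_simps)
      moreover have "dvd_in (poly_set S) F (F * (A * G))" using AB G by (auto simp: dvd_in_def)
      moreover have "dvd_in (poly_set S) F (B * (G * H))" by (rule P.dvd_in_mult_left[OF GH AB(2)])
      ultimately have "dvd_in (poly_set S) F (D * G)" using P.dvd_in_add by metis
      then obtain Q where "Q \<in> poly_set S" "[:d * e:] * G = Q * F"
        unfolding Dc by (auto simp: dvd_in_def mult.commute)
      moreover obtain k where "prime_prod S k (d * e)" using fact de by blast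
      ultimately show "dvd_in (poly_set S) F G" using primitive_cancel[OF _ F(1) G] by blast
    qed
  qed
qed

text \<open>The content factors in \<open>S\<close>, and its primes stay prime as constants. A
  primitive polynomial that is not prime splits into primitive factors of smaller positive
  degree.\<close>

theorem ufd_poly_set:
  assumes "ufd S"
  shows "ufd (poly_set S)"
proof -
  interpret sub_idom S using assms by (simp add: ufd_def)
  interpret P: sub_idom "poly_set S" by (rule sub_idom_poly_set)
  let ?deg = Polynomial.degree
  have fact: "\<exists>n. prime_prod S n f" if "f \<in> S" "f \<noteq> 0" for f
    using assms that by (auto simp: ufd_def)
  have prim: "\<exists>n. prime_prod (poly_set S) n F" if "primitive_in F" for F
    using that
  proof (induction "?deg F" arbitrary: F rule: less_induct)
    case less
    have FS: "F \<in> poly_set S" "F \<noteq> 0" using less by (auto simp: primitive_in_def)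
    consider "?deg F = 0" | "?deg F > 0" "prime_in (poly_set S) F"
      | "?deg F > 0" "\<not> prime_in (poly_set S) F" by blast
    then show ?case
    proof cases
      case 1
      then obtain a where a: "F = [:a:]" by (metis degree_eq_zeroE)
      then have "a \<in> S" "a \<noteq> 0" using FS by auto
      then show ?thesis using fact[of a] prime_prod_const_poly a by blast
    next
      case 2
      then show ?thesis using P.prime_prod_of_prime by blast
    next
      case 3
      then obtain G H where GH: "G \<in> poly_set S" "H \<in> poly_set S" "F = G * H" "?deg G \<noteq> 0" "?deg H \<noteq> 0"
        using primitive_irreducible_imp_prime[OF assms less.prems] by blast
      have "?deg F = ?deg G + ?deg H" using GH FS by (metis degree_mult_eq mult_eq_0_iff)
      then have lt: "?deg G < ?deg F" "?deg H < ?deg F" using GH by auto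
      have "dvd_in (poly_set S) G F" "dvd_in (poly_set S) H F"
        using GH unfolding dvd_in_def by (auto simp: mult.commute)
      then have "primitive_in G" "primitive_in H" using primitive_dvd[OF less.prems] GH by blast+
      then obtain n m where "prime_prod (poly_set S) n G" "prime_prod (poly_set S) m H"
        using less.hyps[OF lt(1)] less.hyps[OF lt(2)] by blast
      then show ?thesis using P.prime_prod_mult GH by blast
    qed
  qed
  show ?thesis unfolding ufd_def
  proof (intro conjI ballI impI)
    fix F assume F: "F \<in> poly_set S" "F \<noteq> 0"
    then obtain n where "prime_prod S n (Polynomial.lead_coeff F)" using fact coeff_in by fastforce
    then obtain m c F' where *: "prime_prod S m c" "primitive_in F'" "F = [:c:] * F'"
      using extract_content F by blast
    then obtain k where "prime_prod (poly_set S) k F'" using prim by blast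
    then show "\<exists>n. prime_prod (poly_set S) n F"
      using P.prime_prod_mult[OF prime_prod_const_poly[OF *(1)]] *(3) by blast
  qed (rule sub_idom_poly_set)
qed

section \<open>Adjoining one invertible variable\<close>

lemma poly_split_X:
  fixes P :: "'a::idom poly"
  assumes "P \<noteq> 0"
  obtains a P' where "P = Polynomial.monom 1 a * P'" "Polynomial.coeff P' 0 \<noteq> 0"
    "\<And>i. Polynomial.coeff P' i = Polynomial.coeff P (i + a)"
proof -
  define a where "a = (LEAST i. Polynomial.coeff P i \<noteq> 0)"
  have ex: "\<exists>i. Polynomial.coeff P i \<noteq> 0" using assms by (auto simp: poly_eq_iff)
  have a: "Polynomial.coeff P a \<noteq> 0" and less: "\<And>i. i < a \<Longrightarrow> Polynomial.coeff P i = 0"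
    using LeastI_ex[OF ex] not_less_Least unfolding a_def by blast+
  define P' where "P' = poly_shift a P"
  have c: "Polynomial.coeff P' i = Polynomial.coeff P (i + a)" for i
    by (simp add: P'_def coeff_poly_shift add.commute)
  have "P = Polynomial.monom 1 a * P'"
    by (rule poly_eqI) (auto simp: coeff_monom_mult c less)
  then show ?thesis using that c a by simp
qed

text \<open>After powers of the variable are split off, both factors have nonzero constant term. The
  lowest coefficient of the product then gives \<open>k = a + b\<close>, and the degree forces the
  remaining factors to be constant.\<close>

lemma dvd_monom_imp_monom:
  fixes P H :: "'a::idom poly"
  assumes "P * H = Polynomial.monom c k" "c \<noteq> 0"
  shows "\<exists>r e. P = Polynomial.monom r e"
proof -
  have nz: "P * H \<noteq> 0" using assms by (simp add: monom_eq_0_iff)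
  then have "P \<noteq> 0" "H \<noteq> 0" by auto
  obtain a P' where P': "P = Polynomial.monom 1 a * P'" "Polynomial.coeff P' 0 \<noteq> 0"
    by (rule poly_split_X[OF \<open>P \<noteq> 0\<close>])
  obtain b H' where H': "H = Polynomial.monom 1 b * H'" "Polynomial.coeff H' 0 \<noteq> 0"
    by (rule poly_split_X[OF \<open>H \<noteq> 0\<close>])
  have eq: "Polynomial.monom c k = Polynomial.monom 1 (a + b) * (P' * H')"
    unfolding assms(1)[symmetric] P'(1) H'(1) proof -
    have "Polynomial.monom (1::'a) (a + b) = Polynomial.monom 1 a * Polynomial.monom 1 b"
      by (simp add: mult_monom)
    then show "Polynomial.monom 1 a * P' * (Polynomial.monom 1 b * H') = Polynomial.monom 1 (a + b) * (P' * H')"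
      by (simp only: mult_ac)
  qed
  have "Polynomial.coeff (Polynomial.monom c k) (a + b) \<noteq> 0"
    unfolding eq using P' H' by (simp add: coeff_monom_mult coeff_mult_0)
  then have k: "k = a + b" by (simp split: if_splits)
  have "P' \<noteq> 0" "H' \<noteq> 0" using P' H' by auto
  then have "Polynomial.degree (Polynomial.monom 1 (a + b) * (P' * H')) = a + b + (Polynomial.degree P' + Polynomial.degree H')"
    by (simp add: degree_mult_eq degree_monom_eq monom_eq_0_iff)
  then have "Polynomial.degree P' = 0" unfolding eq[symmetric] using k assms by (simp add: degree_monom_eq)
  then obtain r where "P' = [:r:]" by (metis degree_eq_zeroE)
  then have "P = Polynomial.monom r a" using P' by (simp add: smult_monom)
  then show ?thesis by blast
qed

text \<open>\<open>T\<close> is the ring of Laurent polynomials in \<open>x\<close> over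
  \<open>R\<close>, described by clearing denominators. The inverse \<open>y\<close> of
  \<open>x\<close> is a parameter because the surrounding ring is only an integral domain.\<close>

locale laurent_ext = sub_idom R for R :: "'a::idom set" +
  fixes x y :: 'a and T :: "'a set"
  assumes xy: "x * y = 1"
    and transcendental: "\<And>P. P \<in> poly_set R \<Longrightarrow> poly P x = 0 \<Longrightarrow> P = 0"
    and T_eq: "T = {f. \<exists>N. \<exists>P\<in>poly_set R. x ^ N * f = poly P x}"
begin

sublocale P: sub_idom "poly_set R"
  by (rule sub_idom_poly_set)

lemma TI: "\<lbrakk>P \<in> poly_set R; x ^ N * f = poly P x\<rbrakk> \<Longrightarrow> f \<in> T"
  unfolding T_eq by blast

lemma TE:
  assumes "f \<in> T"
  obtains N P where "P \<in> poly_set R" "x ^ N * f = poly P x"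
  using assms unfolding T_eq by blast

lemma x_nonzero: "x \<noteq> 0" using xy by auto

lemma xy_power: "x ^ n * y ^ n = 1"
  by (metis power_mult_distrib xy power_one)

lemma poly_in_T: "P \<in> poly_set R \<Longrightarrow> poly P x \<in> T"
  using TI[of P 0] by simp

lemma R_subset_T: "r \<in> R \<Longrightarrow> r \<in> T"
  using poly_in_T[of "[:r:]"] by simp

lemma x_in_T: "x \<in> T"
  using poly_in_T[of "Polynomial.monom 1 1"] by (simp add: poly_monom)

lemma y_in_T: "y \<in> T"
  using TI[of 1 1 y] xy by simp

lemma poly_inj: "\<lbrakk>P \<in> poly_set R; Q \<in> poly_set R; poly P x = poly Q x\<rbrakk> \<Longrightarrow> P = Q"
  using transcendental[of "P - Q"] by auto

lemma sub_idom_T: "sub_idom T"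
proof
  show "0 \<in> T" "1 \<in> T" using R_subset_T by auto
  fix f g assume "f \<in> T" "g \<in> T"
  obtain N P where P: "P \<in> poly_set R" "x ^ N * f = poly P x" using TE[OF \<open>f \<in> T\<close>] .
  obtain M Q where Q: "Q \<in> poly_set R" "x ^ M * g = poly Q x" using TE[OF \<open>g \<in> T\<close>] .
  have "x ^ (N + M) * (f + g) = x ^ M * (x ^ N * f) + x ^ N * (x ^ M * g)"
    by (simp add: algebra_simps power_add)
  also have "\<dots> = poly (Polynomial.monom 1 M * P + Polynomial.monom 1 N * Q) x"
    by (simp add: P Q poly_monom)
  finally show "f + g \<in> T" by (rule TI[rotated]) (use P Q in auto)
  have "x ^ (N + M) * (f * g) = (x ^ N * f) * (x ^ M * g)"
    by (simp add: algebra_simps power_add)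
  then show "f * g \<in> T" using TI[of "P * Q"] P Q by auto
  show "- f \<in> T" using TI[of "- P" N "- f"] P by auto
qed

sublocale T: sub_idom T
  by (rule sub_idom_T)

lemma unit_x_power: "unit_in T (x ^ n)" "unit_in T (y ^ n)"
proof -
  have "y ^ n * x ^ n = 1" using xy_power[of n] by (simp only: mult.commute)
  then show "unit_in T (x ^ n)" "unit_in T (y ^ n)"
    unfolding unit_in_def using xy_power[of n] x_in_T y_in_T by blast+
qed

lemma dvd_power_cancel:
  assumes "a \<in> T" "dvd_in T p (x ^ n * a)"
  shows "dvd_in T p a"
proof -
  have "y ^ n * (x ^ n * a) = a" using xy_power[of n] by (simp add: algebra_simps)
  then show ?thesis using T.dvd_in_mult_left[OF assms(2) T.power_in[OF y_in_T]] by metis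
qed

lemma prime_dvd_power: "\<lbrakk>prime_in (poly_set R) P; dvd_in (poly_set R) P (Q ^ n); Q \<in> poly_set R\<rbrakk> \<Longrightarrow> dvd_in (poly_set R) P Q"
proof (induction n)
  case 0
  then show ?case using P.prime_not_dvd_unit[of P 1] by simp
next
  case (Suc n)
  then show ?case using prime_inD(4)[OF Suc.prems(1), of Q "Q ^ n"] P.power_in by auto
qed

text \<open>Localization at the powers of \<open>x\<close>: a prime dividing \<open>x\<close>
  becomes a unit. Any other prime divides no power of \<open>x\<close>, so denominators can be
  cleared without affecting divisibility by it, and it stays prime.\<close>

lemma prime_or_unit_poly:
  assumes P: "prime_in (poly_set R) P"
  shows "unit_in T (poly P x) \<or> prime_in T (poly P x)"
proof (cases "dvd_in (poly_set R) P (Polynomial.monom 1 1)")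
  case True
  then obtain Q where Q: "Q \<in> poly_set R" "Polynomial.monom 1 1 = P * Q" by (auto simp: dvd_in_def)
  then have "x = poly P x * poly Q x" by (metis poly_monom poly_mult power_one_right mult_1)
  moreover have "unit_in T x" using unit_x_power(1)[of 1] by simp
  ultimately have "unit_in T (poly P x)"
    using poly_in_T Q prime_inD(1)[OF P] T.unit_in_mult_iff by metis
  then show ?thesis ..
next
  case nX: False
  note PD = prime_inD[OF P]
  have nXk: "\<not> dvd_in (poly_set R) P (Polynomial.monom 1 k)" for k
  proof
    assume "dvd_in (poly_set R) P (Polynomial.monom 1 k)"
    then have "dvd_in (poly_set R) P (Polynomial.monom 1 1 ^ k)"
      by (simp add: monom_power)
    then show False using prime_dvd_power[OF P] nX by auto
  qed
  have "prime_in T (poly P x)" unfolding prime_in_def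
  proof (intro conjI ballI impI)
    show "poly P x \<in> T" using PD poly_in_T by blast
    show "poly P x \<noteq> 0" using PD transcendental by blast
    show "\<not> unit_in T (poly P x)"
    proof
      assume "unit_in T (poly P x)"
      then obtain f where f: "f \<in> T" "poly P x * f = 1" by (auto simp: unit_in_def)
      obtain N F where F: "F \<in> poly_set R" "x ^ N * f = poly F x" using TE[OF f(1)] .
      have "poly (P * F) x = poly (Polynomial.monom 1 N) x"
        using f(2) by (simp add: F(2)[symmetric] poly_monom algebra_simps)
      then have "Polynomial.monom 1 N = P * F" using poly_inj PD F by (metis P.mult_in monom_in_poly_set one_in)
      then show False using nXk[of N] F by (auto simp: dvd_in_def)
    qed
    fix a b assume a: "a \<in> T" and b: "b \<in> T" and "dvd_in T (poly P x) (a * b)"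
    then obtain c where c: "c \<in> T" "a * b = poly P x * c" by (auto simp: dvd_in_def)
    obtain i A where A: "A \<in> poly_set R" "x ^ i * a = poly A x" using TE[OF a] .
    obtain j B where B: "B \<in> poly_set R" "x ^ j * b = poly B x" using TE[OF b] .
    obtain k C where C: "C \<in> poly_set R" "x ^ k * c = poly C x" using TE[OF c(1)] .
    have "poly (A * B * Polynomial.monom 1 k) x = x ^ (i + j + k) * (a * b)"
      by (simp add: A(2)[symmetric] B(2)[symmetric] poly_monom power_add algebra_simps)
    also have "\<dots> = poly (P * (C * Polynomial.monom 1 (i + j))) x"
      unfolding c(2) by (simp add: C(2)[symmetric] poly_monom power_add algebra_simps)
    finally have "A * B * Polynomial.monom 1 k = P * (C * Polynomial.monom 1 (i + j))"
      by (rule poly_inj[rotated 2]) (use A B C PD in auto)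
    then have "dvd_in (poly_set R) P (A * B * Polynomial.monom 1 k)"
      unfolding dvd_in_def using C by auto
    then have "dvd_in (poly_set R) P (A * B)"
      using PD(4)[of "A * B" "Polynomial.monom 1 k"] nXk A B by auto
    then have "dvd_in (poly_set R) P A \<or> dvd_in (poly_set R) P B"
      using PD(4)[of A B] A B by auto
    moreover have "dvd_in T (poly P x) f"
      if "dvd_in (poly_set R) P F" "x ^ m * f = poly F x" "f \<in> T" for f F m
    proof -
      from that(1) obtain Q where "Q \<in> poly_set R" "F = P * Q" by (auto simp: dvd_in_def)
      then have "dvd_in T (poly P x) (x ^ m * f)"
        unfolding dvd_in_def that(2) using poly_in_T by auto
      then show ?thesis using dvd_power_cancel that by blast
    qed
    ultimately show "dvd_in T (poly P x) a \<or> dvd_in T (poly P x) b" using A B a b by blast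
  qed
  then show ?thesis ..
qed

lemma prime_prod_poly: "prime_prod (poly_set R) n F \<Longrightarrow> \<exists>m. prime_prod T m (poly F x)"
proof (induction rule: prime_prod.induct)
  case (unit U)
  then obtain V where UV: "U \<in> poly_set R" "V \<in> poly_set R" "U * V = 1" by (auto simp: unit_in_def)
  then have "poly U x * poly V x = 1" by (metis poly_mult poly_1)
  then have "unit_in T (poly U x)" unfolding unit_in_def using UV poly_in_T by blast
  then show ?case using prime_prod.unit by blast
next
  case (mult P n F)
  then obtain m where m: "prime_prod T m (poly F x)" by blast
  show ?case using prime_or_unit_poly[OF mult.hyps(1)]
  proof
    assume "unit_in T (poly P x)"
    then show ?thesis using T.prime_prod_unit[OF m] by auto
  next
    assume "prime_in T (poly P x)"
    then show ?thesis using prime_prod.mult[OF _ m] by auto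
  qed
qed

text \<open>Powers of \<open>x\<close> are units, so factoring a multiple of \<open>f\<close> that
  is a polynomial in \<open>x\<close> is enough.\<close>

theorem ufd_T: "ufd R \<Longrightarrow> ufd T"
  unfolding ufd_def[of T]
proof (intro conjI ballI impI)
  fix f assume "ufd R" "f \<in> T" "f \<noteq> 0"
  obtain N P where P: "P \<in> poly_set R" "x ^ N * f = poly P x" using TE[OF \<open>f \<in> T\<close>] .
  have "P \<noteq> 0" using P(2) \<open>f \<noteq> 0\<close> x_nonzero by auto
  then obtain n where "prime_prod (poly_set R) n P" using ufd_poly_set[OF \<open>ufd R\<close>] P by (auto simp: ufd_def)
  then obtain m where "prime_prod T m (poly P x)" using prime_prod_poly by blast
  then have "prime_prod T m (y ^ N * (x ^ N * f))" unfolding P(2)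
    using T.prime_prod_unit unit_x_power by blast
  moreover have "y ^ N * (x ^ N * f) = f" using xy_power[of N] by (simp add: algebra_simps)
  ultimately show "\<exists>n. prime_prod T n f" by auto
qed (rule sub_idom_T)

text \<open>This replaces the resultant of \<open>p\<close> and \<open>f\<close> with respect to \<open>x\<close>.\<close>

lemma elimination:
  assumes p: "prime_in T p" and f: "f \<in> T" and nd: "\<not> dvd_in T p f"
    and inv: "\<And>N r k. r \<in> R \<Longrightarrow> x ^ N * p \<noteq> r * x ^ k"
  shows "\<exists>g a b. g \<in> R \<and> g \<noteq> 0 \<and> a \<in> T \<and> b \<in> T \<and> g = a * p + b * f"
proof -
  note pD = prime_inD[OF p]
  let ?deg = Polynomial.degree
  \<comment> \<open>The polynomials whose values at \<open>x\<close> lie in the ideal of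
    \<open>p\<close> and \<open>f\<close>. As in the proof of Gauss's theorem, an element of least
    degree divides all others up to constants.\<close>
  define J where "J = {D \<in> poly_set R. \<exists>a\<in>T. \<exists>b\<in>T. poly D x = a * p + b * f}"
  obtain N P where P: "P \<in> poly_set R" "x ^ N * p = poly P x" using TE[OF pD(1)] .
  obtain M F where F: "F \<in> poly_set R" "x ^ M * f = poly F x" using TE[OF f] .
  have "poly P x = x ^ N * p + 0 * f" "poly F x = 0 * p + x ^ M * f" using P F by auto
  then have PJ: "P \<in> J" and FJ: "F \<in> J"
    unfolding J_def using P(1) F(1) x_in_T T.zero_in T.power_in by blast+
  have P0: "P \<noteq> 0" using P(2) pD(2) x_nonzero by auto
  have Pmonom: "P \<noteq> Polynomial.monom r e" for r e
  proof
    assume *: "P = Polynomial.monom r e"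
    then have "r \<in> R" using P(1) by simp
    then show False using inv[of r N e] P(2) * by (simp add: poly_monom)
  qed
  obtain D where D: "D \<in> J - {0}" "\<And>E. E \<in> J - {0} \<Longrightarrow> ?deg D \<le> ?deg E"
    using ex_has_least_nat[of "\<lambda>E. E \<in> J - {0}" P ?deg] PJ P0 by auto
  have DS: "D \<in> poly_set R" "D \<noteq> 0" using D by (auto simp: J_def)
  obtain a b where ab: "a \<in> T" "b \<in> T" "poly D x = a * p + b * f" using D by (auto simp: J_def)
  have div: "\<exists>c\<in>R. \<exists>Q\<in>poly_set R. c \<noteq> 0 \<and> [:c:] * E = Q * D" if E: "E \<in> J" for E
  proof -
    have ES: "E \<in> poly_set R" using E by (simp add: J_def)
    obtain c Q S where c: "c \<in> R" "c \<noteq> 0" "Q \<in> poly_set R" "S \<in> poly_set R"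
      "[:c:] * E = Q * D + S" "S = 0 \<or> ?deg S < ?deg D"
      using pseudo_division[OF DS ES] by blast
    obtain a' b' where ab': "a' \<in> T" "b' \<in> T" "poly E x = a' * p + b' * f"
      using E by (auto simp: J_def)
    have "S = [:c:] * E - Q * D" using c by simp
    then have "poly S x = c * poly E x - poly Q x * poly D x" by simp
    also have "\<dots> = (c * a' - poly Q x * a) * p + (c * b' - poly Q x * b) * f"
      unfolding ab ab' by (simp add: algebra_simps)
    finally have "poly S x = (c * a' - poly Q x * a) * p + (c * b' - poly Q x * b) * f" .
    moreover have "c * a' - poly Q x * a \<in> T" "c * b' - poly Q x * b \<in> T"
      using ab ab' R_subset_T[OF c(1)] poly_in_T[OF c(3)] by auto
    ultimately have "S \<in> J" unfolding J_def using c(4) by blast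
    then have "S = 0" using c(6) D(2)[of S] by fastforce
    then show ?thesis using c by auto
  qed
  obtain c Q where c: "c \<in> R" "Q \<in> poly_set R" "c \<noteq> 0" "[:c:] * P = Q * D" using div[OF PJ] by blast
  have cp: "c * (x ^ N * p) = poly Q x * poly D x"
    using arg_cong[OF c(4), of "\<lambda>P. poly P x"] P(2) by simp
  have QT: "poly Q x \<in> T" and DT: "poly D x \<in> T" using c DS poly_in_T by auto
  have "poly Q x * poly D x = p * (c * x ^ N)" using cp by (simp add: mult_ac)
  then have "dvd_in T p (poly Q x * poly D x)"
    unfolding dvd_in_def using R_subset_T[OF c(1)] x_in_T by (auto intro!: bexI[of _ "c * x ^ N"])
  then have "dvd_in T p (poly Q x) \<or> dvd_in T p (poly D x)" using pD(4)[OF QT DT] by blast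
  \<comment> \<open>Then \<open>p\<close> would divide a constant multiple of
    \<open>x ^ M * f\<close>, and so the monomial \<open>c' * x ^ M\<close>. Divisors of monomials
    are monomials, which \<open>inv\<close> excludes for \<open>p\<close>.\<close>
  moreover have False if "dvd_in T p (poly D x)"
  proof -
    from that obtain d where d: "d \<in> T" "poly D x = p * d" by (auto simp: dvd_in_def)
    obtain c' Q' where c': "c' \<in> R" "Q' \<in> poly_set R" "c' \<noteq> 0" "[:c':] * F = Q' * D" using div[OF FJ] by blast
    have cT: "c' * x ^ M \<in> T" using R_subset_T[OF c'(1)] x_in_T by auto
    have "c' * x ^ M * f = p * (poly Q' x * d)"
      using arg_cong[OF c'(4), of "\<lambda>P. poly P x"] F(2) d by (simp add: mult_ac)
    then have "dvd_in T p (c' * x ^ M * f)" unfolding dvd_in_def using d poly_in_T[OF c'(2)] by auto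
    then have "dvd_in T p (c' * x ^ M)" using pD(4)[OF cT f] nd by blast
    then obtain h where h: "h \<in> T" "c' * x ^ M = p * h" by (auto simp: dvd_in_def)
    obtain K H where H: "H \<in> poly_set R" "x ^ K * h = poly H x" using TE[OF h(1)] .
    have "poly (P * H) x = x ^ (N + K) * (p * h)"
      by (simp add: P(2)[symmetric] H(2)[symmetric] power_add mult_ac)
    also have "\<dots> = poly (Polynomial.monom c' (M + N + K)) x"
      unfolding h(2)[symmetric] by (simp add: poly_monom power_add mult_ac)
    finally have "P * H = Polynomial.monom c' (M + N + K)"
      by (rule poly_inj[rotated 2]) (use P H c' in auto)
    then show False using dvd_monom_imp_monom[OF _ c'(3)] Pmonom by blast
  qed
  ultimately obtain h where h: "h \<in> T" "poly Q x = p * h" by (auto simp: dvd_in_def)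
  obtain K H where H: "H \<in> poly_set R" "x ^ K * h = poly H x" using TE[OF h(1)] .
  \<comment> \<open>Now \<open>p\<close> divides the cofactor \<open>poly Q x\<close> instead.
    Cancelling \<open>p\<close> shows that \<open>D\<close> divides a monomial, so \<open>D\<close>
    is a monomial itself, and its coefficient \<open>r\<close> is the element free of
    \<open>x\<close>.\<close>
  have "p * (c * x ^ N) = p * (h * poly D x)" using cp h by (simp add: mult_ac)
  then have *: "c * x ^ N = h * poly D x" using pD(2) by simp
  have "poly (D * H) x = x ^ K * (h * poly D x)" by (simp add: H(2)[symmetric] mult_ac)
  also have "\<dots> = poly (Polynomial.monom c (N + K)) x"
    unfolding *[symmetric] by (simp add: poly_monom power_add mult_ac)
  finally have "D * H = Polynomial.monom c (N + K)"
    by (rule poly_inj[rotated 2]) (use DS H c in auto)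
  then obtain r e where re: "D = Polynomial.monom r e" using dvd_monom_imp_monom[OF _ c(3)] by blast
  then have r: "r \<in> R" "r \<noteq> 0" using DS by (auto simp: monom_eq_0_iff)
  have "r = y ^ e * (r * x ^ e)" using xy_power[of e] by (simp add: mult_ac)
  also have "r * x ^ e = a * p + b * f" using ab(3) re by (simp add: poly_monom)
  finally have "r = (y ^ e * a) * p + (y ^ e * b) * f" by (simp add: algebra_simps)
  moreover have "y ^ e * a \<in> T" "y ^ e * b \<in> T" using ab y_in_T by auto
  ultimately show ?thesis using r by blast
qed

end

section \<open>Laurent polynomials\<close>

text \<open>All Laurent polynomials live in one type, with infinitely many variables; those in the variables from \<open>I\<close>
  form the subring \<open>laurent_set I\<close>, so that the number of variables can be varied by induction.\<close>

type_synonym expo = "nat \<Rightarrow>\<^sub>0 int"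
type_synonym 'k laurent = "expo \<Rightarrow>\<^sub>0 'k"

abbreviation coef :: "('e \<Rightarrow>\<^sub>0 'k::zero) \<Rightarrow> 'e \<Rightarrow> 'k" where "coef \<equiv> Poly_Mapping.lookup"
abbreviation supp :: "('e \<Rightarrow>\<^sub>0 'k::zero) \<Rightarrow> 'e set" where "supp \<equiv> Poly_Mapping.keys"
abbreviation term_of :: "'e \<Rightarrow> 'k::zero \<Rightarrow> ('e \<Rightarrow>\<^sub>0 'k)" where "term_of \<equiv> Poly_Mapping.single"

text \<open>The common shape of evaluations, augmentations, pushforwards and boundary maps. In its
  uses \<open>h\<close> is additive in the second argument, which makes \<open>lin h\<close>
  additive.\<close>

definition lin :: "('x \<Rightarrow> 'a::zero \<Rightarrow> 'b::comm_monoid_add) \<Rightarrow> ('x \<Rightarrow>\<^sub>0 'a) \<Rightarrow> 'b" where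
  "lin h f = (\<Sum>x\<in>supp f. h x (coef f x))"

lemma lin_superset:
  assumes "finite A" "supp f \<subseteq> A" "\<And>x. h x 0 = 0"
  shows "lin h f = (\<Sum>x\<in>A. h x (coef f x))"
  unfolding lin_def using assms
  by (intro sum.mono_neutral_left) (auto simp: in_keys_iff)

lemma lin_zero [simp]: "lin h 0 = 0"
  by (simp add: lin_def)

lemma lin_single: "h x 0 = 0 \<Longrightarrow> lin h (term_of x a) = h x a"
  by (cases "a = 0") (auto simp: lin_def)

lemma lin_add:
  assumes "\<And>x. h x 0 = 0" "\<And>x a b. h x (a + b) = h x a + h x b"
  shows "lin h (f + g) = lin h f + lin h g"
proof -
  let ?A = "supp f \<union> supp g"
  have "lin h (f + g) = (\<Sum>x\<in>?A. h x (coef (f + g) x))"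
    by (rule lin_superset) (auto simp: assms dest: subsetD[OF Poly_Mapping.keys_add])
  also have "\<dots> = (\<Sum>x\<in>?A. h x (coef f x)) + (\<Sum>x\<in>?A. h x (coef g x))"
    by (simp add: lookup_add assms sum.distrib)
  also have "\<dots> = lin h f + lin h g"
    by (subst (1 2) lin_superset[of ?A]) (auto simp: assms)
  finally show ?thesis .
qed

lemma lin_sum:
  assumes "\<And>x. h x 0 = 0" "\<And>x a b. h x (a + b) = h x a + h x b"
  shows "lin h (sum F I) = (\<Sum>i\<in>I. lin h (F i))"
  by (induction I rule: infinite_finite_induct) (simp_all add: lin_add assms)

lemma sum_terms: "(\<Sum>x\<in>supp f. term_of x (coef f x)) = f"
proof (rule poly_mapping_eqI)
  fix k
  have "coef (\<Sum>x\<in>supp f. term_of x (coef f x)) k = (\<Sum>x\<in>supp f. coef f x when x = k)"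
    by (simp add: lookup_sum lookup_single)
  also have "\<dots> = coef f k"
    by (cases "k \<in> supp f") (auto simp: when_def in_keys_iff)
  finally show "coef (\<Sum>x\<in>supp f. term_of x (coef f x)) k = coef f k" .
qed

lemma additive_eq_lin:
  fixes f :: "'x \<Rightarrow>\<^sub>0 'a::comm_monoid_add"
  assumes "\<phi> 0 = (0::'b::comm_monoid_add)" "\<And>f g. \<phi> (f + g) = \<phi> f + \<phi> g"
  shows "\<phi> f = lin (\<lambda>x a. \<phi> (term_of x a)) f"
proof -
  have sum: "\<phi> (sum F I) = (\<Sum>i\<in>I. \<phi> (F i))" for F :: "'x \<Rightarrow> _" and I
    by (induction I rule: infinite_finite_induct) (simp_all add: assms)
  have "\<phi> f = \<phi> (\<Sum>x\<in>supp f. term_of x (coef f x))" by (simp add: sum_terms)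
  also have "\<dots> = lin (\<lambda>x a. \<phi> (term_of x a)) f" by (simp add: sum lin_def)
  finally show ?thesis .
qed

lemma lin_mult:
  fixes f g :: "'e::monoid_add \<Rightarrow>\<^sub>0 'k::semiring_0" and h :: "'e \<Rightarrow> 'k \<Rightarrow> 'b::semiring_0"
  assumes h: "\<And>x. h x 0 = 0" "\<And>x a b. h x (a + b) = h x a + h x b"
    and m: "\<And>x y a b. x \<in> supp f \<Longrightarrow> y \<in> supp g \<Longrightarrow> h (x + y) (a * b) = h x a * h y b"
  shows "lin h (f * g) = lin h f * lin h g"
proof -
  have "f * g = (\<Sum>x\<in>supp f. \<Sum>y\<in>supp g. term_of (x + y) (coef f x * coef g y))"
    by (subst sum_terms[of f, symmetric], subst sum_terms[of g, symmetric])
      (simp add: sum_product mult_single)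
  then have "lin h (f * g) = (\<Sum>x\<in>supp f. \<Sum>y\<in>supp g. h (x + y) (coef f x * coef g y))"
    by (simp add: lin_sum lin_single h)
  also have "\<dots> = lin h f * lin h g"
    unfolding lin_def sum_product by (intro sum.cong refl m)
  finally show ?thesis .
qed

section \<open>Laurent polynomials in a given set of variables\<close>

definition laurent_set :: "nat set \<Rightarrow> 'k::idom laurent set" where
  "laurent_set I = {f. \<forall>e\<in>supp f. supp e \<subseteq> I}"

definition lvar :: "nat \<Rightarrow> int \<Rightarrow> 'k::idom laurent" where
  "lvar j k = term_of (term_of j k) 1"

lemma sub_idom_laurent_set: "sub_idom (laurent_set I :: 'k::idom laurent set)"
proof
  fix f g :: "'k laurent" assume f: "f \<in> laurent_set I" and g: "g \<in> laurent_set I"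
  show "f + g \<in> laurent_set I"
    using f g Poly_Mapping.keys_add[of f g] by (auto simp: laurent_set_def)
  show "f * g \<in> laurent_set I" unfolding laurent_set_def
  proof safe
    fix e i assume "e \<in> supp (f * g)" "i \<in> supp e"
    then obtain a b where "a \<in> supp f" "b \<in> supp g" "e = a + b" using keys_mult[of f g] by auto
    moreover from this have "supp a \<subseteq> I" "supp b \<subseteq> I" using f g by (simp_all add: laurent_set_def)
    ultimately show "i \<in> I" using \<open>i \<in> supp e\<close> Poly_Mapping.keys_add[of a b] by auto
  qed
qed (auto simp: laurent_set_def)

lemma term_in_laurent_set: "supp e \<subseteq> I \<Longrightarrow> term_of e a \<in> laurent_set I"
  by (auto simp: laurent_set_def)

lemma laurent_set_mono: "I \<subseteq> J \<Longrightarrow> laurent_set I \<subseteq> laurent_set J"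
  by (auto simp: laurent_set_def)

lemma lvar_in_laurent_set: "j \<in> I \<Longrightarrow> lvar j k \<in> laurent_set I"
  unfolding lvar_def by (rule term_in_laurent_set) auto

lemma lvar_add: "lvar j (k + l) = lvar j k * (lvar j l :: 'k::idom laurent)"
  by (simp add: lvar_def mult_single single_add)

lemma lvar_zero [simp]: "lvar j 0 = 1"
  by (simp add: lvar_def)

lemma lvar_power: "lvar j k ^ n = lvar j (int n * k)"
  by (induction n) (simp_all add: lvar_add algebra_simps)

lemma supp_mult_lvar:
  assumes "e \<in> supp (f * (lvar j k :: 'k::idom laurent))"
  shows "\<exists>e'\<in>supp f. e = e' + term_of j k"
proof -
  obtain a b where "a \<in> supp f" "b \<in> supp (lvar j k :: 'k laurent)" "e = a + b"
    using assms keys_mult[of f "lvar j k"] by auto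
  then show ?thesis by (auto simp: lvar_def)
qed

lemma coef_mult_lvar: "coef (f * (lvar j k :: 'k::idom laurent)) (e + term_of j k) = coef f e"
proof -
  have "coef (f * lvar j k) (e + term_of j k) = (\<Sum>x\<in>supp f. coef f x when x = e)"
    by (subst sum_terms[of f, symmetric])
      (simp add: sum_distrib_right lvar_def mult_single lookup_sum lookup_single)
  also have "\<dots> = coef f e" by (cases "e \<in> supp f") (auto simp: when_def in_keys_iff)
  finally show ?thesis .
qed

text \<open>Exponents from \<open>laurent_set I\<close> vanish at \<open>j\<close>, so the power of
  the new variable can be read off from the coordinate \<open>j\<close> of an exponent. Terms with
  different powers cannot cancel, which makes the variable transcendental.\<close>

lemma laurent_ext_laurent_set:
  assumes j: "j \<notin> I"
  shows "laurent_ext (laurent_set I) (lvar j 1) (lvar j (-1)) (laurent_set (insert j I) :: 'k::idom laurent set)"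
proof -
  interpret R: sub_idom "laurent_set I :: 'k laurent set" by (rule sub_idom_laurent_set)
  interpret T: sub_idom "laurent_set (insert j I) :: 'k laurent set" by (rule sub_idom_laurent_set)
  have xy: "lvar j 1 * lvar j (-1) = (1 :: 'k laurent)" using lvar_add[of j 1 "-1"] by simp
  define S :: "'k laurent set" where
    "S = {f. \<exists>N. \<exists>P\<in>poly_set (laurent_set I). lvar j 1 ^ N * f = poly P (lvar j 1)}"
  have coef_j: "coef e j = 0" if "e \<in> supp f" "f \<in> laurent_set I" for e and f :: "'k laurent"
  proof -
    have "supp e \<subseteq> I" using that by (simp add: laurent_set_def)
    then show ?thesis using j by (metis in_keys_iff subsetD)
  qed
  show ?thesis
  proof unfold_locales
    show "lvar j 1 * lvar j (-1) = (1 :: 'k laurent)" by (rule xy)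
    fix P :: "'k laurent poly" assume P: "P \<in> poly_set (laurent_set I)" and 0: "poly P (lvar j 1) = 0"
    show "P = 0"
    proof (rule poly_eqI, rule poly_mapping_eqI)
      fix i e
      let ?c = "Polynomial.coeff P"
      have c: "?c l \<in> laurent_set I" for l using P by (simp add: poly_set_def)
      show "coef (?c i) e = coef (Polynomial.coeff 0 i) e"
      proof (rule ccontr)
        assume ne: "coef (?c i) e \<noteq> coef (Polynomial.coeff 0 i) e"
        then have e: "e \<in> supp (?c i)" by (simp add: in_keys_iff)
        then have i: "i \<le> Polynomial.degree P" by (intro le_degree) auto
        have other: "coef (?c l * lvar j (int l)) (e + term_of j (int i)) = 0" if "l \<noteq> i" for l
        proof (rule ccontr)
          assume "coef (?c l * lvar j (int l)) (e + term_of j (int i)) \<noteq> 0"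
          then have "e + term_of j (int i) \<in> supp (?c l * lvar j (int l))" by (simp add: in_keys_iff)
          from supp_mult_lvar[OF this] obtain e' where
            e': "e' \<in> supp (?c l)" "e + term_of j (int i) = e' + term_of j (int l)" by blast
          then have "coef (e + term_of j (int i)) j = coef (e' + term_of j (int l)) j" by simp
          then show False using coef_j[OF e c] coef_j[OF e'(1) c] that by (simp add: lookup_add)
        qed
        have "0 = coef (poly P (lvar j 1)) (e + term_of j (int i))" using 0 by simp
        also have "\<dots> = (\<Sum>l\<le>Polynomial.degree P. coef (?c l * lvar j (int l)) (e + term_of j (int i)))"
          by (simp add: poly_altdef lookup_sum lvar_power)
        also have "\<dots> = coef (?c i * lvar j (int i)) (e + term_of j (int i))"
          using i other by (subst sum.remove[of _ i]) auto
        also have "\<dots> = coef (?c i) e" by (rule coef_mult_lvar)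
        finally show False using ne by simp
      qed
    qed
  next
    have Sadd: "f + g \<in> S" if "f \<in> S" "g \<in> S" for f g
    proof -
      from that obtain N P M Q where *: "P \<in> poly_set (laurent_set I)" "lvar j 1 ^ N * f = poly P (lvar j 1)"
        "Q \<in> poly_set (laurent_set I)" "lvar j 1 ^ M * g = poly Q (lvar j 1)" by (auto simp: S_def)
      interpret PR: sub_idom "poly_set (laurent_set I) :: 'k laurent poly set"
        by (rule R.sub_idom_poly_set)
      have "lvar j 1 ^ (N + M) * (f + g) = lvar j 1 ^ M * (lvar j 1 ^ N * f) + lvar j 1 ^ N * (lvar j 1 ^ M * g)"
        by (simp add: algebra_simps power_add)
      also have "\<dots> = poly (Polynomial.monom 1 M * P + Polynomial.monom 1 N * Q) (lvar j 1)"
        by (simp add: * poly_monom)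
      finally have "lvar j 1 ^ (N + M) * (f + g) = poly (Polynomial.monom 1 M * P + Polynomial.monom 1 N * Q) (lvar j 1)" .
      moreover have "Polynomial.monom 1 M * P + Polynomial.monom 1 N * Q \<in> poly_set (laurent_set I)"
        using * by simp
      ultimately show ?thesis unfolding S_def by blast
    qed
    have S0: "0 \<in> S" unfolding S_def by (auto intro!: exI[of _ 0] bexI[of _ 0] simp: poly_set_def)
    have Sterm: "term_of e a \<in> S" if "supp e \<subseteq> insert j I" for e a
    proof -
      define k where "k = coef e j"
      define e' where "e' = e - term_of j k"
      have e'j: "j \<notin> supp e'" by (simp add: e'_def k_def in_keys_iff lookup_minus)
      have "i \<in> I" if "i \<in> supp e'" for i
      proof -
        have "i \<noteq> j" using that e'j by auto
        then have "coef e i \<noteq> 0" using that by (simp add: e'_def in_keys_iff lookup_minus lookup_single when_def split: if_splits)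
        then show ?thesis using \<open>supp e \<subseteq> _\<close> \<open>i \<noteq> j\<close> by (auto simp: in_keys_iff)
      qed
      then have e': "term_of e' a \<in> laurent_set I" by (intro term_in_laurent_set) auto
      \<comment> \<open>The least power of the variable that makes the exponent at \<open>j\<close>
        nonnegative.\<close>
      define N where "N = nat (- k)"
      have pow: "lvar j 1 ^ M = (term_of (term_of j (int M)) 1 :: 'k laurent)" for M
        by (subst lvar_power) (simp add: lvar_def)
      have "lvar j 1 ^ N * term_of e a = term_of (e' + term_of j (int N + k)) a"
        by (simp add: pow mult_single e'_def single_add algebra_simps)
      also have "\<dots> = term_of e' a * lvar j 1 ^ nat (int N + k)"
        by (simp add: pow mult_single N_def)
      also have "\<dots> = poly (Polynomial.monom (term_of e' a) (nat (int N + k))) (lvar j 1)"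
        by (simp add: poly_monom)
      finally have "lvar j 1 ^ N * term_of e a = poly (Polynomial.monom (term_of e' a) (nat (int N + k))) (lvar j 1)" .
      moreover have "Polynomial.monom (term_of e' a) (nat (int N + k)) \<in> poly_set (laurent_set I)" using e' by simp
      ultimately show ?thesis unfolding S_def by blast
    qed
    have "laurent_set (insert j I) \<subseteq> S"
    proof
      fix f :: "'k laurent" assume f: "f \<in> laurent_set (insert j I)"
      have "(\<Sum>e\<in>A. term_of e (coef f e)) \<in> S" if "finite A" "A \<subseteq> supp f" for A
        using that by (induction A rule: finite_induct)
          (use f in \<open>auto intro!: S0 Sadd Sterm simp: laurent_set_def\<close>)
      from this[of "supp f"] show "f \<in> S" by (simp add: sum_terms)
    qed
    moreover have "S \<subseteq> laurent_set (insert j I)"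
    proof
      fix f assume "f \<in> S"
      then obtain N P where P: "P \<in> poly_set (laurent_set I)" "lvar j 1 ^ N * f = poly P (lvar j 1)"
        by (auto simp: S_def)
      have "poly P (lvar j 1) \<in> laurent_set (insert j I)" unfolding poly_altdef
        using P laurent_set_mono[of I "insert j I"] lvar_in_laurent_set[of j "insert j I" 1]
        by (intro T.sum_in) (auto simp: poly_set_def)
      then have "lvar j (-1) ^ N * poly P (lvar j 1) \<in> laurent_set (insert j I)"
        by (auto intro!: lvar_in_laurent_set)
      moreover have "lvar j (-1) ^ N * (lvar j 1 ^ N * f) = (lvar j 1 * lvar j (-1)) ^ N * f"
        by (simp add: power_mult_distrib mult_ac)
      ultimately show "f \<in> laurent_set (insert j I)" using P xy by simp
    qed
    ultimately show "laurent_set (insert j I) = {f. \<exists>N. \<exists>P\<in>poly_set (laurent_set I). lvar j 1 ^ N * f = poly P (lvar j 1 :: 'k laurent)}"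
      unfolding S_def by blast
  qed
qed

text \<open>Without variables the only exponent is 0, and \<open>term_of 0\<close> identifies the
  coefficient ring with \<open>laurent_set {}\<close>.\<close>

lemma ufd_laurent_set_empty:
  assumes "ufd (UNIV :: 'k::idom set)"
  shows "ufd (laurent_set {} :: 'k laurent set)"
  unfolding ufd_def
proof (intro conjI ballI impI sub_idom_laurent_set)
  let ?L = "laurent_set {} :: 'k laurent set"
  have const: "term_of 0 a \<in> ?L" for a by (rule term_in_laurent_set) simp
  have ex: "\<exists>a. f = term_of 0 a" if "f \<in> ?L" for f
  proof -
    have sub: "supp f \<subseteq> {0}" using that by (auto simp: laurent_set_def)
    have "f = (\<Sum>e\<in>supp f. term_of e (coef f e))" by (simp add: sum_terms)
    also have "\<dots> = (\<Sum>e\<in>{0}. term_of e (coef f e))"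
      using sub by (intro sum.mono_neutral_left) (auto simp: in_keys_iff)
    finally show ?thesis by auto
  qed
  have mult: "term_of 0 a * term_of 0 b = (term_of 0 (a * b) :: 'k laurent)" for a b
    by (simp add: mult_single)
  have inj: "term_of 0 a = (term_of 0 b :: 'k laurent) \<longleftrightarrow> a = b" for a b
    by (metis lookup_single_eq)
  have dvd: "dvd_in ?L (term_of 0 a) (term_of 0 b) \<longleftrightarrow> dvd_in UNIV a b" for a b
  proof
    assume "dvd_in ?L (term_of 0 a) (term_of 0 b)"
    then obtain c where "c \<in> ?L" "term_of 0 b = term_of 0 a * c" by (auto simp: dvd_in_def)
    with ex obtain c' where "term_of 0 b = term_of 0 a * (term_of 0 c' :: 'k laurent)" by blast
    then show "dvd_in UNIV a b" by (auto simp: mult inj dvd_in_def)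
  next
    assume "dvd_in UNIV a b"
    then obtain c where "b = a * c" by (auto simp: dvd_in_def)
    then have "term_of 0 b = term_of 0 a * (term_of 0 c :: 'k laurent)" by (simp add: mult)
    then show "dvd_in ?L (term_of 0 a) (term_of 0 b)" using const unfolding dvd_in_def by blast
  qed
  have unit_iff: "unit_in S a \<longleftrightarrow> dvd_in S a 1 \<and> a \<in> S" for S and a :: "'x::idom"
    by (auto simp: unit_in_def dvd_in_def eq_commute[of 1])
  have unit: "unit_in ?L (term_of 0 a) \<longleftrightarrow> unit_in UNIV a" for a
    using dvd[of a 1] const by (simp add: unit_iff)
  have prime: "prime_in ?L (term_of 0 p)" if "prime_in UNIV p" for p
    unfolding prime_in_def
  proof (intro conjI ballI impI)
    show "term_of 0 p \<noteq> (0 :: 'k laurent)" using inj[of p 0] prime_inD(2)[OF that] by simp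
    fix f g assume "f \<in> ?L" "g \<in> ?L" and fg: "dvd_in ?L (term_of 0 p) (f * g)"
    then obtain a b where ab: "f = term_of 0 a" "g = term_of 0 b" using ex by blast
    then have "dvd_in UNIV p (a * b)" using fg by (simp add: mult dvd)
    then show "dvd_in ?L (term_of 0 p) f \<or> dvd_in ?L (term_of 0 p) g"
      using prime_inD(4)[OF that, of a b] by (auto simp: ab dvd)
  qed (use that const unit prime_inD(3)[OF that] in auto)
  have prod: "prime_prod ?L n (term_of 0 a)" if "prime_prod UNIV n a" for n a
    using that
  proof (induction rule: prime_prod.induct)
    case (unit u)
    then show ?case using \<open>\<And>a. unit_in ?L (term_of 0 a) \<longleftrightarrow> unit_in UNIV a\<close> by (auto intro: prime_prod.unit)
  next
    case (mult p n f)
    then have "prime_prod ?L (Suc n) (term_of 0 p * term_of 0 f)" by (intro prime_prod.mult prime)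
    then show ?case by (simp add: mult_single)
  qed
  fix f assume "f \<in> ?L" "f \<noteq> 0"
  with ex obtain a where a: "f = term_of 0 a" by blast
  then have "a \<noteq> 0" using \<open>f \<noteq> 0\<close> by auto
  then obtain n where "prime_prod UNIV n a" using assms by (auto simp: ufd_def)
  from prod[OF this] show "\<exists>n. prime_prod ?L n f" using a by blast
qed

theorem ufd_laurent_set:
  assumes "ufd (UNIV :: 'k::idom set)" "finite I"
  shows "ufd (laurent_set I :: 'k laurent set)"
  using assms(2)
proof (induction I rule: finite_induct)
  case empty
  then show ?case by (rule ufd_laurent_set_empty[OF assms(1)])
next
  case (insert j I)
  then show ?case using laurent_ext.ufd_T[OF laurent_ext_laurent_set] by blast
qed

section \<open>The two coefficient rings\<close>

lemma sub_idom_UNIV: "sub_idom (UNIV :: 'k::idom set)"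
  by unfold_locales auto

lemma ufd_field: "ufd (UNIV :: 'k::field set)"
  unfolding ufd_def
proof (intro conjI ballI impI sub_idom_UNIV)
  fix f :: 'k assume "f \<noteq> 0"
  then have "unit_in UNIV f" by (auto simp: unit_in_def intro!: exI[of _ "inverse f"])
  then show "\<exists>n. prime_prod UNIV n f" using prime_prod.unit by blast
qed

lemma ufd_int: "ufd (UNIV :: int set)"
  unfolding ufd_def
proof (intro conjI ballI impI sub_idom_UNIV)
  have dvd: "dvd_in UNIV a b \<longleftrightarrow> a dvd b" for a b :: int by (auto simp: dvd_in_def dvd_def)
  have unit: "unit_in UNIV a \<longleftrightarrow> is_unit a" for a :: int by (auto simp: unit_in_def dvd_def eq_commute[of 1])
  fix f :: int
  show "\<exists>n. prime_prod UNIV n f" if "f \<noteq> 0"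
    using that
  proof (induction f rule: prime_divisors_induct)
    case (unit x)
    then show ?case using prime_prod.unit[of UNIV x] \<open>\<And>a. unit_in UNIV a \<longleftrightarrow> is_unit a\<close> by blast
  next
    case (factor p x)
    have "prime_elem p" using factor.hyps by auto
    then have "prime_in UNIV p"
      unfolding prime_in_def dvd unit prime_elem_def by blast
    moreover have "x \<noteq> 0" using factor.prems by auto
    ultimately show ?case using factor.IH prime_prod.mult by blast
  qed simp
qed

section \<open>Evaluation at points of the torus\<close>

text \<open>The number of coordinates is fixed only by the parameter \<open>n\<close> of
  \<open>ev\<close>, which reads the first \<open>n\<close> of them. The others are asked to be
  nonzero as well, so that one set serves for every \<open>n\<close>.\<close>

definition torus_points :: "(nat \<Rightarrow> complex) set" where
  "torus_points = {c. \<forall>i. c i \<noteq> 0}"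

definition monomial_at :: "nat \<Rightarrow> (nat \<Rightarrow> complex) \<Rightarrow> expo \<Rightarrow> complex" where
  "monomial_at n c e = (\<Prod>i<n. c i powi coef e i)"

definition ev :: "nat \<Rightarrow> (nat \<Rightarrow> complex) \<Rightarrow> complex laurent \<Rightarrow> complex" where
  "ev n c = lin (\<lambda>e a. a * monomial_at n c e)"

lemma monomial_at_zero [simp]: "monomial_at n c 0 = 1"
  by (simp add: monomial_at_def)

lemma monomial_at_nonzero: "c \<in> torus_points \<Longrightarrow> monomial_at n c e \<noteq> 0"
  by (auto simp: monomial_at_def torus_points_def)

lemma monomial_at_add:
  "c \<in> torus_points \<Longrightarrow> monomial_at n c (e + e') = monomial_at n c e * monomial_at n c e'"
  by (simp add: monomial_at_def torus_points_def lookup_add power_int_add prod.distrib)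

lemma monomial_at_single: "j < n \<Longrightarrow> monomial_at n c (term_of j k) = c j powi k"
proof -
  assume "j < n"
  have "monomial_at n c (term_of j k) = (\<Prod>i<n. if i = j then c i powi k else 1)"
    unfolding monomial_at_def by (intro prod.cong) (auto simp: lookup_single when_def)
  also have "\<dots> = c j powi k" using \<open>j < n\<close> by simp
  finally show ?thesis .
qed

lemma monomial_at_upd:
  assumes "j < n" "z \<noteq> 0"
  shows "monomial_at n (c(j := z * c j)) e = z powi coef e j * monomial_at n c e"
proof -
  have "monomial_at n (c(j := z * c j)) e = (\<Prod>i<n. (if i = j then z powi coef e j else 1) * c i powi coef e i)"
    unfolding monomial_at_def by (intro prod.cong) (auto simp: power_int_mult_distrib)
  also have "\<dots> = z powi coef e j * monomial_at n c e"
    unfolding prod.distrib monomial_at_def using assms(1) by simp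
  finally show ?thesis .
qed

lemma monomial_at_cong:
  assumes "supp e \<subseteq> I" "\<And>i. i \<in> I \<Longrightarrow> c i = d i"
  shows "monomial_at n c e = monomial_at n d e"
  unfolding monomial_at_def
proof (intro prod.cong refl)
  fix i show "c i powi coef e i = d i powi coef e i"
    using assms by (cases "i \<in> supp e") (auto simp: in_keys_iff)
qed

lemma ev_zero [simp]: "ev n c 0 = 0"
  by (simp add: ev_def)

lemma ev_add [simp]: "ev n c (f + g) = ev n c f + ev n c g"
  unfolding ev_def by (rule lin_add) (simp_all add: algebra_simps)

lemma ev_uminus [simp]: "ev n c (- f) = - ev n c f"
  using ev_add[of n c f "- f"] by (simp add: eq_neg_iff_add_eq_0 add.commute)

lemma ev_diff [simp]: "ev n c (f - g) = ev n c f - ev n c g"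
  using ev_add[of n c f "- g"] by simp

lemma ev_sum: "ev n c (sum F I) = (\<Sum>i\<in>I. ev n c (F i))"
  by (induction I rule: infinite_finite_induct) simp_all

lemma ev_term_of: "ev n c (term_of e a) = a * monomial_at n c e"
  unfolding ev_def by (simp add: lin_single)

lemma ev_one [simp]: "ev n c 1 = 1"
  using ev_term_of[of n c 0 1] by simp

lemma ev_mult [simp]: "c \<in> torus_points \<Longrightarrow> ev n c (f * g) = ev n c f * ev n c g"
  unfolding ev_def by (rule lin_mult) (simp_all add: monomial_at_add algebra_simps)

lemma ev_power [simp]: "c \<in> torus_points \<Longrightarrow> ev n c (f ^ k) = ev n c f ^ k"
  by (induction k) simp_all

lemma ev_lvar: "j < n \<Longrightarrow> ev n c (lvar j k) = c j powi k"
  by (simp add: lvar_def ev_term_of monomial_at_single)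

lemma ev_cong:
  assumes "f \<in> laurent_set I" "\<And>i. i \<in> I \<Longrightarrow> c i = d i"
  shows "ev n c f = ev n d f"
  unfolding ev_def lin_def
proof (intro sum.cong refl)
  fix e assume "e \<in> supp f"
  then have "supp e \<subseteq> I" using assms by (simp add: laurent_set_def)
  then show "coef f e * monomial_at n c e = coef f e * monomial_at n d e"
    using monomial_at_cong[of e I c d n] assms(2) by simp
qed

lemma ev_poly:
  assumes "c \<in> torus_points"
  shows "ev n c (poly P x) = poly (map_poly (ev n c) P) (ev n c x)"
  by (induction P) (simp_all add: assms map_poly_pCons)

text \<open>Dedekind's argument for the independence of characters.\<close>

lemma ev_nonzero:
  assumes "f \<noteq> 0" "f \<in> laurent_set {..<n}"
  shows "\<exists>c\<in>torus_points. ev n c f \<noteq> 0"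
  using assms
proof (induction "card (supp f)" arbitrary: f rule: less_induct)
  case less
  have one: "(\<lambda>_. 1) \<in> torus_points" by (simp add: torus_points_def)
  obtain e where e: "e \<in> supp f" using less.prems(1) by (metis all_not_in_conv keys_eq_empty)
  show ?case
  proof (cases "supp f = {e}")
    case True
    then have "ev n (\<lambda>_. 1) f = coef f e * monomial_at n (\<lambda>_. 1) e" by (simp add: ev_def lin_def)
    then have "ev n (\<lambda>_. 1) f \<noteq> 0" using e monomial_at_nonzero[OF one] by (simp add: in_keys_iff)
    then show ?thesis using one by blast
  next
    case False
    then obtain e' where e': "e' \<in> supp f" "e' \<noteq> e" using e by auto
    have "\<exists>j. coef e j \<noteq> coef e' j" using e' by (metis poly_mapping_eqI)
    then obtain j where j: "coef e j \<noteq> coef e' j" by blast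
    have sub: "supp e \<subseteq> {..<n}" "supp e' \<subseteq> {..<n}" using e e' less.prems(2) by (auto simp: laurent_set_def)
    have jn: "j < n"
    proof (rule ccontr)
      assume "\<not> j < n"
      then have "j \<notin> supp e" "j \<notin> supp e'" using sub by auto
      then show False using j by (simp add: in_keys_iff)
    qed
    \<comment> \<open>As a function of the point, \<open>g\<close> is the value of \<open>f\<close>
      after doubling coordinate \<open>j\<close>, minus \<open>2 powi coef e' j\<close> times the
      value of \<open>f\<close>. The exponent \<open>e'\<close> cancels and \<open>e\<close>
      survives, since integer powers of 2 are distinct; so one of the two values of \<open>f\<close>
      is nonzero.\<close>
    define g :: "complex laurent" where
      "g = (\<Sum>x\<in>supp f. term_of x (coef f x * (2 powi coef x j - 2 powi coef e' j)))"
    have cg: "coef g x = coef f x * (2 powi coef x j - 2 powi coef e' j)" for x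
      unfolding g_def by (cases "x \<in> supp f") (auto simp: lookup_sum lookup_single when_def in_keys_iff)
    have "supp g \<subseteq> supp f - {e'}" by (auto simp: in_keys_iff cg)
    then have "card (supp g) < card (supp f)" using e'(1)
      by (intro psubset_card_mono) auto
    moreover have "g \<noteq> 0"
    proof -
      have "(2::complex) powi coef e j \<noteq> 2 powi coef e' j"
      proof
        assume "(2::complex) powi coef e j = 2 powi coef e' j"
        then have "norm ((2::complex) powi coef e j) = norm ((2::complex) powi coef e' j)" by simp
        then have "(2::real) powi coef e j = 2 powi coef e' j" by (simp add: norm_power_int)
        then show False using j
          by (metis linorder_neq_iff power_int_strict_increasing one_less_numeral_iff semiring_norm(76) order_less_irrefl)
      qed
      then have "coef g e \<noteq> 0" using e by (simp add: cg in_keys_iff)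
      then show ?thesis by auto
    qed
    moreover have "g \<in> laurent_set {..<n}"
      using \<open>supp g \<subseteq> _\<close> less.prems(2) by (auto simp: laurent_set_def)
    ultimately obtain c where c: "c \<in> torus_points" "ev n c g \<noteq> 0" using less.hyps[of g] by auto
    let ?c' = "c(j := 2 * c j)"
    have "ev n c g = (\<Sum>x\<in>supp f. coef f x * (2 powi coef x j * monomial_at n c x))
       - 2 powi coef e' j * (\<Sum>x\<in>supp f. coef f x * monomial_at n c x)"
      unfolding g_def by (simp add: ev_sum ev_term_of algebra_simps sum_subtractf sum_distrib_left)
    also have "\<dots> = ev n ?c' f - 2 powi coef e' j * ev n c f"
      unfolding ev_def lin_def by (simp add: monomial_at_upd[OF jn])
    finally have "ev n ?c' f \<noteq> 0 \<or> ev n c f \<noteq> 0" using c(2) by auto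
    moreover have "?c' \<in> torus_points" using c(1) by (simp add: torus_points_def)
    ultimately show ?thesis using c(1) by blast
  qed
qed

text \<open>Regard \<open>f\<close> as a polynomial in variable \<open>j\<close>, with a power of
  the variable split off. Its degree is positive because two exponents differ at \<open>j\<close>.
  For generic values of the other variables its leading and constant coefficients and
  \<open>g\<close> stay nonzero; the fundamental theorem of algebra gives a root, and the constant
  coefficient keeps the root away from 0.\<close>

lemma exists_root_off:
  assumes f: "f \<in> laurent_set {..<n}" and j: "j < n"
    and e: "e \<in> supp f" "e' \<in> supp f" "coef e j \<noteq> coef e' j"
    and g: "g \<in> laurent_set ({..<n} - {j})" "g \<noteq> 0"
  shows "\<exists>c\<in>torus_points. ev n c f = 0 \<and> ev n c g \<noteq> 0"
proof -
  let ?I = "{..<n} - {j}" and ?x = "lvar j 1 :: complex laurent"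
  have ins: "insert j ?I = {..<n}" using j by auto
  interpret E: laurent_ext "laurent_set ?I" ?x "lvar j (-1)" "laurent_set {..<n} :: complex laurent set"
    using laurent_ext_laurent_set[of j ?I] unfolding ins by simp
  obtain N P where P: "P \<in> poly_set (laurent_set ?I)" "?x ^ N * f = poly P ?x" using E.TE[OF f] .
  have f0: "f \<noteq> 0" using e by auto
  have "?x \<noteq> 0" using E.x_nonzero .
  then have "P \<noteq> 0" using P(2) f0 by auto
  then obtain a P' where P': "P = Polynomial.monom 1 a * P'" "Polynomial.coeff P' 0 \<noteq> 0"
    "\<And>i. Polynomial.coeff P' i = Polynomial.coeff P (i + a)" using poly_split_X by blast
  have coeff_in: "Polynomial.coeff P' i \<in> laurent_set ?I" for i using P(1) by (simp add: P'(3) poly_set_def)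
  have deg: "Polynomial.degree P' \<noteq> 0"
  proof
    assume "Polynomial.degree P' = 0"
    then obtain r where r: "P' = [:r:]" by (metis degree_eq_zeroE)
    have rI: "r \<in> laurent_set ?I" using coeff_in[of 0] r by simp
    have fr: "lvar j (int N) * f = r * lvar j (int a)"
      using P(2) by (simp add: P'(1) r poly_monom lvar_power mult.commute)
    have "f = lvar j (- int N) * (lvar j (int N) * f)"
      using lvar_add[of j "- int N" "int N", where ?'k = complex]
      by (simp add: mult.assoc[symmetric])
    also have "\<dots> = r * lvar j (int a - int N)"
      unfolding fr by (simp add: lvar_add[of j "int a" "- int N", simplified] mult_ac)
    finally have fr': "f = r * lvar j (int a - int N)" .
    have "coef d j = int a - int N" if "d \<in> supp f" for d
    proof -
      have "d \<in> supp (r * lvar j (int a - int N))" using that fr' by simp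
      from supp_mult_lvar[OF this] obtain d' where
        d': "d' \<in> supp r" "d = d' + term_of j (int a - int N)" by blast
      then have "supp d' \<subseteq> ?I" using rI by (simp add: laurent_set_def)
      then have "coef d' j = 0" by (auto simp: in_keys_iff)
      then show ?thesis using d' by (simp add: lookup_add)
    qed
    then show False using e by simp
  qed
  \<comment> \<open>The product of all that must survive when the variables other than
    \<open>j\<close> are specialized.\<close>
  define h where "h = g * Polynomial.coeff P' 0 * Polynomial.lead_coeff P'"
  have "P' \<noteq> 0" using P'(2) by auto
  then have "h \<noteq> 0" using g P'(2) by (simp add: h_def)
  moreover have "h \<in> laurent_set {..<n}"
    using g coeff_in laurent_set_mono[of ?I "{..<n}"] unfolding h_def by (intro E.T.mult_in) auto
  ultimately obtain c where c: "c \<in> torus_points" "ev n c h \<noteq> 0" using ev_nonzero by blast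
  define Q where "Q = map_poly (ev n c) P'"
  have Qc: "Polynomial.coeff Q i = ev n c (Polynomial.coeff P' i)" for i
    by (simp add: Q_def coeff_map_poly)
  have nz: "ev n c g \<noteq> 0" "Polynomial.coeff Q 0 \<noteq> 0" "Polynomial.coeff Q (Polynomial.degree P') \<noteq> 0"
    using c by (auto simp: h_def Qc)
  then have "Polynomial.degree Q > 0" using deg le_degree[of Q "Polynomial.degree P'"] by auto
  then obtain z where z: "poly Q z = 0" using alg_closed_imp_poly_has_root by blast
  have z0: "z \<noteq> 0" using z nz(2) by (auto simp: poly_0_coeff_0)
  define d where "d = c(j := z)"
  have d: "d \<in> torus_points" using c z0 by (simp add: d_def torus_points_def)
  have same: "ev n d r = ev n c r" if "r \<in> laurent_set ?I" for r
    using ev_cong[OF that, of d c] by (simp add: d_def)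
  have "map_poly (ev n d) P' = Q"
    by (rule poly_eqI) (simp add: Qc coeff_map_poly same coeff_in)
  then have "ev n d (poly P' ?x) = 0"
    using ev_poly[OF d, of n P' ?x] z j by (simp add: ev_lvar d_def)
  then have "ev n d (?x ^ N * f) = 0" unfolding P(2) P'(1) using d by simp
  then have "ev n d f = 0" using d j z0 by (simp add: ev_lvar d_def)
  moreover have "ev n d g \<noteq> 0" using same g nz by simp
  ultimately show ?thesis using d by blast
qed

text \<open>Over a field a single nonzero term is a unit, so a nonzero nonunit has two exponents.
  They vanish from \<open>n\<close> on and therefore differ below \<open>n\<close>.\<close>

lemma two_exponents:
  fixes f :: "'k::field laurent"
  assumes "f \<in> laurent_set {..<n}" "f \<noteq> 0" "\<not> unit_in (laurent_set {..<n}) f"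
  shows "\<exists>j<n. \<exists>e\<in>supp f. \<exists>e'\<in>supp f. coef e j \<noteq> coef e' j"
proof -
  obtain e where e: "e \<in> supp f" using assms(2) by (metis all_not_in_conv keys_eq_empty)
  have sub: "supp x \<subseteq> {..<n}" if "x \<in> supp f" for x using that assms(1) by (simp add: laurent_set_def)
  have "supp f \<noteq> {e}"
  proof
    assume "supp f = {e}"
    then have f: "f = term_of e (coef f e)" using sum_terms[of f] by simp
    have "coef f e \<noteq> 0" using e by (simp add: in_keys_iff)
    then have "f * term_of (- e) (inverse (coef f e)) = 1" by (subst f) (simp add: mult_single)
    moreover have "term_of (- e) (inverse (coef f e)) \<in> laurent_set {..<n}"
      by (rule term_in_laurent_set) (use sub[OF e] in auto)
    ultimately show False using assms by (auto simp: unit_in_def)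
  qed
  then obtain e' where e': "e' \<in> supp f" "e' \<noteq> e" using e by auto
  then obtain j where j: "coef e j \<noteq> coef e' j" by (metis poly_mapping_eqI)
  have "j < n"
  proof (rule ccontr)
    assume "\<not> j < n"
    then have "j \<notin> supp e" "j \<notin> supp e'" using sub e e' by auto
    then show False using j by (simp add: in_keys_iff)
  qed
  then show ?thesis using j e e' by blast
qed

text \<open>A nonunit involves some variable essentially, and \<open>exists_root_off\<close> with
  \<open>g = 1\<close> then yields a zero.\<close>

lemma no_zeros_imp_monomial:
  assumes "f \<in> laurent_set {..<n}" "f \<noteq> 0" "\<And>c. c \<in> torus_points \<Longrightarrow> ev n c f \<noteq> 0"
  shows "unit_in (laurent_set {..<n}) f"
proof (rule ccontr)
  assume "\<not> ?thesis"
  then obtain j e e' where "j < n" "e \<in> supp f" "e' \<in> supp f" "coef e j \<noteq> coef e' j"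
    using two_exponents assms by blast
  moreover have "(1 :: complex laurent) \<in> laurent_set ({..<n} - {j})"
    using sub_idom.one_in[OF sub_idom_laurent_set] .
  ultimately show False using exists_root_off[OF assms(1), of j e e' 1] assms(3) by auto
qed

text \<open>If \<open>p\<close> did not divide \<open>f\<close>, eliminating a variable that occurs in \<open>p\<close> would yield some \<open>g \<noteq> 0\<close> in the
  other variables that vanishes wherever \<open>p\<close> does; but \<open>p\<close> has a zero above a generic point.\<close>

theorem vanishing_imp_dvd:
  assumes p: "prime_in (laurent_set {..<n}) p" and f: "f \<in> laurent_set {..<n}"
    and van: "\<And>c. c \<in> torus_points \<Longrightarrow> ev n c p = 0 \<Longrightarrow> ev n c f = 0"
  shows "dvd_in (laurent_set {..<n}) p f"
proof (rule ccontr)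
  assume nd: "\<not> ?thesis"
  note pD = prime_inD[OF p]
  obtain j e e' where je: "j < n" "e \<in> supp p" "e' \<in> supp p" "coef e j \<noteq> coef e' j"
    using two_exponents[OF pD(1-3)] by blast
  let ?I = "{..<n} - {j}"
  have ins: "insert j ?I = {..<n}" using je by auto
  interpret E: laurent_ext "laurent_set ?I" "lvar j 1" "lvar j (-1)" "laurent_set {..<n} :: complex laurent set"
    using laurent_ext_laurent_set[of j ?I] unfolding ins by simp
  \<comment> \<open>If \<open>p\<close> were a monomial in variable \<open>j\<close> over the
    remaining variables, all its exponents would agree at \<open>j\<close>. This is the condition
    \<open>inv\<close> of the elimination.\<close>
  have "lvar j 1 ^ N * p \<noteq> r * lvar j 1 ^ k" if r: "r \<in> laurent_set ?I" for N r k
  proof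
    assume "lvar j 1 ^ N * p = r * lvar j 1 ^ k"
    then have pr: "p * lvar j (int N) = r * lvar j (int k)" by (simp add: lvar_power mult.commute)
    have "coef d j = int k - int N" if d: "d \<in> supp p" for d
    proof -
      have "coef (p * lvar j (int N)) (d + term_of j (int N)) \<noteq> 0"
        using d by (simp add: coef_mult_lvar in_keys_iff)
      then have "d + term_of j (int N) \<in> supp (r * lvar j (int k))" unfolding pr by (simp add: in_keys_iff)
      from supp_mult_lvar[OF this] obtain d' where
        d': "d' \<in> supp r" "d + term_of j (int N) = d' + term_of j (int k)" by blast
      then have "supp d' \<subseteq> ?I" using r by (simp add: laurent_set_def)
      then have "coef d' j = 0" by (auto simp: in_keys_iff)
      then have "coef (d + term_of j (int N)) j = int k" using d' by (simp add: lookup_add)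
      then show ?thesis by (simp add: lookup_add)
    qed
    then show False using je by simp
  qed
  then obtain g a b where g: "g \<in> laurent_set ?I" "g \<noteq> 0" "g = a * p + b * f"
    using E.elimination[OF p f nd] by blast
  obtain c where c: "c \<in> torus_points" "ev n c p = 0" "ev n c g \<noteq> 0"
    using exists_root_off[OF pD(1) je g(1,2)] by blast
  then have "ev n c g = 0" unfolding g(3) using van by simp
  then show False using c by simp
qed

section \<open>Descent from complex to integral coefficients\<close>

definition emb :: "int laurent \<Rightarrow> complex laurent" where
  "emb = Poly_Mapping.map of_int"

lemma coef_emb [simp]: "coef (emb f) e = of_int (coef f e)"
  by (simp add: emb_def Poly_Mapping.map.rep_eq when_def)

lemma supp_emb [simp]: "supp (emb f) = supp f"
  by (auto simp: in_keys_iff)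

lemma emb_in [simp]: "emb f \<in> laurent_set I \<longleftrightarrow> f \<in> laurent_set I"
  by (simp add: laurent_set_def)

lemma emb_zero [simp]: "emb 0 = 0"
  by (rule poly_mapping_eqI) simp

lemma emb_eq_zero_iff [simp]: "emb f = 0 \<longleftrightarrow> f = 0"
  by (metis emb_zero keys_eq_empty supp_emb)

lemma emb_eq_lin: "emb f = lin (\<lambda>e a. term_of e (of_int a)) f"
proof -
  have "emb f = (\<Sum>e\<in>supp (emb f). term_of e (coef (emb f) e))" by (simp only: sum_terms)
  then show ?thesis by (simp add: lin_def)
qed

lemma emb_add [simp]: "emb (f + g) = emb f + emb g"
  by (rule poly_mapping_eqI) (simp add: lookup_add)

lemma emb_diff [simp]: "emb (f - g) = emb f - emb g"
  by (rule poly_mapping_eqI) (simp add: lookup_minus)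

lemma emb_mult [simp]: "emb (f * g) = emb f * emb g"
  unfolding emb_eq_lin by (rule lin_mult) (simp_all add: single_add mult_single)

lemma emb_term_of: "emb (term_of e a) = term_of e (of_int a)"
  unfolding emb_eq_lin by (simp add: lin_single)

lemma emb_one [simp]: "emb 1 = 1"
  using emb_term_of[of 0 1] by simp

lemma coef_const_mult: "coef (term_of 0 a * f) e = a * coef (f :: 'k::idom laurent) e"
proof -
  have "coef (term_of 0 a * f) e = (\<Sum>x\<in>supp f. a * coef f x when x = e)"
    by (subst sum_terms[of f, symmetric])
      (simp add: sum_distrib_left mult_single lookup_sum lookup_single)
  also have "\<dots> = a * coef f e" by (cases "e \<in> supp f") (auto simp: when_def in_keys_iff)
  finally show ?thesis .
qed

text \<open>Take a rational basis of the span of \<open>C\<close> and divide it by a common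
  denominator \<open>M\<close> of the coordinates of \<open>C\<close>. The coordinates become
  integers, and independence over the rationals implies independence over the integers.\<close>

lemma integral_basis:
  assumes "finite (C :: complex set)"
  obtains B :: "complex set" and b :: "complex \<Rightarrow> complex" and \<kappa> :: "complex \<Rightarrow> complex \<Rightarrow> int"
  where "finite B" "\<And>z. z \<in> C \<Longrightarrow> z = (\<Sum>i\<in>B. of_int (\<kappa> z i) * b i)"
    "\<And>m :: complex \<Rightarrow> int. (\<Sum>i\<in>B. of_int (m i) * b i) = 0 \<Longrightarrow> \<forall>i\<in>B. m i = 0"
proof -
  interpret Q: vector_space "\<lambda>(q::rat) (z::complex). of_rat q * z"
    by unfold_locales (simp_all add: algebra_simps of_rat_add of_rat_mult)
  obtain B where B: "B \<subseteq> C" "Q.independent B" "C \<subseteq> Q.span B"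
    using Q.maximal_independent_subset .
  have fin: "finite B" using B assms finite_subset by blast
  define r where "r z i = Q.representation B z i" for z i
  have r: "z = (\<Sum>i\<in>B. of_rat (r z i) * i)" if "z \<in> C" for z
    unfolding r_def using Q.sum_representation_eq[OF B(2) _ fin order.refl, of z] B(3) that by auto
  define M :: int where "M = (\<Prod>(z, i)\<in>C \<times> B. snd (quotient_of (r z i)))"
  have Mpos: "M > 0" unfolding M_def by (intro prod_pos) (auto simp: quotient_of_denom_pos')
  have ex: "\<exists>k::int. of_int M * r z i = of_int k" if "z \<in> C" "i \<in> B" for z i
  proof -
    obtain p q where pq: "quotient_of (r z i) = (p, q)" by (cases "quotient_of (r z i)")
    have "r z i = of_int p / of_int q" using quotient_of_div[OF pq] .
    moreover have "q > 0" using quotient_of_denom_pos[OF pq] .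
    moreover have "(case (z, i) of (z, i) \<Rightarrow> snd (quotient_of (r z i))) dvd M"
      unfolding M_def by (rule dvd_prodI) (use that assms fin in auto)
    then have "q dvd M" by (simp add: pq)
    then obtain l where "M = q * l" by (auto simp: dvd_def)
    ultimately have "of_int M * r z i = of_int (l * p)" by simp
    then show ?thesis by blast
  qed
  define \<kappa> where "\<kappa> z i = (SOME k. of_int M * r z i = of_int k)" for z i
  have \<kappa>: "of_int M * r z i = of_int (\<kappa> z i)" if "z \<in> C" "i \<in> B" for z i
    unfolding \<kappa>_def by (rule someI_ex[OF ex[OF that]])
  have M0: "(of_int M :: complex) \<noteq> 0" using Mpos by simp
  show ?thesis
  proof (rule that[of B \<kappa> "\<lambda>i. i / of_int M"])
    fix z assume z: "z \<in> C"
    have "of_rat (r z i) * i = of_int (\<kappa> z i) * (i / of_int M)" if "i \<in> B" for i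
    proof -
      have "of_rat (of_int M * r z i) = (of_rat (of_int (\<kappa> z i)) :: complex)" using \<kappa>[OF z that] by simp
      then have "of_int M * of_rat (r z i) = (of_int (\<kappa> z i) :: complex)" by (simp add: of_rat_mult)
      then show ?thesis using M0 by (simp add: field_simps)
    qed
    then show "z = (\<Sum>i\<in>B. of_int (\<kappa> z i) * (i / of_int M))" by (subst r[OF z]) simp
  next
    fix m :: "complex \<Rightarrow> int" assume *: "(\<Sum>i\<in>B. of_int (m i) * (i / of_int M)) = 0"
    have "(\<Sum>i\<in>B. of_rat (of_int (m i)) * i) = of_int M * (\<Sum>i\<in>B. of_int (m i) * (i / of_int M))"
      unfolding sum_distrib_left using M0 by (intro sum.cong) (auto simp: field_simps)
    then have "(\<Sum>i\<in>B. of_rat (of_int (m i)) * i) = 0" using * by simp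
    from Q.independentD[OF B(2) fin order.refl this] have "\<forall>i\<in>B. rat_of_int (m i) = 0"
      by blast
    then show "\<forall>i\<in>B. m i = 0" by simp
  qed (rule fin)
qed

text \<open>
  If a prime over \<open>\<complex>\<close> divides every member of \<open>F\<close>, then expanding the quotients in an integral basis of
  the group generated by their coefficients produces a non-trivial relation over \<open>\<int>\<close>.
\<close>

theorem common_prime_descent:
  assumes F: "finite F" "F \<subseteq> laurent_set {..<n}" and f0: "f0 \<in> F" "f0 \<noteq> 0"
    and q: "prime_in (laurent_set {..<n}) q" "\<And>f. f \<in> F \<Longrightarrow> dvd_in (laurent_set {..<n}) q (emb f)"
  shows "\<exists>p. prime_in (laurent_set {..<n}) p \<and> (\<forall>f\<in>F. dvd_in (laurent_set {..<n}) p f)"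
proof (rule ccontr)
  assume neg: "\<not> ?thesis"
  let ?LZ = "laurent_set {..<n} :: int laurent set" and ?LC = "laurent_set {..<n} :: complex laurent set"
  interpret Z: sub_idom ?LZ by (rule sub_idom_laurent_set)
  interpret C: sub_idom ?LC by (rule sub_idom_laurent_set)
  note qD = prime_inD[OF q(1)]
  have "\<forall>f\<in>F. \<exists>a. a \<in> ?LC \<and> emb f = q * a" using q(2) by (auto simp: dvd_in_def)
  then obtain a where a: "\<And>f. f \<in> F \<Longrightarrow> a f \<in> ?LC" "\<And>f. f \<in> F \<Longrightarrow> emb f = q * a f" by metis
  define Cs where "Cs = (\<Union>f\<in>F. coef (a f) ` supp (a f))"
  have "finite Cs" using F by (simp add: Cs_def)
  then obtain B b \<kappa> where B: "finite B" "\<And>z. z \<in> Cs \<Longrightarrow> z = (\<Sum>i\<in>B. of_int (\<kappa> z i) * b i)"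
    "\<And>m :: complex \<Rightarrow> int. (\<Sum>i\<in>B. of_int (m i) * b i) = 0 \<Longrightarrow> \<forall>i\<in>B. m i = 0"
    by (rule integral_basis) (rule that)
  \<comment> \<open>The integral Laurent polynomial formed by the \<open>i\<close>-th coordinates of
    the coefficients of \<open>a f\<close>.\<close>
  define A where "A f i = (Poly_Mapping.map (\<lambda>z. \<kappa> z i) (a f) :: int laurent)" for f i
  have cA: "coef (A f i) e = (if e \<in> supp (a f) then \<kappa> (coef (a f) e) i else 0)" for f i e
    by (simp add: A_def Poly_Mapping.map.rep_eq when_def in_keys_iff)
  have AL: "A f i \<in> ?LZ" if "f \<in> F" for f i
    using a(1)[OF that] by (auto simp: laurent_set_def in_keys_iff cA split: if_splits)
  have aA: "a f = (\<Sum>i\<in>B. term_of 0 (b i) * emb (A f i))" if "f \<in> F" for f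
  proof (rule poly_mapping_eqI)
    fix e
    show "coef (a f) e = coef (\<Sum>i\<in>B. term_of 0 (b i) * emb (A f i)) e"
    proof (cases "e \<in> supp (a f)")
      case True
      then have "coef (a f) e \<in> Cs" using that by (auto simp: Cs_def)
      from B(2)[OF this] show ?thesis
        using True by (simp add: lookup_sum coef_const_mult cA mult.commute)
    next
      case False
      then show ?thesis by (simp add: lookup_sum coef_const_mult cA in_keys_iff)
    qed
  qed
  \<comment> \<open>Cross-multiplying \<open>emb f = q * a f\<close> with the same equation for
    \<open>f0\<close> removes \<open>q\<close>. Independence of the basis splits the outcome into
    one integral equation for each \<open>i\<close>.\<close>
  have rel: "f0 * A f i = A f0 i * f" if f: "f \<in> F" and i: "i \<in> B" for f i
  proof -
    have "emb f0 * a f = a f0 * emb f" using a(2) f f0 by (simp add: mult_ac)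
    then have "(\<Sum>i\<in>B. term_of 0 (b i) * emb (f0 * A f i - A f0 i * f)) = 0"
      unfolding aA[OF f] aA[OF f0(1)]
      by (simp add: sum_distrib_left sum_distrib_right sum_subtractf algebra_simps)
    then have "coef (\<Sum>i\<in>B. term_of 0 (b i) * emb (f0 * A f i - A f0 i * f)) e = 0" for e
      by (simp only: lookup_zero)
    then have "(\<Sum>i\<in>B. b i * of_int (coef (f0 * A f i - A f0 i * f) e)) = 0" for e
      by (simp only: lookup_sum coef_const_mult coef_emb)
    then have "(\<Sum>i\<in>B. of_int (coef (f0 * A f i - A f0 i * f) e) * b i) = 0" for e
      by (simp add: mult.commute)
    from B(3)[OF this] have "coef (f0 * A f i - A f0 i * f) e = 0" for e using i by blast
    then have "f0 * A f i - A f0 i * f = 0" by (intro poly_mapping_eqI) simp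
    then show ?thesis by simp
  qed
  have "f0 \<in> ?LZ" using f0 F by auto
  then obtain k where k: "prime_prod ?LZ k f0"
    using ufd_laurent_set[OF ufd_int, of "{..<n}"] f0 by (auto simp: ufd_def)
  \<comment> \<open>As no integral prime divides all of \<open>F\<close>, the equations
    \<open>rel\<close> force \<open>f0\<close> to divide each \<open>A f0 i\<close>. The quotients,
    recombined with the basis, give an inverse of \<open>q\<close>.\<close>
  have "dvd_in ?LZ f0 (A f0 i)" if "i \<in> B" for i
  proof (rule Z.prime_prod_dvd_family[OF k F(2)])
    show "\<exists>f\<in>F. \<not> dvd_in ?LZ p f" if "prime_in ?LZ p" for p using neg that by blast
    show "A f0 i \<in> ?LZ" using AL f0 by blast
    show "dvd_in ?LZ f0 (A f0 i * f)" if "f \<in> F" for f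
      using rel[OF that \<open>i \<in> B\<close>] AL[OF that] unfolding dvd_in_def by metis
  qed
  then have "\<forall>i\<in>B. \<exists>h. h \<in> ?LZ \<and> A f0 i = f0 * h" by (auto simp: dvd_in_def)
  then obtain h where h: "\<And>i. i \<in> B \<Longrightarrow> h i \<in> ?LZ" "\<And>i. i \<in> B \<Longrightarrow> A f0 i = f0 * h i" by metis
  define H where "H = (\<Sum>i\<in>B. term_of 0 (b i) * emb (h i))"
  have HL: "H \<in> ?LC" unfolding H_def
    by (intro C.sum_in C.mult_in term_in_laurent_set) (auto simp: h)
  have "a f0 = emb f0 * H"
    unfolding H_def aA[OF f0(1)] sum_distrib_left by (intro sum.cong refl) (simp add: h mult_ac)
  then have "emb f0 * 1 = emb f0 * (q * H)" using a(2)[OF f0(1)] by (simp add: mult_ac)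
  then have "q * H = 1" using f0 by (metis emb_eq_zero_iff mult_left_cancel)
  then show False using qD HL by (auto simp: unit_in_def)
qed

section \<open>Components of codimension one\<close>

no_notation eq_closure_of (\<open>closure'_of\<index>\<close>)

lemma codimension_ge:
  assumes "C 0 = Z" "\<And>i. i \<le> k \<Longrightarrow> irreducible_in T (C i) \<and> closedin T (C i)"
    "\<And>i. i < k \<Longrightarrow> C i \<subset> C (Suc i)"
  shows "enat k \<le> codimension T Z"
  unfolding codimension_def
  by (rule Sup_upper, rule CollectI, rule exI[of _ k], rule conjI[OF refl], rule exI[of _ C])
    (simp add: assms)

text \<open>Characters enter the geometry only through these properties. \<open>pt\<close>
  identifies points exactly when their first \<open>n\<close> coordinates agree.
  \<open>irreducible_subset\<close> expresses that the torus is separated from the rest of the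
  space, so chains of irreducible sets starting in it stay in it.\<close>

locale torus_chart =
  fixes T :: "'t topology" and n :: nat and pt :: "(nat \<Rightarrow> complex) \<Rightarrow> 't"
  assumes pt_in_space: "c \<in> torus_points \<Longrightarrow> pt c \<in> topspace T"
    and pt_eq_iff: "\<lbrakk>c \<in> torus_points; d \<in> torus_points\<rbrakk> \<Longrightarrow> pt c = pt d \<longleftrightarrow> (\<forall>i<n. c i = d i)"
    and closed_eqs: "closedin T C \<Longrightarrow>
      \<exists>F\<subseteq>laurent_set {..<n}. \<forall>c\<in>torus_points. pt c \<in> C \<longleftrightarrow> (\<forall>f\<in>F. ev n c f = 0)"
    and closed_zeros: "F \<subseteq> laurent_set {..<n} \<Longrightarrow>
      closedin T (pt ` {c \<in> torus_points. \<forall>f\<in>F. ev n c f = 0})"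
    and irreducible_subset: "\<lbrakk>irreducible_in T Z; Z \<inter> pt ` torus_points \<noteq> {}\<rbrakk> \<Longrightarrow> Z \<subseteq> pt ` torus_points"
begin

abbreviation L :: "complex laurent set" where "L \<equiv> laurent_set {..<n}"
abbreviation LZ :: "int laurent set" where "LZ \<equiv> laurent_set {..<n}"

definition T0 :: "'t set" where "T0 = pt ` torus_points"
definition zeros :: "complex laurent set \<Rightarrow> 't set" where
  "zeros F = pt ` {c \<in> torus_points. \<forall>f\<in>F. ev n c f = 0}"

sublocale C: sub_idom L by (rule sub_idom_laurent_set)
sublocale Z: sub_idom LZ by (rule sub_idom_laurent_set)

lemma prime_prod_L: "f \<in> L \<Longrightarrow> f \<noteq> 0 \<Longrightarrow> \<exists>k. prime_prod L k f"
  using ufd_laurent_set[OF ufd_field, of "{..<n}"] by (auto simp: ufd_def)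

lemma pt_in_T0 [simp]: "c \<in> torus_points \<Longrightarrow> pt c \<in> T0"
  by (simp add: T0_def)

lemma pt_in_zeros [simp]:
  assumes "F \<subseteq> L" "c \<in> torus_points"
  shows "pt c \<in> zeros F \<longleftrightarrow> (\<forall>f\<in>F. ev n c f = 0)"
proof
  assume "pt c \<in> zeros F"
  then obtain d where d: "d \<in> torus_points" "\<forall>f\<in>F. ev n d f = 0" "pt c = pt d" by (auto simp: zeros_def)
  then have "\<forall>i<n. c i = d i" using pt_eq_iff assms by blast
  then have "ev n c f = ev n d f" if "f \<in> F" for f
    using ev_cong[of f "{..<n}" c d n] that assms(1) by auto
  then show "\<forall>f\<in>F. ev n c f = 0" using d(2) by simp
qed (use assms in \<open>auto simp: zeros_def\<close>)

lemma zeros_subset_T0: "zeros F \<subseteq> T0"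
  by (auto simp: zeros_def T0_def)

lemma closedin_zeros: "F \<subseteq> L \<Longrightarrow> closedin T (zeros F)"
  unfolding zeros_def by (rule closed_zeros)

lemma subset_T0I: "(\<And>c. c \<in> torus_points \<Longrightarrow> pt c \<in> A \<Longrightarrow> pt c \<in> B) \<Longrightarrow> A \<subseteq> T0 \<Longrightarrow> A \<subseteq> B"
  by (auto simp: T0_def)

lemma irreducible_T0I: "\<lbrakk>irreducible_in T Z; x \<in> Z; x \<in> T0\<rbrakk> \<Longrightarrow> Z \<subseteq> T0"
  using irreducible_subset unfolding T0_def by blast

lemma T0_closed: "closedin T T0"
  using closedin_zeros[of "{}"] by (simp add: zeros_def T0_def)

lemma T0_nonempty: "T0 \<noteq> {}"
proof -
  have "(\<lambda>_. 1) \<in> torus_points" by (simp add: torus_points_def)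
  then show ?thesis by (auto simp: T0_def)
qed

section \<open>Irreducible closed subsets of the torus\<close>

lemma proper_closed:
  assumes "closedin T C" "\<not> T0 \<subseteq> C"
  obtains f where "f \<in> L" "f \<noteq> 0" "\<And>c. c \<in> torus_points \<Longrightarrow> pt c \<in> C \<Longrightarrow> ev n c f = 0"
proof -
  obtain F where F: "F \<subseteq> L" "\<And>c. c \<in> torus_points \<Longrightarrow> pt c \<in> C \<longleftrightarrow> (\<forall>f\<in>F. ev n c f = 0)"
    using closed_eqs[OF assms(1)] by blast
  obtain c where c: "c \<in> torus_points" "pt c \<notin> C" using assms(2) by (auto simp: T0_def)
  then obtain f where f: "f \<in> F" "ev n c f \<noteq> 0" using F by blast
  show ?thesis by (rule that[of f]) (use f F in auto)
qed

text \<open>Two proper closed subsets satisfy nonzero equations \<open>f\<close> and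
  \<open>g\<close>, and some point of the torus is a zero of neither because \<open>f * g\<close> is
  nonzero.\<close>

lemma irreducible_T0: "irreducible_in T T0"
  unfolding irreducible_in_def
proof (intro conjI allI impI)
  show "T0 \<subseteq> topspace T" using closedin_subset[OF T0_closed] .
  fix C D assume *: "closedin T C \<and> closedin T D \<and> T0 \<subseteq> C \<union> D"
  show "T0 \<subseteq> C \<or> T0 \<subseteq> D"
  proof (rule ccontr)
    assume neg: "\<not> ?thesis"
    obtain f where f: "f \<in> L" "f \<noteq> 0" "\<And>c. c \<in> torus_points \<Longrightarrow> pt c \<in> C \<Longrightarrow> ev n c f = 0"
      using proper_closed[of C] * neg by blast
    obtain g where g: "g \<in> L" "g \<noteq> 0" "\<And>c. c \<in> torus_points \<Longrightarrow> pt c \<in> D \<Longrightarrow> ev n c g = 0"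
      using proper_closed[of D] * neg by blast
    have "f * g \<noteq> 0" "f * g \<in> L" using f g by auto
    then obtain c where c: "c \<in> torus_points" "ev n c (f * g) \<noteq> 0" using ev_nonzero by blast
    then have "pt c \<in> C \<union> D" using pt_in_T0 * by blast
    then show False using c f(3)[OF c(1)] g(3)[OF c(1)] by auto
  qed
qed (rule T0_nonempty)

text \<open>A closed set that does not contain the hypersurface has an equation not divisible by
  \<open>p\<close>. If two such sets covered it, the product of their equations would vanish on the
  zeros of \<open>p\<close> and be divisible by \<open>p\<close>, against primality.\<close>

lemma irreducible_zeros:
  assumes p: "prime_in L p"
  shows "irreducible_in T (zeros {p})"
  unfolding irreducible_in_def
proof (intro conjI allI impI)
  note pD = prime_inD[OF p]
  have sub: "{p} \<subseteq> L" using pD by simp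
  show "zeros {p} \<subseteq> topspace T" using closedin_subset[OF closedin_zeros[OF sub]] .
  show "zeros {p} \<noteq> {}"
  proof
    assume "zeros {p} = {}"
    then have "ev n c p \<noteq> 0" if "c \<in> torus_points" for c using that by (auto simp: zeros_def)
    then show False using no_zeros_imp_monomial[OF pD(1,2)] pD(3) by blast
  qed
  fix C D assume *: "closedin T C \<and> closedin T D \<and> zeros {p} \<subseteq> C \<union> D"
  have sep: "\<exists>f\<in>L. \<not> dvd_in L p f \<and> (\<forall>c\<in>torus_points. pt c \<in> A \<longrightarrow> ev n c f = 0)"
    if A: "closedin T A" "\<not> zeros {p} \<subseteq> A" for A
  proof -
    obtain F where F: "F \<subseteq> L" "\<And>c. c \<in> torus_points \<Longrightarrow> pt c \<in> A \<longleftrightarrow> (\<forall>f\<in>F. ev n c f = 0)"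
      using closed_eqs[OF A(1)] by blast
    obtain c where c: "c \<in> torus_points" "ev n c p = 0" "pt c \<notin> A" using A(2) by (auto simp: zeros_def)
    then obtain f where f: "f \<in> F" "ev n c f \<noteq> 0" using F by blast
    have "\<not> dvd_in L p f" using f c by (auto simp: dvd_in_def)
    then show ?thesis using f F by blast
  qed
  show "zeros {p} \<subseteq> C \<or> zeros {p} \<subseteq> D"
  proof (rule ccontr)
    assume neg: "\<not> ?thesis"
    obtain f where f: "f \<in> L" "\<not> dvd_in L p f" "\<forall>c\<in>torus_points. pt c \<in> C \<longrightarrow> ev n c f = 0"
      using sep[of C] * neg by blast
    obtain g where g: "g \<in> L" "\<not> dvd_in L p g" "\<forall>c\<in>torus_points. pt c \<in> D \<longrightarrow> ev n c g = 0"
      using sep[of D] * neg by blast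
    have "ev n c (f * g) = 0" if c: "c \<in> torus_points" "ev n c p = 0" for c
    proof -
      have "pt c \<in> zeros {p}" using c sub by simp
      then have "pt c \<in> C \<union> D" using * by blast
      then show ?thesis using f(3) g(3) c by auto
    qed
    then have "dvd_in L p (f * g)" using vanishing_imp_dvd[OF p] f g by simp
    then show False using pD(4)[OF f(1) g(1)] f g by blast
  qed
qed

text \<open>The zero set of a product is the union of the zero sets, and an irreducible set lies in
  one member of such a union.\<close>

lemma irreducible_in_zeros_prime:
  assumes Z: "irreducible_in T Z"
  shows "\<lbrakk>prime_prod L k f; Z \<subseteq> zeros {f}\<rbrakk> \<Longrightarrow> \<exists>q. prime_in L q \<and> dvd_in L q f \<and> Z \<subseteq> zeros {q}"
proof (induction rule: prime_prod.induct)
  case (unit u)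
  then obtain v where v: "u \<in> L" "v \<in> L" "u * v = 1" by (auto simp: unit_in_def)
  obtain x where "x \<in> Z" using Z by (auto simp: irreducible_in_def)
  then obtain c where c: "c \<in> torus_points" "ev n c u = 0" using unit.prems by (auto simp: zeros_def)
  have "ev n c (u * v) = 0" using c by simp
  then show ?case using v by simp
next
  case (mult p k f)
  have f: "f \<in> L" and p: "p \<in> L" using C.prime_prod_in mult.hyps prime_inD(1) by blast+
  have "Z \<subseteq> zeros {p} \<union> zeros {f}"
  proof
    fix x assume "x \<in> Z"
    then obtain c where "c \<in> torus_points" "ev n c (p * f) = 0" "x = pt c"
      using mult.prems by (auto simp: zeros_def)
    then show "x \<in> zeros {p} \<union> zeros {f}" using f p by auto
  qed
  then have "Z \<subseteq> zeros {p} \<or> Z \<subseteq> zeros {f}"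
    using Z closedin_zeros f p unfolding irreducible_in_def by simp
  then show ?case
  proof
    assume "Z \<subseteq> zeros {p}"
    then show ?thesis using mult.hyps(1) f by (auto simp: dvd_in_def)
  next
    assume "Z \<subseteq> zeros {f}"
    then obtain q where "prime_in L q" "dvd_in L q f" "Z \<subseteq> zeros {q}" using mult.IH by blast
    then show ?thesis using C.dvd_in_mult_left[OF _ p] by blast
  qed
qed

lemma prime_factor_zero:
  assumes c: "c \<in> torus_points"
  shows "\<lbrakk>prime_prod L k f; ev n c f = 0\<rbrakk> \<Longrightarrow> \<exists>q. prime_in L q \<and> dvd_in L q f \<and> ev n c q = 0"
proof (induction rule: prime_prod.induct)
  case (unit u)
  then obtain v where v: "u * v = 1" by (auto simp: unit_in_def)
  have "ev n c (u * v) = 0" using c unit.prems by simp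
  then show ?case using v by simp
next
  case (mult p k f)
  have f: "f \<in> L" and p: "p \<in> L" using C.prime_prod_in mult.hyps prime_inD(1) by blast+
  have "ev n c p = 0 \<or> ev n c f = 0" using mult.prems c by simp
  then show ?case
  proof
    assume "ev n c p = 0"
    then show ?thesis using mult.hyps(1) f by (auto simp: dvd_in_def)
  next
    assume "ev n c f = 0"
    then obtain q where "prime_in L q" "dvd_in L q f" "ev n c q = 0" using mult.IH by blast
    then show ?thesis using C.dvd_in_mult_left[OF _ p] by blast
  qed
qed

lemma zeros_dvd_mono:
  assumes "dvd_in L p f" "p \<in> L"
  shows "zeros {p} \<subseteq> zeros {f}"
  using assms by (auto simp: zeros_def dvd_in_def)

lemma zeros_subset_imp_dvd:
  assumes p: "prime_in L p" and f: "f \<in> L" and sub: "zeros {p} \<subseteq> zeros {f}"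
  shows "dvd_in L p f"
proof (rule vanishing_imp_dvd[OF p f])
  fix c assume c: "c \<in> torus_points" "ev n c p = 0"
  then have "pt c \<in> zeros {p}" using prime_inD(1)[OF p] by simp
  then have "pt c \<in> zeros {f}" using sub by blast
  then show "ev n c f = 0" using f c by simp
qed

text \<open>The inclusion of zero sets turns into divisibility, and a prime that divides a prime is
  associated to it.\<close>

lemma zeros_prime_subset_eq:
  assumes p: "prime_in L p" and q: "prime_in L q" and sub: "zeros {p} \<subseteq> zeros {q}"
  shows "zeros {q} = zeros {p}"
proof -
  have "dvd_in L p q" using zeros_subset_imp_dvd[OF p _ sub] prime_inD(1)[OF q] by blast
  then obtain u where "unit_in L u" "q = p * u" using C.prime_dvd_prime[OF p q] by blast
  then obtain v where "u \<in> L" "v \<in> L" "u * v = 1" by (auto simp: unit_in_def)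
  then have "p = q * v" using \<open>q = p * u\<close> by (simp add: mult.assoc)
  then have "dvd_in L q p" using \<open>v \<in> L\<close> by (auto simp: dvd_in_def)
  then show ?thesis using zeros_dvd_mono[OF _ prime_inD(1)[OF q]] sub by blast
qed

text \<open>A larger irreducible set with a nontrivial equation lies in the zero set of one prime
  factor of the equation, which leaves no room above \<open>zeros {p}\<close>. Both the codimension
  of hypersurfaces and their maximality as components rest on this.\<close>

lemma irreducible_above_zeros:
  assumes p: "prime_in L p" and Z: "irreducible_in T Z" and sub: "zeros {p} \<subseteq> Z"
    and f: "f \<in> L" "f \<noteq> 0" "Z \<subseteq> zeros {f}"
  shows "Z = zeros {p}"
proof -
  obtain k where k: "prime_prod L k f" using prime_prod_L f by blast
  then obtain q where "prime_in L q" "Z \<subseteq> zeros {q}" using irreducible_in_zeros_prime[OF Z k f(3)] by blast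
  then show ?thesis using zeros_prime_subset_eq[OF p] sub by blast
qed

section \<open>Codimension\<close>

lemma zeros_neq_T0:
  assumes "f \<in> L" "f \<noteq> 0"
  shows "\<not> T0 \<subseteq> zeros {f}"
proof
  assume *: "T0 \<subseteq> zeros {f}"
  obtain c where c: "c \<in> torus_points" "ev n c f \<noteq> 0" using ev_nonzero[OF assms(2,1)] by blast
  then have "pt c \<in> zeros {f}" using * by auto
  then show False using c assms by simp
qed

text \<open>An irreducible set that properly contains the torus would meet it, and so be contained
  in it.\<close>

lemma codimension_T0: "codimension T T0 = 0"
proof -
  have "k = 0" if C: "C 0 = T0" "\<forall>i\<le>k. irreducible_in T (C i) \<and> closedin T (C i)" "\<forall>i<k. C i \<subset> C (Suc i)"
    for k C
  proof (rule ccontr)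
    assume "k \<noteq> 0"
    then have "T0 \<subset> C 1" "irreducible_in T (C 1)" using C by (auto dest: spec[of _ 0] spec[of _ 1])
    then show False using irreducible_T0I T0_nonempty by blast
  qed
  then have "codimension T T0 \<le> 0" unfolding codimension_def
    by (intro Sup_least) (auto simp: zero_enat_def)
  then show ?thesis by simp
qed

text \<open>The torus itself gives a chain of length one. In a chain of length two the middle set
  would be a proper closed subset of the torus above the hypersurface, which
  \<open>irreducible_above_zeros\<close> excludes.\<close>

lemma codimension_zeros:
  assumes p: "prime_in L p"
  shows "codimension T (zeros {p}) = 1"
proof -
  note pD = prime_inD[OF p]
  let ?chain = "\<lambda>k C. C 0 = zeros {p} \<and> (\<forall>i\<le>k. irreducible_in T (C i) \<and> closedin T (C i)) \<and> (\<forall>i<k. C i \<subset> C (Suc i))"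
  have irr: "irreducible_in T (zeros {p})" by (rule irreducible_zeros[OF p])
  have ne: "zeros {p} \<noteq> {}" using irr by (simp add: irreducible_in_def)
  have sub: "{p} \<subseteq> L" using pD by simp
  have ge: "enat 1 \<le> codimension T (zeros {p})"
    by (rule codimension_ge[of "\<lambda>i. if i = 0 then zeros {p} else T0"])
      (use irr irreducible_T0 T0_closed closedin_zeros[OF sub] zeros_subset_T0 zeros_neq_T0[OF pD(1,2)] in auto)
  have "k \<le> 1" if C: "?chain k C" for k C
  proof (rule ccontr)
    assume "\<not> k \<le> 1"
    then have k: "1 < k" "2 \<le> k" by auto
    have C': "C 0 = zeros {p}" "\<And>i. i \<le> k \<Longrightarrow> irreducible_in T (C i) \<and> closedin T (C i)"
      "\<And>i. i < k \<Longrightarrow> C i \<subset> C (Suc i)" using C by auto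
    have C01: "zeros {p} \<subset> C 1" using C'(3)[of 0] C'(1) k by simp
    have C12: "C 1 \<subset> C 2" using C'(3)[of 1] k by (simp add: numeral_2_eq_2)
    have irr12: "irreducible_in T (C 1)" "irreducible_in T (C 2)" "closedin T (C 1)"
      using C'(2)[of 1] C'(2)[of 2] k by auto
    obtain x where "x \<in> zeros {p}" using ne by blast
    then have x: "x \<in> C 1" "x \<in> C 2" "x \<in> T0" using C01 C12 zeros_subset_T0 by auto
    then have "C 2 \<subseteq> T0" "C 1 \<subseteq> T0" using irreducible_T0I irr12 by blast+
    then have "\<not> T0 \<subseteq> C 1" using C12 by blast
    then obtain f where f: "f \<in> L" "f \<noteq> 0" "\<And>c. c \<in> torus_points \<Longrightarrow> pt c \<in> C 1 \<Longrightarrow> ev n c f = 0"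
      using proper_closed[OF irr12(3)] by blast
    have "C 1 \<subseteq> zeros {f}" by (rule subset_T0I) (use f \<open>C 1 \<subseteq> T0\<close> in auto)
    then show False using irreducible_above_zeros[OF p irr12(1) _ f(1,2)] C01 by blast
  qed
  then have "codimension T (zeros {p}) \<le> enat 1" unfolding codimension_def by (intro Sup_least) auto
  then show ?thesis using ge by (simp add: one_enat_def)
qed

text \<open>\<open>Z\<close> lies in the hypersurface of some prime. If the inclusion were strict,
  \<open>Z\<close>, the hypersurface and the torus would form a chain of length two.\<close>

lemma codimension_one_cases:
  assumes Z: "irreducible_in T Z" "closedin T Z" "codimension T Z = 1" and f: "f \<in> L" "f \<noteq> 0" "Z \<subseteq> zeros {f}"
  shows "\<exists>q. prime_in L q \<and> Z = zeros {q}"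
proof -
  obtain k where k: "prime_prod L k f" using prime_prod_L f by blast
  then obtain q where q: "prime_in L q" "Z \<subseteq> zeros {q}" using irreducible_in_zeros_prime[OF Z(1) k f(3)] by blast
  note qD = prime_inD[OF q(1)]
  have sub: "{q} \<subseteq> L" using qD by simp
  have "Z = zeros {q}"
  proof (rule ccontr)
    assume "Z \<noteq> zeros {q}"
    define C where "C i = (if i = 0 then Z else if i = 1 then zeros {q} else T0)" for i :: nat
    have "zeros {q} \<subset> T0" using zeros_subset_T0 zeros_neq_T0[OF qD(1,2)] by auto
    then have "enat 2 \<le> codimension T Z"
      using Z(1,2) q(2) \<open>Z \<noteq> _\<close> irreducible_T0 T0_closed irreducible_zeros[OF q(1)] closedin_zeros[OF sub]
      by (intro codimension_ge[of C]) (auto simp: C_def less_Suc_eq numeral_2_eq_2)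
    then show False using Z(3) by (simp add: one_enat_def)
  qed
  then show ?thesis using q by blast
qed

lemma irreducible_closure_of:
  assumes Z: "irreducible_in T Z"
  shows "irreducible_in T (T closure_of Z)"
proof -
  have sub: "Z \<subseteq> T closure_of Z" using Z closure_of_subset[of Z T] by (simp add: irreducible_in_def)
  show ?thesis unfolding irreducible_in_def
  proof (intro conjI allI impI)
    show "T closure_of Z \<subseteq> topspace T" by (rule closure_of_subset_topspace)
    show "T closure_of Z \<noteq> {}" using sub Z by (auto simp: irreducible_in_def)
    fix C D assume *: "closedin T C \<and> closedin T D \<and> T closure_of Z \<subseteq> C \<union> D"
    then have "Z \<subseteq> C \<or> Z \<subseteq> D" using Z sub unfolding irreducible_in_def by blast
    then show "T closure_of Z \<subseteq> C \<or> T closure_of Z \<subseteq> D" using * closure_of_minimal by metis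
  qed
qed

section \<open>Comparing components with the zeros of the greatest common divisor\<close>

definition codim_one_part :: "'t set \<Rightarrow> 't set" where
  "codim_one_part V = \<Union>{Z \<in> irreducible_components T V. codimension T Z = 1 \<and> Z \<subseteq> T0}"

text \<open>A component inside the torus would be the whole torus by maximality, and this has
  codimension 0.\<close>

lemma codim_one_part_full:
  assumes "T0 \<subseteq> V"
  shows "codim_one_part V = {}"
proof -
  have False if Z: "Z \<in> irreducible_components T V" "codimension T Z = 1" "Z \<subseteq> T0" for Z
  proof -
    have "T0 = Z" using Z irreducible_T0 assms by (auto simp: irreducible_components_def)
    then show False using codimension_T0 Z(2) by simp
  qed
  then show ?thesis unfolding codim_one_part_def by blast
qed

text \<open>For maximality: an irreducible subset of \<open>V\<close> above the hypersurface meets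
  the torus, hence lies in it and in the zeros of \<open>h\<close>, and nothing larger fits
  there.\<close>

lemma zeros_prime_in_codim_one_part:
  assumes p: "prime_in L p" "zeros {p} \<subseteq> V" and h: "h \<in> L" "h \<noteq> 0" "V \<inter> T0 \<subseteq> zeros {h}"
  shows "zeros {p} \<subseteq> codim_one_part V"
proof -
  have irr: "irreducible_in T (zeros {p})" by (rule irreducible_zeros[OF p(1)])
  have "zeros {p} \<in> irreducible_components T V" unfolding irreducible_components_def
  proof (intro CollectI conjI allI impI irr p(2))
    fix Z' assume *: "irreducible_in T Z' \<and> zeros {p} \<subseteq> Z' \<and> Z' \<subseteq> V"
    obtain x where "x \<in> zeros {p}" using irr by (auto simp: irreducible_in_def)
    then have "Z' \<subseteq> T0" using irreducible_T0I[of Z' x] * zeros_subset_T0 by blast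
    then have "Z' \<subseteq> zeros {h}" using * h(3) by blast
    then show "Z' = zeros {p}" using irreducible_above_zeros[OF p(1) _ _ h(1,2)] * by blast
  qed
  then show ?thesis unfolding codim_one_part_def
    using codimension_zeros[OF p(1)] zeros_subset_T0 by blast
qed

text \<open>Components are defined by maximality alone. The closure of \<open>Z\<close> is
  irreducible and stays inside \<open>V\<close>, so it equals \<open>Z\<close>.\<close>

lemma component_closed:
  assumes Z: "Z \<in> irreducible_components T V" "Z \<subseteq> T0" and V: "closedin T (V \<inter> T0)"
  shows "closedin T Z"
proof -
  have irr: "irreducible_in T Z" using Z by (simp add: irreducible_components_def)
  have ZV: "Z \<subseteq> V \<inter> T0" using Z by (auto simp: irreducible_components_def)
  have "T closure_of Z \<subseteq> V" using closure_of_minimal[OF ZV V] by blast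
  moreover have "Z \<subseteq> T closure_of Z" using irr closure_of_subset[of Z T] by (simp add: irreducible_in_def)
  ultimately have "T closure_of Z = Z"
    using Z irreducible_closure_of[OF irr] by (auto simp: irreducible_components_def)
  then show ?thesis by (metis closedin_closure_of)
qed

text \<open>If \<open>Z\<close> is not contained in the zeros of \<open>\<Delta>\<close>,
  irreducibility pushes it into the zeros of every cofactor. It is then the hypersurface of a
  complex prime dividing all cofactors, and descent produces a common integral prime.\<close>

lemma codimension_one_in_zeros_gcd:
  assumes Z: "irreducible_in T Z" "closedin T Z" "codimension T Z = 1"
    and F: "finite F" "F \<subseteq> LZ" and f0: "f0 \<in> F" "f0 \<noteq> 0"
    and coprime: "\<And>p. prime_in LZ p \<Longrightarrow> \<exists>f\<in>F. \<not> dvd_in LZ p f"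
    and \<Delta>: "\<Delta> \<in> LZ" and sub: "Z \<subseteq> zeros ((\<lambda>f. emb (\<Delta> * f)) ` F)"
  shows "Z \<subseteq> zeros {emb \<Delta>}"
proof (rule ccontr)
  assume neg: "\<not> ?thesis"
  have sub_f: "Z \<subseteq> zeros {emb f}" if f: "f \<in> F" for f
  proof -
    have fL: "f \<in> LZ" using f F by blast
    have "Z \<subseteq> zeros {emb \<Delta>} \<union> zeros {emb f}"
    proof
      fix x assume "x \<in> Z"
      then obtain c where c: "c \<in> torus_points" "\<forall>f\<in>F. ev n c (emb (\<Delta> * f)) = 0" "x = pt c"
        using sub by (auto simp: zeros_def)
      then have "ev n c (emb \<Delta>) = 0 \<or> ev n c (emb f) = 0" using f by auto
      then show "x \<in> zeros {emb \<Delta>} \<union> zeros {emb f}" using c fL \<Delta> by auto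
    qed
    moreover have "closedin T (zeros {emb \<Delta>})" "closedin T (zeros {emb f})"
      using closedin_zeros fL \<Delta> by auto
    ultimately show ?thesis using Z(1) neg unfolding irreducible_in_def by blast
  qed
  have "emb f0 \<in> L" "emb f0 \<noteq> 0" using f0 F by auto
  then obtain q where q: "prime_in L q" "Z = zeros {q}"
    using codimension_one_cases[OF Z _ _ sub_f[OF f0(1)]] by blast
  have "dvd_in L q (emb f)" if "f \<in> F" for f
    using zeros_subset_imp_dvd[OF q(1), of "emb f"] sub_f[OF that] q(2) that F by auto
  then show False using common_prime_descent[OF F f0 q(1)] coprime by blast
qed

text \<open>\<open>E\<close> stands for the minors. For \<open>n \<ge> 2\<close> the point 1 is
  already a common zero of them by \<open>one\<close>. For \<open>n = 1\<close> it is not, and as a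
  point of a one-dimensional torus it contributes a component of codimension one.\<close>

theorem codim_one_part_gcd:
  fixes E :: "int laurent set" and \<Delta> :: "int laurent"
  assumes V: "\<And>c. c \<in> torus_points \<Longrightarrow>
      pt c \<in> V \<longleftrightarrow> (\<forall>f\<in>E. ev n c (emb f) = 0) \<or> (n \<ge> 1 \<and> (\<forall>i<n. c i = 1))"
    and E: "finite E" "E \<subseteq> LZ"
    and \<Delta>: "\<Delta> \<in> LZ" "\<And>f. f \<in> E \<Longrightarrow> dvd_in LZ \<Delta> f"
      "\<And>e. \<lbrakk>e \<in> LZ; \<And>f. f \<in> E \<Longrightarrow> dvd_in LZ e f\<rbrakk> \<Longrightarrow> dvd_in LZ e \<Delta>"
    and one: "(\<forall>f\<in>E. ev n (\<lambda>_. 1) (emb f) = 0) \<longleftrightarrow> n \<ge> 2"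
  shows "\<Delta> = 0 \<longleftrightarrow> T0 \<subseteq> V"
    and "\<Delta> = 0 \<Longrightarrow> codim_one_part V = {}"
    and "\<lbrakk>\<Delta> \<noteq> 0; n > 1\<rbrakk> \<Longrightarrow> codim_one_part V = zeros {emb \<Delta>}"
    and "\<lbrakk>\<Delta> \<noteq> 0; n = 1\<rbrakk> \<Longrightarrow> codim_one_part V = zeros {emb \<Delta>} \<union> {pt (\<lambda>_. 1)}"
    and "n = 1 \<Longrightarrow> zeros {emb \<Delta>} \<inter> {pt (\<lambda>_. 1)} = {}"
    and "n \<ge> 2 \<Longrightarrow> codim_one_part V = {} \<longleftrightarrow> (\<exists>e a. supp e \<subseteq> {..<n} \<and> \<Delta> = term_of e a)"
proof -
  have one_pt: "(\<lambda>_. 1) \<in> torus_points" by (simp add: torus_points_def)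
  have embE: "emb ` E \<subseteq> L" using E by auto
  \<comment> \<open>The equations of the point 1. A multiple of \<open>xm 0\<close> vanishes there,
    which turns an equation of the common zeros of \<open>E\<close> into one of all of
    \<open>V\<close> inside the torus.\<close>
  define xm where "xm i = lvar i 1 - (1 :: complex laurent)" for i
  have XL: "xm i \<in> L" if "i < n" for i unfolding xm_def using that by (intro C.diff_in lvar_in_laurent_set) auto
  have evx: "ev n c (xm i) = c i - 1" if "i < n" for c i using that by (simp add: xm_def ev_lvar)
  have X0: "xm i \<noteq> 0" if "i < n" for i
  proof
    assume "xm i = 0"
    then have "ev n (\<lambda>_. 2) (xm i) = 0" by simp
    then show False using evx[OF that, of "\<lambda>_. 2"] by simp
  qed
  define Z1 where "Z1 = zeros (xm ` {..<n})"
  have XsubL: "xm ` {..<n} \<subseteq> L" using XL by auto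
  have ptZ1: "pt c \<in> Z1 \<longleftrightarrow> (\<forall>i<n. c i = 1)" if "c \<in> torus_points" for c
    unfolding Z1_def using that XsubL by (auto simp: evx)
  have zero_E: "\<Delta> = 0 \<longleftrightarrow> (\<forall>f\<in>E. f = 0)"
  proof
    assume "\<Delta> = 0" then show "\<forall>f\<in>E. f = 0" using \<Delta>(2) by (auto simp: dvd_in_def)
  next
    assume "\<forall>f\<in>E. f = 0"
    then have "dvd_in LZ 0 \<Delta>" by (intro \<Delta>(3)) auto
    then show "\<Delta> = 0" by (auto simp: dvd_in_def)
  qed
  show zero_iff: "\<Delta> = 0 \<longleftrightarrow> T0 \<subseteq> V"
  proof
    assume "\<Delta> = 0"
    then have z: "f = 0" if "f \<in> E" for f using zero_E that by blast
    have "ev n c (emb f) = 0" if "f \<in> E" for c f using z[OF that] by simp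
    then show "T0 \<subseteq> V" using V by (auto simp: T0_def)
  next
    assume sub: "T0 \<subseteq> V"
    \<comment> \<open>For \<open>n = 0\<close> the torus is the single point 1, which
      \<open>one\<close> keeps out of \<open>V\<close>.\<close>
    have n1: "n \<ge> 1"
    proof (rule ccontr)
      assume "\<not> n \<ge> 1"
      moreover have "pt (\<lambda>_. 1) \<in> V" using sub one_pt by auto
      ultimately show False using V[OF one_pt] one by simp
    qed
    have "f = 0" if f: "f \<in> E" for f
    proof (rule ccontr)
      assume "f \<noteq> 0"
      then have "emb f * xm 0 \<noteq> 0" using X0[of 0] n1 by simp
      moreover have "emb f * xm 0 \<in> L" using f E XL[of 0] n1 by auto
      ultimately obtain c where c: "c \<in> torus_points" "ev n c (emb f * xm 0) \<noteq> 0" using ev_nonzero by blast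
      then have "ev n c (emb f) \<noteq> 0" "c 0 \<noteq> 1" using evx[of 0] n1 by auto
      then have "pt c \<notin> V" using V[OF c(1)] f n1 by auto
      then show False using sub pt_in_T0[OF c(1)] by blast
    qed
    then show "\<Delta> = 0" using zero_E by blast
  qed
  show "codim_one_part V = {}" if "\<Delta> = 0"
    using codim_one_part_full zero_iff that by blast
  have VE: "V \<inter> T0 = (if n \<ge> 1 then zeros (emb ` E) \<union> Z1 else zeros (emb ` E))"
    (is "_ = ?R")
  proof -
    have mem: "pt c \<in> ?R \<longleftrightarrow> pt c \<in> V" if "c \<in> torus_points" for c
      using V[OF that] embE ptZ1[OF that] that by (cases "n \<ge> 1") auto
    have "?R \<subseteq> T0" using zeros_subset_T0 by (auto simp: Z1_def)
    then have "?R \<subseteq> V \<inter> T0" using subset_T0I[of ?R "V \<inter> T0"] mem pt_in_T0 by blast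
    moreover have "V \<inter> T0 \<subseteq> ?R" using subset_T0I[of "V \<inter> T0" ?R] mem by blast
    ultimately show ?thesis by blast
  qed
  have Z1_eq: "Z1 = {pt (\<lambda>_. 1)}"
  proof (rule equalityI)
    show "Z1 \<subseteq> {pt (\<lambda>_. 1)}"
      by (rule subset_T0I) (use ptZ1 pt_eq_iff[OF _ one_pt] zeros_subset_T0 Z1_def in auto)
  qed (use ptZ1[OF one_pt] in auto)
  have gcd: "zeros {emb \<Delta>} \<subseteq> zeros (emb ` E)"
  proof (rule subset_T0I[OF _ zeros_subset_T0])
    fix c assume c: "c \<in> torus_points" "pt c \<in> zeros {emb \<Delta>}"
    have "ev n c (emb f) = 0" if f: "f \<in> E" for f
    proof -
      obtain g where "f = \<Delta> * g" using \<Delta>(2)[OF f] by (auto simp: dvd_in_def)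
      then show ?thesis using c \<Delta>(1) by simp
    qed
    then show "pt c \<in> zeros (emb ` E)" using c embE by auto
  qed
  show disj: "zeros {emb \<Delta>} \<inter> {pt (\<lambda>_. 1)} = {}" if "n = 1"
  proof -
    have "\<not> (\<forall>f\<in>E. ev n (\<lambda>_. 1) (emb f) = 0)" using one that by simp
    then have "pt (\<lambda>_. 1) \<notin> zeros (emb ` E)" using pt_in_zeros[OF embE one_pt] by blast
    then show ?thesis using gcd by blast
  qed
  have main: "zeros {emb \<Delta>} \<subseteq> codim_one_part V \<and> codim_one_part V \<subseteq> zeros {emb \<Delta>} \<union> Z1 \<and>
      (n > 1 \<longrightarrow> codim_one_part V \<subseteq> zeros {emb \<Delta>}) \<and> (n = 1 \<longrightarrow> Z1 \<subseteq> codim_one_part V)"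
    if \<Delta>0: "\<Delta> \<noteq> 0" and n1: "n \<ge> 1"
  proof -
    \<comment> \<open>The cofactors of \<open>\<Delta>\<close> in the members of
      \<open>E\<close>.\<close>
    define F where "F = {f \<in> LZ. \<Delta> * f \<in> E}"
    have "inj_on ((*) \<Delta>) F" using \<Delta>0 by (auto simp: inj_on_def)
    moreover have "(*) \<Delta> ` F \<subseteq> E" by (auto simp: F_def)
    ultimately have F: "finite F" "F \<subseteq> LZ" using E(1) finite_subset finite_imageD by (blast, auto simp: F_def)
    obtain f1 where f1: "f1 \<in> E" "f1 \<noteq> 0" using zero_E \<Delta>0 by blast
    then obtain f0 where f0: "f0 \<in> F" "f0 \<noteq> 0" using \<Delta>(2)[OF f1(1)] by (auto simp: dvd_in_def F_def)
    have "E = (\<lambda>f. \<Delta> * f) ` F"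
    proof (intro equalityI subsetI)
      fix f assume "f \<in> E"
      moreover obtain g where "g \<in> LZ" "f = \<Delta> * g" using \<Delta>(2)[OF \<open>f \<in> E\<close>] by (auto simp: dvd_in_def)
      ultimately show "f \<in> (\<lambda>f. \<Delta> * f) ` F" unfolding F_def by blast
    qed (auto simp: F_def)
    then have EF: "emb ` E = (\<lambda>f. emb (\<Delta> * f)) ` F" by (simp only: image_image)
    \<comment> \<open>With a common prime \<open>p\<close> of the cofactors,
      \<open>\<Delta> * p\<close> would divide all of \<open>E\<close>, hence
      \<open>\<Delta>\<close>.\<close>
    have coprime: "\<exists>f\<in>F. \<not> dvd_in LZ p f" if p: "prime_in LZ p" for p
    proof (rule ccontr)
      assume neg: "\<not> ?thesis"
      have "dvd_in LZ (\<Delta> * p) \<Delta>"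
      proof (rule \<Delta>(3))
        show "\<Delta> * p \<in> LZ" using \<Delta>(1) prime_inD(1)[OF p] by simp
        fix f assume "f \<in> E"
        then obtain g where g: "g \<in> LZ" "f = \<Delta> * g" using \<Delta>(2) by (auto simp: dvd_in_def)
        then have "dvd_in LZ p g" using neg \<open>f \<in> E\<close> by (auto simp: F_def)
        then show "dvd_in LZ (\<Delta> * p) f" using \<Delta>0 g by (simp add: Z.dvd_in_mult_cancel)
      qed
      then have "dvd_in LZ (\<Delta> * p) (\<Delta> * 1)" by simp
      then have "dvd_in LZ p 1" using \<Delta>0 by (simp only: Z.dvd_in_mult_cancel not_False_eq_True)
      then show False using Z.prime_not_dvd_unit[OF p] by simp
    qed
    \<comment> \<open>A nonzero equation for both the common zeros of \<open>E\<close> and the added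
      point 1.\<close>
    define h where "h = emb f1 * xm 0"
    have h: "h \<in> L" "h \<noteq> 0" using f1 E XL[of 0] X0[of 0] n1 by (auto simp: h_def)
    have Vh: "V \<inter> T0 \<subseteq> zeros {h}"
    proof (rule subset_T0I)
      fix c assume c: "c \<in> torus_points" "pt c \<in> V \<inter> T0"
      then have "ev n c (emb f1) = 0 \<or> c 0 = 1" using V[OF c(1)] f1 by auto
      then have "ev n c h = 0" using c evx[of 0 c] n1 by (auto simp: h_def)
      then show "pt c \<in> zeros {h}" using c h by simp
    qed simp
    have embD: "emb \<Delta> \<in> L" "emb \<Delta> \<noteq> 0" using \<Delta>(1) \<Delta>0 by auto
    have ZV: "zeros (emb ` E) \<subseteq> V" "Z1 \<subseteq> V" using VE n1 by auto
    have sup: "zeros {emb \<Delta>} \<subseteq> codim_one_part V"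
    proof (rule subset_T0I[OF _ zeros_subset_T0])
      fix c assume c: "c \<in> torus_points" "pt c \<in> zeros {emb \<Delta>}"
      then have "ev n c (emb \<Delta>) = 0" using embD by simp
      moreover obtain k where "prime_prod L k (emb \<Delta>)" using prime_prod_L embD by blast
      ultimately obtain q where q: "prime_in L q" "dvd_in L q (emb \<Delta>)" "ev n c q = 0"
        using prime_factor_zero[OF c(1)] by blast
      have "zeros {q} \<subseteq> V" using zeros_dvd_mono[OF q(2) prime_inD(1)[OF q(1)]] gcd ZV by blast
      then have "zeros {q} \<subseteq> codim_one_part V" using zeros_prime_in_codim_one_part[OF q(1) _ h Vh] by blast
      moreover have "pt c \<in> zeros {q}" using q c prime_inD(1)[OF q(1)] by simp
      ultimately show "pt c \<in> codim_one_part V" by blast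
    qed
    \<comment> \<open>In one variable the point 1 is the zero set of the single equation
      \<open>xm 0\<close>. A prime factor of it that vanishes at 1 has no other zero.\<close>
    have X1sup: "Z1 \<subseteq> codim_one_part V" if n: "n = 1"
    proof -
      have "ev n (\<lambda>_. 1) (xm 0) = 0" using evx n by simp
      moreover obtain k where "prime_prod L k (xm 0)" using prime_prod_L XL X0 n by blast
      ultimately obtain q where q: "prime_in L q" "dvd_in L q (xm 0)" "ev n (\<lambda>_. 1) q = 0"
        using prime_factor_zero[OF one_pt] by blast
      have "zeros {q} \<subseteq> zeros {xm 0}" using zeros_dvd_mono[OF q(2) prime_inD(1)[OF q(1)]] .
      also have "{xm 0} = xm ` {..<n}" using n by auto
      also have "zeros (xm ` {..<n}) = Z1" by (simp only: Z1_def)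
      finally have "zeros {q} \<subseteq> V" using ZV by blast
      then have "zeros {q} \<subseteq> codim_one_part V" using zeros_prime_in_codim_one_part[OF q(1) _ h Vh] by blast
      moreover have "pt (\<lambda>_. 1) \<in> zeros {q}" using q one_pt prime_inD(1)[OF q(1)] by simp
      ultimately show ?thesis unfolding Z1_eq by blast
    qed
    have cl: "closedin T (zeros (emb ` E))" "closedin T Z1"
      unfolding Z1_def by (intro closedin_zeros embE XsubL)+
    have VE': "V \<inter> T0 = zeros (emb ` E) \<union> Z1" using VE n1 by simp
    then have Vcl: "closedin T (V \<inter> T0)" using cl by auto
    have comp: "Z \<subseteq> zeros {emb \<Delta>} \<or> (Z \<subseteq> Z1 \<and> n = 1)"
      if Z: "Z \<in> irreducible_components T V" "codimension T Z = 1" "Z \<subseteq> T0" for Z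
    proof -
      have irr: "irreducible_in T Z" "Z \<subseteq> V \<inter> T0" using Z by (auto simp: irreducible_components_def)
      have Zcl: "closedin T Z" by (rule component_closed[OF Z(1,3) Vcl])
      have "Z \<subseteq> zeros (emb ` E) \<or> Z \<subseteq> Z1"
        using irr cl VE' unfolding irreducible_in_def by metis
      moreover have "Z1 \<subseteq> zeros (emb ` E)" if "n \<noteq> 1"
      proof -
        have "\<forall>f\<in>E. ev n (\<lambda>_. 1) (emb f) = 0" using one that n1 by simp
        then have "pt (\<lambda>_. 1) \<in> zeros (emb ` E)" using pt_in_zeros[OF embE one_pt] by blast
        then show ?thesis unfolding Z1_eq by blast
      qed
      ultimately have "Z \<subseteq> zeros (emb ` E) \<or> (Z \<subseteq> Z1 \<and> n = 1)" by blast
      then show ?thesis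
        using codimension_one_in_zeros_gcd[OF irr(1) Zcl Z(2) F f0 coprime \<Delta>(1)] unfolding EF by blast
    qed
    have "codim_one_part V \<subseteq> zeros {emb \<Delta>} \<union> (if n = 1 then Z1 else {})"
      unfolding codim_one_part_def using comp by (auto split: if_splits)
    then show ?thesis using sup X1sup by (auto split: if_splits)
  qed
  show W_gt1: "codim_one_part V = zeros {emb \<Delta>}" if "\<Delta> \<noteq> 0" "n > 1"
    using main that by auto
  show "codim_one_part V = zeros {emb \<Delta>} \<union> {pt (\<lambda>_. 1)}" if "\<Delta> \<noteq> 0" "n = 1"
    using main that unfolding Z1_eq by auto
  show "codim_one_part V = {} \<longleftrightarrow> (\<exists>e a. supp e \<subseteq> {..<n} \<and> \<Delta> = term_of e a)" if n2: "n \<ge> 2"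
  proof (cases "\<Delta> = 0")
    \<comment> \<open>Zero counts as a constant; it is the term with coefficient 0.\<close>
    case True
    then have "\<Delta> = term_of 0 0" by simp
    then show ?thesis using \<open>\<Delta> = 0 \<Longrightarrow> codim_one_part V = {}\<close> True
      by (metis empty_subsetI keys_zero)
  next
    case False
    have embD: "emb \<Delta> \<in> L" using \<Delta>(1) by auto
    have W: "codim_one_part V = zeros {emb \<Delta>}" using W_gt1 False n2 by simp
    show ?thesis unfolding W
    proof
      assume emp: "zeros {emb \<Delta>} = {}"
      obtain e where e: "e \<in> supp \<Delta>" using False by (metis all_not_in_conv keys_eq_empty)
      have sube: "supp x \<subseteq> {..<n}" if "x \<in> supp \<Delta>" for x using that \<Delta>(1) by (simp add: laurent_set_def)
      \<comment> \<open>Two exponents that differ in some variable would give a zero, by solving for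
        this variable.\<close>
      have "e' = e" if e': "e' \<in> supp \<Delta>" for e'
      proof (rule ccontr)
        assume "e' \<noteq> e"
        then obtain j where j: "coef e j \<noteq> coef e' j" by (metis poly_mapping_eqI)
        have "j < n"
        proof (rule ccontr)
          assume "\<not> j < n"
          then have "j \<notin> supp e" "j \<notin> supp e'" using sube e e' by auto
          then show False using j by (simp add: in_keys_iff)
        qed
        then obtain c where "c \<in> torus_points" "ev n c (emb \<Delta>) = 0"
          using exists_root_off[OF embD, of j e e' 1] e e' j sub_idom.one_in[OF sub_idom_laurent_set] by auto
        then have "pt c \<in> zeros {emb \<Delta>}" using embD by simp
        then show False using emp by simp
      qed
      then have "supp \<Delta> = {e}" using e by blast
      then have "\<Delta> = term_of e (coef \<Delta> e)" using sum_terms[of \<Delta>] by simp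
      then show "\<exists>e a. supp e \<subseteq> {..<n} \<and> \<Delta> = term_of e a" using sube e by blast
    next
      assume "\<exists>e a. supp e \<subseteq> {..<n} \<and> \<Delta> = term_of e a"
      then obtain e a where ea: "\<Delta> = term_of e a" by blast
      then have "a \<noteq> 0" using False by auto
      then show "zeros {emb \<Delta>} = {}"
        by (auto simp: zeros_def ea emb_term_of ev_term_of monomial_at_nonzero)
    qed
  qed
qed

end

section \<open>Torsion-free abelian groups\<close>

context comm_group
begin

text \<open>A generating family, encoded as a surjection from a free abelian group, so that
  relations are elements of its kernel.\<close>

definition spans_by :: "nat set \<Rightarrow> (expo \<Rightarrow> 'a) \<Rightarrow> bool" where
  "spans_by I h \<longleftrightarrow> h \<in> hom (free_Abelian_group I) G \<and> h ` carrier (free_Abelian_group I) = carrier G"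

lemma spans_by_add: "\<lbrakk>spans_by I h; supp f \<subseteq> I; supp g \<subseteq> I\<rbrakk> \<Longrightarrow> h (f + g) = h f \<otimes> h g"
  by (auto simp: spans_by_def hom_def)

lemma spans_by_closed: "\<lbrakk>spans_by I h; supp f \<subseteq> I\<rbrakk> \<Longrightarrow> h f \<in> carrier G"
  by (auto simp: spans_by_def hom_def)

lemma spans_by_surj: "\<lbrakk>spans_by I h; y \<in> carrier G\<rbrakk> \<Longrightarrow> \<exists>f. supp f \<subseteq> I \<and> y = h f"
  unfolding spans_by_def by (metis carrier_free_Abelian_group_iff imageE)

lemma spans_by_group_hom: "spans_by I h \<Longrightarrow> group_hom (free_Abelian_group I) G h"
  by (auto simp: spans_by_def group_hom_def group_hom_axioms_def is_group)

text \<open>A generator on which some multiple vanishes is trivial and can be dropped; otherwise an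
  elementary operation shortens the relation.\<close>

lemma redundant_generator:
  assumes tf: "\<forall>x\<in>carrier G. \<forall>k::nat. 0 < k \<longrightarrow> x [^] k = \<one> \<longrightarrow> x = \<one>"
    and I: "finite I"
  shows "\<lbrakk>spans_by I h; supp r \<subseteq> I; r \<noteq> 0; h r = \<one>\<rbrakk> \<Longrightarrow> \<exists>i\<in>I. \<exists>h'. spans_by I h' \<and> h' (frag_of i) = \<one>"
proof (induction "\<Sum>i\<in>I. nat \<bar>coef r i\<bar>" arbitrary: h r rule: less_induct)
  case less
  note h = less.prems(1) and rI = less.prems(2)
  obtain i where i: "i \<in> supp r" using less.prems(3) by (metis all_not_in_conv keys_eq_empty)
  show ?case
  proof (cases "supp r = {i}")
    case True
    define k where "k = coef r i"
    have r: "r = frag_cmul k (frag_of i)" 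
    proof (rule poly_mapping_eqI)
      fix x show "coef r x = coef (frag_cmul k (frag_of i)) x"
      proof (cases "x = i")
        case False
        then have "x \<notin> supp r" using True by simp
        then show ?thesis using False by (simp add: in_keys_iff)
      qed (simp add: k_def)
    qed
    have iI: "supp (frag_of i) \<subseteq> I" using i rI by auto
    have "h (frag_of i [^]\<^bsub>free_Abelian_group I\<^esub> k) = h (frag_of i) [^] k"
      using group_hom.hom_int_pow[OF spans_by_group_hom[OF h]] iI by simp
    then have hk: "h (frag_of i) [^] k = \<one>" using less.prems(4) r iI by simp
    have k0: "k \<noteq> 0" using i by (simp add: k_def in_keys_iff)
    have c: "h (frag_of i) \<in> carrier G" using spans_by_closed[OF h iI] .
    define m where "m = nat \<bar>k\<bar>"
    have "h (frag_of i) [^] m = \<one>"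
    proof (cases "k < 0")
      case True
      then have "k = - int m" by (simp add: m_def)
      then have "inv (h (frag_of i) [^] m) = \<one>" using hk int_pow_neg_int[OF c, of m] by metis
      then show ?thesis using c by (metis inv_inv inv_one nat_pow_closed)
    next
      case False
      then have "k = int m" by (simp add: m_def)
      then show ?thesis using hk int_pow_int by metis
    qed
    moreover have "m > 0" using k0 by (simp add: m_def)
    ultimately have "h (frag_of i) = \<one>" using tf c by blast
    then show ?thesis using h i rI by blast
  next
    case False
    then obtain j where j: "j \<in> supp r" "j \<noteq> i" using i by auto
    have *: "\<exists>i\<in>I. \<exists>h'. spans_by I h' \<and> h' (frag_of i) = \<one>"
      if ij: "i \<in> supp r" "j \<in> supp r" "i \<noteq> j" "\<bar>coef r j\<bar> \<le> \<bar>coef r i\<bar>" for i j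
    proof -
      \<comment> \<open>The sign for which adding \<open>s\<close> times the coordinate at
        \<open>j\<close> to that at \<open>i\<close> lowers the absolute value by that of the
        coordinate at \<open>j\<close>. The automorphism \<open>\<alpha> s\<close> performs this on
        relations, and the spanning map is composed with its inverse.\<close>
      define s where "s = - sgn (coef r i) * sgn (coef r j)"
      define \<alpha> where "\<alpha> t f = f + term_of i (t * coef f j)" for t :: int and f :: expo
      have iI: "i \<in> I" "j \<in> I" using ij rI by auto
      have \<alpha>_add: "\<alpha> t (f + g) = \<alpha> t f + \<alpha> t g" for t f g
        by (simp add: \<alpha>_def lookup_add algebra_simps single_add)
      have \<alpha>_inv: "\<alpha> t (\<alpha> (- t) f) = f" for t f
        using ij by (simp add: \<alpha>_def lookup_add lookup_single when_def single_add[symmetric])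
      have \<alpha>_I: "supp (\<alpha> t f) \<subseteq> I" if "supp f \<subseteq> I" for t f
        unfolding \<alpha>_def using Poly_Mapping.keys_add[of f "term_of i (t * coef f j)"] that iI
        by (auto split: if_splits)
      have h': "spans_by I (h \<circ> \<alpha> (- s))" unfolding spans_by_def
      proof (intro conjI homI)
        fix f g assume "f \<in> carrier (free_Abelian_group I)" "g \<in> carrier (free_Abelian_group I)"
        then show "(h \<circ> \<alpha> (- s)) f \<in> carrier G"
          "(h \<circ> \<alpha> (- s)) (f \<otimes>\<^bsub>free_Abelian_group I\<^esub> g) = (h \<circ> \<alpha> (- s)) f \<otimes> (h \<circ> \<alpha> (- s)) g"
          using spans_by_closed[OF h] spans_by_add[OF h] \<alpha>_I by (auto simp: \<alpha>_add)
      next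
        show "(h \<circ> \<alpha> (- s)) ` carrier (free_Abelian_group I) = carrier G"
        proof (intro equalityI subsetI)
          fix y assume "y \<in> carrier G"
          then obtain f where f: "supp f \<subseteq> I" "y = h f" using spans_by_surj[OF h] by blast
          then have "y = (h \<circ> \<alpha> (- s)) (\<alpha> s f)" using \<alpha>_inv[of "- s" f] by simp
          then show "y \<in> (h \<circ> \<alpha> (- s)) ` carrier (free_Abelian_group I)"
            by (rule image_eqI) (simp add: \<alpha>_I[OF f(1)])
        next
          fix y assume "y \<in> (h \<circ> \<alpha> (- s)) ` carrier (free_Abelian_group I)"
          then obtain f where "supp f \<subseteq> I" "y = h (\<alpha> (- s) f)" by auto
          then show "y \<in> carrier G" using spans_by_closed[OF h \<alpha>_I] by simp
        qed
      qed
      define r' where "r' = \<alpha> s r"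
      have cr': "coef r' x = (if x = i then coef r i + s * coef r j else coef r x)" for x
        by (auto simp: r'_def \<alpha>_def lookup_add lookup_single when_def)
      have nz: "coef r i \<noteq> 0" "coef r j \<noteq> 0" using ij by (auto simp: in_keys_iff)
      have small: "\<bar>coef r i + s * coef r j\<bar> < \<bar>coef r i\<bar>"
        using nz ij(4) unfolding s_def by (auto simp: sgn_if abs_if split: if_splits)
      have "(\<Sum>x\<in>I. nat \<bar>coef r' x\<bar>) < (\<Sum>x\<in>I. nat \<bar>coef r x\<bar>)"
        by (rule sum_strict_mono_ex1) (use I iI small in \<open>auto simp: cr' nat_less_eq_zless\<close>)
      moreover have "r' \<noteq> 0"
      proof
        assume "r' = 0"
        then have "coef r' j = 0" by simp
        then show False using cr'[of j] ij nz by simp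
      qed
      moreover have "(h \<circ> \<alpha> (- s)) r' = \<one>"
        using \<alpha>_inv[of "- s" r] less.prems(4) by (simp add: r'_def)
      ultimately show ?thesis using less.hyps[of r' "h \<circ> \<alpha> (- s)"] h' \<alpha>_I[OF rI, of s] by (simp add: r'_def)
    qed
    show ?thesis
    proof (cases "\<bar>coef r j\<bar> \<le> \<bar>coef r i\<bar>")
      case True
      then show ?thesis using *[OF i j(1)] j by blast
    next
      case False
      then show ?thesis using *[OF j(1) i] j by simp
    qed
  qed
qed

lemma drop_generator:
  assumes h: "spans_by I h" and i: "i \<in> I" "h (frag_of i) = \<one>"
  shows "spans_by (I - {i}) h"
  unfolding spans_by_def
proof (intro conjI homI equalityI subsetI)
  fix f g assume "f \<in> carrier (free_Abelian_group (I - {i}))" "g \<in> carrier (free_Abelian_group (I - {i}))"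
  then have "supp f \<subseteq> I" "supp g \<subseteq> I" by auto
  then show "h f \<in> carrier G" "h (f \<otimes>\<^bsub>free_Abelian_group (I - {i})\<^esub> g) = h f \<otimes> h g"
    using spans_by_closed[OF h] spans_by_add[OF h] by auto
next
  fix y assume "y \<in> carrier G"
  then obtain f where f: "supp f \<subseteq> I" "y = h f" using spans_by_surj[OF h] by blast
  define f' where "f' = f - term_of i (coef f i)"
  have f': "supp f' \<subseteq> I - {i}"
    using f by (auto simp: f'_def in_keys_iff lookup_minus lookup_single when_def split: if_splits)
  have iI: "supp (frag_of i) \<subseteq> I" using i by simp
  have "term_of i (coef f i) = frag_cmul (coef f i) (frag_of i)"
    by (rule poly_mapping_eqI) (simp add: lookup_single when_def)
  then have "term_of i (coef f i) = frag_of i [^]\<^bsub>free_Abelian_group I\<^esub> (coef f i)"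
    using iI by simp
  then have "h (term_of i (coef f i)) = h (frag_of i) [^] (coef f i)"
    using group_hom.hom_int_pow[OF spans_by_group_hom[OF h], of "frag_of i"] iI by simp
  then have "h (term_of i (coef f i)) = \<one>" using i by (simp add: int_pow_one)
  moreover have "h (f' + term_of i (coef f i)) = h f' \<otimes> h (term_of i (coef f i))"
    by (rule spans_by_add[OF h]) (use f' i in auto)
  moreover have "h f' \<in> carrier G" by (rule spans_by_closed[OF h]) (use f' in auto)
  moreover have "f' + term_of i (coef f i) = f" by (simp add: f'_def)
  ultimately have "h f = h f'" by simp
  then show "y \<in> h ` carrier (free_Abelian_group (I - {i}))" using f f' by auto
next
  fix y assume "y \<in> h ` carrier (free_Abelian_group (I - {i}))"
  then obtain f where "supp f \<subseteq> I - {i}" "y = h f" by auto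
  then show "y \<in> carrier G" using spans_by_closed[OF h, of f] by blast
qed

text \<open>In a finite generating family of least size there is no relation, because a relation
  would allow a generator to be dropped after a change of generators.\<close>

theorem torsion_free_imp_free:
  assumes tf: "\<forall>x\<in>carrier G. \<forall>k::nat. 0 < k \<longrightarrow> x [^] k = \<one> \<longrightarrow> x = \<one>"
    and I: "finite I" "spans_by I h"
  shows "\<exists>n. G \<cong> free_Abelian_group {..<n::nat}"
proof -
  obtain J where J: "finite J \<and> (\<exists>h. spans_by J h)"
    "\<And>K. finite K \<and> (\<exists>h. spans_by K h) \<Longrightarrow> card J \<le> card K"
    using ex_has_least_nat[of "\<lambda>J. finite J \<and> (\<exists>h. spans_by J h)" I card] I by auto
  obtain h where h: "spans_by J h" using J by blast
  have inj: "r = 0" if r: "supp r \<subseteq> J" "h r = \<one>" for r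
  proof (rule ccontr)
    assume "r \<noteq> 0"
    then obtain i h' where i: "i \<in> J" "spans_by J h'" "h' (frag_of i) = \<one>"
      using redundant_generator[of J h r, OF tf _ h r(1) _ r(2)] J(1) by blast
    then have "card J \<le> card (J - {i})" using J drop_generator by blast
    then show False using i(1) J(1) by (metis card_Diff1_less leD)
  qed
  have "inj_on h (carrier (free_Abelian_group J))"
    using group_hom.inj_on_one_iff[OF spans_by_group_hom[OF h]] inj by simp
  then have "h \<in> iso (free_Abelian_group J) G"
    using h by (auto simp: iso_def bij_betw_def spans_by_def)
  then have 1: "G \<cong> free_Abelian_group J"
    using group.iso_sym[OF group_free_Abelian_group] is_isoI by blast
  have "J \<approx> {..<card J}" using J(1) by (simp add: eqpoll_iff_card)
  then have "free_Abelian_group J \<cong> free_Abelian_group {..<card J}"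
    using isomorphic_free_Abelian_groups by blast
  then show ?thesis using iso_trans[OF 1] by blast
qed

end

lemma rank_unique:
  assumes "A \<cong> free_Abelian_group {..<n::nat}" "A \<cong> free_Abelian_group {..<m::nat}" "group A"
  shows "n = m"
proof -
  have "free_Abelian_group {..<n} \<cong> A" using group.iso_sym[OF assms(3,1)] .
  then have "free_Abelian_group {..<n} \<cong> free_Abelian_group {..<m}" using iso_trans assms(2) by blast
  then have "{..<n} \<approx> {..<m}" using isomorphic_free_Abelian_groups by blast
  then show ?thesis by (simp add: eqpoll_iff_card)
qed

section \<open>Minors and kernel vectors\<close>

text \<open>The formula of \<open>ring_det\<close> in a type class ring. With functions as matrices,
  a ring homomorphism carries one to the other directly.\<close>

definition leibniz_det :: "nat \<Rightarrow> (nat \<Rightarrow> nat \<Rightarrow> 'k::comm_ring_1) \<Rightarrow> 'k" where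
  "leibniz_det k A = (\<Sum>\<sigma>\<in>{\<sigma>. \<sigma> permutes {..<k}}. (if evenperm \<sigma> then 1 else - 1) * (\<Prod>i<k. A i (\<sigma> i)))"

lemma leibniz_det_eq_det: "leibniz_det k A = det (mat k k (\<lambda>(i, j). A i j))"
proof -
  have "(\<Prod>i<k. A i (\<sigma> i)) = (\<Prod>i = 0..<k. mat k k (\<lambda>(i, j). A i j) $$ (i, \<sigma> i))"
    if "\<sigma> permutes {0..<k}" for \<sigma>
    using that permutes_in_image[OF that] by (auto simp: lessThan_atLeast0 intro!: prod.cong)
  then show ?thesis
    unfolding leibniz_det_def det_def by (auto simp: lessThan_atLeast0 sign_def intro!: sum.cong)
qed

lemma leibniz_det_eq_zero_iff:
  fixes A :: "nat \<Rightarrow> nat \<Rightarrow> 'k::field"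
  shows "leibniz_det k A = 0 \<longleftrightarrow> (\<exists>w. (\<exists>j<k. w j \<noteq> 0) \<and> (\<forall>i<k. (\<Sum>j<k. A i j * w j) = 0))"
proof -
  let ?M = "mat k k (\<lambda>(i, j). A i j)"
  have prod: "(?M *\<^sub>v v) $ i = (\<Sum>j<k. A i j * v $ j)" if "i < k" "v \<in> carrier_vec k" for i v
    using that by (auto simp: scalar_prod_def lessThan_atLeast0 intro!: sum.cong)
  have "leibniz_det k A = 0 \<longleftrightarrow> (\<exists>v. v \<in> carrier_vec k \<and> v \<noteq> 0\<^sub>v k \<and> ?M *\<^sub>v v = 0\<^sub>v k)"
    unfolding leibniz_det_eq_det by (rule det_0_iff_vec_prod_zero[of ?M]) simp
  also have "\<dots> \<longleftrightarrow> (\<exists>w. (\<exists>j<k. w j \<noteq> 0) \<and> (\<forall>i<k. (\<Sum>j<k. A i j * w j) = 0))"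
  proof
    assume "\<exists>v. v \<in> carrier_vec k \<and> v \<noteq> 0\<^sub>v k \<and> ?M *\<^sub>v v = 0\<^sub>v k"
    then obtain v where v: "v \<in> carrier_vec k" "v \<noteq> 0\<^sub>v k" "?M *\<^sub>v v = 0\<^sub>v k" by blast
    have "\<exists>j<k. v $ j \<noteq> 0"
    proof (rule ccontr)
      assume "\<not> ?thesis"
      then have "v = 0\<^sub>v k" using v(1) by (intro eq_vecI) auto
      then show False using v by simp
    qed
    moreover have "(\<Sum>j<k. A i j * v $ j) = 0" if "i < k" for i
      using prod[OF that v(1)] v(3) that by simp
    ultimately show "\<exists>w. (\<exists>j<k. w j \<noteq> 0) \<and> (\<forall>i<k. (\<Sum>j<k. A i j * w j) = 0)" by blast
  next
    assume "\<exists>w. (\<exists>j<k. w j \<noteq> 0) \<and> (\<forall>i<k. (\<Sum>j<k. A i j * w j) = 0)"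
    then obtain w where w: "\<exists>j<k. w j \<noteq> 0" "\<forall>i<k. (\<Sum>j<k. A i j * w j) = 0" by blast
    have "vec k w \<noteq> 0\<^sub>v k"
    proof
      assume *: "vec k w = 0\<^sub>v k"
      obtain j where "j < k" "w j \<noteq> 0" using w by blast
      moreover have "vec k w $ j = 0\<^sub>v k $ j" using * by simp
      ultimately show False by simp
    qed
    moreover have "?M *\<^sub>v vec k w = 0\<^sub>v k"
    proof (rule eq_vecI)
      fix i assume "i < dim_vec (0\<^sub>v k)"
      then have i: "i < k" by simp
      then show "(?M *\<^sub>v vec k w) $ i = 0\<^sub>v k $ i" using prod[OF i, of "vec k w"] w(2) by simp
    qed simp
    ultimately show "\<exists>v. v \<in> carrier_vec k \<and> v \<noteq> 0\<^sub>v k \<and> ?M *\<^sub>v v = 0\<^sub>v k"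
      by (intro exI[of _ "vec k w"]) simp
  qed
  finally show ?thesis .
qed

text \<open>Zero rows make the matrix square, and each term of its determinant then contains a zero
  factor.\<close>

lemma wide_matrix_kernel:
  fixes A :: "nat \<Rightarrow> nat \<Rightarrow> 'k::field"
  assumes "h < k"
  shows "\<exists>w. (\<exists>j<k. w j \<noteq> 0) \<and> (\<forall>i<h. (\<Sum>j<k. A i j * w j) = 0)"
proof -
  define B where "B i j = (if i < h then A i j else 0)" for i j
  have "(\<Prod>i<k. B i (\<sigma> i)) = 0" for \<sigma> :: "nat \<Rightarrow> nat"
    using assms by (intro prod_zero bexI[of _ h]) (auto simp: B_def)
  then have "leibniz_det k B = 0" by (simp add: leibniz_det_def)
  then obtain w where w: "\<exists>j<k. w j \<noteq> 0" "\<forall>i<k. (\<Sum>j<k. B i j * w j) = 0"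
    using leibniz_det_eq_zero_iff by blast
  have "(\<Sum>j<k. A i j * w j) = 0" if "i < h" for i
    using w(2) that assms by (auto simp: B_def dest!: spec[of _ i])
  then show ?thesis using w(1) by blast
qed

text \<open>Choose as few rows \<open>I\<close> as possible that still have trivial kernel. There
  are at least \<open>k\<close> of them, since a wide matrix has a kernel. By minimality each row of
  \<open>I\<close> has a vector killed by all other rows of \<open>I\<close> but not by it; these
  vectors are independent, so there are at most \<open>k\<close> rows.\<close>

lemma injective_matrix_has_minor:
  fixes A :: "nat \<Rightarrow> nat \<Rightarrow> 'k::field"
  assumes inj: "\<And>w. (\<forall>i<h. (\<Sum>j<k. A i j * w j) = 0) \<Longrightarrow> \<forall>j<k. w j = 0"
  shows "\<exists>r. strict_mono_on {..<k} r \<and> r ` {..<k} \<subseteq> {..<h} \<and> leibniz_det k (\<lambda>i j. A (r i) j) \<noteq> 0"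
proof -
  define good where "good I \<longleftrightarrow> I \<subseteq> {..<h} \<and> (\<forall>w. (\<forall>i\<in>I. (\<Sum>j<k. A i j * w j) = 0) \<longrightarrow> (\<forall>j<k. w j = 0))" for I
  have "\<forall>j<k. w j = 0" if "\<forall>i\<in>{..<h}. (\<Sum>j<k. A i j * w j) = 0" for w
    by (rule inj) (use that in simp)
  then have "good {..<h}" unfolding good_def by blast
  then obtain I where I: "good I" "\<And>K. good K \<Longrightarrow> card I \<le> card K"
    using ex_has_least_nat[of good "{..<h}" card] by blast
  have Ih: "I \<subseteq> {..<h}" "finite I" using I(1) finite_subset by (auto simp: good_def)
  obtain r where r: "strict_mono_on {..<card I} r" "\<forall>l<card I. r l \<in> I"
    using finite_enumerate[OF Ih(2)] by blast
  have rinj: "inj_on r {..<card I}" using strict_mono_on_imp_inj_on[OF r(1)] .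
  have "r ` {..<card I} = I" using r(2) rinj Ih(2) by (intro card_subset_eq) (auto simp: card_image)
  then have rI: "\<exists>l<card I. i = r l" if "i \<in> I" for i using that by auto
  have ge: "k \<le> card I"
  proof (rule ccontr)
    assume "\<not> k \<le> card I"
    then obtain w where w: "\<exists>j<k. w j \<noteq> 0" "\<forall>l<card I. (\<Sum>j<k. A (r l) j * w j) = 0"
      using wide_matrix_kernel[of "card I" k "\<lambda>l. A (r l)"] by auto
    then have "\<forall>i\<in>I. (\<Sum>j<k. A i j * w j) = 0" using rI by blast
    then show False using w(1) I(1) unfolding good_def by blast
  qed
  have "\<exists>w. (\<Sum>j<k. A i j * w j) \<noteq> 0 \<and> (\<forall>i'\<in>I - {i}. (\<Sum>j<k. A i' j * w j) = 0)" if i: "i \<in> I" for i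
  proof -
    have "card (I - {i}) < card I" using card_Diff1_less[OF Ih(2) i] .
    then have "\<not> good (I - {i})" using I(2) leD by blast
    moreover have "I - {i} \<subseteq> {..<h}" using Ih by blast
    ultimately obtain w where w: "\<forall>i'\<in>I - {i}. (\<Sum>j<k. A i' j * w j) = 0" "\<not> (\<forall>j<k. w j = 0)"
      unfolding good_def by blast
    have "(\<Sum>j<k. A i j * w j) \<noteq> 0"
    proof
      assume "(\<Sum>j<k. A i j * w j) = 0"
      then have "\<forall>i'\<in>I. (\<Sum>j<k. A i' j * w j) = 0" using w(1) by blast
      then show False using I(1) w(2) unfolding good_def by blast
    qed
    then show ?thesis using w(1) by blast
  qed
  then obtain W where W: "\<And>i. i \<in> I \<Longrightarrow> (\<Sum>j<k. A i j * W i j) \<noteq> 0"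
    "\<And>i i'. \<lbrakk>i \<in> I; i' \<in> I - {i}\<rbrakk> \<Longrightarrow> (\<Sum>j<k. A i' j * W i j) = 0" by metis
  have le: "card I \<le> k"
  proof (rule ccontr)
    assume "\<not> card I \<le> k"
    then obtain x where x: "\<exists>l<card I. x l \<noteq> 0" "\<forall>j<k. (\<Sum>l<card I. W (r l) j * x l) = 0"
      using wide_matrix_kernel[of k "card I" "\<lambda>j l. W (r l) j"] by auto
    have "x l = 0" if l: "l < card I" for l
    proof -
      have other: "(\<Sum>j<k. A (r l) j * W (r l') j) = 0" if "l' < card I" "l' \<noteq> l" for l'
      proof -
        have "r l \<noteq> r l'" using rinj that l by (auto simp: inj_on_def)
        then show ?thesis using W(2)[of "r l'" "r l"] r(2) that l by auto
      qed
      have "0 = (\<Sum>j<k. A (r l) j * (\<Sum>l'<card I. W (r l') j * x l'))" using x(2) by simp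
      also have "\<dots> = (\<Sum>l'<card I. (\<Sum>j<k. A (r l) j * W (r l') j) * x l')"
        unfolding sum_distrib_left sum_distrib_right by (subst sum.swap) (simp add: mult.assoc)
      also have "\<dots> = (\<Sum>j<k. A (r l) j * W (r l) j) * x l"
        using l other by (subst sum.remove[of _ l]) auto
      finally show ?thesis using W(1)[of "r l"] r(2) l by auto
    qed
    then show False using x(1) by blast
  qed
  have k: "card I = k" using ge le by simp
  have "leibniz_det k (\<lambda>i j. A (r i) j) \<noteq> 0"
  proof
    assume "leibniz_det k (\<lambda>i j. A (r i) j) = 0"
    from this[unfolded leibniz_det_eq_zero_iff] obtain w where
      w: "\<exists>j<k. w j \<noteq> 0" "\<forall>i<k. (\<Sum>j<k. A (r i) j * w j) = 0" by blast
    have "\<forall>i\<in>I. (\<Sum>j<k. A i j * w j) = 0"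
    proof
      fix i assume "i \<in> I"
      then obtain l where "l < k" "i = r l" using rI k by auto
      then show "(\<Sum>j<k. A i j * w j) = 0" using w(2) by simp
    qed
    then show False using w(1) I(1) unfolding good_def by blast
  qed
  then show ?thesis using r Ih k by (intro exI[of _ r]) auto
qed

definition independent_pair :: "nat \<Rightarrow> (nat \<Rightarrow> complex) \<Rightarrow> (nat \<Rightarrow> complex) \<Rightarrow> bool" where
  "independent_pair m u v \<longleftrightarrow> (\<forall>a b. (\<forall>j<m. a * u j + b * v j = 0) \<longrightarrow> a = 0 \<and> b = 0)"

definition kernel_vec :: "nat \<Rightarrow> nat \<Rightarrow> (nat \<Rightarrow> nat \<Rightarrow> complex) \<Rightarrow> (nat \<Rightarrow> complex) \<Rightarrow> bool" where
  "kernel_vec h m P u \<longleftrightarrow> (\<forall>i<h. (\<Sum>j<m. P i j * u j) = 0)"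

lemma kernel_vec_comb:
  assumes "kernel_vec h m P u" "kernel_vec h m P v"
  shows "kernel_vec h m P (\<lambda>j. a * u j + b * v j)"
  unfolding kernel_vec_def
proof (intro allI impI)
  fix i assume "i < h"
  have "(\<Sum>j<m. P i j * (a * u j + b * v j)) = a * (\<Sum>j<m. P i j * u j) + b * (\<Sum>j<m. P i j * v j)"
    by (simp add: sum_distrib_left sum.distrib algebra_simps)
  then show "(\<Sum>j<m. P i j * (a * u j + b * v j)) = 0" using assms \<open>i < h\<close> by (simp add: kernel_vec_def)
qed

text \<open>Corank at least two, without ranks. Two independent kernel vectors have a nonzero
  combination that vanishes at the column a minor omits, so the minor is singular. Conversely, a
  kernel of dimension at most one becomes trivial after deletion of a suitable column, and an
  injective matrix has a nonzero maximal minor.\<close>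

theorem minors_zero_iff_independent_kernel:
  "(\<forall>r c. strict_mono_on {..<m-1} r \<and> r ` {..<m-1} \<subseteq> {..<h} \<and>
      strict_mono_on {..<m-1} c \<and> c ` {..<m-1} \<subseteq> {..<m} \<longrightarrow> leibniz_det (m - 1) (\<lambda>i j. P (r i) (c j)) = 0)
   \<longleftrightarrow> (\<exists>u v. kernel_vec h m P u \<and> kernel_vec h m P v \<and> independent_pair m u v)"
    (is "?L \<longleftrightarrow> ?R")
proof
  assume ?R
  then obtain u v where uv: "kernel_vec h m P u" "kernel_vec h m P v" "independent_pair m u v" by blast
  show ?L
  proof (intro allI impI)
    fix r c :: "nat \<Rightarrow> nat"
    assume rc: "strict_mono_on {..<m-1} r \<and> r ` {..<m-1} \<subseteq> {..<h} \<and>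
      strict_mono_on {..<m-1} c \<and> c ` {..<m-1} \<subseteq> {..<m}"
    have cinj: "inj_on c {..<m-1}" using strict_mono_on_imp_inj_on rc by blast
    have m0: "m \<noteq> 0"
    proof
      assume "m = 0"
      then show False using uv(3) by (auto simp: independent_pair_def dest: spec[of _ 1])
    qed
    have "card (c ` {..<m-1}) = m - 1" using card_image[OF cinj] by simp
    then have "card ({..<m} - c ` {..<m-1}) = 1"
      using rc m0 by (subst card_Diff_subset) auto
    then obtain j0 where j0: "{..<m} - c ` {..<m-1} = {j0}" by (rule card_1_singletonE)
    then have j0m: "j0 < m" "j0 \<notin> c ` {..<m-1}" by auto
    \<comment> \<open>The combination that vanishes at \<open>j0\<close>; if \<open>u\<close> and
      \<open>v\<close> both vanish there, \<open>u\<close> itself serves.\<close>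
    define w where "w j = (if u j0 = 0 \<and> v j0 = 0 then u j else v j0 * u j + (- u j0) * v j)" for j
    have kw: "kernel_vec h m P w"
    proof (cases "u j0 = 0 \<and> v j0 = 0")
      case True
      then have "w = u" by (simp add: fun_eq_iff w_def)
      then show ?thesis using uv(1) by simp
    next
      case False
      then have "w = (\<lambda>j. v j0 * u j + (- u j0) * v j)" by (auto simp: fun_eq_iff w_def)
      then show ?thesis using kernel_vec_comb[OF uv(1,2), of "v j0" "- u j0"] by simp
    qed
    have wj0: "w j0 = 0" by (simp add: w_def)
    have "\<exists>j<m. w j \<noteq> 0"
    proof (rule ccontr)
      assume neg: "\<not> ?thesis"
      show False
      proof (cases "u j0 = 0 \<and> v j0 = 0")
        case True
        then have "\<forall>j<m. 1 * u j + 0 * v j = 0" using neg by (simp add: w_def)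
        then have "(1::complex) = 0" using uv(3) unfolding independent_pair_def by blast
        then show False by simp
      next
        case False
        then have "\<forall>j<m. v j0 * u j + (- u j0) * v j = 0" using neg by (auto simp: w_def)
        then have "v j0 = 0 \<and> - u j0 = 0" using uv(3) unfolding independent_pair_def by blast
        then show False using False by simp
      qed
    qed
    then obtain j where j: "j < m" "w j \<noteq> 0" by blast
    then have "j \<in> c ` {..<m-1}" using j0 wj0 by (cases "j = j0") auto
    then obtain l where l: "l < m - 1" "j = c l" by auto
    have "(\<Sum>l<m-1. P (r i) (c l) * w (c l)) = 0" if i: "i < m - 1" for i
    proof -
      have "r i < h" using rc i by auto
      then have "0 = (\<Sum>j<m. P (r i) j * w j)" using kw by (simp add: kernel_vec_def)
      also have "\<dots> = (\<Sum>j\<in>c ` {..<m-1}. P (r i) j * w j)"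
        using rc j0 wj0 by (intro sum.mono_neutral_right) auto
      also have "\<dots> = (\<Sum>l<m-1. P (r i) (c l) * w (c l))" unfolding sum.reindex[OF cinj] by simp
      finally show ?thesis by simp
    qed
    then show "leibniz_det (m - 1) (\<lambda>i j. P (r i) (c j)) = 0"
      unfolding leibniz_det_eq_zero_iff using l j by (intro exI[of _ "\<lambda>l. w (c l)"]) auto
  qed
next
  assume L: ?L
  show ?R
  proof (rule ccontr)
    assume neg: "\<not> ?R"
    show False
    proof (cases "m = 0")
      \<comment> \<open>Here \<open>m - 1\<close> is 0, and the only minor is the empty determinant
        1.\<close>
      case True
      have "leibniz_det 0 (\<lambda>i j. P i j) = 0"
        using L[rule_format, of "\<lambda>i. i" "\<lambda>i. i"] True by (simp add: strict_mono_on_def)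
      then show False by (simp add: leibniz_det_def)
    next
      case m0: False
      \<comment> \<open>A coordinate that detects kernel vectors: one where a nonzero kernel vector
        does not vanish, or 0 if the kernel is trivial.\<close>
      have "\<exists>j0<m. \<forall>w. kernel_vec h m P w \<and> w j0 = 0 \<longrightarrow> (\<forall>j<m. w j = 0)"
      proof (cases "\<exists>u. kernel_vec h m P u \<and> (\<exists>j<m. u j \<noteq> 0)")
        case True
        then obtain u j0 where u: "kernel_vec h m P u" "j0 < m" "u j0 \<noteq> 0" by blast
        have "\<forall>j<m. w j = 0" if w: "kernel_vec h m P w" "w j0 = 0" for w
        proof (rule ccontr)
          assume ne: "\<not> ?thesis"
          have "independent_pair m u w" unfolding independent_pair_def
          proof (intro allI impI)
            fix a b assume ab: "\<forall>j<m. a * u j + b * w j = 0"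
            then have "a * u j0 + b * w j0 = 0" using u(2) by blast
            then have "a = 0" using w(2) u(3) by simp
            then show "a = 0 \<and> b = 0" using ab ne by auto
          qed
          then show False using neg u(1) w(1) by blast
        qed
        then show ?thesis using u(2) by blast
      next
        case False
        then have "\<forall>w. kernel_vec h m P w \<and> w 0 = 0 \<longrightarrow> (\<forall>j<m. w j = 0)" by blast
        then show ?thesis using m0 by blast
      qed
      then obtain j0 where j0: "j0 < m" "\<And>w. \<lbrakk>kernel_vec h m P w; w j0 = 0\<rbrakk> \<Longrightarrow> \<forall>j<m. w j = 0" by blast
      \<comment> \<open>The increasing enumeration of the columns other than \<open>j0\<close>;
        \<open>c'\<close> is its left inverse.\<close>
      define c where "c l = (if l < j0 then l else Suc l)" for l
      define c' where "c' j = (if j < j0 then j else j - 1)" for j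
      have c: "strict_mono_on {..<m-1} c" "c ` {..<m-1} \<subseteq> {..<m}"
        using j0(1) by (auto simp: strict_mono_on_def c_def)
      have c'c: "c' (c l) = l" for l by (simp add: c_def c'_def)
      have cinj: "inj_on c {..<m-1}" by (rule inj_on_inverseI[of _ c']) (rule c'c)
      have crange: "c ` {..<m-1} = {..<m} - {j0}"
      proof (rule card_subset_eq)
        show "c ` {..<m-1} \<subseteq> {..<m} - {j0}" using c(2) by (auto simp: c_def split: if_splits)
        show "card (c ` {..<m-1}) = card ({..<m} - {j0})" using j0(1) unfolding card_image[OF cinj] by simp
      qed simp
      have "\<exists>r. strict_mono_on {..<m-1} r \<and> r ` {..<m-1} \<subseteq> {..<h} \<and> leibniz_det (m-1) (\<lambda>i j. P (r i) (c j)) \<noteq> 0"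
      proof (rule injective_matrix_has_minor[where h = h and k = "m - 1" and A = "\<lambda>i j. P i (c j)"])
        fix w :: "nat \<Rightarrow> complex" assume w: "\<forall>i<h. (\<Sum>j<m-1. P i (c j) * w j) = 0"
        define x where "x j = (if j = j0 then 0 else w (c' j))" for j
        have xc: "x (c l) = w l" for l using c'c by (auto simp: x_def c_def)
        have "kernel_vec h m P x" unfolding kernel_vec_def
        proof (intro allI impI)
          fix i assume "i < h"
          have "(\<Sum>j<m. P i j * x j) = (\<Sum>j\<in>c ` {..<m-1}. P i j * x j)"
            unfolding crange using j0(1) by (intro sum.mono_neutral_right) (auto simp: x_def)
          also have "\<dots> = (\<Sum>l<m-1. P i (c l) * w l)" unfolding sum.reindex[OF cinj] by (simp add: xc)
          finally show "(\<Sum>j<m. P i j * x j) = 0" using w \<open>i < h\<close> by simp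
        qed
        moreover have "x j0 = 0" by (simp add: x_def)
        ultimately have "\<forall>j<m. x j = 0" by (rule j0(2))
        then have "x (c j) = 0" if "j < m - 1" for j using c(2) that by blast
        then show "\<forall>j<m-1. w j = 0" by (simp add: xc)
      qed
      then show False using L c by blast
    qed
  qed
qed

section \<open>Group rings and characters\<close>

text \<open>For a group homomorphism \<open>p\<close> this is the induced map of group rings. It is
  also applied to set-theoretic sections in order to lift elements.\<close>

definition push :: "('x \<Rightarrow> 'y) \<Rightarrow> ('x \<Rightarrow>\<^sub>0 'k::comm_monoid_add) \<Rightarrow> ('y \<Rightarrow>\<^sub>0 'k)" where
  "push p = lin (\<lambda>x a. term_of (p x) a)"

lemma push_zero [simp]: "push p 0 = 0"
  by (simp add: push_def)

lemma push_add: "push p (f + g) = push p f + push p g"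
  unfolding push_def by (rule lin_add) (simp_all add: single_add)

lemma push_single [simp]: "push p (term_of x a) = term_of (p x) a"
  by (simp add: push_def lin_single)

lemma push_sum: "push p (sum F I) = (\<Sum>i\<in>I. push p (F i))"
  unfolding push_def by (rule lin_sum) (simp_all add: single_add)

lemma push_push:
  assumes "\<And>x. x \<in> supp f \<Longrightarrow> q (p x) = r x"
  shows "push q (push p f) = push r f"
proof -
  have "push q (push p f) = (\<Sum>x\<in>supp f. push q (term_of (p x) (coef f x)))"
    by (simp add: push_def[of p] lin_def push_sum)
  also have "\<dots> = push r f" unfolding push_def[of r] lin_def using assms by (intro sum.cong) simp_all
  finally show ?thesis .
qed

lemma push_id: "(\<And>x. x \<in> supp f \<Longrightarrow> p x = x) \<Longrightarrow> push p f = f"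
  unfolding push_def lin_def by (subst (2) sum_terms[of f, symmetric]) (simp cong: sum.cong)

lemma lin_push:
  assumes "\<And>y. h y 0 = 0" "\<And>y a b. h y (a + b) = h y a + h y b"
  shows "lin h (push p f) = lin (\<lambda>x a. h (p x) a) f"
proof -
  have "lin h (push p f) = (\<Sum>x\<in>supp f. lin h (term_of (p x) (coef f x)))"
    unfolding push_def[of p] lin_def[of _ f] by (rule lin_sum) (use assms in auto)
  then show ?thesis by (simp add: lin_single assms lin_def[of _ f])
qed

lemma supp_push: "supp (push p f) \<subseteq> p ` supp f"
proof -
  have "supp (\<Sum>x\<in>A. term_of (p x) (coef f x)) \<subseteq> p ` A" if "finite A" for A
    using that
  proof (induction A rule: finite_induct)
    case (insert x A)
    then show ?case using Poly_Mapping.keys_add[of "term_of (p x) (coef f x)" "\<Sum>x\<in>A. term_of (p x) (coef f x)"]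
      by (auto split: if_splits)
  qed simp
  from this[of "supp f"] show ?thesis by (simp add: push_def lin_def)
qed

lemma carrier_group_ring [simp]: "f \<in> carrier (group_ring G) \<longleftrightarrow> supp f \<subseteq> carrier G"
  by (simp add: group_ring_def)

lemma add_group_ring [simp]: "f \<oplus>\<^bsub>group_ring G\<^esub> g = f + g"
  by (simp add: group_ring_def)

lemma zero_group_ring [simp]: "\<zero>\<^bsub>group_ring G\<^esub> = 0"
  by (simp add: group_ring_def)

lemma one_group_ring [simp]: "\<one>\<^bsub>group_ring G\<^esub> = term_of \<one>\<^bsub>G\<^esub> 1"
  by (simp add: group_ring_def)

lemma mult_group_ring:
  "f \<otimes>\<^bsub>group_ring G\<^esub> g = (\<Sum>x\<in>supp f. \<Sum>y\<in>supp g. term_of (x \<otimes>\<^bsub>G\<^esub> y) (coef f x * coef g y))"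
  by (simp add: group_ring_def)

lemma lin_group_ring_mult:
  fixes h :: "'g \<Rightarrow> 'k::comm_ring_1 \<Rightarrow> 'b::semiring_0"
  assumes h: "\<And>x. h x 0 = 0" "\<And>x a b. h x (a + b) = h x a + h x b"
    and m: "\<And>x y a b. x \<in> supp f \<Longrightarrow> y \<in> supp g \<Longrightarrow> h (x \<otimes>\<^bsub>G\<^esub> y) (a * b) = h x a * h y b"
  shows "lin h (f \<otimes>\<^bsub>group_ring G\<^esub> g) = lin h f * lin h g"
proof -
  have "lin h (f \<otimes>\<^bsub>group_ring G\<^esub> g) = (\<Sum>x\<in>supp f. \<Sum>y\<in>supp g. h (x \<otimes>\<^bsub>G\<^esub> y) (coef f x * coef g y))"
    by (simp add: mult_group_ring lin_sum lin_single h)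
  also have "\<dots> = lin h f * lin h g"
    unfolding lin_def sum_product by (intro sum.cong refl m)
  finally show ?thesis .
qed

lemma char_eval_eq_lin: "char_eval \<rho> = lin (\<lambda>x a. a * \<rho> x)"
  by (simp add: char_eval_def lin_def fun_eq_iff)

lemma char_eval_add: "char_eval \<rho> (f + g) = char_eval \<rho> f + char_eval \<rho> g"
  unfolding char_eval_eq_lin by (rule lin_add) (simp_all add: algebra_simps)

lemma char_eval_single [simp]: "char_eval \<rho> (term_of x a) = a * \<rho> x"
  by (simp add: char_eval_eq_lin lin_single)

lemma char_eval_zero [simp]: "char_eval \<rho> 0 = 0"
  by (simp add: char_eval_def)

lemma char_eval_sum: "char_eval \<rho> (sum F I) = (\<Sum>i\<in>I. char_eval \<rho> (F i))"
  by (induction I rule: infinite_finite_induct) (simp_all add: char_eval_add)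

section \<open>Characters\<close>

lemma nonzero_complex_simps [simp]:
  "carrier nonzero_complex = - {0}" "x \<otimes>\<^bsub>nonzero_complex\<^esub> y = x * y" "\<one>\<^bsub>nonzero_complex\<^esub> = 1"
  by (simp_all add: nonzero_complex_def)

lemma group_nonzero_complex: "group nonzero_complex"
proof (rule groupI)
  fix x assume "x \<in> carrier nonzero_complex"
  then show "\<exists>y\<in>carrier nonzero_complex. y \<otimes>\<^bsub>nonzero_complex\<^esub> x = \<one>\<^bsub>nonzero_complex\<^esub>"
    by (intro bexI[of _ "inverse x"]) auto
qed auto

lemma char_torus_mult: "\<lbrakk>\<rho> \<in> char_torus G; x \<in> carrier G; y \<in> carrier G\<rbrakk> \<Longrightarrow> \<rho> (x \<otimes>\<^bsub>G\<^esub> y) = \<rho> x * \<rho> y"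
  by (auto simp: char_torus_def hom_def)

lemma char_torus_nonzero: "\<lbrakk>\<rho> \<in> char_torus G; x \<in> carrier G\<rbrakk> \<Longrightarrow> \<rho> x \<noteq> 0"
  by (auto simp: char_torus_def hom_def)

lemma char_torus_group_hom: "\<lbrakk>group G; \<rho> \<in> char_torus G\<rbrakk> \<Longrightarrow> group_hom G nonzero_complex \<rho>"
  using group_nonzero_complex by (simp add: group_hom_def group_hom_axioms_def char_torus_def)

lemma char_torus_one: "\<lbrakk>group G; \<rho> \<in> char_torus G\<rbrakk> \<Longrightarrow> \<rho> \<one>\<^bsub>G\<^esub> = 1"
  using group_hom.hom_one[OF char_torus_group_hom] by simp

lemma char_torus_pow:
  assumes "group G" "\<rho> \<in> char_torus G" "x \<in> carrier G"
  shows "\<rho> (x [^]\<^bsub>G\<^esub> (k::nat)) = \<rho> x ^ k"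
proof -
  interpret group G by fact
  show ?thesis
    by (induction k) (simp_all add: char_torus_one[OF assms(1,2)] char_torus_mult[OF assms(2)] assms(3) mult.commute)
qed

lemma char_torus_eqI:
  "\<lbrakk>\<rho> \<in> char_torus G; \<sigma> \<in> char_torus G; \<And>x. x \<in> carrier G \<Longrightarrow> \<rho> x = \<sigma> x\<rbrakk> \<Longrightarrow> \<rho> = \<sigma>"
  unfolding char_torus_def by (blast intro: extensionalityI)

lemma char_eval_mult:
  assumes "\<rho> \<in> char_torus G" "f \<in> carrier (group_ring G)" "g \<in> carrier (group_ring G)"
  shows "char_eval \<rho> (f \<otimes>\<^bsub>group_ring G\<^esub> g) = char_eval \<rho> f * char_eval \<rho> g"
  unfolding char_eval_eq_lin
proof (rule lin_group_ring_mult)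
  fix x y :: 'a and a b :: complex assume "x \<in> supp f" "y \<in> supp g"
  then have "x \<in> carrier G" "y \<in> carrier G" using assms by auto
  then show "a * b * \<rho> (x \<otimes>\<^bsub>G\<^esub> y) = a * \<rho> x * (b * \<rho> y)" using char_torus_mult[OF assms(1)] by simp
qed (simp_all add: algebra_simps)

lemma (in group) group_ring_mult_closed:
  assumes "f \<in> carrier (group_ring G)" "g \<in> carrier (group_ring G)"
  shows "f \<otimes>\<^bsub>group_ring G\<^esub> g \<in> carrier (group_ring G)"
proof -
  have *: "supp (sum F I) \<subseteq> carrier G" if "\<And>i. i \<in> I \<Longrightarrow> supp (F i) \<subseteq> carrier G"
    for F :: "'i \<Rightarrow> 'a \<Rightarrow>\<^sub>0 'c" and I
    using that
  proof (induction I rule: infinite_finite_induct)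
    case (insert i I)
    then show ?case using Poly_Mapping.keys_add[of "F i" "sum F I"] by auto
  qed auto
  show ?thesis unfolding carrier_group_ring mult_group_ring
    by (intro * order.trans[OF keys_single[THEN equalityD1]]) (use assms in auto)
qed

section \<open>The Zariski topology on the character group\<close>

context group
begin

lemma topspace_zariski: "topspace (zariski G) = char_torus G"
proof -
  have "term_of \<one> (1::complex) \<in> carrier (group_ring G)" by simp
  moreover have "char_eval \<rho> (term_of \<one> 1) \<noteq> 0" if "\<rho> \<in> char_torus G" for \<rho>
    using char_torus_one[OF is_group that] by simp
  then have "{\<rho> \<in> char_torus G. char_eval \<rho> (term_of \<one> 1) \<noteq> 0} = char_torus G" by blast
  ultimately have "char_torus G \<in> {{\<rho> \<in> char_torus G. char_eval \<rho> f \<noteq> 0} | f. f \<in> carrier (group_ring G)}"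
    by blast
  then show ?thesis unfolding zariski_def topology_generated_by_topspace by blast
qed

text \<open>The topology is generated by the nonvanishing sets as a subbasis. They form a basis,
  because the nonvanishing sets of \<open>f\<close> and \<open>g\<close> intersect in that of the
  product.\<close>

lemma zariski_nbhd:
  assumes "openin (zariski G) U" "\<rho> \<in> U"
  shows "\<exists>f\<in>carrier (group_ring G). char_eval \<rho> f \<noteq> 0 \<and> {\<sigma> \<in> char_torus G. char_eval \<sigma> f \<noteq> 0} \<subseteq> U"
proof -
  have "generate_topology_on {{\<rho> \<in> char_torus G. char_eval \<rho> f \<noteq> 0} | f. f \<in> carrier (group_ring G)} U"
    using assms(1) unfolding zariski_def by (rule openin_topology_generated_by)
  then have "\<forall>\<rho>\<in>U. \<exists>f\<in>carrier (group_ring G). char_eval \<rho> f \<noteq> 0 \<and> {\<sigma> \<in> char_torus G. char_eval \<sigma> f \<noteq> 0} \<subseteq> U"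
  proof (induction rule: generate_topology_on.induct)
    case (Int A B)
    show ?case
    proof
      fix \<rho> assume \<rho>: "\<rho> \<in> A \<inter> B"
      obtain f where f: "f \<in> carrier (group_ring G)" "char_eval \<rho> f \<noteq> 0" "{\<sigma> \<in> char_torus G. char_eval \<sigma> f \<noteq> 0} \<subseteq> A"
        using Int.IH(1) \<rho> by blast
      obtain g where g: "g \<in> carrier (group_ring G)" "char_eval \<rho> g \<noteq> 0" "{\<sigma> \<in> char_torus G. char_eval \<sigma> g \<noteq> 0} \<subseteq> B"
        using Int.IH(2) \<rho> by blast
      have \<rho>T: "\<rho> \<in> char_torus G"
      proof -
        have "openin (zariski G) A"
          unfolding zariski_def openin_topology_generated_by_iff by (rule Int.hyps(1))
        then have "A \<subseteq> topspace (zariski G)" by (rule openin_subset)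
        then show ?thesis using \<rho> topspace_zariski by blast
      qed
      have "f \<otimes>\<^bsub>group_ring G\<^esub> g \<in> carrier (group_ring G)" by (rule group_ring_mult_closed[OF f(1) g(1)])
      moreover have ev: "char_eval \<sigma> (f \<otimes>\<^bsub>group_ring G\<^esub> g) = char_eval \<sigma> f * char_eval \<sigma> g" if "\<sigma> \<in> char_torus G" for \<sigma>
        by (rule char_eval_mult[OF that f(1) g(1)])
      moreover have "{\<sigma> \<in> char_torus G. char_eval \<sigma> (f \<otimes>\<^bsub>group_ring G\<^esub> g) \<noteq> 0} \<subseteq> A \<inter> B"
        using f(3) g(3) ev by auto
      ultimately show "\<exists>f\<in>carrier (group_ring G). char_eval \<rho> f \<noteq> 0 \<and> {\<sigma> \<in> char_torus G. char_eval \<sigma> f \<noteq> 0} \<subseteq> A \<inter> B"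
        using f(2) g(2) ev[OF \<rho>T] by (intro bexI[of _ "f \<otimes>\<^bsub>group_ring G\<^esub> g"]) simp_all
    qed
  next
    case (UN K)
    show ?case
    proof
      fix \<rho> assume "\<rho> \<in> \<Union>K"
      then obtain A where A: "A \<in> K" "\<rho> \<in> A" by blast
      then obtain f where "f \<in> carrier (group_ring G)" "char_eval \<rho> f \<noteq> 0"
        "{\<sigma> \<in> char_torus G. char_eval \<sigma> f \<noteq> 0} \<subseteq> A" using UN.IH by blast
      then show "\<exists>f\<in>carrier (group_ring G). char_eval \<rho> f \<noteq> 0 \<and> {\<sigma> \<in> char_torus G. char_eval \<sigma> f \<noteq> 0} \<subseteq> \<Union>K"
        using A(1) by (intro bexI[of _ f]) auto
    qed
  next
    case (Basis U)
    then obtain f where "f \<in> carrier (group_ring G)" "U = {\<rho> \<in> char_torus G. char_eval \<rho> f \<noteq> 0}" by blast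
    then show ?case by (intro ballI bexI[of _ f]) auto
  qed auto
  then show ?thesis using assms(2) by blast
qed

text \<open>All functions vanishing on \<open>C\<close> serve as equations: a point outside has a
  basic neighbourhood that misses \<open>C\<close>, given by one of them.\<close>

lemma zariski_closed_eqs:
  assumes "closedin (zariski G) C"
  shows "\<exists>F\<subseteq>carrier (group_ring G). \<forall>\<rho>\<in>char_torus G. \<rho> \<in> C \<longleftrightarrow> (\<forall>f\<in>F. char_eval \<rho> f = 0)"
proof -
  define F where "F = {f \<in> carrier (group_ring G). \<forall>\<rho>\<in>C. char_eval \<rho> f = 0}"
  have "\<rho> \<in> C" if \<rho>: "\<rho> \<in> char_torus G" "\<forall>f\<in>F. char_eval \<rho> f = 0" for \<rho>
  proof (rule ccontr)
    assume "\<rho> \<notin> C"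
    have op: "openin (zariski G) (char_torus G - C)" using assms by (simp add: closedin_def topspace_zariski)
    then obtain f where f: "f \<in> carrier (group_ring G)" "char_eval \<rho> f \<noteq> 0"
      "{\<sigma> \<in> char_torus G. char_eval \<sigma> f \<noteq> 0} \<subseteq> char_torus G - C"
      using zariski_nbhd[OF op, of \<rho>] \<rho>(1) \<open>\<rho> \<notin> C\<close> by blast
    have "C \<subseteq> char_torus G" using closedin_subset[OF assms] topspace_zariski by simp
    then have "f \<in> F" using f by (auto simp: F_def)
    then show False using \<rho>(2) f(2) by blast
  qed
  then show ?thesis by (intro exI[of _ F]) (auto simp: F_def)
qed

lemma zariski_closed_zeros:
  assumes "F \<subseteq> carrier (group_ring G)"
  shows "closedin (zariski G) {\<rho> \<in> char_torus G. \<forall>f\<in>F. char_eval \<rho> f = 0}"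
proof -
  have "openin (zariski G) {\<rho> \<in> char_torus G. char_eval \<rho> f \<noteq> 0}" if "f \<in> F" for f
    unfolding zariski_def by (rule topology_generated_by_Basis) (use that assms in blast)
  then have "openin (zariski G) (\<Union>f\<in>F. {\<rho> \<in> char_torus G. char_eval \<rho> f \<noteq> 0})"
    by (intro openin_Union) blast
  moreover have "(\<Union>f\<in>F. {\<rho> \<in> char_torus G. char_eval \<rho> f \<noteq> 0}) =
      topspace (zariski G) - {\<rho> \<in> char_torus G. \<forall>f\<in>F. char_eval \<rho> f = 0}"
    unfolding topspace_zariski by blast
  ultimately show ?thesis unfolding closedin_def topspace_zariski by auto
qed

end

section \<open>Coordinates on the character torus\<close>

lemma irreducible_in_Un:
  "\<lbrakk>irreducible_in T S; S \<subseteq> C \<union> D; closedin T C; closedin T D\<rbrakk> \<Longrightarrow> S \<subseteq> C \<or> S \<subseteq> D"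
  by (simp add: irreducible_in_def)

context comm_group
begin

lemma torsion_subgroup: "subgroup (torsion_elements G) G"
proof (rule subgroupI)
  show "torsion_elements G \<noteq> {}"
  proof -
    have "\<one> \<in> torsion_elements G" unfolding torsion_elements_def by (intro CollectI conjI exI[of _ 1]) simp_all
    then show ?thesis by blast
  qed
next
  fix x assume "x \<in> torsion_elements G"
  then obtain k :: nat where k: "x \<in> carrier G" "k > 0" "x [^] k = \<one>" by (auto simp: torsion_elements_def)
  then have "inv x [^] k = \<one>" by (simp add: nat_pow_inv)
  then show "inv x \<in> torsion_elements G" using k by (auto simp: torsion_elements_def)
next
  fix x y assume "x \<in> torsion_elements G" "y \<in> torsion_elements G"
  then obtain k l :: nat where k: "x \<in> carrier G" "k > 0" "x [^] k = \<one>"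
    and l: "y \<in> carrier G" "l > 0" "y [^] l = \<one>" by (auto simp: torsion_elements_def)
  have "x [^] (k * l) = \<one>" using k nat_pow_pow[of x k l] by simp
  moreover have "y [^] (k * l) = \<one>" using l nat_pow_pow[of y l k] by (simp add: mult.commute)
  ultimately have "(x \<otimes> y) [^] (k * l) = \<one>" using k l by (simp add: nat_pow_distrib)
  moreover have "k * l > 0" using k l by simp
  ultimately show "x \<otimes> y \<in> torsion_elements G"
    using m_closed[OF k(1) l(1)] unfolding torsion_elements_def by blast
qed (auto simp: torsion_elements_def)

lemma torsion_quotient_torsion_free:
  assumes a: "a \<in> carrier (G Mod torsion_elements G)" "k > 0"
    "a [^]\<^bsub>G Mod torsion_elements G\<^esub> (k::nat) = \<one>\<^bsub>G Mod torsion_elements G\<^esub>"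
  shows "a = \<one>\<^bsub>G Mod torsion_elements G\<^esub>"
proof -
  let ?T = "torsion_elements G"
  have normal: "?T \<lhd> G" using torsion_subgroup by (simp add: normal_iff_subgroup)
  obtain x where x: "x \<in> carrier G" "a = ?T #> x" using a(1) by (auto simp: carrier_FactGroup)
  have "?T #> (x [^] k) = ?T" using a(3) normal.FactGroup_pow[OF normal x(1), of k] x by simp
  then have "x [^] k \<in> ?T" using coset_join1 torsion_subgroup x by blast
  then obtain l :: nat where l: "l > 0" "(x [^] k) [^] l = \<one>" by (auto simp: torsion_elements_def)
  then have "x [^] (k * l) = \<one>" using nat_pow_pow x by simp
  moreover have "k * l > 0" using l a(2) by simp
  ultimately have "x \<in> ?T" using x(1) unfolding torsion_elements_def by blast
  then show ?thesis using coset_join2[OF x(1) torsion_subgroup] x by simp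
qed

end

section \<open>The maximal torsion-free abelian quotient\<close>

context group
begin

lemma comm_group_abelianization: "comm_group (abelianization G)"
  unfolding abelianization_def by (rule derived_quot_is_comm_group)

lemma comm_group_abf: "comm_group (abf G)"
  unfolding abf_def
  by (rule comm_group.abelian_FactGroup[OF comm_group_abelianization comm_group.torsion_subgroup[OF comm_group_abelianization]])

lemma abf_torsion_free:
  "\<forall>x\<in>carrier (abf G). \<forall>k::nat. 0 < k \<longrightarrow> x [^]\<^bsub>abf G\<^esub> k = \<one>\<^bsub>abf G\<^esub> \<longrightarrow> x = \<one>\<^bsub>abf G\<^esub>"
  unfolding abf_def using comm_group.torsion_quotient_torsion_free[OF comm_group_abelianization] by blast

lemma abf_proj_eq: "abf_proj G = (\<lambda>a. torsion_elements (abelianization G) #>\<^bsub>abelianization G\<^esub> a) \<circ> (\<lambda>x. derived G (carrier G) #> x)"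
  by (simp add: fun_eq_iff abf_proj_def)

lemma coset_hom: "(\<lambda>x. derived G (carrier G) #> x) \<in> hom G (abelianization G)"
  unfolding abelianization_def by (rule normal.r_coset_hom_Mod[OF derived_self_is_normal])

lemma abf_proj_hom: "abf_proj G \<in> hom G (abf G)"
proof -
  interpret Ab: comm_group "abelianization G" by (rule comm_group_abelianization)
  have "torsion_elements (abelianization G) \<lhd> abelianization G"
    using Ab.torsion_subgroup by (simp add: Ab.normal_iff_subgroup)
  then have "(\<lambda>a. torsion_elements (abelianization G) #>\<^bsub>abelianization G\<^esub> a) \<in> hom (abelianization G) (abf G)"
    unfolding abf_def by (rule normal.r_coset_hom_Mod)
  then show ?thesis unfolding abf_proj_eq using Group.hom_compose[OF coset_hom] by blast
qed

lemma abf_proj_surj: "abf_proj G ` carrier G = carrier (abf G)"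
proof -
  have "(\<lambda>x. derived G (carrier G) #> x) ` carrier G = carrier (abelianization G)"
    by (simp add: abelianization_def carrier_FactGroup)
  then show ?thesis unfolding abf_proj_eq image_comp[symmetric] by (simp add: abf_def carrier_FactGroup)
qed

text \<open>This describes the kernel of the projection inside \<open>G\<close>, without iterated
  cosets; characters and additive functions are compared with the quotient in this form.\<close>

lemma abf_proj_one_imp:
  assumes x: "x \<in> carrier G" and one: "abf_proj G x = \<one>\<^bsub>abf G\<^esub>"
  shows "\<exists>k::nat. k > 0 \<and> x [^] k \<in> derived G (carrier G)"
proof -
  let ?N = "derived G (carrier G)"
  interpret Ab: comm_group "abelianization G" by (rule comm_group_abelianization)
  have NxA: "?N #> x \<in> carrier (abelianization G)" using coset_hom x by (auto simp: hom_def)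
  have "torsion_elements (abelianization G) #>\<^bsub>abelianization G\<^esub> (?N #> x) = torsion_elements (abelianization G)"
    using one by (simp add: abf_proj_def abf_def)
  then have "?N #> x \<in> torsion_elements (abelianization G)"
    using Ab.coset_join1[OF _ NxA Ab.torsion_subgroup] by blast
  then obtain k :: nat where k: "k > 0" "(?N #> x) [^]\<^bsub>abelianization G\<^esub> k = \<one>\<^bsub>abelianization G\<^esub>"
    by (auto simp: torsion_elements_def)
  then have "?N #> (x [^] k) = ?N"
    using normal.FactGroup_pow[OF derived_self_is_normal x, of k] by (simp add: abelianization_def)
  then have "x [^] k \<in> ?N" using coset_join1 derived_is_subgroup[of "carrier G"] x by blast
  then show ?thesis using k by blast
qed

lemma char_derived:
  assumes \<rho>: "\<rho> \<in> char_torus G" and x: "x \<in> derived G (carrier G)"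
  shows "\<rho> x = 1"
proof -
  interpret \<rho>: group_hom G nonzero_complex \<rho> using char_torus_group_hom[OF is_group \<rho>] .
  have "h \<in> kernel G nonzero_complex \<rho>" if "h \<in> derived_set G (carrier G)" for h
  proof -
    from that obtain a b where ab: "a \<in> carrier G" "b \<in> carrier G" "h = a \<otimes> b \<otimes> inv a \<otimes> inv b" by auto
    have inv: "\<rho> (inv a) * \<rho> a = 1" "\<rho> (inv b) * \<rho> b = 1"
      using char_torus_mult[OF \<rho>] char_torus_one[OF is_group \<rho>] ab by (metis inv_closed l_inv)+
    have "\<rho> h = (\<rho> (inv a) * \<rho> a) * (\<rho> (inv b) * \<rho> b)"
      unfolding ab(3) using ab(1,2) by (simp add: char_torus_mult[OF \<rho>])
    then have "\<rho> h = 1" by (simp only: inv mult_1)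
    moreover have "h \<in> carrier G" using ab by simp
    ultimately show ?thesis by (simp add: kernel_def)
  qed
  then have "derived_set G (carrier G) \<subseteq> kernel G nonzero_complex \<rho>" by blast
  then have "derived G (carrier G) \<subseteq> kernel G nonzero_complex \<rho>"
    unfolding derived_def by (rule generate_subgroup_incl[OF _ \<rho>.subgroup_kernel])
  then show ?thesis using x by (auto simp: kernel_def)
qed

end

section \<open>Coordinates from a basis of the quotient\<close>

locale fg_group = group G for G :: "('a, 'b) monoid_scheme" (structure) +
  assumes fg: "finitely_generated G"
begin

sublocale A: comm_group "abf G" by (rule comm_group_abf)

lemma abf_spanned: "\<exists>I h. finite I \<and> A.spans_by I h"
proof -
  obtain S where S: "S \<subseteq> carrier G" "finite S" "generate G S = carrier G"
    using fg by (auto simp: finitely_generated_def)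
  obtain s where s: "bij_betw s {0..<card S} S" using ex_bij_betw_nat_finite[OF S(2)] by blast
  let ?I = "{0..<card S}"
  have sG: "s i \<in> carrier G" if "i \<in> ?I" for i using bij_betwE[OF s] that S by blast
  have hom: "abf_proj G \<in> hom G (abf G)" by (rule abf_proj_hom)
  have "(\<lambda>i. abf_proj G (s i)) ` ?I \<subseteq> carrier (abf G)" using sG hom by (auto simp: hom_def)
  then obtain h where h: "h \<in> hom (free_Abelian_group ?I) (abf G)" "\<And>i. i \<in> ?I \<Longrightarrow> h (frag_of i) = abf_proj G (s i)"
    by (rule A.free_Abelian_group_universal) (rule that)
  interpret h: group_hom "free_Abelian_group ?I" "abf G" h
    using h by (simp add: group_hom_def group_hom_axioms_def)
  interpret \<pi>: group_hom G "abf G" "abf_proj G"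
    using hom by (simp add: group_hom_def group_hom_axioms_def is_group)
  let ?H = "{x \<in> carrier G. abf_proj G x \<in> h ` carrier (free_Abelian_group ?I)}"
  have img: "subgroup (h ` carrier (free_Abelian_group ?I)) (abf G)" by (rule h.img_is_subgroup)
  have "subgroup ?H G"
    by (rule subgroupI)
      (use \<pi>.hom_one subgroup.one_closed[OF img] subgroup.m_inv_closed[OF img] subgroup.m_closed[OF img] in auto)
  moreover have "S \<subseteq> ?H"
  proof
    fix x assume "x \<in> S"
    then have "x \<in> s ` ?I" using s by (simp add: bij_betw_def)
    then obtain i where "i \<in> ?I" "x = s i" by blast
    then show "x \<in> ?H" using h(2)[of i] sG[of i] by (auto intro!: image_eqI[of _ _ "frag_of i"])
  qed
  ultimately have "generate G S \<subseteq> ?H" by (rule generate_subgroup_incl[rotated])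
  then have "abf_proj G x \<in> h ` carrier (free_Abelian_group ?I)" if "x \<in> carrier G" for x
    using S(3) that by auto
  then have "carrier (abf G) \<subseteq> h ` carrier (free_Abelian_group ?I)"
    unfolding abf_proj_surj[symmetric] by (rule image_subsetI)
  then have "A.spans_by ?I h"
    unfolding A.spans_by_def using h(1) subgroup.subset[OF img] by (intro conjI equalityI)
  then show ?thesis by blast
qed

lemma abf_iso_free: "abf G \<cong> free_Abelian_group {..<b1 G}"
proof -
  obtain I h where I: "finite I" "A.spans_by I h" using abf_spanned by blast
  obtain n where n: "abf G \<cong> free_Abelian_group {..<n::nat}"
    using A.torsion_free_imp_free[OF abf_torsion_free I] by blast
  then have "b1 G = n" unfolding b1_def
    by (intro the_equality) (use rank_unique[OF _ _ A.is_group] in blast)+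
  then show ?thesis using n by simp
qed

text \<open>A choice of basis: elements of \<open>abf G\<close> become exponent vectors, and
  \<open>\<kappa>\<close> leads back.\<close>

definition \<iota> :: "'a set set \<Rightarrow> expo" where
  "\<iota> = (SOME f. f \<in> iso (abf G) (free_Abelian_group {..<b1 G}))"

definition \<kappa> :: "expo \<Rightarrow> 'a set set" where
  "\<kappa> = inv_into (carrier (abf G)) \<iota>"

lemma \<iota>_iso: "\<iota> \<in> iso (abf G) (free_Abelian_group {..<b1 G})"
  using abf_iso_free unfolding \<iota>_def is_iso_def by (metis all_not_in_conv someI_ex)

lemma \<iota>_bij: "bij_betw \<iota> (carrier (abf G)) {e. supp e \<subseteq> {..<b1 G}}"
proof -
  have "{e. supp e \<subseteq> {..<b1 G}} = carrier (free_Abelian_group {..<b1 G})" by auto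
  then show ?thesis using \<iota>_iso by (simp add: iso_def)
qed

lemma \<iota>_mult: "\<lbrakk>a \<in> carrier (abf G); b \<in> carrier (abf G)\<rbrakk> \<Longrightarrow> \<iota> (a \<otimes>\<^bsub>abf G\<^esub> b) = \<iota> a + \<iota> b"
  using \<iota>_iso by (auto simp: iso_def hom_def)

lemma \<iota>_supp: "a \<in> carrier (abf G) \<Longrightarrow> supp (\<iota> a) \<subseteq> {..<b1 G}"
  using bij_betwE[OF \<iota>_bij] by blast

lemma \<kappa>_closed: "supp e \<subseteq> {..<b1 G} \<Longrightarrow> \<kappa> e \<in> carrier (abf G)"
  unfolding \<kappa>_def using bij_betwE[OF bij_betw_inv_into[OF \<iota>_bij]] by blast

lemma \<iota>_\<kappa>: "supp e \<subseteq> {..<b1 G} \<Longrightarrow> \<iota> (\<kappa> e) = e"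
  unfolding \<kappa>_def using bij_betw_inv_into_right[OF \<iota>_bij] by simp

lemma \<kappa>_\<iota>: "a \<in> carrier (abf G) \<Longrightarrow> \<kappa> (\<iota> a) = a"
  unfolding \<kappa>_def using bij_betw_inv_into_left[OF \<iota>_bij] by simp

lemma \<iota>_one: "\<iota> \<one>\<^bsub>abf G\<^esub> = 0"
  using \<iota>_mult[of "\<one>\<^bsub>abf G\<^esub>" "\<one>\<^bsub>abf G\<^esub>"] by simp

lemma abf_proj_closed: "x \<in> carrier G \<Longrightarrow> abf_proj G x \<in> carrier (abf G)"
  using abf_proj_surj by blast

lemma abf_proj_mult: "\<lbrakk>x \<in> carrier G; y \<in> carrier G\<rbrakk> \<Longrightarrow> abf_proj G (x \<otimes> y) = abf_proj G x \<otimes>\<^bsub>abf G\<^esub> abf_proj G y"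
  using abf_proj_hom by (auto simp: hom_def)

definition expo_of :: "'a \<Rightarrow> expo" where "expo_of x = \<iota> (abf_proj G x)"

lemma expo_of_mult: "\<lbrakk>x \<in> carrier G; y \<in> carrier G\<rbrakk> \<Longrightarrow> expo_of (x \<otimes> y) = expo_of x + expo_of y"
  by (simp add: expo_of_def abf_proj_mult \<iota>_mult abf_proj_closed)

lemma expo_of_supp: "x \<in> carrier G \<Longrightarrow> supp (expo_of x) \<subseteq> {..<b1 G}"
  by (simp add: expo_of_def \<iota>_supp abf_proj_closed)

lemma expo_of_surj: "supp e \<subseteq> {..<b1 G} \<Longrightarrow> \<exists>x\<in>carrier G. expo_of x = e"
  using \<kappa>_closed[of e] \<iota>_\<kappa>[of e] abf_proj_surj unfolding expo_of_def by (metis imageE)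

definition char_at :: "(nat \<Rightarrow> complex) \<Rightarrow> 'a set set \<Rightarrow> complex" where
  "char_at c = (\<lambda>a\<in>carrier (abf G). monomial_at (b1 G) c (\<iota> a))"

definition pt :: "(nat \<Rightarrow> complex) \<Rightarrow> 'a \<Rightarrow> complex" where
  "pt c = (\<lambda>x\<in>carrier G. monomial_at (b1 G) c (expo_of x))"

lemma pt_eq_pullback: "pt c = pullback_char G (char_at c)"
  by (auto simp: pt_def pullback_char_def char_at_def expo_of_def abf_proj_closed)

lemma char_at_in: "c \<in> torus_points \<Longrightarrow> char_at c \<in> char_torus (abf G)"
  unfolding char_torus_def char_at_def
  by (auto simp: hom_def monomial_at_nonzero \<iota>_mult monomial_at_add)

lemma pt_in: "c \<in> torus_points \<Longrightarrow> pt c \<in> char_torus G"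
  unfolding char_torus_def pt_def
  by (auto simp: hom_def monomial_at_nonzero expo_of_mult monomial_at_add)

lemma char_at_surj:
  assumes \<chi>: "\<chi> \<in> char_torus (abf G)"
  shows "\<exists>c\<in>torus_points. \<chi> = char_at c"
proof -
  let ?n = "b1 G"
  \<comment> \<open>The coordinates are the values at the basis; the value 1 beyond
    \<open>b1 G\<close> keeps the point in \<open>torus_points\<close>.\<close>
  define c where "c i = (if i < ?n then \<chi> (\<kappa> (frag_of i)) else 1)" for i
  have c: "c \<in> torus_points"
    unfolding torus_points_def c_def using char_torus_nonzero[OF \<chi> \<kappa>_closed] by auto
  have "\<chi> (\<kappa> e) = monomial_at ?n c e" if "supp e \<subseteq> {..<?n}" for e
    using that
  proof (induction e rule: free_Abelian_group_induct[consumes 1, case_names zero diff gen])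
    case zero
    have "\<kappa> 0 = \<one>\<^bsub>abf G\<^esub>" using \<kappa>_\<iota>[of "\<one>\<^bsub>abf G\<^esub>"] by (simp add: \<iota>_one)
    then show ?case using char_torus_one[OF A.is_group \<chi>] by simp
  next
    case (diff e f)
    have ef: "supp (e - f) \<subseteq> {..<?n}" using diff(1,2) keys_diff[of e f] by blast
    have "\<kappa> (e - f) \<otimes>\<^bsub>abf G\<^esub> \<kappa> f = \<kappa> (\<iota> (\<kappa> (e - f) \<otimes>\<^bsub>abf G\<^esub> \<kappa> f))"
      using \<kappa>_closed[OF ef] \<kappa>_closed[OF diff(2)] by (simp add: \<kappa>_\<iota>)
    also have "\<dots> = \<kappa> e" using \<kappa>_closed[OF ef] \<kappa>_closed[OF diff(2)] by (simp add: \<iota>_mult \<iota>_\<kappa> ef diff)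
    finally have "\<chi> (\<kappa> (e - f)) * \<chi> (\<kappa> f) = \<chi> (\<kappa> e)"
      using char_torus_mult[OF \<chi> \<kappa>_closed[OF ef] \<kappa>_closed[OF diff(2)]] by simp
    moreover have "monomial_at ?n c (e - f) * monomial_at ?n c f = monomial_at ?n c e"
      using monomial_at_add[OF c, of ?n "e - f" f] by simp
    ultimately have "\<chi> (\<kappa> (e - f)) * monomial_at ?n c f = monomial_at ?n c (e - f) * monomial_at ?n c f"
      using diff by simp
    then show ?case using monomial_at_nonzero[OF c] by simp
  next
    case (gen i)
    then show ?case by (simp add: monomial_at_single c_def)
  qed
  then have "\<chi> a = char_at c a" if "a \<in> carrier (abf G)" for a
    using \<iota>_supp[OF that] \<kappa>_\<iota>[OF that] that by (simp add: char_at_def) metis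
  then have "\<chi> = char_at c" using char_torus_eqI[OF \<chi> char_at_in[OF c]] by blast
  then show ?thesis using c by blast
qed

lemma char_torus0_eq: "char_torus0 G = pt ` torus_points"
proof -
  have "char_torus (abf G) = char_at ` torus_points" using char_at_in char_at_surj by blast
  then show ?thesis unfolding char_torus0_def by (simp add: image_image pt_eq_pullback)
qed

lemma char_eval_pt:
  assumes "f \<in> carrier (group_ring G)"
  shows "char_eval (pt c) f = ev (b1 G) c (push expo_of f)"
proof -
  have "ev (b1 G) c (push expo_of f) = (\<Sum>x\<in>supp f. coef f x * monomial_at (b1 G) c (expo_of x))"
    unfolding ev_def by (subst lin_push) (simp_all add: lin_def algebra_simps)
  also have "\<dots> = char_eval (pt c) f"
    unfolding char_eval_def using assms by (intro sum.cong refl) (auto simp: pt_def)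
  finally show ?thesis by simp
qed

lemma char_eval_char_at:
  assumes "f \<in> carrier (group_ring (abf G))"
  shows "char_eval (char_at c) f = ev (b1 G) c (push \<iota> f)"
proof -
  have "ev (b1 G) c (push \<iota> f) = (\<Sum>x\<in>supp f. coef f x * monomial_at (b1 G) c (\<iota> x))"
    unfolding ev_def by (subst lin_push) (simp_all add: lin_def algebra_simps)
  also have "\<dots> = char_eval (char_at c) f"
    unfolding char_eval_def using assms by (intro sum.cong refl) (auto simp: char_at_def)
  finally show ?thesis by simp
qed

text \<open>The elements with a power in the derived subgroup form the kernel of the projection to
  \<open>abf G\<close>. As a family of equations the condition shows that the identity component is
  closed.\<close>

lemma char_torus0_iff:
  "\<rho> \<in> char_torus0 G \<longleftrightarrow> \<rho> \<in> char_torus G \<and> (\<forall>x\<in>carrier G. \<forall>k::nat. k > 0 \<and> x [^] k \<in> derived G (carrier G) \<longrightarrow> \<rho> x = 1)"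
proof safe
  assume \<rho>: "\<rho> \<in> char_torus0 G"
  then obtain c where c: "c \<in> torus_points" "\<rho> = pt c" by (auto simp: char_torus0_eq)
  then show "\<rho> \<in> char_torus G" using pt_in by simp
  fix x and k :: nat assume x: "x \<in> carrier G" "k > 0" "x [^] k \<in> derived G (carrier G)"
  have "abf_proj G (x [^] k) = \<one>\<^bsub>abf G\<^esub>"
  proof -
    interpret Ab: comm_group "abelianization G" by (rule comm_group_abelianization)
    have "derived G (carrier G) #> (x [^] k) = \<one>\<^bsub>abelianization G\<^esub>"
      using coset_join2[OF _ derived_is_subgroup[of "carrier G"] x(3)] x by (simp add: abelianization_def)
    then show ?thesis
      using Ab.coset_join2[OF Ab.one_closed Ab.torsion_subgroup subgroup.one_closed[OF Ab.torsion_subgroup]]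
      by (simp add: abf_proj_def abf_def)
  qed
  moreover have "abf_proj G (x [^] k) = abf_proj G x [^]\<^bsub>abf G\<^esub> k"
    using group_hom.hom_nat_pow[of G "abf G" "abf_proj G"] abf_proj_hom x
    by (simp add: group_hom_def group_hom_axioms_def is_group)
  ultimately have "abf_proj G x = \<one>\<^bsub>abf G\<^esub>"
    using abf_torsion_free abf_proj_closed x by metis
  then show "\<rho> x = 1" using x by (simp add: c(2) pt_def expo_of_def \<iota>_one)
next
  assume \<rho>: "\<rho> \<in> char_torus G"
    and tors: "\<forall>x\<in>carrier G. \<forall>k::nat. k > 0 \<and> x [^] k \<in> derived G (carrier G) \<longrightarrow> \<rho> x = 1"
  define s where "s a = (SOME x. x \<in> carrier G \<and> abf_proj G x = a)" for a
  have s: "s a \<in> carrier G \<and> abf_proj G (s a) = a" if "a \<in> carrier (abf G)" for a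
  proof -
    have "a \<in> abf_proj G ` carrier G" using that abf_proj_surj by simp
    then have "\<exists>x. x \<in> carrier G \<and> abf_proj G x = a" by blast
    then show ?thesis unfolding s_def by (rule someI_ex)
  qed
  have fac: "\<rho> x = \<rho> y" if xy: "x \<in> carrier G" "y \<in> carrier G" "abf_proj G x = abf_proj G y" for x y
  proof -
    have "abf_proj G (x \<otimes> inv y) = abf_proj G y \<otimes>\<^bsub>abf G\<^esub> abf_proj G (inv y)"
      using xy abf_proj_mult by simp
    also have "\<dots> = abf_proj G (y \<otimes> inv y)" by (rule abf_proj_mult[symmetric]) (use xy in auto)
    also have "\<dots> = \<one>\<^bsub>abf G\<^esub>"
      using xy group_hom.hom_one[of G "abf G" "abf_proj G"] abf_proj_hom
      by (simp add: group_hom_def group_hom_axioms_def is_group)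
    finally have one: "abf_proj G (x \<otimes> inv y) = \<one>\<^bsub>abf G\<^esub>" .
    have xyG: "x \<otimes> inv y \<in> carrier G" using xy by simp
    have "\<rho> (x \<otimes> inv y) = 1" using abf_proj_one_imp[OF xyG one] tors xyG by blast
    then have "\<rho> x * \<rho> (inv y) = 1" using char_torus_mult[OF \<rho>] xy by simp
    moreover have "\<rho> y * \<rho> (inv y) = 1"
      using char_torus_mult[OF \<rho>, of y "inv y"] char_torus_one[OF is_group \<rho>] xy by simp
    ultimately show ?thesis by (metis mult_cancel_right mult_zero_right zero_neq_one)
  qed
  define \<chi> where "\<chi> = (\<lambda>a\<in>carrier (abf G). \<rho> (s a))"
  have "\<chi> \<in> char_torus (abf G)" unfolding char_torus_def
  proof (intro IntI homI)
    fix a b assume a: "a \<in> carrier (abf G)" and b: "b \<in> carrier (abf G)"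
    show "\<chi> a \<in> carrier nonzero_complex" using char_torus_nonzero[OF \<rho>] s[OF a] a by (simp add: \<chi>_def)
    have "\<rho> (s (a \<otimes>\<^bsub>abf G\<^esub> b)) = \<rho> (s a \<otimes> s b)"
      using s a b by (intro fac) (simp_all add: abf_proj_mult)
    then show "\<chi> (a \<otimes>\<^bsub>abf G\<^esub> b) = \<chi> a \<otimes>\<^bsub>nonzero_complex\<^esub> \<chi> b"
      using a b s char_torus_mult[OF \<rho>] by (simp add: \<chi>_def)
  qed (simp add: \<chi>_def)
  moreover have "\<rho> = pullback_char G \<chi>"
  proof (rule extensionalityI[of _ "carrier G"])
    show "\<rho> \<in> extensional (carrier G)" using \<rho> by (simp add: char_torus_def)
    fix x assume x: "x \<in> carrier G"
    have "\<rho> x = \<rho> (s (abf_proj G x))" using s[OF abf_proj_closed[OF x]] x by (intro fac) auto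
    then show "\<rho> x = pullback_char G \<chi> x" using x abf_proj_closed by (simp add: pullback_char_def \<chi>_def)
  qed (simp add: pullback_char_def)
  ultimately show "\<rho> \<in> char_torus0 G" by (auto simp: char_torus0_def)
qed

lemma char_torus0_closed: "closedin (zariski G) (char_torus0 G)"
proof -
  define Ts where "Ts = {x \<in> carrier G. \<exists>k::nat. k > 0 \<and> x [^] k \<in> derived G (carrier G)}"
  define F where "F = (\<lambda>x. term_of x 1 - term_of \<one> (1::complex)) ` Ts"
  have ev: "char_eval \<rho> (term_of x 1 - term_of \<one> 1) = \<rho> x - 1" if "\<rho> \<in> char_torus G" for \<rho> x
    using char_eval_add[of \<rho> "term_of x 1 - term_of \<one> 1" "term_of \<one> 1"] char_torus_one[OF is_group that]
    by simp
  have "(\<forall>f\<in>F. char_eval \<rho> f = 0) \<longleftrightarrow> (\<forall>x\<in>Ts. \<rho> x = 1)" if "\<rho> \<in> char_torus G" for \<rho>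
    by (simp add: F_def ev[OF that])
  moreover have "\<rho> \<in> char_torus0 G \<longleftrightarrow> \<rho> \<in> char_torus G \<and> (\<forall>x\<in>Ts. \<rho> x = 1)" for \<rho>
    unfolding char_torus0_iff Ts_def by blast
  ultimately have eq: "char_torus0 G = {\<rho> \<in> char_torus G. \<forall>f\<in>F. char_eval \<rho> f = 0}" by blast
  have "term_of x 1 - term_of \<one> (1::complex) \<in> carrier (group_ring G)" if "x \<in> Ts" for x
    using keys_diff[of "term_of x (1::complex)" "term_of \<one> 1"] that by (auto simp: Ts_def)
  then have "F \<subseteq> carrier (group_ring G)" unfolding F_def by (rule image_subsetI)
  then show ?thesis unfolding eq by (rule zariski_closed_zeros)
qed

text \<open>On a torsion element \<open>g\<close> of order \<open>k\<close>, either \<open>\<rho> g = 1\<close> or \<open>1 + \<rho> g + \<dots> + \<rho> g ^ (k - 1) = 0\<close>; both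
  conditions are closed, so an irreducible set cannot meet both.\<close>

lemma irreducible_meets_torus0:
  assumes Z: "irreducible_in (zariski G) Z" "Z \<inter> char_torus0 G \<noteq> {}"
  shows "Z \<subseteq> char_torus0 G"
proof
  fix \<rho> assume \<rho>: "\<rho> \<in> Z"
  have ZT: "Z \<subseteq> char_torus G" using Z(1) topspace_zariski by (simp add: irreducible_in_def)
  have "\<rho> x = 1" if x: "x \<in> carrier G" "k > 0" "x [^] k \<in> derived G (carrier G)" for x and k :: nat
  proof -
    define f where "f = term_of x 1 + term_of \<one> (- 1::complex)"
    define g where "g = (\<Sum>i<k. term_of (x [^] i) (1::complex))"
    have f: "f \<in> carrier (group_ring G)"
      unfolding f_def using x Poly_Mapping.keys_add[of "term_of x 1" "term_of \<one> (- 1::complex)"] by auto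
    have g: "g \<in> carrier (group_ring G)"
      unfolding g_def carrier_group_ring using x Poly_Mapping.keys_sum[of "\<lambda>i. term_of (x [^] i) (1::complex)" "{..<k}"]
      by fastforce
    have evf: "char_eval \<sigma> f = \<sigma> x - 1" if "\<sigma> \<in> char_torus G" for \<sigma>
      using char_torus_one[OF is_group that] by (simp add: f_def char_eval_add)
    have evg: "char_eval \<sigma> g = (\<Sum>i<k. \<sigma> x ^ i)" if "\<sigma> \<in> char_torus G" for \<sigma>
      using char_torus_pow[OF is_group that x(1)] by (simp add: g_def char_eval_sum)
    let ?C = "{\<sigma> \<in> char_torus G. \<forall>h\<in>{f}. char_eval \<sigma> h = 0}" and ?D = "{\<sigma> \<in> char_torus G. \<forall>h\<in>{g}. char_eval \<sigma> h = 0}"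
    have "Z \<subseteq> ?C \<union> ?D"
    proof
      fix \<sigma> assume "\<sigma> \<in> Z"
      then have \<sigma>: "\<sigma> \<in> char_torus G" using ZT by blast
      have "\<sigma> x ^ k = 1" using char_derived[OF \<sigma> x(3)] char_torus_pow[OF is_group \<sigma> x(1)] by simp
      moreover have "(1 - \<sigma> x) * (\<Sum>i<k. \<sigma> x ^ i) = 1 - \<sigma> x ^ k" by (rule one_diff_power_eq[symmetric])
      ultimately have "(1 - \<sigma> x) * (\<Sum>i<k. \<sigma> x ^ i) = 0" by simp
      then show "\<sigma> \<in> ?C \<union> ?D" using \<sigma> evf[OF \<sigma>] evg[OF \<sigma>] by auto
    qed
    moreover have "closedin (zariski G) ?C" "closedin (zariski G) ?D"
      by (rule zariski_closed_zeros, use f g in simp)+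
    ultimately have "Z \<subseteq> ?C \<or> Z \<subseteq> ?D" by (rule irreducible_in_Un[OF Z(1)])
    \<comment> \<open>At a point of the identity component the geometric sum equals
      \<open>k\<close>, which is not 0.\<close>
    moreover have "\<not> Z \<subseteq> ?D"
    proof
      assume sub: "Z \<subseteq> ?D"
      obtain \<sigma> where \<sigma>: "\<sigma> \<in> Z" "\<sigma> \<in> char_torus0 G" using Z(2) by blast
      then have \<sigma>T: "\<sigma> \<in> char_torus G" and "\<sigma> x = 1" using char_torus0_iff x by blast+
      then have "char_eval \<sigma> g = of_nat k" using evg[OF \<sigma>T] by simp
      moreover have "char_eval \<sigma> g = 0" using sub \<sigma> by blast
      ultimately show False using x(2) by simp
    qed
    ultimately have "Z \<subseteq> ?C" by simp
    then have "char_eval \<rho> f = 0" using \<rho> by blast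
    then show ?thesis using evf \<rho> ZT by auto
  qed
  then show "\<rho> \<in> char_torus0 G" unfolding char_torus0_iff using \<rho> ZT by blast
qed

lemma push_expo_of_in: "f \<in> carrier (group_ring G) \<Longrightarrow> push expo_of f \<in> laurent_set {..<b1 G}"
  using supp_push[of expo_of f] expo_of_supp by (auto simp: laurent_set_def)

sublocale chart: torus_chart "zariski G" "b1 G" pt
proof
  let ?n = "b1 G"
  fix c assume "c \<in> torus_points"
  then show "pt c \<in> topspace (zariski G)" using pt_in topspace_zariski by simp
next
  let ?n = "b1 G"
  fix c d assume c: "c \<in> torus_points" and d: "d \<in> torus_points"
  show "pt c = pt d \<longleftrightarrow> (\<forall>i<?n. c i = d i)"
  proof
    assume eq: "pt c = pt d"
    show "\<forall>i<?n. c i = d i"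
    proof (intro allI impI)
      fix i assume i: "i < ?n"
      obtain x where x: "x \<in> carrier G" "expo_of x = frag_of i" using expo_of_surj[of "frag_of i"] i by auto
      have "pt c x = pt d x" using eq by simp
      then show "c i = d i" using x i by (simp add: pt_def monomial_at_single)
    qed
  next
    assume "\<forall>i<?n. c i = d i"
    then show "pt c = pt d" unfolding pt_def
      by (intro restrict_ext monomial_at_cong[OF expo_of_supp]) auto
  qed
next
  fix C assume "closedin (zariski G) C"
  then obtain F where F: "F \<subseteq> carrier (group_ring G)" "\<forall>\<rho>\<in>char_torus G. \<rho> \<in> C \<longleftrightarrow> (\<forall>f\<in>F. char_eval \<rho> f = 0)"
    using zariski_closed_eqs by blast
  show "\<exists>F\<subseteq>laurent_set {..<b1 G}. \<forall>c\<in>torus_points. pt c \<in> C \<longleftrightarrow> (\<forall>f\<in>F. ev (b1 G) c f = 0)"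
  proof (intro exI[of _ "push expo_of ` F"] conjI ballI)
    show "push expo_of ` F \<subseteq> laurent_set {..<b1 G}" using F(1) push_expo_of_in by blast
    fix c assume "c \<in> torus_points"
    then have "pt c \<in> C \<longleftrightarrow> (\<forall>f\<in>F. char_eval (pt c) f = 0)" using F(2) pt_in by blast
    also have "\<dots> \<longleftrightarrow> (\<forall>f\<in>F. ev (b1 G) c (push expo_of f) = 0)" using F(1) char_eval_pt by (intro ball_cong refl) auto
    finally show "pt c \<in> C \<longleftrightarrow> (\<forall>f\<in>push expo_of ` F. ev (b1 G) c f = 0)" by simp
  qed
next
  fix F :: "complex laurent set" assume F: "F \<subseteq> laurent_set {..<b1 G}"
  \<comment> \<open>A set-theoretic section of \<open>expo_of\<close>; it lifts equations on the
    torus to elements of the group ring of \<open>G\<close>.\<close>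
  define s where "s e = (SOME x. x \<in> carrier G \<and> expo_of x = e)" for e
  have s: "s e \<in> carrier G \<and> expo_of (s e) = e" if "supp e \<subseteq> {..<b1 G}" for e
    unfolding s_def by (rule someI_ex) (use expo_of_surj[OF that] in blast)
  have sf: "push s f \<in> carrier (group_ring G)" "push expo_of (push s f) = f" if "f \<in> F" for f
  proof -
    have supp: "supp e \<subseteq> {..<b1 G}" if "e \<in> supp f" for e using F \<open>f \<in> F\<close> that by (auto simp: laurent_set_def)
    show "push s f \<in> carrier (group_ring G)" using supp_push[of s f] s supp by auto
    have "push expo_of (push s f) = push (\<lambda>e. e) f" by (rule push_push) (use s supp in blast)
    then show "push expo_of (push s f) = f" using push_id[of f "\<lambda>e. e"] by simp
  qed
  have eq: "pt ` {c \<in> torus_points. \<forall>f\<in>F. ev (b1 G) c f = 0} =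
      char_torus0 G \<inter> {\<rho> \<in> char_torus G. \<forall>f\<in>push s ` F. char_eval \<rho> f = 0}"
    unfolding char_torus0_eq using pt_in by (auto simp: char_eval_pt sf simp del: carrier_group_ring)
  have "closedin (zariski G) {\<rho> \<in> char_torus G. \<forall>f\<in>push s ` F. char_eval \<rho> f = 0}"
    by (rule zariski_closed_zeros) (use sf in blast)
  then show "closedin (zariski G) (pt ` {c \<in> torus_points. \<forall>f\<in>F. ev (b1 G) c f = 0})"
    unfolding eq by (rule closedin_Int[OF char_torus0_closed])
next
  fix Z assume "irreducible_in (zariski G) Z" "Z \<inter> pt ` torus_points \<noteq> {}"
  then show "Z \<subseteq> pt ` torus_points" using irreducible_meets_torus0 by (simp add: char_torus0_eq)
qed

lemma chart_T0: "chart.T0 = char_torus0 G"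
  by (simp add: chart.T0_def char_torus0_eq)

lemma W1_eq: "W1 G = chart.codim_one_part (V1 G)"
  by (simp add: W1_def chart.codim_one_part_def chart_T0)

end

section \<open>The coordinate ring and quotient modules\<close>

lemma additive_finsum:
  fixes F :: "'m \<Rightarrow> 'c::comm_monoid_add"
  assumes "abelian_monoid M" and add: "\<And>y z. \<lbrakk>y \<in> carrier M; z \<in> carrier M\<rbrakk> \<Longrightarrow> F (y \<oplus>\<^bsub>M\<^esub> z) = F y + F z"
    and zero: "F \<zero>\<^bsub>M\<^esub> = 0" and "finite I" and y: "y \<in> I \<rightarrow> carrier M"
  shows "F (finsum M y I) = (\<Sum>i\<in>I. F (y i))"
proof -
  interpret abelian_monoid M by fact
  show ?thesis using \<open>finite I\<close> y
  proof (induction I rule: finite_induct)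
    case (insert i I)
    then have "y \<in> I \<rightarrow> carrier M" "y i \<in> carrier M" by auto
    then show ?case using insert by (simp add: add)
  qed (simp add: zero)
qed

lemma multiplicative_finprod:
  fixes F :: "'m \<Rightarrow> 'c::comm_monoid_mult"
  assumes "comm_monoid M" and mult: "\<And>y z. \<lbrakk>y \<in> carrier M; z \<in> carrier M\<rbrakk> \<Longrightarrow> F (y \<otimes>\<^bsub>M\<^esub> z) = F y * F z"
    and one: "F \<one>\<^bsub>M\<^esub> = 1" and "finite I" and y: "y \<in> I \<rightarrow> carrier M"
  shows "F (finprod M y I) = (\<Prod>i\<in>I. F (y i))"
proof -
  interpret comm_monoid M by fact
  show ?thesis using \<open>finite I\<close> y
  proof (induction I rule: finite_induct)
    case (insert i I)
    then have "y \<in> I \<rightarrow> carrier M" "y i \<in> carrier M" by auto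
    then show ?case using insert by (simp add: mult)
  qed (simp add: one)
qed

lemma ring_hom_ring_det:
  fixes F :: "'r \<Rightarrow> 'c::comm_ring_1"
  assumes R: "cring R"
    and add: "\<And>y z. \<lbrakk>y \<in> carrier R; z \<in> carrier R\<rbrakk> \<Longrightarrow> F (y \<oplus>\<^bsub>R\<^esub> z) = F y + F z"
    and mult: "\<And>y z. \<lbrakk>y \<in> carrier R; z \<in> carrier R\<rbrakk> \<Longrightarrow> F (y \<otimes>\<^bsub>R\<^esub> z) = F y * F z"
    and one: "F \<one>\<^bsub>R\<^esub> = 1"
    and A: "\<And>i j. \<lbrakk>i < k; j < k\<rbrakk> \<Longrightarrow> A i j \<in> carrier R"
  shows "F (ring_det R k A) = leibniz_det k (\<lambda>i j. F (A i j))" and "ring_det R k A \<in> carrier R"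
proof -
  interpret R: cring R by fact
  have zero: "F \<zero>\<^bsub>R\<^esub> = 0" using add[of "\<zero>\<^bsub>R\<^esub>" "\<zero>\<^bsub>R\<^esub>"] by simp
  have "F (\<ominus>\<^bsub>R\<^esub> \<one>\<^bsub>R\<^esub>) + F \<one>\<^bsub>R\<^esub> = F (\<ominus>\<^bsub>R\<^esub> \<one>\<^bsub>R\<^esub> \<oplus>\<^bsub>R\<^esub> \<one>\<^bsub>R\<^esub>)" by (rule add[symmetric]) auto
  then have "F (\<ominus>\<^bsub>R\<^esub> \<one>\<^bsub>R\<^esub>) + 1 = 0" using zero one by (simp add: R.l_neg)
  then have minus: "F (\<ominus>\<^bsub>R\<^esub> \<one>\<^bsub>R\<^esub>) = - 1" by (simp add: eq_neg_iff_add_eq_0)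
  have fin: "finite {\<sigma>. \<sigma> permutes {..<k}}" by (rule finite_permutations) simp
  have entry: "(\<lambda>i. A i (\<sigma> i)) \<in> {..<k} \<rightarrow> carrier R" if "\<sigma> permutes {..<k}" for \<sigma>
    using permutes_in_image[OF that] A by auto
  have prod: "finprod R (\<lambda>i. A i (\<sigma> i)) {..<k} \<in> carrier R" if "\<sigma> permutes {..<k}" for \<sigma>
    by (rule R.finprod_closed[OF entry[OF that]])
  have sgn: "(if evenperm \<sigma> then \<one>\<^bsub>R\<^esub> else \<ominus>\<^bsub>R\<^esub> \<one>\<^bsub>R\<^esub>) \<in> carrier R" for \<sigma> :: "nat \<Rightarrow> nat" by simp
  let ?t = "\<lambda>\<sigma>. (if evenperm \<sigma> then \<one>\<^bsub>R\<^esub> else \<ominus>\<^bsub>R\<^esub> \<one>\<^bsub>R\<^esub>) \<otimes>\<^bsub>R\<^esub> finprod R (\<lambda>i. A i (\<sigma> i)) {..<k}"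
  have terms: "?t \<in> {\<sigma>. \<sigma> permutes {..<k}} \<rightarrow> carrier R" using prod by simp
  show "ring_det R k A \<in> carrier R" unfolding ring_det_def by (rule R.finsum_closed[OF terms])
  have "F (ring_det R k A) = (\<Sum>\<sigma>\<in>{\<sigma>. \<sigma> permutes {..<k}}. F (?t \<sigma>))"
    unfolding ring_det_def by (rule additive_finsum[OF R.abelian_monoid_axioms add zero fin terms])
  also have "\<dots> = leibniz_det k (\<lambda>i j. F (A i j))" unfolding leibniz_det_def
  proof (intro sum.cong refl)
    fix \<sigma> assume "\<sigma> \<in> {\<sigma>. \<sigma> permutes {..<k}}"
    then have \<sigma>: "\<sigma> permutes {..<k}" by simp
    have "F (finprod R (\<lambda>i. A i (\<sigma> i)) {..<k}) = (\<Prod>i<k. F (A i (\<sigma> i)))"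
      by (rule multiplicative_finprod[OF R.comm_monoid_axioms mult one _ entry[OF \<sigma>]]) simp_all
    then show "F (?t \<sigma>) = (if evenperm \<sigma> then 1 else - 1) * (\<Prod>i<k. F (A i (\<sigma> i)))"
      using mult[OF sgn prod[OF \<sigma>], of \<sigma>] one minus by (simp split: if_splits)
  qed
  finally show "F (ring_det R k A) = leibniz_det k (\<lambda>i j. F (A i j))" .
qed

text \<open>Both the Alexander module and the first homology are quotients of this shape, so their
  module laws are established together.\<close>

locale additive_quotient =
  fixes C N :: "'m::ab_group_add set" and sm :: "'r \<Rightarrow> 'm \<Rightarrow> 'm"
  assumes C: "0 \<in> C" "\<And>x y. \<lbrakk>x \<in> C; y \<in> C\<rbrakk> \<Longrightarrow> x - y \<in> C"
    and N: "0 \<in> N" "\<And>x y. \<lbrakk>x \<in> N; y \<in> N\<rbrakk> \<Longrightarrow> x - y \<in> N"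
    and NC: "N \<subseteq> C"
begin

definition Q :: "('r, 'm set) module" where
  "Q = quotient_module \<lparr>carrier = C, monoid.mult = undefined, one = undefined,
     ring.zero = 0, ring.add = (+), module.smult = sm\<rparr> N"

definition cl :: "'m \<Rightarrow> 'm set" where "cl x = (\<lambda>n. n + x) ` N"

lemma C_uminus: "x \<in> C \<Longrightarrow> - x \<in> C" using C(2)[OF C(1)] by simp
lemma C_add: "\<lbrakk>x \<in> C; y \<in> C\<rbrakk> \<Longrightarrow> x + y \<in> C" using C(2)[of x "- y"] C_uminus by simp
lemma N_uminus: "x \<in> N \<Longrightarrow> - x \<in> N" using N(2)[OF N(1)] by simp
lemma N_add: "\<lbrakk>x \<in> N; y \<in> N\<rbrakk> \<Longrightarrow> x + y \<in> N" using N(2)[of x "- y"] N_uminus by simp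

lemma coset_eq: "a_r_coset \<lparr>carrier = C, monoid.mult = undefined, one = undefined,
     ring.zero = 0, ring.add = (+), module.smult = sm\<rparr> N x = cl x"
  by (auto simp: a_r_coset_def r_coset_def cl_def)

lemma carrier_Q: "carrier Q = cl ` C"
  unfolding Q_def quotient_module_def by (auto simp: A_RCOSETS_def RCOSETS_def r_coset_def cl_def)

lemma zero_Q: "\<zero>\<^bsub>Q\<^esub> = N"
  by (simp add: Q_def quotient_module_def)

lemma cl_eq_iff: "cl x = cl y \<longleftrightarrow> x - y \<in> N"
proof
  assume "cl x = cl y"
  moreover have "0 + x \<in> cl x" unfolding cl_def using N(1) by (rule imageI)
  ultimately obtain n where "n \<in> N" "x = n + y" by (auto simp: cl_def)
  then show "x - y \<in> N" by simp
next
  assume xy: "x - y \<in> N"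
  show "cl x = cl y"
  proof (intro equalityI subsetI)
    fix z assume "z \<in> cl x"
    then obtain n where n: "n \<in> N" "z = n + x" by (auto simp: cl_def)
    then have "z = (n + (x - y)) + y" by simp
    then show "z \<in> cl y" unfolding cl_def using N_add[OF n(1) xy] by blast
  next
    fix z assume "z \<in> cl y"
    then obtain n where n: "n \<in> N" "z = n + y" by (auto simp: cl_def)
    then have "z = (n - (x - y)) + x" by simp
    then show "z \<in> cl x" unfolding cl_def using N(2)[OF n(1) xy] by blast
  qed
qed

lemma cl_zero: "cl 0 = N"
  by (simp add: cl_def)

lemma cl_zero_iff: "cl x = \<zero>\<^bsub>Q\<^esub> \<longleftrightarrow> x \<in> N"
  using cl_eq_iff[of x 0] by (simp add: cl_zero zero_Q)

lemma add_Q: "cl x \<oplus>\<^bsub>Q\<^esub> cl y = cl (x + y)"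
proof -
  have "cl x \<oplus>\<^bsub>Q\<^esub> cl y = (\<Union>a\<in>cl x. \<Union>b\<in>cl y. {a + b})"
    by (simp add: Q_def quotient_module_def set_add_def set_mult_def)
  also have "\<dots> = cl (x + y)"
  proof (intro equalityI subsetI)
    fix z assume "z \<in> (\<Union>a\<in>cl x. \<Union>b\<in>cl y. {a + b})"
    then obtain n n' where n: "n \<in> N" "n' \<in> N" "z = (n + x) + (n' + y)" by (auto simp: cl_def)
    then have "z = (n + n') + (x + y)" by (simp add: algebra_simps)
    then show "z \<in> cl (x + y)" unfolding cl_def using N_add[OF n(1,2)] by blast
  next
    fix z assume "z \<in> cl (x + y)"
    then obtain n where n: "n \<in> N" "z = n + (x + y)" by (auto simp: cl_def)
    have "n + x \<in> cl x" "0 + y \<in> cl y" unfolding cl_def using n(1) N(1) by blast+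
    moreover have "z = (n + x) + (0 + y)" using n by (simp add: algebra_simps)
    ultimately show "z \<in> (\<Union>a\<in>cl x. \<Union>b\<in>cl y. {a + b})" by blast
  qed
  finally show ?thesis .
qed

lemma abelian_group_Q: "abelian_group Q"
proof (rule abelian_groupI)
  have zero: "\<zero>\<^bsub>Q\<^esub> = cl 0" by (simp only: zero_Q cl_zero)
  show "\<zero>\<^bsub>Q\<^esub> \<in> carrier Q" unfolding zero carrier_Q using C(1) by (rule imageI)
  fix x y z assume "x \<in> carrier Q" "y \<in> carrier Q" "z \<in> carrier Q"
  then obtain a b c where abc: "a \<in> C" "b \<in> C" "c \<in> C" "x = cl a" "y = cl b" "z = cl c"
    by (auto simp: carrier_Q)
  show "x \<oplus>\<^bsub>Q\<^esub> y \<in> carrier Q" using abc C_add by (simp add: add_Q carrier_Q)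
  show "x \<oplus>\<^bsub>Q\<^esub> y \<oplus>\<^bsub>Q\<^esub> z = x \<oplus>\<^bsub>Q\<^esub> (y \<oplus>\<^bsub>Q\<^esub> z)" using abc by (simp add: add_Q add.assoc)
  show "x \<oplus>\<^bsub>Q\<^esub> y = y \<oplus>\<^bsub>Q\<^esub> x" using abc by (simp add: add_Q add.commute)
  show "\<zero>\<^bsub>Q\<^esub> \<oplus>\<^bsub>Q\<^esub> x = x" using abc by (simp add: zero add_Q)
  have "cl (- a) \<in> carrier Q" unfolding carrier_Q using C_uminus[OF abc(1)] by (rule imageI)
  moreover have "cl (- a) \<oplus>\<^bsub>Q\<^esub> x = \<zero>\<^bsub>Q\<^esub>" using abc by (simp add: zero add_Q)
  ultimately show "\<exists>y\<in>carrier Q. y \<oplus>\<^bsub>Q\<^esub> x = \<zero>\<^bsub>Q\<^esub>" by blast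
qed

text \<open>In \<open>quotient_module\<close> a scalar sends a coset to the union of the cosets of
  all multiples of its members. These cosets coincide because \<open>N\<close> is stable under the
  scalar.\<close>

lemma smult_Q:
  assumes r: "\<And>x. x \<in> N \<Longrightarrow> sm r x \<in> N" "\<And>x y. \<lbrakk>x \<in> C; y \<in> C\<rbrakk> \<Longrightarrow> sm r (x + y) = sm r x + sm r y"
    and x: "x \<in> C"
  shows "r \<odot>\<^bsub>Q\<^esub> cl x = cl (sm r x)"
proof -
  have "r \<odot>\<^bsub>Q\<^esub> cl x = (\<Union>y\<in>cl x. cl (sm r y))"
    by (simp add: Q_def quotient_module_def coset_eq)
  also have "\<dots> = cl (sm r x)"
  proof -
    have "cl (sm r y) = cl (sm r x)" if "y \<in> cl x" for y
    proof -
      from that obtain n where n: "n \<in> N" "y = n + x" by (auto simp: cl_def)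
      then have "sm r y = sm r n + sm r x" using r(2) NC x by blast
      then show ?thesis using r(1)[OF n(1)] by (simp add: cl_eq_iff)
    qed
    moreover have "0 + x \<in> cl x" unfolding cl_def using N(1) by (rule imageI)
    ultimately show ?thesis by blast
  qed
  finally show ?thesis .
qed

text \<open>Distributivity in the scalar is asked only modulo \<open>N\<close>: on the free abelian
  group of symbols \<open>(b, x)\<close>, multiplication by \<open>r + s\<close> agrees with the sum
  of the two multiplications only up to relations.\<close>

lemma module_Q:
  assumes R: "cring R"
    and smC: "\<And>r x. \<lbrakk>r \<in> carrier R; x \<in> C\<rbrakk> \<Longrightarrow> sm r x \<in> C"
    and smN: "\<And>r x. \<lbrakk>r \<in> carrier R; x \<in> N\<rbrakk> \<Longrightarrow> sm r x \<in> N"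
    and add: "\<And>r x y. \<lbrakk>r \<in> carrier R; x \<in> C; y \<in> C\<rbrakk> \<Longrightarrow> sm r (x + y) = sm r x + sm r y"
    and l_distr: "\<And>r s x. \<lbrakk>r \<in> carrier R; s \<in> carrier R; x \<in> C\<rbrakk> \<Longrightarrow> sm (r \<oplus>\<^bsub>R\<^esub> s) x - (sm r x + sm s x) \<in> N"
    and assoc: "\<And>r s x. \<lbrakk>r \<in> carrier R; s \<in> carrier R; x \<in> C\<rbrakk> \<Longrightarrow> sm (r \<otimes>\<^bsub>R\<^esub> s) x = sm r (sm s x)"
    and one: "\<And>x. x \<in> C \<Longrightarrow> sm \<one>\<^bsub>R\<^esub> x = x"
  shows "module R Q"
proof -
  interpret R: cring R by fact
  have sm: "r \<odot>\<^bsub>Q\<^esub> cl x = cl (sm r x)" if "r \<in> carrier R" "x \<in> C" for r x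
    by (rule smult_Q) (use that smN add in auto)
  show ?thesis
  proof (rule moduleI[OF R abelian_group_Q])
    fix r x assume "r \<in> carrier R" "x \<in> carrier Q"
    then show "r \<odot>\<^bsub>Q\<^esub> x \<in> carrier Q" by (auto simp: carrier_Q sm smC)
  next
    fix r s x assume rs: "r \<in> carrier R" "s \<in> carrier R" and "x \<in> carrier Q"
    then obtain a where a: "a \<in> C" "x = cl a" by (auto simp: carrier_Q)
    show "(r \<oplus>\<^bsub>R\<^esub> s) \<odot>\<^bsub>Q\<^esub> x = r \<odot>\<^bsub>Q\<^esub> x \<oplus>\<^bsub>Q\<^esub> s \<odot>\<^bsub>Q\<^esub> x"
      using rs a l_distr by (simp add: sm add_Q cl_eq_iff)
    show "(r \<otimes>\<^bsub>R\<^esub> s) \<odot>\<^bsub>Q\<^esub> x = r \<odot>\<^bsub>Q\<^esub> (s \<odot>\<^bsub>Q\<^esub> x)"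
      using rs a by (simp add: sm smC assoc)
  next
    fix r x y assume r: "r \<in> carrier R" and "x \<in> carrier Q" "y \<in> carrier Q"
    then obtain a b where "a \<in> C" "x = cl a" "b \<in> C" "y = cl b" by (auto simp: carrier_Q)
    then show "r \<odot>\<^bsub>Q\<^esub> (x \<oplus>\<^bsub>Q\<^esub> y) = r \<odot>\<^bsub>Q\<^esub> x \<oplus>\<^bsub>Q\<^esub> r \<odot>\<^bsub>Q\<^esub> y"
      using r by (simp add: sm add_Q C_add add)
  next
    fix x assume "x \<in> carrier Q"
    then show "\<one>\<^bsub>R\<^esub> \<odot>\<^bsub>Q\<^esub> x = x" by (auto simp: carrier_Q sm one)
  qed
qed

end

section \<open>The group ring as a ring of Laurent polynomials\<close>

context fg_group
begin

definition \<Psi> :: "('a set set \<Rightarrow>\<^sub>0 int) \<Rightarrow> int laurent" where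
  "\<Psi> = push \<iota>"

lemma \<Psi>_add: "\<Psi> (f + g) = \<Psi> f + \<Psi> g"
  by (simp add: \<Psi>_def push_add)

lemma \<Psi>_zero [simp]: "\<Psi> 0 = 0"
  by (simp add: \<Psi>_def)

lemma \<Psi>_one: "\<Psi> (term_of \<one>\<^bsub>abf G\<^esub> 1) = 1"
  by (simp add: \<Psi>_def \<iota>_one)

lemma \<Psi>_mult:
  assumes "f \<in> carrier (Lambda G)" "g \<in> carrier (Lambda G)"
  shows "\<Psi> (f \<otimes>\<^bsub>Lambda G\<^esub> g) = \<Psi> f * \<Psi> g"
  unfolding \<Psi>_def push_def
proof (rule lin_group_ring_mult)
  fix x y and a b :: int assume "x \<in> supp f" "y \<in> supp g"
  then have "x \<in> carrier (abf G)" "y \<in> carrier (abf G)" using assms by auto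
  then show "term_of (\<iota> (x \<otimes>\<^bsub>abf G\<^esub> y)) (a * b) = term_of (\<iota> x) a * term_of (\<iota> y) b"
    by (simp add: \<iota>_mult mult_single)
qed (simp_all add: single_add)

lemma \<Psi>_in: "f \<in> carrier (Lambda G) \<Longrightarrow> \<Psi> f \<in> laurent_set {..<b1 G}"
  using supp_push[of \<iota> f] \<iota>_supp by (auto simp: \<Psi>_def laurent_set_def)

lemma push_\<kappa>_\<Psi>: "f \<in> carrier (Lambda G) \<Longrightarrow> push \<kappa> (\<Psi> f) = f"
  unfolding \<Psi>_def using push_push[of f \<kappa> \<iota> "\<lambda>x. x"] push_id[of f "\<lambda>x. x"] \<kappa>_\<iota> by auto

lemma \<Psi>_inj: "\<lbrakk>f \<in> carrier (Lambda G); g \<in> carrier (Lambda G); \<Psi> f = \<Psi> g\<rbrakk> \<Longrightarrow> f = g"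
  using push_\<kappa>_\<Psi> by metis

lemma \<Psi>_surj: "f \<in> laurent_set {..<b1 G} \<Longrightarrow> \<exists>g\<in>carrier (Lambda G). \<Psi> g = f"
proof -
  assume f: "f \<in> laurent_set {..<b1 G}"
  have "\<Psi> (push \<kappa> f) = push (\<lambda>e. e) f"
    unfolding \<Psi>_def by (rule push_push) (use f \<iota>_\<kappa> in \<open>auto simp: laurent_set_def\<close>)
  moreover have "push \<kappa> f \<in> carrier (Lambda G)"
    using supp_push[of \<kappa> f] \<kappa>_closed f by (auto simp: laurent_set_def)
  ultimately show ?thesis using push_id[of f "\<lambda>e. e"] by auto
qed

lemma Lambda_mult_closed:
  "\<lbrakk>f \<in> carrier (Lambda G); g \<in> carrier (Lambda G)\<rbrakk> \<Longrightarrow> f \<otimes>\<^bsub>Lambda G\<^esub> g \<in> carrier (Lambda G)"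
  by (rule A.group_ring_mult_closed)

lemma Lambda_add_closed:
  fixes f g :: "'a set set \<Rightarrow>\<^sub>0 int"
  shows "\<lbrakk>f \<in> carrier (Lambda G); g \<in> carrier (Lambda G)\<rbrakk> \<Longrightarrow> f + g \<in> carrier (Lambda G)"
  using Poly_Mapping.keys_add[of f g] by auto

text \<open>The multiplicative laws are pulled back along the injective map \<open>\<Psi>\<close>
  from the type of Laurent polynomials.\<close>

lemma cring_Lambda: "cring (Lambda G)"
proof (rule cringI)
  show "abelian_group (Lambda G)"
  proof (rule abelian_groupI)
    fix f assume "f \<in> carrier (Lambda G)"
    then show "\<exists>g\<in>carrier (Lambda G). g \<oplus>\<^bsub>Lambda G\<^esub> f = \<zero>\<^bsub>Lambda G\<^esub>"
      by (intro bexI[of _ "- f"]) auto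
  qed (use Lambda_add_closed in \<open>auto simp: algebra_simps\<close>)
  show "comm_monoid (Lambda G)"
  proof (rule comm_monoidI)
    fix f g h assume f: "f \<in> carrier (Lambda G)" and g: "g \<in> carrier (Lambda G)" and h: "h \<in> carrier (Lambda G)"
    show "f \<otimes>\<^bsub>Lambda G\<^esub> g \<in> carrier (Lambda G)" by (rule Lambda_mult_closed[OF f g])
    show "f \<otimes>\<^bsub>Lambda G\<^esub> g \<otimes>\<^bsub>Lambda G\<^esub> h = f \<otimes>\<^bsub>Lambda G\<^esub> (g \<otimes>\<^bsub>Lambda G\<^esub> h)"
      by (rule \<Psi>_inj) (simp_all only: Lambda_mult_closed f g h \<Psi>_mult mult.assoc)
    show "f \<otimes>\<^bsub>Lambda G\<^esub> g = g \<otimes>\<^bsub>Lambda G\<^esub> f"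
      by (rule \<Psi>_inj) (simp_all only: Lambda_mult_closed f g \<Psi>_mult mult.commute)
    have one: "term_of \<one>\<^bsub>abf G\<^esub> (1::int) \<in> carrier (Lambda G)" by simp
    show "\<one>\<^bsub>Lambda G\<^esub> \<otimes>\<^bsub>Lambda G\<^esub> f = f"
      by (rule \<Psi>_inj) (simp_all only: Lambda_mult_closed one f \<Psi>_mult one_group_ring \<Psi>_one mult_1)
  qed simp
  fix f g h assume f: "f \<in> carrier (Lambda G)" and g: "g \<in> carrier (Lambda G)" and h: "h \<in> carrier (Lambda G)"
  show "(f \<oplus>\<^bsub>Lambda G\<^esub> g) \<otimes>\<^bsub>Lambda G\<^esub> h = f \<otimes>\<^bsub>Lambda G\<^esub> h \<oplus>\<^bsub>Lambda G\<^esub> g \<otimes>\<^bsub>Lambda G\<^esub> h"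
    by (rule \<Psi>_inj) (simp_all only: add_group_ring Lambda_mult_closed Lambda_add_closed f g h \<Psi>_mult \<Psi>_add distrib_right)
qed

sublocale \<Lambda>: cring "Lambda G"
  by (rule cring_Lambda)

lemma divides_iff:
  assumes "f \<in> carrier (Lambda G)" "g \<in> carrier (Lambda G)"
  shows "f divides\<^bsub>Lambda G\<^esub> g \<longleftrightarrow> dvd_in (laurent_set {..<b1 G}) (\<Psi> f) (\<Psi> g)"
proof
  assume "f divides\<^bsub>Lambda G\<^esub> g"
  then obtain h where "h \<in> carrier (Lambda G)" "g = f \<otimes>\<^bsub>Lambda G\<^esub> h" unfolding factor_def by blast
  then show "dvd_in (laurent_set {..<b1 G}) (\<Psi> f) (\<Psi> g)"
    unfolding dvd_in_def using \<Psi>_mult[OF assms(1)] \<Psi>_in by blast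
next
  assume "dvd_in (laurent_set {..<b1 G}) (\<Psi> f) (\<Psi> g)"
  then obtain k where k: "k \<in> laurent_set {..<b1 G}" "\<Psi> g = \<Psi> f * k" by (auto simp: dvd_in_def)
  then obtain h where h: "h \<in> carrier (Lambda G)" "\<Psi> h = k" using \<Psi>_surj by blast
  have "g = f \<otimes>\<^bsub>Lambda G\<^esub> h"
    by (rule \<Psi>_inj) (simp_all only: assms h k Lambda_mult_closed \<Psi>_mult)
  then show "f divides\<^bsub>Lambda G\<^esub> g" unfolding factor_def using h by blast
qed

text \<open>The ring homomorphism through which \<open>Lambda G\<close> acts on the complex numbers
  at the character with coordinates \<open>c\<close>.\<close>

definition ch :: "(nat \<Rightarrow> complex) \<Rightarrow> ('a set set \<Rightarrow>\<^sub>0 int) \<Rightarrow> complex" where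
  "ch c f = ev (b1 G) c (emb (\<Psi> f))"

lemma ch_add: "ch c (f + g) = ch c f + ch c g"
  by (simp add: ch_def \<Psi>_add)

lemma ch_zero [simp]: "ch c 0 = 0"
  by (simp add: ch_def)

lemma ch_mult: "\<lbrakk>c \<in> torus_points; f \<in> carrier (Lambda G); g \<in> carrier (Lambda G)\<rbrakk> \<Longrightarrow>
    ch c (f \<otimes>\<^bsub>Lambda G\<^esub> g) = ch c f * ch c g"
  by (simp only: ch_def \<Psi>_mult emb_mult ev_mult)

lemma ch_one: "ch c (term_of \<one>\<^bsub>abf G\<^esub> 1) = 1"
  by (simp add: ch_def \<Psi>_one)

end

section \<open>Crossed homomorphisms and the Alexander module\<close>

lemma (in comm_monoid) finprod_single:
  assumes "finite A" "i \<in> A" "f \<in> A \<rightarrow> carrier G" "\<And>j. \<lbrakk>j \<in> A; j \<noteq> i\<rbrakk> \<Longrightarrow> f j = \<one>"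
  shows "finprod G f A = f i"
proof -
  have *: "f \<in> (A - {i}) \<rightarrow> carrier G" "f i \<in> carrier G" using assms by auto
  have "finprod G f (insert i (A - {i})) = f i \<otimes> finprod G f (A - {i})"
    by (rule finprod_insert) (use assms * in auto)
  moreover have "finprod G f (A - {i}) = \<one>"
    using assms(4) by (intro finprod_one_eqI) auto
  moreover have "insert i (A - {i}) = A" using assms(2) by blast
  ultimately show ?thesis using * by simp
qed

lemma (in abelian_monoid) finsum_single:
  assumes "finite A" "i \<in> A" "f \<in> A \<rightarrow> carrier G" "\<And>j. \<lbrakk>j \<in> A; j \<noteq> i\<rbrakk> \<Longrightarrow> f j = \<zero>"
  shows "finsum G f A = f i"
  using add.finprod_single[of A i f] assms by (simp add: finsum_def)

context fg_group
begin

abbreviation ZG :: "('a \<Rightarrow>\<^sub>0 int) ring" where "ZG \<equiv> int_group_ring G"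
abbreviation IG :: "('a \<Rightarrow>\<^sub>0 int) set" where "IG \<equiv> carrier (augmentation_ideal G)"
abbreviation theta :: "('a \<Rightarrow>\<^sub>0 int) \<Rightarrow> ('a set set \<Rightarrow>\<^sub>0 int)" where "theta \<equiv> group_ring_map (abf_proj G)"

lemma theta_eq: "theta = push (abf_proj G)"
proof
  fix f :: "'a \<Rightarrow>\<^sub>0 int"
  have "frag_cmul z (frag_of y) = term_of y z" for z and y :: "'a set set"
    by (rule poly_mapping_eqI) (simp add: lookup_single when_def)
  then show "theta f = push (abf_proj G) f"
    by (simp add: group_ring_map_def frag_extend_def push_def lin_def)
qed

lemma theta_closed: "r \<in> carrier ZG \<Longrightarrow> theta r \<in> carrier (Lambda G)"
  using supp_push[of "abf_proj G" r] abf_proj_closed by (auto simp: theta_eq)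

lemma augmentation_eq: "augmentation = lin (\<lambda>x z. z)"
  by (simp add: fun_eq_iff augmentation_def lin_def)

lemma augmentation_add: "augmentation (f + g) = augmentation f + augmentation g"
  unfolding augmentation_eq by (rule lin_add) simp_all

lemma augmentation_diff: "augmentation (f - g) = augmentation f - augmentation g"
  using augmentation_add[of "f - g" g] by simp

lemma augmentation_single [simp]: "augmentation (term_of x z) = z"
  by (simp add: augmentation_eq lin_single)

lemma augmentation_mult: "augmentation (f \<otimes>\<^bsub>ZG\<^esub> g) = augmentation f * augmentation g"
  unfolding augmentation_eq by (rule lin_group_ring_mult) simp_all

lemma IG_iff: "f \<in> IG \<longleftrightarrow> f \<in> carrier ZG \<and> augmentation f = 0"
  by (simp add: augmentation_ideal_def)

lemma IG_simps [simp]: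
  "x \<oplus>\<^bsub>augmentation_ideal G\<^esub> y = x + y" "r \<odot>\<^bsub>augmentation_ideal G\<^esub> x = r \<otimes>\<^bsub>ZG\<^esub> x"
  by (simp_all add: augmentation_ideal_def)

lemma ZG_add_closed: "\<lbrakk>f \<in> carrier ZG; g \<in> carrier ZG\<rbrakk> \<Longrightarrow> f + g \<in> carrier ZG"
  using Poly_Mapping.keys_add[of f g] by auto

lemma ZG_diff_closed: "\<lbrakk>f \<in> carrier ZG; g \<in> carrier ZG\<rbrakk> \<Longrightarrow> f - g \<in> carrier ZG"
  using keys_diff[of f g] by auto

lemma IG_add: "\<lbrakk>x \<in> IG; y \<in> IG\<rbrakk> \<Longrightarrow> x + y \<in> IG"
  unfolding IG_iff using ZG_add_closed[of x y] by (simp add: augmentation_add)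

lemma IG_diff: "\<lbrakk>x \<in> IG; y \<in> IG\<rbrakk> \<Longrightarrow> x - y \<in> IG"
  unfolding IG_iff using ZG_diff_closed[of x y] by (simp add: augmentation_diff)

lemma IG_smult: "\<lbrakk>r \<in> carrier ZG; x \<in> IG\<rbrakk> \<Longrightarrow> r \<otimes>\<^bsub>ZG\<^esub> x \<in> IG"
  unfolding IG_iff using group_ring_mult_closed[of r x] augmentation_mult[of r x] by simp

definition del :: "'a \<Rightarrow> ('a \<Rightarrow>\<^sub>0 int)" where "del x = frag_of x - frag_of \<one>"

lemma del_in: "x \<in> carrier G \<Longrightarrow> del x \<in> IG"
  unfolding IG_iff del_def by (intro conjI ZG_diff_closed) (simp_all add: augmentation_diff)

text \<open>The crossed homomorphism rule for the elements \<open>x - 1\<close> in the augmentation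
  ideal; linear maps on the Alexander module inherit it.\<close>

lemma del_mult:
  assumes "x \<in> carrier G" "y \<in> carrier G"
  shows "del (x \<otimes> y) = del x + frag_of x \<otimes>\<^bsub>ZG\<^esub> del y"
proof -
  have lookup: "coef (del y) z * (1::int) = coef (del y) z" for z by simp
  have "frag_of x \<otimes>\<^bsub>ZG\<^esub> del y = push (\<lambda>z. x \<otimes> z) (del y)"
    by (simp add: mult_group_ring push_def lin_def)
  also have "\<dots> = push (\<lambda>z. x \<otimes> z) (frag_of y) - push (\<lambda>z. x \<otimes> z) (frag_of \<one>)"
    unfolding del_def using push_add[of "\<lambda>z. x \<otimes> z" "frag_of y - frag_of \<one>" "frag_of \<one>"] by simp
  also have "\<dots> = frag_of (x \<otimes> y) - frag_of x" using assms by simp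
  finally show ?thesis by (simp add: del_def)
qed

definition crossed :: "(nat \<Rightarrow> complex) \<Rightarrow> ('a \<Rightarrow> complex) \<Rightarrow> bool" where
  "crossed c f \<longleftrightarrow> (\<forall>x\<in>carrier G. \<forall>y\<in>carrier G. f (x \<otimes> y) = f x + pt c x * f y)"

definition extend_lin :: "('a \<Rightarrow> complex) \<Rightarrow> ('a \<Rightarrow>\<^sub>0 int) \<Rightarrow> complex" where
  "extend_lin f = lin (\<lambda>x z. of_int z * f x)"

lemma extend_lin_add: "extend_lin f (r + s) = extend_lin f r + extend_lin f s"
  unfolding extend_lin_def by (rule lin_add) (simp_all add: algebra_simps)

lemma extend_lin_single [simp]: "extend_lin f (term_of x z) = of_int z * f x"
  by (simp add: extend_lin_def lin_single)

lemma extend_lin_diff: "extend_lin f (r - s) = extend_lin f r - extend_lin f s"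
  using extend_lin_add[of f "r - s" s] by simp

lemma ch_theta:
  assumes "r \<in> carrier ZG"
  shows "ch c (theta r) = extend_lin (pt c) r"
proof -
  have "ch c (theta r) = lin (\<lambda>x z. ch c (theta (term_of x z))) r"
    by (rule additive_eq_lin) (simp_all add: theta_eq push_add ch_add)
  also have "\<dots> = lin (\<lambda>x z. of_int z * monomial_at (b1 G) c (expo_of x)) r"
    by (simp add: theta_eq ch_def \<Psi>_def emb_term_of ev_term_of expo_of_def)
  also have "\<dots> = extend_lin (pt c) r"
    unfolding extend_lin_def lin_def using assms by (intro sum.cong refl) (auto simp: pt_def)
  finally show ?thesis .
qed

text \<open>In the double sum the summand \<open>f x\<close> of the crossed rule is multiplied by
  the augmentation of \<open>s\<close>, which vanishes. Linearity over the group ring thus holds on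
  the augmentation ideal.\<close>

lemma extend_lin_mult:
  assumes f: "crossed c f" and r: "r \<in> carrier ZG" and s: "s \<in> IG"
  shows "extend_lin f (r \<otimes>\<^bsub>ZG\<^esub> s) = extend_lin (pt c) r * extend_lin f s"
proof -
  have sum: "extend_lin f (sum F I) = (\<Sum>i\<in>I. extend_lin f (F i))" for F :: "'a \<Rightarrow> 'a \<Rightarrow>\<^sub>0 int" and I
    unfolding extend_lin_def by (rule lin_sum) (simp_all add: algebra_simps)
  have sG: "s \<in> carrier ZG" and aug: "(\<Sum>y\<in>supp s. coef s y) = 0"
    using s by (auto simp: IG_iff augmentation_def)
  have "extend_lin f (r \<otimes>\<^bsub>ZG\<^esub> s) = (\<Sum>x\<in>supp r. \<Sum>y\<in>supp s. of_int (coef r x * coef s y) * f (x \<otimes> y))"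
    by (simp add: mult_group_ring sum)
  also have "\<dots> = (\<Sum>x\<in>supp r. \<Sum>y\<in>supp s. of_int (coef r x) * f x * of_int (coef s y)
      + of_int (coef r x) * pt c x * (of_int (coef s y) * f y))"
  proof (intro sum.cong refl)
    fix x y assume "x \<in> supp r" "y \<in> supp s"
    then have "f (x \<otimes> y) = f x + pt c x * f y" using f r sG by (auto simp: crossed_def)
    then show "of_int (coef r x * coef s y) * f (x \<otimes> y) = of_int (coef r x) * f x * of_int (coef s y)
      + of_int (coef r x) * pt c x * (of_int (coef s y) * f y)" by (simp add: algebra_simps)
  qed
  also have "\<dots> = (\<Sum>x\<in>supp r. of_int (coef r x) * f x * (\<Sum>y\<in>supp s. of_int (coef s y))
      + of_int (coef r x) * pt c x * (\<Sum>y\<in>supp s. of_int (coef s y) * f y))"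
    by (simp only: sum.distrib sum_distrib_left)
  also have "(\<Sum>y\<in>supp s. of_int (coef s y)) = (0::complex)" using aug by (metis of_int_0 of_int_sum)
  finally show ?thesis by (simp add: extend_lin_def lin_def sum_distrib_right)
qed

section \<open>The tensor product as a quotient of a free abelian group\<close>

definition FC :: "(('a set set \<Rightarrow>\<^sub>0 int) \<times> ('a \<Rightarrow>\<^sub>0 int) \<Rightarrow>\<^sub>0 int) set" where
  "FC = carrier (free_Abelian_group (carrier (Lambda G) \<times> IG))"

abbreviation rels :: "(('a set set \<Rightarrow>\<^sub>0 int) \<times> ('a \<Rightarrow>\<^sub>0 int) \<Rightarrow>\<^sub>0 int) set" where
  "rels \<equiv> base_change_relations ZG (Lambda G) theta (augmentation_ideal G)"

definition NN :: "(('a set set \<Rightarrow>\<^sub>0 int) \<times> ('a \<Rightarrow>\<^sub>0 int) \<Rightarrow>\<^sub>0 int) set" where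
  "NN = generate (free_Abelian_group (carrier (Lambda G) \<times> IG)) rels"

definition smA :: "('a set set \<Rightarrow>\<^sub>0 int) \<Rightarrow> (('a set set \<Rightarrow>\<^sub>0 int) \<times> ('a \<Rightarrow>\<^sub>0 int) \<Rightarrow>\<^sub>0 int) \<Rightarrow> _" where
  "smA b = frag_extend (\<lambda>(b', x). frag_of (b \<otimes>\<^bsub>Lambda G\<^esub> b', x))"

lemma FC_iff: "w \<in> FC \<longleftrightarrow> supp w \<subseteq> carrier (Lambda G) \<times> IG"
  unfolding FC_def by (rule carrier_free_Abelian_group_iff)

lemma FC_diff: "\<lbrakk>v \<in> FC; w \<in> FC\<rbrakk> \<Longrightarrow> v - w \<in> FC"
  unfolding FC_iff using keys_diff[of v w] by blast

lemma FC_frag: "\<lbrakk>b \<in> carrier (Lambda G); x \<in> IG\<rbrakk> \<Longrightarrow> frag_of (b, x) \<in> FC"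
  unfolding FC_iff keys_frag_of by (simp del: carrier_group_ring)

lemma FC_induct [consumes 1, case_names zero diff frag]:
  assumes "w \<in> FC" "P 0" "\<And>v w. \<lbrakk>v \<in> FC; w \<in> FC; P v; P w\<rbrakk> \<Longrightarrow> P (v - w)"
    "\<And>b x. \<lbrakk>b \<in> carrier (Lambda G); x \<in> IG\<rbrakk> \<Longrightarrow> P (frag_of (b, x))"
  shows "P w"
proof (rule free_Abelian_group_induct[of w "carrier (Lambda G) \<times> IG" P])
  show "supp w \<subseteq> carrier (Lambda G) \<times> IG" using assms(1) by (simp only: FC_iff)
  fix a assume "a \<in> carrier (Lambda G) \<times> IG"
  then show "P (frag_of a)" using assms(4) by (cases a) blast
qed (use assms(2,3) in \<open>auto simp only: FC_iff\<close>)

lemma rels_cases [consumes 1, case_names left right assoc]: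
  assumes "w \<in> rels"
  obtains b b' x where "b \<in> carrier (Lambda G)" "b' \<in> carrier (Lambda G)" "x \<in> IG"
      "w = frag_of (b + b', x) - frag_of (b, x) - frag_of (b', x)"
    | b x x' where "b \<in> carrier (Lambda G)" "x \<in> IG" "x' \<in> IG"
      "w = frag_of (b, x + x') - frag_of (b, x) - frag_of (b, x')"
    | b r x where "b \<in> carrier (Lambda G)" "r \<in> carrier ZG" "x \<in> IG"
      "w = frag_of (b \<otimes>\<^bsub>Lambda G\<^esub> theta r, x) - frag_of (b, r \<otimes>\<^bsub>ZG\<^esub> x)"
  using assms unfolding base_change_relations_def IG_simps add_group_ring by blast

lemma rels_left: "\<lbrakk>b \<in> carrier (Lambda G); b' \<in> carrier (Lambda G); x \<in> IG\<rbrakk> \<Longrightarrow>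
    frag_of (b + b', x) - frag_of (b, x) - frag_of (b', x) \<in> rels"
  unfolding base_change_relations_def IG_simps add_group_ring by blast

lemma rels_right: "\<lbrakk>b \<in> carrier (Lambda G); x \<in> IG; x' \<in> IG\<rbrakk> \<Longrightarrow>
    frag_of (b, x + x') - frag_of (b, x) - frag_of (b, x') \<in> rels"
  unfolding base_change_relations_def IG_simps add_group_ring by blast

lemma rels_assoc: "\<lbrakk>b \<in> carrier (Lambda G); r \<in> carrier ZG; x \<in> IG\<rbrakk> \<Longrightarrow>
    frag_of (b \<otimes>\<^bsub>Lambda G\<^esub> theta r, x) - frag_of (b, r \<otimes>\<^bsub>ZG\<^esub> x) \<in> rels"
  unfolding base_change_relations_def IG_simps add_group_ring by blast

lemma rels_FC: "rels \<subseteq> FC"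
proof
  fix w assume "w \<in> rels"
  then show "w \<in> FC"
  proof (cases rule: rels_cases)
    case (left b b' x)
    then show ?thesis using Lambda_add_closed by (simp only: FC_diff FC_frag)
  next
    case (right b x x')
    then show ?thesis using IG_add by (simp only: FC_diff FC_frag)
  next
    case (assoc b r x)
    then show ?thesis using Lambda_mult_closed theta_closed IG_smult by (simp only: FC_diff FC_frag)
  qed
qed

lemma rels_NN: "w \<in> rels \<Longrightarrow> w \<in> NN"
  unfolding NN_def by (rule generate.incl)

lemma NN_minimal:
  assumes S: "0 \<in> S" "\<And>v w. \<lbrakk>v \<in> S; w \<in> S\<rbrakk> \<Longrightarrow> v - w \<in> S" and sub: "rels \<subseteq> S"
  shows "NN \<subseteq> S"
proof -
  let ?F = "free_Abelian_group (carrier (Lambda G) \<times> IG)"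
  have neg: "- w \<in> S" if "w \<in> S" for w using S(2)[OF S(1) that] by simp
  have "w \<in> FC \<and> w \<in> S" if "w \<in> generate ?F rels" for w
    using that
  proof (induction rule: generate.induct)
    case one
    then show ?case using S by (simp add: FC_iff)
  next
    case (incl w)
    then show ?case using rels_FC sub by blast
  next
    case (inv w)
    then have "w \<in> FC" "w \<in> S" using rels_FC sub by blast+
    then show ?case using neg[of w] FC_diff[of 0 w] by (simp add: FC_iff)
  next
    case (eng v w)
    then show ?case using S(2)[of v "- w"] neg[of w] FC_diff[of v "- w"] FC_diff[of 0 w] by (simp add: FC_iff)
  qed
  then show ?thesis unfolding NN_def by blast
qed

sublocale AM: additive_quotient FC NN smA
proof
  let ?F = "free_Abelian_group (carrier (Lambda G) \<times> IG)"
  have sg: "subgroup NN ?F" unfolding NN_def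
    by (rule group.generate_is_subgroup) (use rels_FC in \<open>simp_all add: FC_def\<close>)
  show NC: "NN \<subseteq> FC" using subgroup.subset[OF sg] by (simp add: FC_def)
  show "0 \<in> FC" by (simp add: FC_iff)
  show "0 \<in> NN" using subgroup.one_closed[OF sg] by simp
  show "x - y \<in> FC" if "x \<in> FC" "y \<in> FC" for x y using FC_diff that .
  fix x y assume x: "x \<in> NN" and y: "y \<in> NN"
  have "inv\<^bsub>?F\<^esub> y = - y" using FC_iff[of y] y NC by (intro inv_free_Abelian_group) blast
  then have "- y \<in> NN" using subgroup.m_inv_closed[OF sg y] by simp
  then show "x - y \<in> NN" using subgroup.m_closed[OF sg x, of "- y"] by simp
qed

lemma alexander_module_eq: "alexander_module G = AM.Q"
  unfolding alexander_module_def base_change_def Let_def AM.Q_def unfolding FC_def NN_def smA_def ..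

lemma smA_add: "smA b (v + w) = smA b v + smA b w"
  by (simp add: smA_def frag_extend_add)

lemma smA_diff: "smA b (v - w) = smA b v - smA b w"
  by (simp add: smA_def frag_extend_diff)

lemma smA_frag [simp]: "smA b (frag_of (b', x)) = frag_of (b \<otimes>\<^bsub>Lambda G\<^esub> b', x)"
  by (simp add: smA_def)

lemma smA_zero [simp]: "smA b 0 = 0"
  by (simp add: smA_def)

lemma smA_FC: "\<lbrakk>w \<in> FC; b \<in> carrier (Lambda G)\<rbrakk> \<Longrightarrow> smA b w \<in> FC"
proof (induction rule: FC_induct)
  case zero
  then show ?case by (simp add: FC_iff)
next
  case (diff v w)
  then show ?case unfolding smA_diff by (intro FC_diff)
next
  case (frag b' x)
  then show ?case unfolding smA_frag by (intro FC_frag Lambda_mult_closed)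
qed

text \<open>Multiplication by \<open>b\<close> turns each defining relation into a relation of the
  same kind.\<close>

lemma smA_NN:
  assumes b: "b \<in> carrier (Lambda G)" and w: "w \<in> NN"
  shows "smA b w \<in> NN"
proof -
  have "NN \<subseteq> {w. smA b w \<in> NN}"
  proof (rule NN_minimal)
    show "rels \<subseteq> {w. smA b w \<in> NN}"
    proof
      fix w assume "w \<in> rels"
      then have "smA b w \<in> rels"
      proof (cases rule: rels_cases)
        case (left b1 b2 x)
        have "b \<otimes>\<^bsub>Lambda G\<^esub> (b1 + b2) = b \<otimes>\<^bsub>Lambda G\<^esub> b1 + b \<otimes>\<^bsub>Lambda G\<^esub> b2"
          using \<Lambda>.r_distr[OF left(1,2) b] by (simp only: add_group_ring)
        then show ?thesis unfolding left(4) smA_diff smA_frag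
          using rels_left[OF Lambda_mult_closed[OF b left(1)] Lambda_mult_closed[OF b left(2)] left(3)] by simp
      next
        case (right b1 x x')
        then show ?thesis unfolding right(4) smA_diff smA_frag
          using rels_right[OF Lambda_mult_closed[OF b right(1)] right(2,3)] by simp
      next
        case (assoc b1 r x)
        have "b \<otimes>\<^bsub>Lambda G\<^esub> (b1 \<otimes>\<^bsub>Lambda G\<^esub> theta r) = b \<otimes>\<^bsub>Lambda G\<^esub> b1 \<otimes>\<^bsub>Lambda G\<^esub> theta r"
          using \<Lambda>.m_assoc[OF b assoc(1) theta_closed[OF assoc(2)]] by simp
        then show ?thesis unfolding assoc(4) smA_diff smA_frag
          using rels_assoc[OF Lambda_mult_closed[OF b assoc(1)] assoc(2,3)] by simp
      qed
      then show "w \<in> {w. smA b w \<in> NN}" using rels_NN by simp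
    qed
  qed (use AM.N in \<open>auto simp: smA_diff\<close>)
  then show ?thesis using w by blast
qed

sublocale M: module "Lambda G" "alexander_module G"
  unfolding alexander_module_eq
proof (rule AM.module_Q[OF cring_Lambda smA_FC smA_NN])
  fix r s w assume r: "r \<in> carrier (Lambda G)" and s: "s \<in> carrier (Lambda G)" and w: "w \<in> FC"
  show "smA (r \<oplus>\<^bsub>Lambda G\<^esub> s) w - (smA r w + smA s w) \<in> NN"
    using w
  proof (induction rule: FC_induct)
    case zero
    then show ?case using AM.N by simp
  next
    case (diff v w)
    have "smA (r \<oplus>\<^bsub>Lambda G\<^esub> s) (v - w) - (smA r (v - w) + smA s (v - w)) =
      (smA (r \<oplus>\<^bsub>Lambda G\<^esub> s) v - (smA r v + smA s v)) - (smA (r \<oplus>\<^bsub>Lambda G\<^esub> s) w - (smA r w + smA s w))"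
      by (simp add: smA_diff)
    then show ?case using AM.N(2)[OF diff.IH] by simp
  next
    case (frag b x)
    have "(r + s) \<otimes>\<^bsub>Lambda G\<^esub> b = r \<otimes>\<^bsub>Lambda G\<^esub> b + s \<otimes>\<^bsub>Lambda G\<^esub> b"
      using \<Lambda>.l_distr[OF r s frag(1)] by (simp only: add_group_ring)
    then show ?case
      using rels_NN[OF rels_left[OF Lambda_mult_closed[OF r frag(1)] Lambda_mult_closed[OF s frag(1)] frag(2)]]
      by (simp add: diff_diff_add)
  qed
  show "smA (r \<otimes>\<^bsub>Lambda G\<^esub> s) w = smA r (smA s w)"
    using w by (induction rule: FC_induct) (simp_all only: smA_zero smA_diff smA_frag \<Lambda>.m_assoc r s)
next
  fix w assume "w \<in> FC"
  then show "smA \<one>\<^bsub>Lambda G\<^esub> w = w"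
    by (induction rule: FC_induct) (simp_all only: smA_zero smA_diff smA_frag \<Lambda>.l_one)
qed (simp_all add: smA_add)

abbreviation AG :: "('a set set \<Rightarrow>\<^sub>0 int, (('a set set \<Rightarrow>\<^sub>0 int) \<times> ('a \<Rightarrow>\<^sub>0 int) \<Rightarrow>\<^sub>0 int) set) module" where
  "AG \<equiv> alexander_module G"

lemma carrier_AG: "carrier AG = AM.cl ` FC"
  by (simp only: alexander_module_eq AM.carrier_Q)

lemma add_AG: "AM.cl v \<oplus>\<^bsub>AG\<^esub> AM.cl w = AM.cl (v + w)"
  by (simp only: alexander_module_eq AM.add_Q)

lemma smult_AG: "\<lbrakk>b \<in> carrier (Lambda G); w \<in> FC\<rbrakk> \<Longrightarrow> b \<odot>\<^bsub>AG\<^esub> AM.cl w = AM.cl (smA b w)"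
  unfolding alexander_module_eq by (rule AM.smult_Q) (simp_all add: smA_NN smA_add del: carrier_group_ring)

section \<open>Linear maps from the Alexander module to the complex numbers\<close>

definition chi_linear :: "(nat \<Rightarrow> complex) \<Rightarrow> ((('a set set \<Rightarrow>\<^sub>0 int) \<times> ('a \<Rightarrow>\<^sub>0 int) \<Rightarrow>\<^sub>0 int) set \<Rightarrow> complex) \<Rightarrow> bool" where
  "chi_linear c F \<longleftrightarrow>
     (\<forall>y\<in>carrier AG. \<forall>z\<in>carrier AG. F (y \<oplus>\<^bsub>AG\<^esub> z) = F y + F z) \<and>
     (\<forall>b\<in>carrier (Lambda G). \<forall>y\<in>carrier AG. F (b \<odot>\<^bsub>AG\<^esub> y) = ch c b * F y)"

lemma chi_linear_add: "\<lbrakk>chi_linear c F; y \<in> carrier AG; z \<in> carrier AG\<rbrakk> \<Longrightarrow> F (y \<oplus>\<^bsub>AG\<^esub> z) = F y + F z"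
  unfolding chi_linear_def by blast

lemma chi_linear_smult: "\<lbrakk>chi_linear c F; b \<in> carrier (Lambda G); y \<in> carrier AG\<rbrakk> \<Longrightarrow> F (b \<odot>\<^bsub>AG\<^esub> y) = ch c b * F y"
  unfolding chi_linear_def by blast

lemma chi_linear_zero: "chi_linear c F \<Longrightarrow> F \<zero>\<^bsub>AG\<^esub> = 0"
  using chi_linear_add[of c F "\<zero>\<^bsub>AG\<^esub>" "\<zero>\<^bsub>AG\<^esub>"] by simp

lemma chi_linear_comb: "\<lbrakk>chi_linear c F; chi_linear c F'\<rbrakk> \<Longrightarrow> chi_linear c (\<lambda>y. a * F y + b * F' y)"
  unfolding chi_linear_def by (simp add: algebra_simps)

lemma cl_add_F: "\<lbrakk>chi_linear c F; v \<in> FC; w \<in> FC\<rbrakk> \<Longrightarrow> F (AM.cl (v + w)) = F (AM.cl v) + F (AM.cl w)"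
  using chi_linear_add[of c F "AM.cl v" "AM.cl w"] by (simp add: carrier_AG add_AG)

lemma cl_diff_F: "\<lbrakk>chi_linear c F; v \<in> FC; w \<in> FC\<rbrakk> \<Longrightarrow> F (AM.cl (v - w)) = F (AM.cl v) - F (AM.cl w)"
  using cl_add_F[of c F "v - w" w] FC_diff[of v w] by simp

text \<open>The map sending \<open>(b, x)\<close> to \<open>ch c b * extend_lin f x\<close> respects
  the three families of relations; the balancing relation is the one that uses the crossed
  rule.\<close>

lemma crossed_imp_chi_linear:
  assumes c: "c \<in> torus_points" and f: "crossed c f"
  shows "\<exists>F. chi_linear c F \<and> (\<forall>b\<in>carrier (Lambda G). \<forall>x\<in>IG. F (AM.cl (frag_of (b, x))) = ch c b * extend_lin f x)"
proof -
  define E where "E = lin (\<lambda>(b, x) z. of_int z * (ch c b * extend_lin f x))"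
  have E_add: "E (v + w) = E v + E w" for v w
    unfolding E_def by (rule lin_add) (auto simp: algebra_simps)
  have E_diff: "E (v - w) = E v - E w" for v w using E_add[of "v - w" w] by simp
  have E_zero: "E 0 = 0" by (simp add: E_def)
  have E_frag: "E (frag_of (b, x)) = ch c b * extend_lin f x" for b x
    unfolding E_def by (subst lin_single) auto
  have "NN \<subseteq> {w. E w = 0}"
  proof (rule NN_minimal)
    show "rels \<subseteq> {w. E w = 0}"
    proof
      fix w assume "w \<in> rels"
      then have "E w = 0"
      proof (cases rule: rels_cases)
        case (left b b' x)
        show ?thesis unfolding left(4) by (simp add: E_diff E_add E_frag ch_add algebra_simps)
      next
        case (right b x x')
        show ?thesis unfolding right(4) by (simp add: E_diff E_add E_frag extend_lin_add algebra_simps)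
      next
        case (assoc b r x)
        show ?thesis
          using extend_lin_mult[OF f assoc(2,3)] ch_mult[OF c assoc(1) theta_closed[OF assoc(2)]] ch_theta[OF assoc(2)]
          by (simp add: assoc(4) E_diff E_frag)
      qed
      then show "w \<in> {w. E w = 0}" by simp
    qed
  qed (simp_all add: E_zero E_diff)
  \<comment> \<open>The value at an arbitrary representative; it is well defined on cosets since
    \<open>E\<close> vanishes on \<open>NN\<close>.\<close>
  define F where "F K = E (SOME w. w \<in> K)" for K
  have F: "F (AM.cl w) = E w" for w
  proof -
    have "0 + w \<in> AM.cl w" unfolding AM.cl_def using AM.N(1) by (rule imageI)
    then have "(SOME v. v \<in> AM.cl w) \<in> AM.cl w" by (rule someI)
    then obtain v where "v \<in> NN" "(SOME v. v \<in> AM.cl w) = v + w" unfolding AM.cl_def by blast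
    then show ?thesis using \<open>NN \<subseteq> _\<close> by (auto simp: F_def E_add)
  qed
  have E_smA: "E (smA b w) = ch c b * E w" if b: "b \<in> carrier (Lambda G)" and "w \<in> FC" for b w
    using that(2)
  proof (induction rule: FC_induct)
    case (frag b' x)
    then show ?case using ch_mult[OF c b frag(1)] by (simp add: E_frag)
  qed (simp_all add: E_zero smA_diff E_diff algebra_simps)
  have "chi_linear c F" unfolding chi_linear_def
  proof (intro conjI ballI)
    fix y z assume "y \<in> carrier AG" "z \<in> carrier AG"
    then show "F (y \<oplus>\<^bsub>AG\<^esub> z) = F y + F z" by (auto simp: carrier_AG add_AG F E_add)
  next
    fix b y assume b: "b \<in> carrier (Lambda G)" and "y \<in> carrier AG"
    then obtain w where "w \<in> FC" "y = AM.cl w" unfolding carrier_AG by blast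
    then show "F (b \<odot>\<^bsub>AG\<^esub> y) = ch c b * F y" using smult_AG[OF b] E_smA[OF b] by (simp add: F)
  qed
  then show ?thesis using F E_frag by auto
qed

lemma chi_linear_frag:
  assumes F: "chi_linear c F" and b: "b \<in> carrier (Lambda G)" and x: "x \<in> IG"
  shows "F (AM.cl (frag_of (b, x))) = ch c b * F (AM.cl (frag_of (\<one>\<^bsub>Lambda G\<^esub>, x)))"
proof -
  have w: "frag_of (\<one>\<^bsub>Lambda G\<^esub>, x) \<in> FC" by (rule FC_frag[OF \<Lambda>.one_closed x])
  have "AM.cl (frag_of (b, x)) = b \<odot>\<^bsub>AG\<^esub> AM.cl (frag_of (\<one>\<^bsub>Lambda G\<^esub>, x))"
    using smult_AG[OF b w] \<Lambda>.r_one[OF b] by (simp only: smA_frag)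
  then show ?thesis using chi_linear_smult[OF F b] w unfolding carrier_AG by simp
qed

lemma chi_linear_frag_add:
  assumes F: "chi_linear c F" and x: "x \<in> IG" and y: "y \<in> IG"
  shows "F (AM.cl (frag_of (\<one>\<^bsub>Lambda G\<^esub>, x + y))) =
     F (AM.cl (frag_of (\<one>\<^bsub>Lambda G\<^esub>, x))) + F (AM.cl (frag_of (\<one>\<^bsub>Lambda G\<^esub>, y)))"
proof -
  let ?e = "\<lambda>x. frag_of (\<one>\<^bsub>Lambda G\<^esub>, x)"
  have "?e (x + y) - (?e x + ?e y) \<in> NN"
    using rels_NN[OF rels_right[OF \<Lambda>.one_closed x y]] by (simp only: diff_diff_add)
  then have "AM.cl (?e (x + y)) = AM.cl (?e x + ?e y)" by (simp only: AM.cl_eq_iff)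
  then show ?thesis using cl_add_F[OF F FC_frag[OF \<Lambda>.one_closed x] FC_frag[OF \<Lambda>.one_closed y]] by simp
qed

definition crossed_of :: "((('a set set \<Rightarrow>\<^sub>0 int) \<times> ('a \<Rightarrow>\<^sub>0 int) \<Rightarrow>\<^sub>0 int) set \<Rightarrow> complex) \<Rightarrow> 'a \<Rightarrow> complex" where
  "crossed_of F x = F (AM.cl (frag_of (\<one>\<^bsub>Lambda G\<^esub>, del x)))"

text \<open>Moving \<open>frag_of x\<close> across the tensor sign turns its action on
  \<open>y - 1\<close> into the scalar \<open>pt c x\<close>.\<close>

lemma crossed_crossed_of:
  assumes F: "chi_linear c F"
  shows "crossed c (crossed_of F)"
  unfolding crossed_def
proof (intro ballI)
  fix x y assume x: "x \<in> carrier G" and y: "y \<in> carrier G"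
  let ?e = "\<lambda>x. frag_of (\<one>\<^bsub>Lambda G\<^esub>, x)"
  have xZ: "frag_of x \<in> carrier ZG" using x by simp
  have "frag_of (\<one>\<^bsub>Lambda G\<^esub> \<otimes>\<^bsub>Lambda G\<^esub> theta (frag_of x), del y) - ?e (frag_of x \<otimes>\<^bsub>ZG\<^esub> del y) \<in> NN"
    by (rule rels_NN[OF rels_assoc[OF \<Lambda>.one_closed xZ del_in[OF y]]])
  then have "AM.cl (?e (frag_of x \<otimes>\<^bsub>ZG\<^esub> del y)) = AM.cl (frag_of (theta (frag_of x), del y))"
    using \<Lambda>.l_one[OF theta_closed[OF xZ]] AM.cl_eq_iff by metis
  then have "F (AM.cl (?e (frag_of x \<otimes>\<^bsub>ZG\<^esub> del y))) = ch c (theta (frag_of x)) * crossed_of F y"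
    using chi_linear_frag[OF F theta_closed[OF xZ] del_in[OF y]] by (simp only: crossed_of_def)
  also have "ch c (theta (frag_of x)) = pt c x" using ch_theta[OF xZ] by simp
  finally have "F (AM.cl (?e (frag_of x \<otimes>\<^bsub>ZG\<^esub> del y))) = pt c x * crossed_of F y" .
  then show "crossed_of F (x \<otimes> y) = crossed_of F x + pt c x * crossed_of F y"
    using chi_linear_frag_add[OF F del_in[OF x] IG_smult[OF xZ del_in[OF y]]] del_mult[OF x y]
    by (simp only: crossed_of_def)
qed

text \<open>\<open>AG\<close> is generated by the elements \<open>1 \<otimes> (x - 1)\<close>.\<close>

lemma chi_linear_eq_zero:
  assumes F: "chi_linear c F" and zero: "\<And>x. x \<in> carrier G \<Longrightarrow> crossed_of F x = 0" and y: "y \<in> carrier AG"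
  shows "F y = 0"
proof -
  let ?\<phi> = "\<lambda>x. F (AM.cl (frag_of (\<one>\<^bsub>Lambda G\<^esub>, x)))"
  have \<phi>_add: "?\<phi> (x + y) = ?\<phi> x + ?\<phi> y" if "x \<in> IG" "y \<in> IG" for x y
    by (rule chi_linear_frag_add[OF F that])
  have zeroI: "0 \<in> IG" by (simp add: IG_iff augmentation_def)
  have \<phi>_diff: "?\<phi> (x - y) = ?\<phi> x - ?\<phi> y" if "x \<in> IG" "y \<in> IG" for x y
    using \<phi>_add[OF IG_diff[OF that] that(2)] by simp
  have \<phi>0: "?\<phi> 0 = 0" using \<phi>_diff[OF zeroI zeroI] by simp
  \<comment> \<open>The induction runs over all of the group ring, whose elements need not have
    augmentation 0; subtracting the augmentation at the identity brings each of them into the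
    ideal.\<close>
  have key: "z - term_of \<one> (augmentation z) \<in> IG \<and> ?\<phi> (z - term_of \<one> (augmentation z)) = 0"
    if "supp z \<subseteq> carrier G" for z
    using that
  proof (induction z rule: free_Abelian_group_induct[consumes 1, case_names zero diff gen])
    case zero
    then show ?case using zeroI \<phi>0 by (simp add: augmentation_def)
  next
    case (diff x y)
    let ?x = "x - term_of \<one> (augmentation x)" and ?y = "y - term_of \<one> (augmentation y)"
    have eq: "x - y - term_of \<one> (augmentation (x - y)) = ?x - ?y"
      by (simp add: augmentation_diff single_diff)
    have xI: "?x \<in> IG" and yI: "?y \<in> IG" using diff.IH by blast+
    have "?\<phi> (?x - ?y) = ?\<phi> ?x - ?\<phi> ?y" by (rule \<phi>_diff[OF xI yI])
    also have "\<dots> = 0" using diff.IH by (simp only: diff_0_right)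
    finally show ?case unfolding eq using IG_diff[OF xI yI] by blast
  next
    case (gen x)
    then show ?case using del_in[of x] zero[of x] by (simp add: del_def crossed_of_def)
  qed
  have \<phi>: "?\<phi> x = 0" if "x \<in> IG" for x
  proof -
    have "x - term_of \<one> (augmentation x) = x" "supp x \<subseteq> carrier G" using that by (simp_all add: IG_iff)
    then show ?thesis using key[of x] by (simp only:)
  qed
  obtain w where w: "w \<in> FC" "y = AM.cl w" using y unfolding carrier_AG by blast
  have "F (AM.cl w) = 0" using w(1)
  proof (induction rule: FC_induct)
    case zero
    have "AM.cl 0 = \<zero>\<^bsub>AG\<^esub>" by (simp only: alexander_module_eq AM.cl_zero AM.zero_Q)
    then show ?case using chi_linear_zero[OF F] by simp
  next
    case (diff v w)
    then show ?case using cl_diff_F[OF F] by simp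
  next
    case (frag b x)
    then show ?case using chi_linear_frag[OF F frag] \<phi>[OF frag(2)] by simp
  qed
  then show ?thesis using w by simp
qed

end

section \<open>Presentations of the Alexander module\<close>

context fg_group
begin

definition comb :: "nat \<Rightarrow> (nat \<Rightarrow> _) \<Rightarrow> (nat \<Rightarrow> ('a set set \<Rightarrow>\<^sub>0 int)) \<Rightarrow> _" where
  "comb m x a = (\<Oplus>\<^bsub>AG\<^esub>j\<in>{..<m}. a j \<odot>\<^bsub>AG\<^esub> x j)"

lemma comb_terms:
  "\<lbrakk>x \<in> {..<m} \<rightarrow> carrier AG; a \<in> {..<m} \<rightarrow> carrier (Lambda G)\<rbrakk> \<Longrightarrow> (\<lambda>j. a j \<odot>\<^bsub>AG\<^esub> x j) \<in> {..<m} \<rightarrow> carrier AG"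
  using M.smult_closed by (auto simp del: carrier_group_ring)

lemma comb_closed:
  "\<lbrakk>x \<in> {..<m} \<rightarrow> carrier AG; a \<in> {..<m} \<rightarrow> carrier (Lambda G)\<rbrakk> \<Longrightarrow> comb m x a \<in> carrier AG"
  unfolding comb_def by (rule M.finsum_closed[OF comb_terms])

lemma comb_add:
  assumes x: "x \<in> {..<m} \<rightarrow> carrier AG" and a: "a \<in> {..<m} \<rightarrow> carrier (Lambda G)" and b: "b \<in> {..<m} \<rightarrow> carrier (Lambda G)"
  shows "comb m x (\<lambda>j. a j + b j) = comb m x a \<oplus>\<^bsub>AG\<^esub> comb m x b"
proof -
  have "comb m x (\<lambda>j. a j + b j) = (\<Oplus>\<^bsub>AG\<^esub>j\<in>{..<m}. a j \<odot>\<^bsub>AG\<^esub> x j \<oplus>\<^bsub>AG\<^esub> b j \<odot>\<^bsub>AG\<^esub> x j)"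
    unfolding comb_def
  proof (rule M.finsum_cong')
    show "(\<lambda>j. a j \<odot>\<^bsub>AG\<^esub> x j \<oplus>\<^bsub>AG\<^esub> b j \<odot>\<^bsub>AG\<^esub> x j) \<in> {..<m} \<rightarrow> carrier AG"
      using comb_terms[OF x a] comb_terms[OF x b] by (intro Pi_I M.add.m_closed) (auto simp: Pi_iff)
    fix j assume "j \<in> {..<m}"
    then have "a j \<in> carrier (Lambda G)" "b j \<in> carrier (Lambda G)" "x j \<in> carrier AG" using assms by blast+
    from M.smult_l_distr[OF this] show "(a j + b j) \<odot>\<^bsub>AG\<^esub> x j = a j \<odot>\<^bsub>AG\<^esub> x j \<oplus>\<^bsub>AG\<^esub> b j \<odot>\<^bsub>AG\<^esub> x j"
      by (simp only: add_group_ring)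
  qed simp
  also have "\<dots> = comb m x a \<oplus>\<^bsub>AG\<^esub> comb m x b"
    unfolding comb_def by (rule M.finsum_addf[OF comb_terms[OF x a] comb_terms[OF x b]])
  finally show ?thesis .
qed

lemma comb_smult:
  assumes x: "x \<in> {..<m} \<rightarrow> carrier AG" and a: "a \<in> {..<m} \<rightarrow> carrier (Lambda G)" and b: "b \<in> carrier (Lambda G)"
  shows "b \<odot>\<^bsub>AG\<^esub> comb m x a = comb m x (\<lambda>j. b \<otimes>\<^bsub>Lambda G\<^esub> a j)"
proof -
  have "b \<odot>\<^bsub>AG\<^esub> comb m x a = (\<Oplus>\<^bsub>AG\<^esub>j\<in>{..<m}. b \<odot>\<^bsub>AG\<^esub> (a j \<odot>\<^bsub>AG\<^esub> x j))"
    unfolding comb_def by (rule M.finsum_smult_ldistr[OF _ b comb_terms[OF x a]]) simp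
  also have "\<dots> = comb m x (\<lambda>j. b \<otimes>\<^bsub>Lambda G\<^esub> a j)" unfolding comb_def
  proof (rule M.finsum_cong')
    show "(\<lambda>j. (b \<otimes>\<^bsub>Lambda G\<^esub> a j) \<odot>\<^bsub>AG\<^esub> x j) \<in> {..<m} \<rightarrow> carrier AG"
      by (rule comb_terms[OF x]) (use a b Lambda_mult_closed in blast)
    fix j assume "j \<in> {..<m}"
    then have "a j \<in> carrier (Lambda G)" "x j \<in> carrier AG" using assms by blast+
    then show "b \<odot>\<^bsub>AG\<^esub> (a j \<odot>\<^bsub>AG\<^esub> x j) = (b \<otimes>\<^bsub>Lambda G\<^esub> a j) \<odot>\<^bsub>AG\<^esub> x j"
      using M.smult_assoc1[OF b] by simp
  qed simp
  finally show ?thesis .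
qed

definition basis_row :: "nat \<Rightarrow> nat \<Rightarrow> ('a set set \<Rightarrow>\<^sub>0 int)" where
  "basis_row i j = (if j = i then \<one>\<^bsub>Lambda G\<^esub> else \<zero>\<^bsub>Lambda G\<^esub>)"

lemma basis_row_closed: "basis_row i j \<in> carrier (Lambda G)"
  unfolding basis_row_def using \<Lambda>.one_closed \<Lambda>.zero_closed by (simp del: carrier_group_ring one_group_ring zero_group_ring)

lemma comb_basis_row:
  assumes x: "x \<in> {..<m} \<rightarrow> carrier AG" and i: "i < m"
  shows "comb m x (basis_row i) = x i"
proof -
  have xi: "x i \<in> carrier AG" using x i by blast
  have "comb m x (basis_row i) = basis_row i i \<odot>\<^bsub>AG\<^esub> x i"
    unfolding comb_def
  proof (rule M.finsum_single)
    show "(\<lambda>j. basis_row i j \<odot>\<^bsub>AG\<^esub> x j) \<in> {..<m} \<rightarrow> carrier AG"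
      by (rule comb_terms[OF x]) (use basis_row_closed in blast)
    fix j assume "j \<in> {..<m}" "j \<noteq> i"
    then have "x j \<in> carrier AG" "basis_row i j = \<zero>\<^bsub>Lambda G\<^esub>" using x by (auto simp: basis_row_def)
    then show "basis_row i j \<odot>\<^bsub>AG\<^esub> x j = \<zero>\<^bsub>AG\<^esub>" using M.smult_l_null by metis
  qed (use i in auto)
  also have "\<dots> = x i" unfolding basis_row_def using M.smult_one[OF xi] by (simp only: simp_thms if_True)
  finally show ?thesis .
qed

lemma chi_linear_comb_eq:
  assumes F: "chi_linear c F" and x: "x \<in> {..<m} \<rightarrow> carrier AG" and a: "a \<in> {..<m} \<rightarrow> carrier (Lambda G)"
  shows "F (comb m x a) = (\<Sum>j<m. ch c (a j) * F (x j))"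
proof -
  have "F (comb m x a) = (\<Sum>j<m. F (a j \<odot>\<^bsub>AG\<^esub> x j))"
    unfolding comb_def
    by (rule additive_finsum[OF M.abelian_monoid_axioms chi_linear_add[OF F] chi_linear_zero[OF F] _ comb_terms[OF x a]]) simp_all
  also have "\<dots> = (\<Sum>j<m. ch c (a j) * F (x j))"
    using x a by (intro sum.cong refl chi_linear_smult[OF F]) blast+
  finally show ?thesis .
qed

lemma ch_finsum_mult:
  fixes h :: nat
  assumes c: "c \<in> torus_points" and d: "d \<in> {..<h} \<rightarrow> carrier (Lambda G)" and P: "\<And>i. i < h \<Longrightarrow> P i \<in> carrier (Lambda G)"
  shows "ch c (\<Oplus>\<^bsub>Lambda G\<^esub>i\<in>{..<h}. d i \<otimes>\<^bsub>Lambda G\<^esub> P i) = (\<Sum>i<h. ch c (d i) * ch c (P i))"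
proof -
  have "ch c (\<Oplus>\<^bsub>Lambda G\<^esub>i\<in>{..<h}. d i \<otimes>\<^bsub>Lambda G\<^esub> P i) = (\<Sum>i<h. ch c (d i \<otimes>\<^bsub>Lambda G\<^esub> P i))"
  proof (rule additive_finsum[OF \<Lambda>.abelian_monoid_axioms])
    show "(\<lambda>i. d i \<otimes>\<^bsub>Lambda G\<^esub> P i) \<in> {..<h} \<rightarrow> carrier (Lambda G)"
      using d P by (intro Pi_I Lambda_mult_closed) blast+
  qed (simp_all add: ch_add)
  also have "\<dots> = (\<Sum>i<h. ch c (d i) * ch c (P i))"
    using d P by (intro sum.cong refl ch_mult[OF c]) blast+
  finally show ?thesis .
qed

text \<open>A linear map is determined by its values at the generators \<open>x j\<close>, and the
  possible values are the kernel vectors of the evaluated matrix. Independence of a pair is carried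
  along in both directions, so no dimensions are needed.\<close>

theorem presentation_kernel:
  assumes c: "c \<in> torus_points" and P: "is_presentation (Lambda G) AG m h P"
  shows "(\<exists>u v. kernel_vec h m (\<lambda>i j. ch c (P i j)) u \<and> kernel_vec h m (\<lambda>i j. ch c (P i j)) v \<and> independent_pair m u v)
    \<longleftrightarrow> (\<exists>f g. crossed c f \<and> crossed c g \<and> (\<forall>a b. (\<forall>x\<in>carrier G. a * f x + b * g x = 0) \<longrightarrow> a = 0 \<and> b = 0))"
    (is "?L \<longleftrightarrow> ?R")
proof -
  let ?A = "\<lambda>i j. ch c (P i j)"
  have "\<forall>i<h. \<forall>j<m. P i j \<in> carrier (Lambda G)"
    using P unfolding is_presentation_def by (rule conjunct1)
  then have Pc: "P i j \<in> carrier (Lambda G)" if "i < h" "j < m" for i j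
    using that by blast
  obtain x where x: "x \<in> {..<m} \<rightarrow> carrier AG"
    and span': "\<forall>y\<in>carrier AG. \<exists>a\<in>{..<m} \<rightarrow> carrier (Lambda G). y = comb m x a"
    and rel': "\<forall>a\<in>{..<m} \<rightarrow> carrier (Lambda G). comb m x a = \<zero>\<^bsub>AG\<^esub> \<longleftrightarrow>
        (\<exists>d\<in>{..<h} \<rightarrow> carrier (Lambda G). \<forall>j<m. a j = (\<Oplus>\<^bsub>Lambda G\<^esub>i\<in>{..<h}. d i \<otimes>\<^bsub>Lambda G\<^esub> P i j))"
    using P unfolding is_presentation_def comb_def[symmetric] by (elim conjE bexE) (rule that)
  note span = span'[rule_format] and rel = rel'[rule_format]
  have xj: "x j \<in> carrier AG" if "j < m" for j using x that by blast
  have F_ker: "kernel_vec h m ?A (\<lambda>j. F (x j))" if F: "chi_linear c F" for F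
    unfolding kernel_vec_def
  proof (intro allI impI)
    fix i assume i: "i < h"
    have row: "P i \<in> {..<m} \<rightarrow> carrier (Lambda G)" using Pc i by blast
    \<comment> \<open>Each row of \<open>P\<close> is itself a relation, with
      \<open>basis_row i\<close> as its coefficients.\<close>
    have "comb m x (P i) = \<zero>\<^bsub>AG\<^esub>"
    proof (subst rel[OF row], intro bexI[of _ "basis_row i"] allI impI)
      show "basis_row i \<in> {..<h} \<rightarrow> carrier (Lambda G)" using basis_row_closed by blast
      fix j assume j: "j < m"
      have "(\<Oplus>\<^bsub>Lambda G\<^esub>k\<in>{..<h}. basis_row i k \<otimes>\<^bsub>Lambda G\<^esub> P k j) = basis_row i i \<otimes>\<^bsub>Lambda G\<^esub> P i j"
      proof (rule \<Lambda>.finsum_single)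
        show "(\<lambda>k. basis_row i k \<otimes>\<^bsub>Lambda G\<^esub> P k j) \<in> {..<h} \<rightarrow> carrier (Lambda G)"
          using Pc j basis_row_closed by (intro Pi_I Lambda_mult_closed) blast+
        fix k assume "k \<in> {..<h}" "k \<noteq> i"
        then show "basis_row i k \<otimes>\<^bsub>Lambda G\<^esub> P k j = \<zero>\<^bsub>Lambda G\<^esub>"
          unfolding basis_row_def using \<Lambda>.l_null[OF Pc[of k j]] j by (simp only: simp_thms if_False lessThan_iff)
      qed (use i in auto)
      also have "\<dots> = P i j" unfolding basis_row_def using \<Lambda>.l_one[OF Pc[OF i j]] by (simp only: simp_thms if_True)
      finally show "P i j = (\<Oplus>\<^bsub>Lambda G\<^esub>k\<in>{..<h}. basis_row i k \<otimes>\<^bsub>Lambda G\<^esub> P k j)" by simp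
    qed
    then show "(\<Sum>j<m. ?A i j * F (x j)) = 0"
      using chi_linear_comb_eq[OF F x row] chi_linear_zero[OF F] by simp
  qed
  have F_zero: "F y = 0" if F: "chi_linear c F" and z: "\<forall>j<m. F (x j) = 0" and y: "y \<in> carrier AG" for F y
  proof -
    obtain a where a: "a \<in> {..<m} \<rightarrow> carrier (Lambda G)" "y = comb m x a" using span[OF y] by blast
    then show ?thesis using chi_linear_comb_eq[OF F x a(1)] z by simp
  qed
  have ker_F: "\<exists>F. chi_linear c F \<and> (\<forall>j<m. F (x j) = v j)" if v: "kernel_vec h m ?A v" for v
  proof -
    define E where "E a = (\<Sum>j<m. ch c (a j) * v j)" for a
    \<comment> \<open>Two expressions of the same element differ by a combination of rows of
      \<open>P\<close>, on which a kernel vector gives 0.\<close>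
    have wd: "E a = E b" if a: "a \<in> {..<m} \<rightarrow> carrier (Lambda G)" and b: "b \<in> {..<m} \<rightarrow> carrier (Lambda G)"
      and ab: "comb m x a = comb m x b" for a b
    proof -
      define d where "d j = a j - b j" for j
      have d: "d \<in> {..<m} \<rightarrow> carrier (Lambda G)"
      proof
        fix j assume "j \<in> {..<m}"
        then have "a j \<in> carrier (Lambda G)" "b j \<in> carrier (Lambda G)" using a b by blast+
        then show "d j \<in> carrier (Lambda G)" using keys_diff[of "a j" "b j"] by (auto simp: d_def)
      qed
      have "comb m x (\<lambda>j. d j + b j) = comb m x d \<oplus>\<^bsub>AG\<^esub> comb m x b" by (rule comb_add[OF x d b])
      then have "comb m x b = comb m x d \<oplus>\<^bsub>AG\<^esub> comb m x b" using ab by (simp add: d_def)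
      then have "comb m x d = \<zero>\<^bsub>AG\<^esub>"
        using M.add.r_cancel_one'[OF comb_closed[OF x b] comb_closed[OF x d]] by simp
      then obtain e where e: "e \<in> {..<h} \<rightarrow> carrier (Lambda G)"
        "\<forall>j<m. d j = (\<Oplus>\<^bsub>Lambda G\<^esub>i\<in>{..<h}. e i \<otimes>\<^bsub>Lambda G\<^esub> P i j)" using rel[OF d] by blast
      have "ch c (d j) = (\<Sum>i<h. ch c (e i) * ?A i j)" if "j < m" for j
        using e(2) that ch_finsum_mult[OF c e(1), of "\<lambda>i. P i j"] Pc by simp
      then have "E d = (\<Sum>j<m. \<Sum>i<h. ch c (e i) * (?A i j * v j))"
        by (simp add: E_def sum_distrib_right mult.assoc)
      also have "\<dots> = (\<Sum>i<h. ch c (e i) * (\<Sum>j<m. ?A i j * v j))"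
        by (subst sum.swap) (simp add: sum_distrib_left)
      also have "\<dots> = 0" using v by (simp add: kernel_vec_def)
      finally have "E d = 0" .
      moreover have "ch c (a j) = ch c (d j) + ch c (b j)" for j
        using ch_add[of c "d j" "b j"] by (simp add: d_def)
      then have "E a = E d + E b" by (simp add: E_def sum.distrib algebra_simps)
      ultimately show ?thesis by simp
    qed
    define rep where "rep y = (SOME a. a \<in> {..<m} \<rightarrow> carrier (Lambda G) \<and> y = comb m x a)" for y
    have rep: "rep y \<in> {..<m} \<rightarrow> carrier (Lambda G) \<and> y = comb m x (rep y)" if "y \<in> carrier AG" for y
    proof -
      have "\<exists>a. a \<in> {..<m} \<rightarrow> carrier (Lambda G) \<and> y = comb m x a" using span[OF that] by blast
      then show ?thesis unfolding rep_def by (rule someI_ex)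
    qed
    define F where "F y = E (rep y)" for y
    have F: "F (comb m x a) = E a" if a: "a \<in> {..<m} \<rightarrow> carrier (Lambda G)" for a
      unfolding F_def using rep[OF comb_closed[OF x a]] wd[OF _ a] by metis
    have "chi_linear c F" unfolding chi_linear_def
    proof (intro conjI ballI)
      fix y z assume "y \<in> carrier AG" "z \<in> carrier AG"
      then obtain a b where a: "a \<in> {..<m} \<rightarrow> carrier (Lambda G)" "y = comb m x a"
        and b: "b \<in> {..<m} \<rightarrow> carrier (Lambda G)" "z = comb m x b" using span by metis
      have ab: "(\<lambda>j. a j + b j) \<in> {..<m} \<rightarrow> carrier (Lambda G)"
        using a b by (intro Pi_I Lambda_add_closed) blast+
      have "F (y \<oplus>\<^bsub>AG\<^esub> z) = E (\<lambda>j. a j + b j)"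
        unfolding a(2) b(2) comb_add[OF x a(1) b(1), symmetric] by (rule F[OF ab])
      then show "F (y \<oplus>\<^bsub>AG\<^esub> z) = F y + F z"
        using F a b by (simp add: E_def ch_add algebra_simps sum.distrib)
    next
      fix r y assume r: "r \<in> carrier (Lambda G)" and "y \<in> carrier AG"
      then obtain a where a: "a \<in> {..<m} \<rightarrow> carrier (Lambda G)" "y = comb m x a" using span by metis
      have ra: "(\<lambda>j. r \<otimes>\<^bsub>Lambda G\<^esub> a j) \<in> {..<m} \<rightarrow> carrier (Lambda G)"
        using a r by (intro Pi_I Lambda_mult_closed) blast+
      have "F (r \<odot>\<^bsub>AG\<^esub> y) = E (\<lambda>j. r \<otimes>\<^bsub>Lambda G\<^esub> a j)"
        unfolding a(2) comb_smult[OF x a(1) r] by (rule F[OF ra])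
      also have "\<dots> = (\<Sum>j<m. ch c r * (ch c (a j) * v j))"
        unfolding E_def
      proof (intro sum.cong refl)
        fix j assume "j \<in> {..<m}"
        then have "a j \<in> carrier (Lambda G)" using a(1) by blast
        from ch_mult[OF c r this] show "ch c (r \<otimes>\<^bsub>Lambda G\<^esub> a j) * v j = ch c r * (ch c (a j) * v j)"
          by (simp only: mult.assoc)
      qed
      finally show "F (r \<odot>\<^bsub>AG\<^esub> y) = ch c r * F y"
        using F[OF a(1)] a(2) by (simp add: E_def sum_distrib_left)
    qed
    moreover have "F (x i) = v i" if i: "i < m" for i
    proof -
      have br: "basis_row i \<in> {..<m} \<rightarrow> carrier (Lambda G)" using basis_row_closed by blast
      have "F (x i) = E (basis_row i)" using F[OF br] comb_basis_row[OF x i] by simp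
      also have "\<dots> = (\<Sum>j<m. if j = i then v j else 0)"
        unfolding E_def by (intro sum.cong refl) (auto simp: basis_row_def ch_one)
      also have "\<dots> = v i" using i by simp
      finally show ?thesis .
    qed
    ultimately show ?thesis by blast
  qed
  show ?thesis
  proof
    assume ?L
    then obtain u v where uv: "kernel_vec h m ?A u" "kernel_vec h m ?A v" "independent_pair m u v" by blast
    obtain F where F: "chi_linear c F" "\<forall>j<m. F (x j) = u j" using ker_F[OF uv(1)] by blast
    obtain F' where F': "chi_linear c F'" "\<forall>j<m. F' (x j) = v j" using ker_F[OF uv(2)] by blast
    have "a = 0 \<and> b = 0" if ab: "\<forall>x\<in>carrier G. a * crossed_of F x + b * crossed_of F' x = 0" for a b
    proof -
      let ?H = "\<lambda>y. a * F y + b * F' y"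
      have "chi_linear c ?H" by (rule chi_linear_comb[OF F(1) F'(1)])
      moreover have "crossed_of ?H x = 0" if "x \<in> carrier G" for x
        using ab that by (simp add: crossed_of_def)
      ultimately have "?H y = 0" if "y \<in> carrier AG" for y using chi_linear_eq_zero that by blast
      then have "\<forall>j<m. a * u j + b * v j = 0" using F(2) F'(2) xj by metis
      then show ?thesis using uv(3) unfolding independent_pair_def by blast
    qed
    then show ?R using crossed_crossed_of[OF F(1)] crossed_crossed_of[OF F'(1)] by blast
  next
    assume ?R
    then obtain f g where fg: "crossed c f" "crossed c g"
      "\<And>a b. (\<forall>x\<in>carrier G. a * f x + b * g x = 0) \<Longrightarrow> a = 0 \<and> b = 0" by blast
    obtain F where F: "chi_linear c F"
      "\<forall>b\<in>carrier (Lambda G). \<forall>x\<in>IG. F (AM.cl (frag_of (b, x))) = ch c b * extend_lin f x"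
      using crossed_imp_chi_linear[OF c fg(1)] by blast
    obtain F' where F': "chi_linear c F'"
      "\<forall>b\<in>carrier (Lambda G). \<forall>x\<in>IG. F' (AM.cl (frag_of (b, x))) = ch c b * extend_lin g x"
      using crossed_imp_chi_linear[OF c fg(2)] by blast
    have crossed_one: "f \<one> = 0" if "crossed c f" for f
    proof -
      have "f (\<one> \<otimes> \<one>) = f \<one> + pt c \<one> * f \<one>" using that one_closed unfolding crossed_def by blast
      moreover have "pt c \<one> = 1" using char_torus_one[OF is_group pt_in[OF c]] .
      ultimately show ?thesis by simp
    qed
    have ev: "crossed_of H y = k y" if "crossed c k" "y \<in> carrier G"
      "\<forall>b\<in>carrier (Lambda G). \<forall>x\<in>IG. H (AM.cl (frag_of (b, x))) = ch c b * extend_lin k x" for H k y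
    proof -
      have "H (AM.cl (frag_of (\<one>\<^bsub>Lambda G\<^esub>, del y))) = ch c \<one>\<^bsub>Lambda G\<^esub> * extend_lin k (del y)"
        using that(3) \<Lambda>.one_closed del_in[OF that(2)] by blast
      then show ?thesis using crossed_one[OF that(1)] by (simp add: crossed_of_def ch_one del_def extend_lin_diff)
    qed
    have "independent_pair m (\<lambda>j. F (x j)) (\<lambda>j. F' (x j))" unfolding independent_pair_def
    proof (intro allI impI)
      fix a b assume ab: "\<forall>j<m. a * F (x j) + b * F' (x j) = 0"
      let ?H = "\<lambda>y. a * F y + b * F' y"
      have H: "chi_linear c ?H" by (rule chi_linear_comb[OF F(1) F'(1)])
      have "a * f y + b * g y = 0" if y: "y \<in> carrier G" for y
      proof -
        have "AM.cl (frag_of (\<one>\<^bsub>Lambda G\<^esub>, del y)) \<in> carrier AG"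
          unfolding carrier_AG by (rule imageI) (rule FC_frag[OF \<Lambda>.one_closed del_in[OF y]])
        from F_zero[OF H ab this] show ?thesis
          using ev[OF fg(1) y F(2)] ev[OF fg(2) y F'(2)] by (simp only: crossed_of_def)
      qed
      then show "a = 0 \<and> b = 0" using fg(3) by blast
    qed
    then show ?L using F_ker[OF F(1)] F_ker[OF F'(1)] by blast
  qed
qed

end

section \<open>First homology\<close>

definition sc :: "complex \<Rightarrow> ('x \<Rightarrow>\<^sub>0 complex) \<Rightarrow> ('x \<Rightarrow>\<^sub>0 complex)" where
  "sc a = Poly_Mapping.map ((*) a)"

lemma coef_sc [simp]: "coef (sc a f) x = a * coef f x"
  by (simp add: sc_def Poly_Mapping.map.rep_eq when_def)

lemma sc_add: "sc a (f + g) = sc a f + sc a g"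
  by (rule poly_mapping_eqI) (simp add: lookup_add algebra_simps)

lemma sc_diff: "sc a (f - g) = sc a f - sc a g"
  by (rule poly_mapping_eqI) (simp add: lookup_minus algebra_simps)

lemma sc_add_left: "sc (a + b) f = sc a f + sc b f"
  by (rule poly_mapping_eqI) (simp add: lookup_add algebra_simps)

lemma sc_sc: "sc a (sc b f) = sc (a * b) f"
  by (rule poly_mapping_eqI) simp

lemma sc_one [simp]: "sc 1 f = f"
  by (rule poly_mapping_eqI) simp

lemma sc_zero [simp]: "sc 0 f = 0" "sc a 0 = 0"
  by (rule poly_mapping_eqI, simp)+

lemma sc_term_of [simp]: "sc a (term_of x b) = term_of x (a * b)"
  by (rule poly_mapping_eqI) (simp add: lookup_single when_def)

lemma supp_sc: "supp (sc a f) \<subseteq> supp f"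
  by (auto simp: in_keys_iff)

lemma sc_sum: "sc a (sum F I) = (\<Sum>i\<in>I. sc a (F i))"
  by (induction I rule: infinite_finite_induct) (simp_all add: sc_add)

lemma lin_sc:
  assumes "\<And>x. h x 0 = (0::complex)" "\<And>x b. h x (a * b) = a * h x b"
  shows "lin h (sc a f) = a * lin h f"
proof -
  have "lin h (sc a f) = (\<Sum>x\<in>supp f. h x (coef (sc a f) x))"
    by (rule lin_superset[OF finite_keys supp_sc]) (rule assms)
  then show ?thesis by (simp add: assms lin_def sum_distrib_left)
qed

interpretation scv: vector_space "sc :: complex \<Rightarrow> ('x \<Rightarrow>\<^sub>0 complex) \<Rightarrow> ('x \<Rightarrow>\<^sub>0 complex)"
  by unfold_locales (simp_all add: sc_add sc_add_left sc_sc)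

interpretation cv: vector_space "(*) :: complex \<Rightarrow> complex \<Rightarrow> complex"
  by unfold_locales (simp_all add: algebra_simps)

interpretation scp: vector_space_pair "sc :: complex \<Rightarrow> ('x \<Rightarrow>\<^sub>0 complex) \<Rightarrow> ('x \<Rightarrow>\<^sub>0 complex)"
    "(*) :: complex \<Rightarrow> complex \<Rightarrow> complex"
  by unfold_locales

text \<open>Duality in any dimension: \<open>z\<close> is independent of a basis of
  \<open>B\<close>, so a functional can be prescribed as 1 at \<open>z\<close> and 0 on the
  basis.\<close>

lemma separating_functional:
  fixes B :: "('x \<Rightarrow>\<^sub>0 complex) set"
  assumes B: "0 \<in> B" "\<And>v w. \<lbrakk>v \<in> B; w \<in> B\<rbrakk> \<Longrightarrow> v + w \<in> B" "\<And>a v. v \<in> B \<Longrightarrow> sc a v \<in> B"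
    and z: "z \<notin> B"
  shows "\<exists>\<phi>. (\<forall>v w. \<phi> (v + w) = \<phi> v + \<phi> w) \<and> (\<forall>a v. \<phi> (sc a v) = a * \<phi> v) \<and> (\<forall>v\<in>B. \<phi> v = 0) \<and> \<phi> z = (1::complex)"
proof -
  have sub: "scv.subspace B" unfolding scv.subspace_def using B by blast
  obtain K where K: "K \<subseteq> B" "scv.independent K" "B \<subseteq> scv.span K" by (rule scv.maximal_independent_subset)
  have "scv.span K \<subseteq> B" by (rule scv.span_minimal[OF K(1) sub])
  then have zK: "z \<notin> scv.span K" using z by blast
  then have ind: "scv.independent (insert z K)" using K(2) by (rule scv.independent_insertI)
  obtain \<phi> where \<phi>: "Vector_Spaces.linear sc (*) \<phi>" "\<forall>v\<in>insert z K. \<phi> v = (if v = z then 1 else 0)"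
    using scp.linear_independent_extend[OF ind, of "\<lambda>v. if v = z then 1 else 0"] by blast
  have "z \<notin> K" using zK scv.span_base by blast
  then have "\<phi> v = 0" if "v \<in> K" for v using \<phi>(2) that by auto
  then have "\<phi> v = 0" if "v \<in> B" for v
    using scp.linear_eq_0_on_span[OF \<phi>(1), of K v] K(3) that by blast
  moreover have "\<phi> z = 1" using \<phi>(2) by simp
  moreover have "\<phi> (v + w) = \<phi> v + \<phi> w" for v w using scp.linear_add[OF \<phi>(1)] .
  moreover have "\<phi> (sc a v) = a * \<phi> v" for a v using scp.linear_scale[OF \<phi>(1)] .
  ultimately show ?thesis by blast
qed

section \<open>Cycles and boundaries in degree one\<close>

context fg_group
begin

definition C1 :: "('a list \<Rightarrow>\<^sub>0 complex) set" where
  "C1 = {w. supp w \<subseteq> {xs. length xs = 1 \<and> set xs \<subseteq> carrier G}}"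

definition bdry :: "(nat \<Rightarrow> complex) \<Rightarrow> ('a list \<Rightarrow>\<^sub>0 complex) \<Rightarrow> ('a list \<Rightarrow>\<^sub>0 complex)" where
  "bdry c = bar_boundary G (pt c)"

definition Z1 :: "(nat \<Rightarrow> complex) \<Rightarrow> ('a list \<Rightarrow>\<^sub>0 complex) set" where
  "Z1 c = {w \<in> C1. bdry c w = 0}"

definition B1 :: "(nat \<Rightarrow> complex) \<Rightarrow> ('a list \<Rightarrow>\<^sub>0 complex) set" where
  "B1 c = bdry c ` carrier (bar_chains G 2)"

text \<open>The boundary of the bar symbol \<open>[x, y]\<close>. A linear functional on 1-chains
  kills all of these exactly if its values on the symbols \<open>[x]\<close> form a crossed
  homomorphism.\<close>

definition sym2 :: "(nat \<Rightarrow> complex) \<Rightarrow> 'a \<Rightarrow> 'a \<Rightarrow> ('a list \<Rightarrow>\<^sub>0 complex)" where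
  "sym2 c x y = term_of [y] (pt c x) - term_of [x \<otimes> y] 1 + term_of [x] 1"

lemma bdry_eq_lin: "bdry c = lin (\<lambda>xs a. sc a (bar_boundary_symbol G (pt c) xs))"
  by (simp add: fun_eq_iff bdry_def bar_boundary_def lin_def sc_def)

lemma bdry_add: "bdry c (v + w) = bdry c v + bdry c w"
  unfolding bdry_eq_lin by (rule lin_add) (simp_all add: sc_add_left)

lemma bdry_single: "bdry c (term_of xs a) = sc a (bar_boundary_symbol G (pt c) xs)"
  unfolding bdry_eq_lin by (rule lin_single) simp

lemma bdry_sc: "bdry c (sc a w) = sc a (bdry c w)"
proof -
  have "bdry c (sc a w) = (\<Sum>x\<in>supp w. sc (coef (sc a w) x) (bar_boundary_symbol G (pt c) x))"
    unfolding bdry_eq_lin by (rule lin_superset[OF finite_keys supp_sc]) simp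
  also have "\<dots> = sc a (bdry c w)" unfolding bdry_eq_lin lin_def by (simp add: sc_sum sc_sc)
  finally show ?thesis .
qed

lemma bdry_zero [simp]: "bdry c 0 = 0"
  by (simp add: bdry_eq_lin)

lemma symbol1: "bar_boundary_symbol G (pt c) [x] = term_of [] (pt c x - 1)"
  by (simp add: single_diff single_uminus)

lemma symbol2: "bar_boundary_symbol G (pt c) [x, y] = sym2 c x y"
  by (simp add: sym2_def single_uminus)

definition lf :: "('a \<Rightarrow> complex) \<Rightarrow> ('a list \<Rightarrow>\<^sub>0 complex) \<Rightarrow> complex" where
  "lf f = lin (\<lambda>xs a. a * f (hd xs))"

lemma lf_add: "lf f (v + w) = lf f v + lf f w"
  unfolding lf_def by (rule lin_add) (simp_all add: algebra_simps)

lemma lf_diff: "lf f (v - w) = lf f v - lf f w"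
  using lf_add[of f "v - w" w] by simp

lemma lf_single [simp]: "lf f (term_of xs a) = a * f (hd xs)"
  unfolding lf_def by (rule lin_single) simp

lemma lf_sc: "lf f (sc a w) = a * lf f w"
  unfolding lf_def by (rule lin_sc) simp_all

lemma lf_sum: "lf f (sum F I) = (\<Sum>i\<in>I. lf f (F i))"
  by (induction I rule: infinite_finite_induct) (simp_all add: lf_add, simp_all add: lf_def)

lemma C1_E: "\<lbrakk>w \<in> C1; xs \<in> supp w\<rbrakk> \<Longrightarrow> \<exists>x\<in>carrier G. xs = [x]"
proof -
  assume "w \<in> C1" "xs \<in> supp w"
  then have "length xs = 1" "set xs \<subseteq> carrier G" by (auto simp: C1_def)
  then show ?thesis by (cases xs) auto
qed

lemma C1_single: "x \<in> carrier G \<Longrightarrow> term_of [x] a \<in> C1"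
  by (simp add: C1_def)

lemma C1_add: "\<lbrakk>v \<in> C1; w \<in> C1\<rbrakk> \<Longrightarrow> v + w \<in> C1"
  unfolding C1_def using Poly_Mapping.keys_add[of v w] by blast

lemma C1_diff: "\<lbrakk>v \<in> C1; w \<in> C1\<rbrakk> \<Longrightarrow> v - w \<in> C1"
  unfolding C1_def using keys_diff[of v w] by blast

lemma C1_sc: "w \<in> C1 \<Longrightarrow> sc a w \<in> C1"
  unfolding C1_def using supp_sc[of a w] by blast

lemma C1_zero: "0 \<in> C1"
  by (simp add: C1_def)

lemma bdry_C1: "w \<in> C1 \<Longrightarrow> bdry c w = term_of [] (lf (\<lambda>x. pt c x - 1) w)"
proof -
  assume w: "w \<in> C1"
  have add: "term_of [] (sum F I) = (\<Sum>i\<in>I. term_of [] (F i))" for F :: "'a list \<Rightarrow> complex" and I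
    by (induction I rule: infinite_finite_induct) (simp_all add: single_add)
  have "bdry c w = (\<Sum>xs\<in>supp w. term_of [] (coef w xs * (pt c (hd xs) - 1)))"
    unfolding bdry_eq_lin lin_def
  proof (intro sum.cong refl)
    fix xs assume "xs \<in> supp w"
    then obtain x where "xs = [x]" using C1_E[OF w] by blast
    then show "sc (coef w xs) (bar_boundary_symbol G (pt c) xs) = term_of [] (coef w xs * (pt c (hd xs) - 1))"
      by (simp only: symbol1 sc_term_of list.sel)
  qed
  then show ?thesis by (simp add: lf_def lin_def add)
qed

lemma Z1_iff: "w \<in> Z1 c \<longleftrightarrow> w \<in> C1 \<and> lf (\<lambda>x. pt c x - 1) w = 0"
proof -
  have eq: "term_of [] a = (0 :: 'a list \<Rightarrow>\<^sub>0 complex) \<longleftrightarrow> a = 0" for a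
    by (metis lookup_single_eq single_zero lookup_zero)
  have "bdry c w = 0 \<longleftrightarrow> lf (\<lambda>x. pt c x - 1) w = 0" if "w \<in> C1"
    unfolding bdry_C1[OF that] by (rule eq)
  then show ?thesis unfolding Z1_def by blast
qed

lemma sym2_B1: "\<lbrakk>x \<in> carrier G; y \<in> carrier G\<rbrakk> \<Longrightarrow> sym2 c x y \<in> B1 c"
proof -
  assume xy: "x \<in> carrier G" "y \<in> carrier G"
  have "bdry c (term_of [x, y] 1) = sym2 c x y" by (simp only: bdry_single symbol2 sc_one)
  moreover have "term_of [x, y] 1 \<in> carrier (bar_chains G 2)" using xy by (simp add: bar_chains_def)
  ultimately show ?thesis unfolding B1_def by (metis imageI)
qed

lemma B1_induct:
  assumes S: "0 \<in> S" "\<And>v w. \<lbrakk>v \<in> S; w \<in> S\<rbrakk> \<Longrightarrow> v + w \<in> S" "\<And>a v. v \<in> S \<Longrightarrow> sc a v \<in> S"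
    and sym: "\<And>x y. \<lbrakk>x \<in> carrier G; y \<in> carrier G\<rbrakk> \<Longrightarrow> sym2 c x y \<in> S"
  shows "B1 c \<subseteq> S"
proof
  fix w assume "w \<in> B1 c"
  then obtain v where v: "supp v \<subseteq> {xs. length xs = 2 \<and> set xs \<subseteq> carrier G}" "w = bdry c v"
    by (auto simp: B1_def bar_chains_def)
  have sum: "sum F I \<in> S" if "\<And>i. i \<in> I \<Longrightarrow> F i \<in> S" for F :: "'a list \<Rightarrow> _" and I
    using that by (induction I rule: infinite_finite_induct) (simp_all add: S)
  show "w \<in> S" unfolding v(2) bdry_eq_lin lin_def
  proof (rule sum)
    fix xs assume "xs \<in> supp v"
    then have "length xs = 2" "set xs \<subseteq> carrier G" using v(1) by auto
    then obtain x y where "xs = [x, y]" "x \<in> carrier G" "y \<in> carrier G"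
      by (auto simp: numeral_2_eq_2 length_Suc_conv)
    then show "sc (coef v xs) (bar_boundary_symbol G (pt c) xs) \<in> S"
      using S(3)[OF sym] by (simp only: symbol2)
  qed
qed

lemma B1_zero: "0 \<in> B1 c"
proof -
  have "0 \<in> carrier (bar_chains G 2)" by (simp add: bar_chains_def)
  then show ?thesis unfolding B1_def by (metis bdry_zero imageI)
qed

lemma B1_add: "\<lbrakk>v \<in> B1 c; w \<in> B1 c\<rbrakk> \<Longrightarrow> v + w \<in> B1 c"
proof -
  assume "v \<in> B1 c" "w \<in> B1 c"
  then obtain v' w' where vw: "v' \<in> carrier (bar_chains G 2)" "v = bdry c v'" "w' \<in> carrier (bar_chains G 2)" "w = bdry c w'"
    by (auto simp: B1_def)
  have "v' + w' \<in> carrier (bar_chains G 2)"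
    using vw Poly_Mapping.keys_add[of v' w'] by (auto simp: bar_chains_def)
  moreover have "v + w = bdry c (v' + w')" using vw by (simp add: bdry_add)
  ultimately show ?thesis unfolding B1_def by (rule rev_image_eqI)
qed

lemma B1_sc: "w \<in> B1 c \<Longrightarrow> sc a w \<in> B1 c"
proof -
  assume "w \<in> B1 c"
  then obtain w' where w: "w' \<in> carrier (bar_chains G 2)" "w = bdry c w'" by (auto simp: B1_def)
  have "sc a w' \<in> carrier (bar_chains G 2)"
    using w supp_sc[of a w'] by (auto simp: bar_chains_def)
  moreover have "sc a w = bdry c (sc a w')" using w by (simp add: bdry_sc)
  ultimately show ?thesis unfolding B1_def by (rule rev_image_eqI)
qed

lemma sc_minus_one: "sc (- 1) w = - w"
  by (rule poly_mapping_eqI) simp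

lemma B1_diff: "\<lbrakk>v \<in> B1 c; w \<in> B1 c\<rbrakk> \<Longrightarrow> v - w \<in> B1 c"
  using B1_add[of v c "sc (- 1) w"] B1_sc[of w c "- 1"] by (simp add: sc_minus_one)

lemma lf_sym2: "lf f (sym2 c x y) = pt c x * f y - f (x \<otimes> y) + f x"
  by (simp add: sym2_def lf_add lf_diff)

lemma crossed_lf_B1:
  assumes "crossed c f" "w \<in> B1 c"
  shows "lf f w = 0"
proof -
  have "B1 c \<subseteq> {w. lf f w = 0}"
    by (rule B1_induct) (use assms(1) in \<open>auto simp: lf_add lf_sc lf_sym2 crossed_def, simp add: lf_def\<close>)
  then show ?thesis using assms(2) by blast
qed

lemma crossed_pt_minus_one:
  assumes "c \<in> torus_points"
  shows "crossed c (\<lambda>x. pt c x - 1)"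
  unfolding crossed_def using char_torus_mult[OF pt_in[OF assms]] by (simp add: algebra_simps)

lemma B1_subset_Z1:
  assumes c: "c \<in> torus_points"
  shows "B1 c \<subseteq> Z1 c"
proof
  fix w assume w: "w \<in> B1 c"
  have "B1 c \<subseteq> C1"
    by (rule B1_induct) (simp_all add: C1_zero C1_add C1_sc sym2_def C1_diff C1_single)
  then show "w \<in> Z1 c" unfolding Z1_iff using crossed_lf_B1[OF crossed_pt_minus_one[OF c] w] w by blast
qed

text \<open>A functional that kills the boundaries but not some cycle gives a crossed homomorphism
  \<open>f\<close>; it is no multiple of \<open>pt c x - 1\<close>, because the latter kills all
  cycles. Conversely, if every cycle is a boundary, \<open>f\<close> vanishes on the kernel of the
  functional given by \<open>pt c x - 1\<close>, and is therefore a multiple of it.\<close>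

theorem Z1_neq_B1_iff:
  assumes c: "c \<in> torus_points"
  shows "Z1 c \<noteq> B1 c \<longleftrightarrow> (\<exists>f. crossed c f \<and> (\<nexists>k. \<forall>x\<in>carrier G. f x = k * (pt c x - 1)))"
proof
  assume "Z1 c \<noteq> B1 c"
  then obtain z where z: "z \<in> Z1 c" "z \<notin> B1 c" using B1_subset_Z1[OF c] by blast
  obtain \<phi> where \<phi>: "\<And>v w. \<phi> (v + w) = \<phi> v + \<phi> w" "\<And>a v. \<phi> (sc a v) = a * \<phi> v" "\<And>v. v \<in> B1 c \<Longrightarrow> \<phi> v = 0" "\<phi> z = (1::complex)"
    using separating_functional[OF B1_zero B1_add B1_sc z(2)] by blast
  define f where "f x = \<phi> (term_of [x] 1)" for x
  have \<phi>_sum: "\<phi> (sum F I) = (\<Sum>i\<in>I. \<phi> (F i))" for F :: "'a list \<Rightarrow> _" and I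
    using \<phi>(3)[OF B1_zero] by (induction I rule: infinite_finite_induct) (simp_all add: \<phi>(1))
  have \<phi>_single: "\<phi> (term_of [x] a) = a * f x" for x a
    using \<phi>(2)[of a "term_of [x] 1"] by (simp add: f_def)
  have \<phi>_lf: "\<phi> w = lf f w" if w: "w \<in> C1" for w
  proof -
    have "\<phi> w = \<phi> (\<Sum>xs\<in>supp w. term_of xs (coef w xs))" by (simp only: sum_terms)
    also have "\<dots> = (\<Sum>xs\<in>supp w. coef w xs * f (hd xs))"
      unfolding \<phi>_sum
    proof (intro sum.cong refl)
      fix xs assume "xs \<in> supp w"
      then obtain x where "xs = [x]" using C1_E[OF w] by blast
      then show "\<phi> (term_of xs (coef w xs)) = coef w xs * f (hd xs)" by (simp add: \<phi>_single)
    qed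
    finally show ?thesis by (simp add: lf_def lin_def)
  qed
  have "crossed c f" unfolding crossed_def
  proof (intro ballI)
    fix x y assume xy: "x \<in> carrier G" "y \<in> carrier G"
    have "sym2 c x y \<in> C1" using xy by (simp add: sym2_def C1_add C1_diff C1_single)
    then have "lf f (sym2 c x y) = 0" using \<phi>(3)[OF sym2_B1[OF xy]] \<phi>_lf by simp
    then show "f (x \<otimes> y) = f x + pt c x * f y" by (simp add: lf_sym2 algebra_simps)
  qed
  moreover have False if k: "\<forall>x\<in>carrier G. f x = k * (pt c x - 1)" for k
  proof -
    have zC: "z \<in> C1" "lf (\<lambda>x. pt c x - 1) z = 0" using z(1) by (auto simp: Z1_iff)
    have "lf f z = (\<Sum>xs\<in>supp z. k * (coef z xs * (pt c (hd xs) - 1)))"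
      unfolding lf_def lin_def
    proof (intro sum.cong refl)
      fix xs assume "xs \<in> supp z"
      then obtain x where "x \<in> carrier G" "xs = [x]" using C1_E[OF zC(1)] by blast
      then show "coef z xs * f (hd xs) = k * (coef z xs * (pt c (hd xs) - 1))" using k by simp
    qed
    also have "\<dots> = k * lf (\<lambda>x. pt c x - 1) z" by (simp add: lf_def lin_def sum_distrib_left)
    finally show False using zC \<phi>_lf[OF zC(1)] \<phi>(4) by simp
  qed
  ultimately show "\<exists>f. crossed c f \<and> (\<nexists>k. \<forall>x\<in>carrier G. f x = k * (pt c x - 1))" by blast
next
  assume "\<exists>f. crossed c f \<and> (\<nexists>k. \<forall>x\<in>carrier G. f x = k * (pt c x - 1))"
  then obtain f where f: "crossed c f" "\<nexists>k. \<forall>x\<in>carrier G. f x = k * (pt c x - 1)" by blast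
  show "Z1 c \<noteq> B1 c"
  proof
    assume "Z1 c = B1 c"
    then have zero: "lf f z = 0" if "z \<in> C1" "lf (\<lambda>x. pt c x - 1) z = 0" for z
      using crossed_lf_B1[OF f(1)] that Z1_iff by blast
    show False
    proof (cases "\<forall>x\<in>carrier G. pt c x = 1")
      case True
      have "f x = 0 * (pt c x - 1)" if x: "x \<in> carrier G" for x
        using zero[OF C1_single[OF x, of 1]] True x by simp
      then show False using f(2) by blast
    next
      case False
      then obtain s where s: "s \<in> carrier G" "pt c s \<noteq> 1" by blast
      have "f x = f s / (pt c s - 1) * (pt c x - 1)" if x: "x \<in> carrier G" for x
      proof -
        \<comment> \<open>The combination of \<open>[x]\<close> and \<open>[s]\<close> that is a
          cycle; \<open>f\<close> vanishes on it, which yields the factor of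
          proportionality.\<close>
        define z where "z = term_of [x] 1 - term_of [s] ((pt c x - 1) / (pt c s - 1))"
        have "z \<in> C1" unfolding z_def by (intro C1_diff C1_single x s)
        moreover have "lf (\<lambda>x. pt c x - 1) z = 0" using s by (simp add: z_def lf_diff)
        ultimately have "lf f z = 0" by (rule zero)
        then show ?thesis by (simp add: z_def lf_diff algebra_simps)
      qed
      then show False using f(2) by blast
    qed
  qed
qed

text \<open>Modulo boundaries \<open>[x \<otimes> y]\<close> equals \<open>[x]\<close> plus
  \<open>pt c x\<close> times \<open>[y]\<close>, and inverses reduce in the same way, so the
  symbols of generators of \<open>G\<close> span.\<close>

lemma C1_finitely_spanned:
  assumes c: "c \<in> torus_points" and S: "S \<subseteq> carrier G" "generate G S = carrier G" and w: "w \<in> C1"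
  shows "\<exists>u. supp u \<subseteq> (\<lambda>s. [s]) ` S \<and> w - u \<in> B1 c"
proof -
  let ?\<rho> = "pt c"
  define H where "H = {w. \<exists>u. supp u \<subseteq> (\<lambda>s. [s]) ` S \<and> w - u \<in> B1 c}"
  have HI: "w \<in> H" if "supp u \<subseteq> (\<lambda>s. [s]) ` S" "w - u \<in> B1 c" for w u using that unfolding H_def by blast
  have Hadd: "v + w \<in> H" if "v \<in> H" "w \<in> H" for v w
  proof -
    from that obtain u u' where u: "supp u \<subseteq> (\<lambda>s. [s]) ` S" "v - u \<in> B1 c" "supp u' \<subseteq> (\<lambda>s. [s]) ` S" "w - u' \<in> B1 c"
      unfolding H_def by blast
    have "supp (u + u') \<subseteq> (\<lambda>s. [s]) ` S" using u Poly_Mapping.keys_add[of u u'] by blast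
    moreover have "v + w - (u + u') \<in> B1 c" using B1_add[OF u(2,4)] by (simp add: algebra_simps)
    ultimately show ?thesis by (rule HI)
  qed
  have Hsc: "sc a w \<in> H" if "w \<in> H" for a w
  proof -
    from that obtain u where u: "supp u \<subseteq> (\<lambda>s. [s]) ` S" "w - u \<in> B1 c" unfolding H_def by blast
    have "supp (sc a u) \<subseteq> (\<lambda>s. [s]) ` S" using u(1) supp_sc[of a u] by blast
    moreover have "sc a w - sc a u \<in> B1 c" using B1_sc[OF u(2), of a] by (simp add: sc_diff)
    ultimately show ?thesis by (rule HI)
  qed
  have HB: "w \<in> H" if "w \<in> B1 c" for w by (rule HI[of 0]) (use that in simp_all)
  have one: "pt c \<one> = 1" using char_torus_one[OF is_group pt_in[OF c]] .
  have H1: "term_of [\<one>] 1 \<in> H"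
  proof -
    have "sym2 c \<one> \<one> \<in> B1 c" by (rule sym2_B1) simp_all
    moreover have "sym2 c \<one> \<one> = term_of [\<one>] 1" by (simp add: sym2_def one)
    ultimately show ?thesis using HB by simp
  qed
  have gen: "x \<in> carrier G \<and> term_of [x] 1 \<in> H" if "x \<in> generate G S" for x
    using that
  proof (induction rule: generate.induct)
    case one
    then show ?case using H1 by simp
  next
    case (incl s)
    have "term_of [s] 1 \<in> H" by (rule HI[of "term_of [s] 1"]) (use incl B1_zero in auto)
    then show ?case using incl S by blast
  next
    case (inv s)
    then have s: "s \<in> carrier G" using S by blast
    have sH: "term_of [s] 1 \<in> H" by (rule HI[of "term_of [s] 1"]) (use inv B1_zero in auto)
    have "term_of [inv s] 1 = sym2 c (inv s) s + (term_of [\<one>] 1 + sc (- ?\<rho> (inv s)) (term_of [s] 1))"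
      using s by (simp add: sym2_def single_uminus)
    moreover have "sym2 c (inv s) s + (term_of [\<one>] 1 + sc (- ?\<rho> (inv s)) (term_of [s] 1)) \<in> H"
      by (intro Hadd Hsc H1 sH HB[OF sym2_B1]) (use s in simp_all)
    ultimately show ?case using s by (simp only: inv_closed)
  next
    case (eng x y)
    have "term_of [x \<otimes> y] 1 = sc (- 1) (sym2 c x y) + (term_of [x] 1 + sc (?\<rho> x) (term_of [y] 1))"
      by (simp add: sym2_def sc_minus_one)
    moreover have "sc (- 1) (sym2 c x y) + (term_of [x] 1 + sc (?\<rho> x) (term_of [y] 1)) \<in> H"
      using eng.IH by (intro Hadd Hsc HB[OF sym2_B1]) simp_all
    ultimately show ?case using eng.IH by (simp only: m_closed)
  qed
  have "w = (\<Sum>xs\<in>supp w. sc (coef w xs) (term_of xs 1))" by (simp add: sum_terms)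
  moreover have "(\<Sum>xs\<in>A. sc (coef w xs) (term_of xs 1)) \<in> H" if "finite A" "A \<subseteq> supp w" for A
    using that
  proof (induction A rule: finite_induct)
    case empty
    then show ?case using HB[OF B1_zero] by simp
  next
    case (insert xs A)
    then obtain x where x: "x \<in> carrier G" "xs = [x]" using C1_E[OF w, of xs] by blast
    then have "term_of xs 1 \<in> H" using gen[of x] S(2) by simp
    then show ?case using insert Hadd Hsc by (simp del: sc_term_of)
  qed
  from this[of "supp w"] have "(\<Sum>xs\<in>supp w. sc (coef w xs) (term_of xs 1)) \<in> H" by simp
  ultimately have "w \<in> H" by simp
  then show ?thesis by (simp add: H_def)
qed

text \<open>The dimension is the least size of a finite generating set, so it says something about
  nontriviality only once such a set exists. A finite generating set of cycle classes is therefore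
  constructed from generators of \<open>G\<close>.\<close>

lemma V1_iff_Z1_neq_B1:
  assumes c: "c \<in> torus_points"
  shows "pt c \<in> V1 G \<longleftrightarrow> Z1 c \<noteq> B1 c"
proof -
  interpret H: additive_quotient "Z1 c" "B1 c" sc
  proof
    show "0 \<in> Z1 c" using B1_zero B1_subset_Z1[OF c] by blast
    show "x - y \<in> Z1 c" if "x \<in> Z1 c" "y \<in> Z1 c" for x y
      using that C1_diff by (simp add: Z1_iff lf_diff)
  qed (use B1_zero B1_diff B1_subset_Z1[OF c] in auto)
  have H1: "group_homology 1 G (pt c) = H.Q"
    unfolding group_homology_def H.Q_def
    by (simp add: Z1_def B1_def bdry_def C1_def bar_chains_def sc_def[abs_def] numeral_2_eq_2)
  have scZ: "sc a w \<in> Z1 c" if "w \<in> Z1 c" for a w using that C1_sc by (simp add: Z1_iff lf_sc)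
  have mod: "module class_ring H.Q"
    by (rule H.module_Q) (use scZ B1_sc B1_zero in \<open>auto simp: sc_add sc_add_left sc_sc class_cring.cring_axioms\<close>)
  interpret V: vectorspace class_ring H.Q
    using mod class_field by (simp add: vectorspace_def)
  have smult: "a \<odot>\<^bsub>H.Q\<^esub> H.cl w = H.cl (sc a w)" if "w \<in> Z1 c" for a w
    by (rule H.smult_Q) (use that B1_sc sc_add in auto)
  have span_empty: "V.span {} = {\<zero>\<^bsub>H.Q\<^esub>}"
    by (auto simp: V.span_def V.lincomb_def)
  have trivial: "carrier H.Q = {\<zero>\<^bsub>H.Q\<^esub>} \<longleftrightarrow> Z1 c = B1 c"
  proof
    assume triv: "carrier H.Q = {\<zero>\<^bsub>H.Q\<^esub>}"
    have "w \<in> B1 c" if "w \<in> Z1 c" for w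
    proof -
      have "H.cl w \<in> carrier H.Q" unfolding H.carrier_Q using that by (rule imageI)
      then show ?thesis using triv H.cl_zero_iff by simp
    qed
    then show "Z1 c = B1 c" using H.NC by blast
  next
    assume "Z1 c = B1 c"
    then have "H.cl w = \<zero>\<^bsub>H.Q\<^esub>" if "w \<in> Z1 c" for w using that H.cl_zero_iff by simp
    moreover have "0 \<in> Z1 c" by (rule H.C(1))
    ultimately show "carrier H.Q = {\<zero>\<^bsub>H.Q\<^esub>}" unfolding H.carrier_Q by blast
  qed
  obtain S where S: "S \<subseteq> carrier G" "finite S" "generate G S = carrier G"
    using fg by (auto simp: finitely_generated_def)
  \<comment> \<open>A generator with nontrivial character value, if there is one; subtracting a
    multiple of \<open>[s0]\<close> corrects \<open>[s]\<close> to a cycle. If all values are 1, the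
    denominator in \<open>r\<close> is 0, so \<open>r s = 0\<close> and \<open>[s]\<close> is a
    cycle already.\<close>
  define s0 where "s0 = (if \<exists>s\<in>S. pt c s \<noteq> 1 then SOME s. s \<in> S \<and> pt c s \<noteq> 1 else \<one>)"
  define r where "r s = (pt c s - 1) / (pt c s0 - 1)" for s
  have one: "pt c \<one> = 1" using char_torus_one[OF is_group pt_in[OF c]] .
  have s0: "s0 \<in> carrier G \<and> (\<forall>s\<in>S. pt c s - 1 = r s * (pt c s0 - 1))"
  proof (cases "\<exists>s\<in>S. pt c s \<noteq> 1")
    case True
    then have "\<exists>s. s \<in> S \<and> pt c s \<noteq> 1" by blast
    from someI_ex[OF this] have "s0 \<in> S \<and> pt c s0 \<noteq> 1" using True by (simp add: s0_def)
    then show ?thesis using S(1) by (auto simp: r_def)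
  next
    case False
    then have "s0 = \<one>" unfolding s0_def by (simp only: if_False)
    then show ?thesis using False one by (simp add: r_def)
  qed
  define z where "z s = term_of [s] 1 - term_of [s0] (r s)" for s
  have zC: "z s \<in> C1" if "s \<in> S" for s unfolding z_def using that S(1) s0 by (intro C1_diff C1_single) auto
  have zZ: "z s \<in> Z1 c" if "s \<in> S" for s
    unfolding Z1_iff using zC[OF that] s0 that by (simp add: z_def lf_diff)
  define K where "K = (\<lambda>s. H.cl (z s)) ` S"
  have K: "finite K" "K \<subseteq> carrier H.Q" using S(2) zZ by (auto simp: K_def H.carrier_Q)
  interpret W: submodule class_ring "V.span K" H.Q
    by (rule V.span_is_submodule[OF K(2)])
  have gen: "V.span K = carrier H.Q"
  proof
    show "V.span K \<subseteq> carrier H.Q" by (rule V.span_is_subset2[OF K(2)])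
    show "carrier H.Q \<subseteq> V.span K"
    proof
      fix y assume "y \<in> carrier H.Q"
      then obtain w where w: "w \<in> Z1 c" "y = H.cl w" by (auto simp: H.carrier_Q)
      then obtain u where u: "supp u \<subseteq> (\<lambda>s. [s]) ` S" "w - u \<in> B1 c"
        using C1_finitely_spanned[OF c S(1,3), of w] by (auto simp: Z1_iff)
      have lfu: "lf (\<lambda>x. pt c x - 1) u = 0"
        using w(1) crossed_lf_B1[OF crossed_pt_minus_one[OF c] u(2)] by (simp add: Z1_iff lf_diff)
      have inj: "inj_on (\<lambda>s. [s]) S" by (rule inj_onI) simp
      have usum: "u = (\<Sum>s\<in>S. term_of [s] (coef u [s]))"
      proof -
        have "u = (\<Sum>xs\<in>supp u. term_of xs (coef u xs))" by (simp add: sum_terms)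
        also have "\<dots> = (\<Sum>xs\<in>(\<lambda>s. [s]) ` S. term_of xs (coef u xs))"
          using u(1) S(2) by (intro sum.mono_neutral_left) (auto simp: in_keys_iff)
        finally show ?thesis by (simp add: sum.reindex[OF inj])
      qed
      have "0 = (\<Sum>s\<in>S. coef u [s] * (pt c s - 1))"
        using lfu by (subst (asm) usum) (simp add: lf_sum)
      also have "\<dots> = (\<Sum>s\<in>S. coef u [s] * r s) * (pt c s0 - 1)"
        unfolding sum_distrib_right
      proof (intro sum.cong refl)
        fix s assume "s \<in> S"
        then have "pt c s - 1 = r s * (pt c s0 - 1)" using s0 by blast
        then show "coef u [s] * (pt c s - 1) = coef u [s] * r s * (pt c s0 - 1)" by (simp only: mult.assoc)
      qed
      finally have "(\<Sum>s\<in>S. coef u [s] * r s) = 0 \<or> pt c s0 = 1" by simp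
      then have rsum: "(\<Sum>s\<in>S. coef u [s] * r s) = 0" by (auto simp: r_def)
      have tsum: "(\<Sum>s\<in>A. term_of [s0] (g s)) = term_of [s0] (sum g A)" for g :: "'a \<Rightarrow> complex" and A
        by (induction A rule: infinite_finite_induct) (simp_all add: single_add)
      \<comment> \<open>The corrections at \<open>[s0]\<close> add up to 0 because \<open>u\<close>
        is a cycle.\<close>
      have zu: "(\<Sum>s\<in>S. sc (coef u [s]) (z s)) = u"
        by (subst (2) usum) (simp add: z_def sc_diff sum_subtractf tsum rsum)
      have "(\<Sum>s\<in>A. sc (coef u [s]) (z s)) \<in> Z1 c \<and> H.cl (\<Sum>s\<in>A. sc (coef u [s]) (z s)) \<in> V.span K" if "finite A" "A \<subseteq> S" for A
        using that
      proof (induction A rule: finite_induct)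
        case empty
        have "H.cl 0 = \<zero>\<^bsub>H.Q\<^esub>" using H.cl_zero_iff H.N(1) by blast
        then show ?case using H.C(1) W.zero_closed by simp
      next
        case (insert s A)
        have sS: "s \<in> S" using insert by blast
        have IH: "(\<Sum>s\<in>A. sc (coef u [s]) (z s)) \<in> Z1 c" "H.cl (\<Sum>s\<in>A. sc (coef u [s]) (z s)) \<in> V.span K"
          using insert by blast+
        have "H.cl (z s) \<in> V.span K" using V.in_own_span[OF K(2)] sS by (auto simp: K_def)
        then have "coef u [s] \<odot>\<^bsub>H.Q\<^esub> H.cl (z s) \<in> V.span K" using W.smult_closed by simp
        then have 1: "H.cl (sc (coef u [s]) (z s)) \<in> V.span K" using smult[OF zZ[OF sS]] by simp
        have "H.cl (sc (coef u [s]) (z s)) \<oplus>\<^bsub>H.Q\<^esub> H.cl (\<Sum>s\<in>A. sc (coef u [s]) (z s)) \<in> V.span K"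
          using W.m_closed[OF 1 IH(2)] by simp
        then show ?case using insert.hyps IH(1) H.C_add[OF scZ[OF zZ[OF sS]]] by (simp add: H.add_Q)
      qed
      from this[OF S(2) order.refl] have "H.cl u \<in> V.span K" unfolding zu by (rule conjunct2)
      moreover have "H.cl w = H.cl u" using u(2) by (simp add: H.cl_eq_iff)
      ultimately show "y \<in> V.span K" using w by simp
    qed
  qed
  have "V.dim \<ge> 1 \<longleftrightarrow> carrier H.Q \<noteq> {\<zero>\<^bsub>H.Q\<^esub>}"
  proof
    assume d: "V.dim \<ge> 1"
    show "carrier H.Q \<noteq> {\<zero>\<^bsub>H.Q\<^esub>}"
    proof
      assume "carrier H.Q = {\<zero>\<^bsub>H.Q\<^esub>}"
      then have "V.dim \<le> card ({} :: (('a list \<Rightarrow>\<^sub>0 complex) set) set)"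
        by (intro V.gen_ge_dim) (simp_all add: span_empty)
      then show False using d by simp
    qed
  next
    assume ne: "carrier H.Q \<noteq> {\<zero>\<^bsub>H.Q\<^esub>}"
    \<comment> \<open>The finite generating set \<open>K\<close> ensures that the least size is
      attained. At size 0 the empty set would generate.\<close>
    let ?P = "\<lambda>n. \<exists>A. finite A \<and> card A = n \<and> A \<subseteq> carrier H.Q \<and> V.span A = carrier H.Q"
    have "?P (card K)" using K gen by blast
    then have "?P (V.dim)" unfolding V.dim_def by (rule LeastI)
    then obtain A where A: "finite A" "card A = V.dim" "V.span A = carrier H.Q" by blast
    show "V.dim \<ge> 1"
    proof (rule ccontr)
      assume "\<not> V.dim \<ge> 1"
      then have "card A = 0" unfolding A(2) by linarith
      then have "A = {}" using A(1) by (simp only: card_0_eq)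
      then show False using A(3) span_empty ne by simp
    qed
  qed
  then have "pt c \<in> V1 G \<longleftrightarrow> carrier H.Q \<noteq> {\<zero>\<^bsub>H.Q\<^esub>}"
    using pt_in[OF c] by (simp only: V1_def mem_Collect_eq H1 simp_thms)
  then show ?thesis using trivial by simp
qed

end

section \<open>The Alexander polynomial\<close>

lemma emb_push: "push p (Poly_Mapping.map of_int f) = emb (push p f)"
proof -
  have supp: "supp (Poly_Mapping.map of_int f :: 'a \<Rightarrow>\<^sub>0 complex) = supp f"
    by (auto simp: in_keys_iff Poly_Mapping.map.rep_eq when_def)
  have "emb (push p f) = lin (\<lambda>x a. term_of (p x) (of_int a)) f"
    unfolding emb_eq_lin by (rule lin_push) (simp_all add: single_add)
  also have "\<dots> = push p (Poly_Mapping.map of_int f)"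
    unfolding push_def lin_def supp by (intro sum.cong refl) (simp add: Poly_Mapping.map.rep_eq in_keys_iff when_def)
  finally show ?thesis by simp
qed

lemma leibniz_det_cong:
  assumes "\<And>i j. \<lbrakk>i < k; j < k\<rbrakk> \<Longrightarrow> A i j = B i j"
  shows "leibniz_det k A = leibniz_det k B"
  unfolding leibniz_det_def
proof (intro sum.cong refl)
  fix \<sigma> assume "\<sigma> \<in> {\<sigma>. \<sigma> permutes {..<k}}"
  then have "\<sigma> i < k" if "i < k" for i using permutes_in_image[of \<sigma> "{..<k}" i] that by simp
  then have "(\<Prod>i<k. A i (\<sigma> i)) = (\<Prod>i<k. B i (\<sigma> i))" by (intro prod.cong refl assms) auto
  then show "(if evenperm \<sigma> then 1 else - 1) * (\<Prod>i<k. A i (\<sigma> i)) = (if evenperm \<sigma> then 1 else - 1) * (\<Prod>i<k. B i (\<sigma> i))"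
    by (simp only:)
qed

context fg_group
begin

section \<open>Crossed homomorphisms at the trivial character\<close>

definition additive :: "('a \<Rightarrow> complex) \<Rightarrow> bool" where
  "additive f \<longleftrightarrow> (\<forall>x\<in>carrier G. \<forall>y\<in>carrier G. f (x \<otimes> y) = f x + f y)"

text \<open>The space of crossed homomorphisms has dimension at least two, expressed by an
  independent pair.\<close>

definition two_crossed :: "(nat \<Rightarrow> complex) \<Rightarrow> bool" where
  "two_crossed c \<longleftrightarrow> (\<exists>f g. crossed c f \<and> crossed c g \<and>
     (\<forall>a b. (\<forall>x\<in>carrier G. a * f x + b * g x = 0) \<longrightarrow> a = 0 \<and> b = 0))"

lemma pt_trivial_iff: "(\<forall>x\<in>carrier G. pt c x = 1) \<longleftrightarrow> (\<forall>i<b1 G. c i = 1)"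
proof
  assume triv: "\<forall>x\<in>carrier G. pt c x = 1"
  show "\<forall>i<b1 G. c i = 1"
  proof (intro allI impI)
    fix i assume i: "i < b1 G"
    obtain x where x: "x \<in> carrier G" "expo_of x = frag_of i" using expo_of_surj[of "frag_of i"] i by auto
    have "pt c x = 1" using triv x(1) by blast
    then show "c i = 1" using x i by (simp add: pt_def monomial_at_single)
  qed
next
  assume "\<forall>i<b1 G. c i = 1"
  then show "\<forall>x\<in>carrier G. pt c x = 1" by (simp add: pt_def monomial_at_def)
qed

lemma crossed_trivial_iff: "(\<forall>i<b1 G. c i = 1) \<Longrightarrow> crossed c f \<longleftrightarrow> additive f"
proof -
  assume "\<forall>i<b1 G. c i = 1"
  then have "pt c x = 1" if "x \<in> carrier G" for x using pt_trivial_iff that by blast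
  then show ?thesis by (simp add: crossed_def additive_def)
qed

lemma additive_coordinate: "additive (\<lambda>x. of_int (coef (expo_of x) i))"
  by (simp add: additive_def expo_of_mult lookup_add)

lemma additive_mult: "\<lbrakk>additive f; x \<in> carrier G; y \<in> carrier G\<rbrakk> \<Longrightarrow> f (x \<otimes> y) = f x + f y"
  by (simp add: additive_def)

lemma additive_one: "additive f \<Longrightarrow> f \<one> = 0"
  using additive_mult[of f \<one> \<one>] by simp

lemma additive_inv: "\<lbrakk>additive f; x \<in> carrier G\<rbrakk> \<Longrightarrow> f (inv x) = - f x"
  using additive_mult[of f "inv x" x] additive_one[of f] by (simp add: eq_neg_iff_add_eq_0)

lemma additive_derived:
  assumes f: "additive f" and x: "x \<in> derived G (carrier G)"
  shows "f x = 0"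
proof -
  let ?K = "{x \<in> carrier G. f x = 0}"
  have "subgroup ?K G"
  proof (rule subgroupI)
    have "\<one> \<in> ?K" using additive_one[OF f] by simp
    then show "?K \<noteq> {}" by blast
  qed (auto simp: additive_inv[OF f] additive_mult[OF f])
  moreover have "derived_set G (carrier G) \<subseteq> ?K"
  proof
    fix h assume "h \<in> derived_set G (carrier G)"
    then obtain a b where "a \<in> carrier G" "b \<in> carrier G" "h = a \<otimes> b \<otimes> inv a \<otimes> inv b" by auto
    then show "h \<in> ?K" by (simp add: additive_inv[OF f] additive_mult[OF f])
  qed
  ultimately have "derived G (carrier G) \<subseteq> ?K"
    unfolding derived_def by (rule generate_subgroup_incl[rotated])
  then show ?thesis using x by blast
qed

lemma additive_pow: "\<lbrakk>additive f; x \<in> carrier G\<rbrakk> \<Longrightarrow> f (x [^] (k::nat)) = of_nat k * f x"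
  by (induction k) (simp_all add: additive_one additive_mult algebra_simps)

text \<open>Some positive power of \<open>x\<close> lies in the derived subgroup, on which additive
  functions vanish, and the complex numbers have no torsion.\<close>

lemma additive_expo_zero:
  assumes f: "additive f" and x: "x \<in> carrier G" and e: "expo_of x = 0"
  shows "f x = 0"
proof -
  have "abf_proj G x = \<kappa> (\<iota> \<one>\<^bsub>abf G\<^esub>)"
    using \<kappa>_\<iota>[OF abf_proj_closed[OF x]] e unfolding expo_of_def \<iota>_one by simp
  also have "\<dots> = \<one>\<^bsub>abf G\<^esub>" by (rule \<kappa>_\<iota>[OF A.one_closed])
  finally obtain k :: nat where k: "k > 0" "x [^] k \<in> derived G (carrier G)"
    using abf_proj_one_imp[OF x] by blast
  have "of_nat k * f x = 0" using additive_derived[OF f k(2)] additive_pow[OF f x, of k] by simp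
  then show ?thesis using k(1) by simp
qed

lemma additive_expo_eq:
  assumes f: "additive f" and x: "x \<in> carrier G" and y: "y \<in> carrier G" and e: "expo_of x = expo_of y"
  shows "f x = f y"
proof -
  have xy: "x \<otimes> inv y \<in> carrier G" using x y by simp
  have "(x \<otimes> inv y) \<otimes> y = x" using x y by (simp add: m_assoc)
  then have "expo_of x = expo_of (x \<otimes> inv y) + expo_of y" using expo_of_mult[OF xy y] by simp
  then have "expo_of (x \<otimes> inv y) = 0" using e by simp
  from additive_expo_zero[OF f xy this] have "f x + f (inv y) = 0"
    using additive_mult[OF f x inv_closed[OF y]] by simp
  then show ?thesis using additive_inv[OF f y] by simp
qed

definition gen :: "nat \<Rightarrow> 'a" where
  "gen i = (SOME x. x \<in> carrier G \<and> expo_of x = frag_of i)"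

lemma gen: "i < b1 G \<Longrightarrow> gen i \<in> carrier G \<and> expo_of (gen i) = frag_of i"
  unfolding gen_def by (rule someI_ex) (use expo_of_surj[of "frag_of i"] in auto)

text \<open>The coordinates of the exponent form the basis of the additive functions dual to the
  elements \<open>gen i\<close>.\<close>

lemma additive_eq_sum:
  assumes f: "additive f" and x: "x \<in> carrier G"
  shows "f x = (\<Sum>i<b1 G. of_int (coef (expo_of x) i) * f (gen i))"
proof -
  let ?S = "\<lambda>e. \<Sum>i<b1 G. of_int (coef e i) * f (gen i)"
  have "\<forall>y\<in>carrier G. expo_of y = e \<longrightarrow> f y = ?S e" if "supp e \<subseteq> {..<b1 G}" for e
    using that
  proof (induction e rule: free_Abelian_group_induct[consumes 1, case_names zero diff single])
    case zero
    then show ?case using additive_expo_zero[OF f] by simp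
  next
    case (diff e e')
    show ?case
    proof (intro ballI impI)
      fix y assume y: "y \<in> carrier G" "expo_of y = e - e'"
      obtain z where z: "z \<in> carrier G" "expo_of z = e'" using expo_of_surj[OF diff(2)] by blast
      have yz: "y \<otimes> z \<in> carrier G" using y z by simp
      have "expo_of (y \<otimes> z) = e" using expo_of_mult[OF y(1) z(1)] y z by simp
      then have "f (y \<otimes> z) = ?S e" using diff(3) yz by blast
      moreover have "f z = ?S e'" using diff(4) z by blast
      moreover have "f y = f (y \<otimes> z) - f z" using additive_mult[OF f y(1) z(1)] by simp
      ultimately have "f y = ?S e - ?S e'" by (simp only:)
      then show "f y = ?S (e - e')" by (simp add: lookup_minus algebra_simps sum_subtractf)
    qed
  next
    case (single i)
    then have i: "i < b1 G" by simp
    have "?S (frag_of i) = (\<Sum>j<b1 G. if j = i then f (gen i) else 0)"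
      by (intro sum.cong refl) (simp add: lookup_single when_def)
    then have S: "?S (frag_of i) = f (gen i)" using i by simp
    show ?case unfolding S
      using additive_expo_eq[OF f _ conjunct1[OF gen[OF i]]] conjunct2[OF gen[OF i]] by simp
  qed
  then show ?thesis using expo_of_supp[OF x] x by blast
qed

lemma gen_coordinate: "i < b1 G \<Longrightarrow> coef (expo_of (gen i)) j = (if j = i then 1 else 0)"
  using gen[of i] by (simp add: lookup_single when_def)

lemma two_crossed_trivial:
  assumes c: "\<forall>i<b1 G. c i = 1"
  shows "two_crossed c \<longleftrightarrow> b1 G \<ge> 2"
proof
  assume n: "b1 G \<ge> 2"
  let ?f = "\<lambda>i x. of_int (coef (expo_of x) i) :: complex"
  have "a = 0 \<and> b = 0" if ab: "\<forall>x\<in>carrier G. a * ?f 0 x + b * ?f 1 x = 0" for a b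
  proof -
    have "gen i \<in> carrier G" if "i < 2" for i using gen[of i] n that by (meson conjunct1 less_le_trans)
    then have "a * ?f 0 (gen 0) + b * ?f 1 (gen 0) = 0" "a * ?f 0 (gen 1) + b * ?f 1 (gen 1) = 0"
      using ab by simp_all
    then show ?thesis using n by (simp add: gen_coordinate)
  qed
  then show "two_crossed c"
    unfolding two_crossed_def crossed_trivial_iff[OF c] using additive_coordinate by blast
next
  assume "two_crossed c"
  then obtain f g where fg: "additive f" "additive g"
    and ind: "\<And>a b. (\<forall>x\<in>carrier G. a * f x + b * g x = 0) \<Longrightarrow> a = 0 \<and> b = 0"
    unfolding two_crossed_def crossed_trivial_iff[OF c] by blast
  have comb: "a * f x + b * g x = (\<Sum>i<b1 G. of_int (coef (expo_of x) i) * (a * f (gen i) + b * g (gen i)))"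
    if "x \<in> carrier G" for a b x
    unfolding distrib_left sum.distrib mult.left_commute[of _ a] mult.left_commute[of _ b] sum_distrib_left[symmetric]
    using additive_eq_sum[OF fg(1) that] additive_eq_sum[OF fg(2) that] by (rule arg_cong2[where f = "\<lambda>u v. a * u + b * v"])
  show "b1 G \<ge> 2"
  proof (rule ccontr)
    assume "\<not> b1 G \<ge> 2"
    then have i0: "i = 0" if "i < b1 G" for i using that by linarith
    have ind': "a = 0 \<and> b = 0" if ab: "a * f (gen 0) + b * g (gen 0) = 0" for a b
    proof (rule ind, intro ballI)
      fix x assume x: "x \<in> carrier G"
      have "of_int (coef (expo_of x) i) * (a * f (gen i) + b * g (gen i)) = 0" if "i \<in> {..<b1 G}" for i
      proof -
        have "i = 0" using i0 that by blast
        then show ?thesis using ab by simp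
      qed
      then show "a * f x + b * g x = 0" unfolding comb[OF x] by (rule sum.neutral[OF ballI])
    qed
    \<comment> \<open>These coefficients cancel at \<open>gen 0\<close>, which decides everything
      when there is at most one coordinate. Hence both functions vanish at \<open>gen 0\<close>, and
      then even the coefficients 1 and 0 give a relation.\<close>
    have "g (gen 0) = 0 \<and> - f (gen 0) = 0" by (rule ind') simp
    then have "(1::complex) = 0 \<and> (0::complex) = 0" by (intro ind') simp
    then show False by simp
  qed
qed

text \<open>Off the trivial character \<open>pt c x - 1\<close> is a nonzero crossed homomorphism,
  so any \<open>f\<close> that is no multiple of it completes an independent pair. At the trivial
  character it is zero, and any nonzero additive function already gives homology.\<close>

lemma V1_iff_two_crossed:
  assumes c: "c \<in> torus_points"
  shows "pt c \<in> V1 G \<longleftrightarrow> two_crossed c \<or> (b1 G \<ge> 1 \<and> (\<forall>i<b1 G. c i = 1))"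
proof -
  let ?p = "\<lambda>x. pt c x - 1"
  have V: "pt c \<in> V1 G \<longleftrightarrow> (\<exists>f. crossed c f \<and> (\<nexists>k. \<forall>x\<in>carrier G. f x = k * ?p x))"
    using V1_iff_Z1_neq_B1[OF c] Z1_neq_B1_iff[OF c] by (simp only:)
  show ?thesis
  proof
    assume "pt c \<in> V1 G"
    then obtain f where f: "crossed c f" "\<nexists>k. \<forall>x\<in>carrier G. f x = k * ?p x" using V by blast
    show "two_crossed c \<or> (b1 G \<ge> 1 \<and> (\<forall>i<b1 G. c i = 1))"
    proof (cases "\<forall>i<b1 G. c i = 1")
      case True
      have add: "additive f" using f(1) crossed_trivial_iff[OF True] by blast
      have "b1 G \<ge> 1"
      proof (rule ccontr)
        assume "\<not> b1 G \<ge> 1"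
        then have "b1 G = 0" by linarith
        then have "f x = 0 * ?p x" if "x \<in> carrier G" for x using additive_eq_sum[OF add that] by simp
        then show False using f(2) by blast
      qed
      then show ?thesis using True by blast
    next
      case False
      then obtain y where y: "y \<in> carrier G" "pt c y \<noteq> 1" using pt_trivial_iff by blast
      have "a = 0 \<and> b = 0" if ab: "\<forall>x\<in>carrier G. a * f x + b * ?p x = 0" for a b
      proof -
        have a: "a = 0"
        proof (rule ccontr)
          assume a: "a \<noteq> 0"
          have "f x = (- b / a) * ?p x" if "x \<in> carrier G" for x
          proof -
            have "a * f x + b * ?p x = 0" using ab that by blast
            then have "a * f x = - b * ?p x" by (simp add: eq_neg_iff_add_eq_0)
            then show ?thesis using a by (simp add: field_simps)
          qed
          then show False using f(2) by blast
        qed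
        have "a * f y + b * ?p y = 0" using ab y(1) by blast
        then show ?thesis using a y(2) by simp
      qed
      then have "two_crossed c" unfolding two_crossed_def using f(1) crossed_pt_minus_one[OF c] by blast
      then show ?thesis by blast
    qed
  next
    assume "two_crossed c \<or> (b1 G \<ge> 1 \<and> (\<forall>i<b1 G. c i = 1))"
    then show "pt c \<in> V1 G"
    proof
      assume "two_crossed c"
      then obtain f g where fg: "crossed c f" "crossed c g"
        and ind: "\<And>a b. (\<forall>x\<in>carrier G. a * f x + b * g x = 0) \<Longrightarrow> a = 0 \<and> b = 0"
        unfolding two_crossed_def by blast
      show ?thesis
      proof (rule ccontr)
        assume "pt c \<notin> V1 G"
        then obtain k l where k: "\<forall>x\<in>carrier G. f x = k * ?p x" and l: "\<forall>x\<in>carrier G. g x = l * ?p x"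
          using V fg by blast
        \<comment> \<open>Two multiples of the same function satisfy this relation; it forces
          \<open>k = 0\<close>, so \<open>f\<close> would vanish on \<open>G\<close>.\<close>
        have "l = 0 \<and> - k = 0" by (rule ind) (simp add: k l)
        then have "(1::complex) = 0 \<and> (0::complex) = 0" by (intro ind) (simp add: k)
        then show False by simp
      qed
    next
      assume n: "b1 G \<ge> 1 \<and> (\<forall>i<b1 G. c i = 1)"
      let ?f = "\<lambda>x. of_int (coef (expo_of x) 0) :: complex"
      have "crossed c ?f" using crossed_trivial_iff n additive_coordinate by blast
      moreover have False if k: "\<forall>x\<in>carrier G. ?f x = k * ?p x" for k
      proof -
        have g: "gen 0 \<in> carrier G" using gen[of 0] n by simp
        have "pt c (gen 0) = 1" using pt_trivial_iff n g by blast
        moreover have "?f (gen 0) = k * ?p (gen 0)" using k g by blast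
        moreover have "?f (gen 0) = 1" using gen_coordinate[of 0 0] n by simp
        ultimately show False by simp
      qed
      ultimately show ?thesis using V by blast
    qed
  qed
qed

lemma minors_vanish_iff_two_crossed:
  assumes c: "c \<in> torus_points" and P: "is_presentation (Lambda G) AG m h P"
  shows "(\<forall>M\<in>minors (Lambda G) (m - 1) h m P. ch c M = 0) \<longleftrightarrow> two_crossed c"
proof -
  have "\<forall>i<h. \<forall>j<m. P i j \<in> carrier (Lambda G)"
    using P unfolding is_presentation_def by (rule conjunct1)
  then have det: "ch c (ring_det (Lambda G) (m - 1) (\<lambda>i j. P (r i) (s j))) = leibniz_det (m - 1) (\<lambda>i j. ch c (P (r i) (s j)))"
    if "r ` {..<m - 1} \<subseteq> {..<h}" "s ` {..<m - 1} \<subseteq> {..<m}" for r s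
    by (intro ring_hom_ring_det(1)[OF cring_Lambda])
      (use that in \<open>auto simp: ch_add ch_one ch_mult[OF c] image_subset_iff simp del: carrier_group_ring\<close>)
  have "(\<forall>M\<in>minors (Lambda G) (m - 1) h m P. ch c M = 0) \<longleftrightarrow>
    (\<forall>r s. strict_mono_on {..<m-1} r \<and> r ` {..<m-1} \<subseteq> {..<h} \<and> strict_mono_on {..<m-1} s \<and> s ` {..<m-1} \<subseteq> {..<m} \<longrightarrow>
      ch c (ring_det (Lambda G) (m - 1) (\<lambda>i j. P (r i) (s j))) = 0)"
    unfolding minors_def by blast
  also have "\<dots> \<longleftrightarrow>
    (\<forall>r s. strict_mono_on {..<m-1} r \<and> r ` {..<m-1} \<subseteq> {..<h} \<and> strict_mono_on {..<m-1} s \<and> s ` {..<m-1} \<subseteq> {..<m} \<longrightarrow>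
      leibniz_det (m - 1) (\<lambda>i j. ch c (P (r i) (s j))) = 0)"
    by (intro all_cong1 imp_cong refl) (simp only: det)
  also have "\<dots> \<longleftrightarrow> two_crossed c"
    unfolding two_crossed_def presentation_kernel[OF c P, symmetric]
    by (rule minors_zero_iff_independent_kernel[where P = "\<lambda>i j. ch c (P i j)"])
  finally show ?thesis .
qed

section \<open>Minors and their greatest common divisor\<close>

lemma minors_cases:
  assumes P: "\<forall>i<h. \<forall>j<m. P i j \<in> carrier (Lambda G)" and M: "M \<in> minors (Lambda G) k h m P"
  obtains r s where "M \<in> carrier (Lambda G)" "\<Psi> M = leibniz_det k (\<lambda>i j. \<Psi> (P (r i) (s j)))"
    "r ` {..<k} \<subseteq> {..<h}" "s ` {..<k} \<subseteq> {..<m}"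
proof -
  obtain r s where M: "M = ring_det (Lambda G) k (\<lambda>i j. P (r i) (s j))"
    and rs: "r ` {..<k} \<subseteq> {..<h}" "s ` {..<k} \<subseteq> {..<m}" using M unfolding minors_def by blast
  have "P (r i) (s j) \<in> carrier (Lambda G)" if "i < k" "j < k" for i j
  proof -
    have "r i < h" "s j < m" using rs that by auto
    then show ?thesis using P by blast
  qed
  note det = ring_hom_ring_det[OF cring_Lambda, where F = \<Psi> and k = k, OF _ \<Psi>_mult _ this]
  show thesis
  proof (rule that[OF _ _ rs])
    show "M \<in> carrier (Lambda G)" unfolding M by (rule det(2)) (simp_all add: \<Psi>_add \<Psi>_one)
    show "\<Psi> M = leibniz_det k (\<lambda>i j. \<Psi> (P (r i) (s j)))"
      unfolding M by (rule det(1)) (simp_all add: \<Psi>_add \<Psi>_one)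
  qed
qed

lemma minors_closed:
  assumes "\<forall>i<h. \<forall>j<m. P i j \<in> carrier (Lambda G)"
  shows "minors (Lambda G) k h m P \<subseteq> carrier (Lambda G)"
  by (rule subsetI, erule minors_cases[OF assms])

text \<open>The index functions in \<open>minors\<close> are arbitrary outside
  \<open>{..<k}\<close>. Restricted to it they range over a finite set, and the determinant is
  unchanged.\<close>

lemma finite_minors:
  assumes P: "\<forall>i<h. \<forall>j<m. P i j \<in> carrier (Lambda G)"
  shows "finite (\<Psi> ` minors (Lambda G) k h m P)"
proof (rule finite_subset)
  let ?D = "\<lambda>(r, s). leibniz_det k (\<lambda>i j. \<Psi> (P (r i) (s j)))"
  let ?I = "({..<k} \<rightarrow>\<^sub>E {..<h}) \<times> ({..<k} \<rightarrow>\<^sub>E {..<m})"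
  show "\<Psi> ` minors (Lambda G) k h m P \<subseteq> ?D ` ?I"
  proof (rule image_subsetI)
    fix M assume "M \<in> minors (Lambda G) k h m P"
    then obtain r s where M: "\<Psi> M = leibniz_det k (\<lambda>i j. \<Psi> (P (r i) (s j)))"
      and rs: "r ` {..<k} \<subseteq> {..<h}" "s ` {..<k} \<subseteq> {..<m}" by (rule minors_cases[OF P])
    have "\<Psi> M = ?D (restrict r {..<k}, restrict s {..<k})"
      unfolding M case_prod_conv by (rule leibniz_det_cong) simp
    moreover have "(restrict r {..<k}, restrict s {..<k}) \<in> ?I" using rs by auto
    ultimately show "\<Psi> M \<in> ?D ` ?I" by (rule image_eqI)
  qed
qed (intro finite_imageI finite_SigmaI finite_PiE finite_lessThan)

text \<open>The multiples of \<open>e\<close> form an ideal, so a common divisor of the generators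
  divides the whole ideal. Hence \<open>\<Delta>\<close> is a greatest common divisor of the minors
  themselves.\<close>

lemma gcd_of_ideal:
  assumes M: "M \<subseteq> carrier (Lambda G)" and \<Delta>: "is_gcd_of_set (Lambda G) (Idl\<^bsub>Lambda G\<^esub> M) \<Delta>"
  shows "\<Delta> \<in> carrier (Lambda G)" and "f \<in> M \<Longrightarrow> \<Delta> divides\<^bsub>Lambda G\<^esub> f"
    and "\<lbrakk>e \<in> carrier (Lambda G); \<And>f. f \<in> M \<Longrightarrow> e divides\<^bsub>Lambda G\<^esub> f\<rbrakk> \<Longrightarrow> e divides\<^bsub>Lambda G\<^esub> \<Delta>"
proof -
  show "\<Delta> \<in> carrier (Lambda G)" using \<Delta> unfolding is_gcd_of_set_def by (rule conjunct1)
  show "\<Delta> divides\<^bsub>Lambda G\<^esub> f" if "f \<in> M"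
    using \<Delta> \<Lambda>.genideal_self[OF M] that unfolding is_gcd_of_set_def by blast
  assume e: "e \<in> carrier (Lambda G)" and dvd: "\<And>f. f \<in> M \<Longrightarrow> e divides\<^bsub>Lambda G\<^esub> f"
  have comm: "x \<otimes>\<^bsub>Lambda G\<^esub> e = e \<otimes>\<^bsub>Lambda G\<^esub> x" if "x \<in> carrier (Lambda G)" for x
    by (rule \<Lambda>.m_comm[OF that e])
  have "M \<subseteq> PIdl\<^bsub>Lambda G\<^esub> e"
  proof
    fix f assume "f \<in> M"
    from dvd[OF this] obtain x where x: "x \<in> carrier (Lambda G)" "f = e \<otimes>\<^bsub>Lambda G\<^esub> x" unfolding factor_def by (rule bexE)
    have "f = x \<otimes>\<^bsub>Lambda G\<^esub> e" unfolding comm[OF x(1)] by (rule x(2))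
    then show "f \<in> PIdl\<^bsub>Lambda G\<^esub> e" unfolding cgenideal_def using x(1) by blast
  qed
  then have "Idl\<^bsub>Lambda G\<^esub> M \<subseteq> PIdl\<^bsub>Lambda G\<^esub> e" by (rule \<Lambda>.genideal_minimal[OF \<Lambda>.cgenideal_ideal[OF e]])
  note sub = subsetD[OF this]
  have "e divides\<^bsub>Lambda G\<^esub> f" if f: "f \<in> Idl\<^bsub>Lambda G\<^esub> M" for f
  proof -
    obtain x where x: "x \<in> carrier (Lambda G)" "f = x \<otimes>\<^bsub>Lambda G\<^esub> e" using sub[OF f] unfolding cgenideal_def by blast
    show ?thesis unfolding factor_def x(2) comm[OF x(1)] using x(1) by blast
  qed
  then have "\<forall>f\<in>Idl\<^bsub>Lambda G\<^esub> M. e divides\<^bsub>Lambda G\<^esub> f" by (rule ballI)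
  then show "e divides\<^bsub>Lambda G\<^esub> \<Delta>" using \<Delta> e unfolding is_gcd_of_set_def by simp
qed

lemma zero_locus_eq:
  assumes f: "f \<in> carrier (Lambda G)"
  shows "zero_locus G f = chart.zeros {emb (\<Psi> f)}"
proof -
  have "supp (Poly_Mapping.map of_int f :: 'a set set \<Rightarrow>\<^sub>0 complex) \<subseteq> supp f"
    by (auto simp: in_keys_iff Poly_Mapping.map.rep_eq when_def)
  then have "Poly_Mapping.map of_int f \<in> carrier (group_ring (abf G) :: ('a set set \<Rightarrow>\<^sub>0 complex) ring)"
    using f by simp
  from char_eval_char_at[OF this]
  have ev: "char_eval (char_at c) (Poly_Mapping.map of_int f) = ev (b1 G) c (emb (\<Psi> f))" for c
    unfolding emb_push \<Psi>_def .
  have "{\<chi> \<in> char_torus (abf G). char_eval \<chi> (Poly_Mapping.map of_int f) = 0}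
      = char_at ` {c \<in> torus_points. ev (b1 G) c (emb (\<Psi> f)) = 0}" (is "?L = ?R")
  proof
    show "?L \<subseteq> ?R"
    proof
      fix \<chi> assume "\<chi> \<in> ?L"
      then have \<chi>: "\<chi> \<in> char_torus (abf G)" "char_eval \<chi> (Poly_Mapping.map of_int f) = 0" by blast+
      obtain c where c: "c \<in> torus_points" "\<chi> = char_at c" using char_at_surj[OF \<chi>(1)] by blast
      then show "\<chi> \<in> ?R" using \<chi>(2) ev[of c] by simp
    qed
    show "?R \<subseteq> ?L" using char_at_in ev by auto
  qed
  then show ?thesis unfolding zero_locus_def chart.zeros_def by (simp add: image_image pt_eq_pullback)
qed

lemma trivial_char_eq: "trivial_char G = pt (\<lambda>_. 1)"
  by (simp add: trivial_char_def pt_def monomial_at_def)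

text \<open>A monomial with coefficient 1 is a unit, the inverse being the monomial with the
  opposite exponent.\<close>

lemma const_up_to_unitsI:
  assumes e: "supp e \<subseteq> {..<b1 G}" and f: "f \<in> carrier (Lambda G)" "\<Psi> f = term_of e a"
  shows "const_up_to_units (abf G) f"
proof -
  define u :: "expo \<Rightarrow> 'a set set \<Rightarrow>\<^sub>0 int" where "u e = term_of (\<kappa> e) 1" for e
  have u: "u e \<in> carrier (Lambda G)" "\<Psi> (u e) = term_of e 1" if "supp e \<subseteq> {..<b1 G}" for e
    using \<kappa>_closed[OF that] \<iota>_\<kappa>[OF that] by (simp_all add: u_def \<Psi>_def)
  have one: "term_of \<one>\<^bsub>abf G\<^esub> b \<in> carrier (Lambda G)" "\<Psi> (term_of \<one>\<^bsub>abf G\<^esub> b) = term_of 0 b" for b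
    by (simp_all add: \<Psi>_def \<iota>_one)
  have e': "supp (- e) \<subseteq> {..<b1 G}" using e by simp
  have "u e \<otimes>\<^bsub>Lambda G\<^esub> u (- e) = \<one>\<^bsub>Lambda G\<^esub>"
    unfolding one_group_ring
    by (rule \<Psi>_inj[OF Lambda_mult_closed[OF u(1)[OF e] u(1)[OF e']] one(1)])
      (simp add: \<Psi>_mult[OF u(1)[OF e] u(1)[OF e']] u(2)[OF e] u(2)[OF e'] one(2) mult_single)
  moreover have "u (- e) \<otimes>\<^bsub>Lambda G\<^esub> u e = u e \<otimes>\<^bsub>Lambda G\<^esub> u (- e)"
    by (rule \<Lambda>.m_comm[OF u(1)[OF e'] u(1)[OF e]])
  ultimately have "u e \<in> Units (Lambda G)" unfolding Units_def using u(1)[OF e] u(1)[OF e'] by auto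
  moreover have "f = u e \<otimes>\<^bsub>Lambda G\<^esub> term_of \<one>\<^bsub>abf G\<^esub> a"
    by (rule \<Psi>_inj[OF f(1) Lambda_mult_closed[OF u(1)[OF e] one(1)]])
      (simp add: \<Psi>_mult[OF u(1)[OF e] one(1)] u(2)[OF e] one(2) f(2) mult_single)
  ultimately show ?thesis unfolding const_up_to_units_def by blast
qed

text \<open>Units evaluate to nonzero numbers at every character, so no classification of the units
  of the group ring is involved.\<close>

lemma const_up_to_units_no_zeros:
  assumes f: "const_up_to_units (abf G) f" "f \<noteq> 0"
  shows "chart.zeros {emb (\<Psi> f)} = {}"
proof -
  obtain u a where u: "u \<in> Units (Lambda G)" and fu: "f = u \<otimes>\<^bsub>Lambda G\<^esub> term_of \<one>\<^bsub>abf G\<^esub> a"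
    using f(1) unfolding const_up_to_units_def by blast
  obtain v where v: "u \<in> carrier (Lambda G)" "v \<in> carrier (Lambda G)" "u \<otimes>\<^bsub>Lambda G\<^esub> v = term_of \<one>\<^bsub>abf G\<^esub> 1"
    using u unfolding Units_def one_group_ring by blast
  have a: "term_of \<one>\<^bsub>abf G\<^esub> a \<in> carrier (Lambda G)" by simp
  have a0: "a \<noteq> 0"
  proof
    assume "a = 0"
    then have "f = u \<otimes>\<^bsub>Lambda G\<^esub> \<zero>\<^bsub>Lambda G\<^esub>" using fu by simp
    then show False using \<Lambda>.r_null[OF v(1)] f(2) by simp
  qed
  have "ev (b1 G) c (emb (\<Psi> f)) \<noteq> 0" if c: "c \<in> torus_points" for c
  proof -
    have "ch c u * ch c v = 1" unfolding ch_mult[OF c v(1,2), symmetric] v(3) by (rule ch_one)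
    then have "ch c u \<noteq> 0" by auto
    moreover have "ch c (term_of \<one>\<^bsub>abf G\<^esub> a) = of_int a"
      unfolding ch_def \<Psi>_def push_single \<iota>_one emb_term_of ev_term_of by simp
    ultimately have "ch c f \<noteq> 0" unfolding fu ch_mult[OF c v(1) a] using a0 by simp
    then show ?thesis by (simp add: ch_def)
  qed
  then show ?thesis unfolding chart.zeros_def by simp
qed

theorem alexander_polynomial_W1:
  assumes "is_alexander_polynomial G \<Delta>"
  shows "\<Delta> = 0 \<longleftrightarrow> char_torus0 G \<subseteq> V1 G"
    and "\<Delta> = 0 \<Longrightarrow> W1 G = {}"
    and "\<lbrakk>\<Delta> \<noteq> 0; b1 G > 1\<rbrakk> \<Longrightarrow> W1 G = zero_locus G \<Delta>"
    and "\<lbrakk>\<Delta> \<noteq> 0; b1 G = 1\<rbrakk> \<Longrightarrow> W1 G = zero_locus G \<Delta> \<union> {trivial_char G}"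
    and "b1 G = 1 \<Longrightarrow> zero_locus G \<Delta> \<inter> {trivial_char G} = {}"
    and "b1 G \<ge> 2 \<Longrightarrow> W1 G = {} \<longleftrightarrow> const_up_to_units (abf G) \<Delta>"
proof -
  obtain m h P where P: "is_presentation (Lambda G) AG m h P"
    and gcd: "is_gcd_of_set (Lambda G) (Idl\<^bsub>Lambda G\<^esub> (minors (Lambda G) (m - 1) h m P)) \<Delta>"
    using assms unfolding is_alexander_polynomial_def elementary_ideal1_def by blast
  define M where "M = minors (Lambda G) (m - 1) h m P"
  have Pc: "\<forall>i<h. \<forall>j<m. P i j \<in> carrier (Lambda G)"
    using P unfolding is_presentation_def by (rule conjunct1)
  have MC: "M \<subseteq> carrier (Lambda G)" unfolding M_def by (rule minors_closed[OF Pc])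
  note gcdM = gcd_of_ideal[OF MC gcd[folded M_def]]
  note \<Delta> = gcdM(1)
  have van: "(\<forall>f\<in>\<Psi> ` M. ev (b1 G) c (emb f) = 0) \<longleftrightarrow> two_crossed c" if "c \<in> torus_points" for c
    using minors_vanish_iff_two_crossed[OF that P] unfolding M_def[symmetric] ch_def by simp
  have V: "pt c \<in> V1 G \<longleftrightarrow> (\<forall>f\<in>\<Psi> ` M. ev (b1 G) c (emb f) = 0) \<or> (b1 G \<ge> 1 \<and> (\<forall>i<b1 G. c i = 1))"
    if "c \<in> torus_points" for c
    unfolding van[OF that] by (rule V1_iff_two_crossed[OF that])
  have fin: "finite (\<Psi> ` M)" unfolding M_def by (rule finite_minors[OF Pc])
  have sub: "\<Psi> ` M \<subseteq> laurent_set {..<b1 G}" using MC \<Psi>_in by blast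
  have dvd1: "dvd_in (laurent_set {..<b1 G}) (\<Psi> \<Delta>) f" if "f \<in> \<Psi> ` M" for f
  proof -
    from that obtain g where g: "f = \<Psi> g" "g \<in> M" by (rule imageE)
    have "g \<in> carrier (Lambda G)" using MC g(2) by (rule subsetD)
    from divides_iff[OF \<Delta> this] show ?thesis unfolding g(1) using gcdM(2)[OF g(2)] by (rule iffD1)
  qed
  have dvd2: "dvd_in (laurent_set {..<b1 G}) e (\<Psi> \<Delta>)"
    if e: "e \<in> laurent_set {..<b1 G}" "\<And>f. f \<in> \<Psi> ` M \<Longrightarrow> dvd_in (laurent_set {..<b1 G}) e f" for e
  proof -
    obtain d where d: "d \<in> carrier (Lambda G)" "\<Psi> d = e" using \<Psi>_surj[OF e(1)] by blast
    have "d divides\<^bsub>Lambda G\<^esub> f" if "f \<in> M" for f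
    proof -
      have "f \<in> carrier (Lambda G)" using MC that by (rule subsetD)
      from divides_iff[OF d(1) this] show ?thesis unfolding d(2) using e(2)[OF imageI[OF that]] by (rule iffD2)
    qed
    from gcdM(3)[OF d(1) this] show ?thesis unfolding divides_iff[OF d(1) \<Delta>] d(2) .
  qed
  have one: "(\<forall>f\<in>\<Psi> ` M. ev (b1 G) (\<lambda>_. 1) (emb f) = 0) \<longleftrightarrow> b1 G \<ge> 2"
  proof -
    have "(\<lambda>_. 1) \<in> torus_points" by (simp add: torus_points_def)
    from van[OF this] show ?thesis using two_crossed_trivial[of "\<lambda>_. 1"] by simp
  qed
  note main = chart.codim_one_part_gcd[of "V1 G" "\<Psi> ` M" "\<Psi> \<Delta>"]
  note prems = V fin sub \<Psi>_in[OF \<Delta>] dvd1 dvd2 one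
  have main1: "\<Psi> \<Delta> = 0 \<longleftrightarrow> chart.T0 \<subseteq> V1 G"
    by (rule main(1); fact prems)
  have main2: "chart.codim_one_part (V1 G) = {}" if "\<Psi> \<Delta> = 0"
    by (rule main(2); fact prems that)
  have main3: "chart.codim_one_part (V1 G) = chart.zeros {emb (\<Psi> \<Delta>)}" if "\<Psi> \<Delta> \<noteq> 0" "b1 G > 1"
    by (rule main(3); fact prems that)
  have main4: "chart.codim_one_part (V1 G) = chart.zeros {emb (\<Psi> \<Delta>)} \<union> {pt (\<lambda>_. 1)}" if "\<Psi> \<Delta> \<noteq> 0" "b1 G = 1"
    by (rule main(4); fact prems that)
  have main5: "chart.zeros {emb (\<Psi> \<Delta>)} \<inter> {pt (\<lambda>_. 1)} = {}" if "b1 G = 1"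
    by (rule main(5); fact prems that)
  have main6: "chart.codim_one_part (V1 G) = {} \<longleftrightarrow> (\<exists>e a. supp e \<subseteq> {..<b1 G} \<and> \<Psi> \<Delta> = term_of e a)" if "b1 G \<ge> 2"
    by (rule main(6); fact prems that)
  have zero: "\<Psi> \<Delta> = 0 \<longleftrightarrow> \<Delta> = 0"
  proof
    assume "\<Psi> \<Delta> = 0"
    then have "\<Psi> \<Delta> = \<Psi> 0" by simp
    then show "\<Delta> = 0" by (rule \<Psi>_inj[OF \<Delta>, rotated]) simp
  qed simp
  show "\<Delta> = 0 \<longleftrightarrow> char_torus0 G \<subseteq> V1 G" using main1 unfolding zero chart_T0 .
  show W0: "W1 G = {}" if "\<Delta> = 0" using main2 that unfolding zero W1_eq by blast
  show W: "W1 G = zero_locus G \<Delta>" if "\<Delta> \<noteq> 0" "b1 G > 1"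
    using main3 that unfolding zero W1_eq zero_locus_eq[OF \<Delta>] by blast
  show "W1 G = zero_locus G \<Delta> \<union> {trivial_char G}" if "\<Delta> \<noteq> 0" "b1 G = 1"
    using main4 that unfolding zero W1_eq zero_locus_eq[OF \<Delta>] trivial_char_eq by blast
  show "zero_locus G \<Delta> \<inter> {trivial_char G} = {}" if "b1 G = 1"
    using main5[OF that] unfolding zero_locus_eq[OF \<Delta>] trivial_char_eq .
  show "W1 G = {} \<longleftrightarrow> const_up_to_units (abf G) \<Delta>" if n: "b1 G \<ge> 2"
  proof
    assume "W1 G = {}"
    then obtain e a where "supp e \<subseteq> {..<b1 G}" "\<Psi> \<Delta> = term_of e a" using main6[OF n] unfolding W1_eq by blast
    then show "const_up_to_units (abf G) \<Delta>" using const_up_to_unitsI \<Delta> by blast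
  next
    assume const: "const_up_to_units (abf G) \<Delta>"
    show "W1 G = {}"
    proof (cases "\<Delta> = 0")
      case False
      have "b1 G > 1" using n by linarith
      from W[OF False this] show ?thesis
        unfolding zero_locus_eq[OF \<Delta>] const_up_to_units_no_zeros[OF const False] .
    qed (rule W0)
  qed
qed

end

theorem corollary3p2:
  fixes G :: "('a, 'b) monoid_scheme" and \<Delta> :: "'a set set \<Rightarrow>\<^sub>0 int"
  assumes "group G" and "finitely_generated G" and "is_alexander_polynomial G \<Delta>"
  shows "((\<Delta> = \<zero>\<^bsub>Lambda G\<^esub> \<longleftrightarrow> char_torus0 G \<subseteq> V1 G) \<and> (\<Delta> = \<zero>\<^bsub>Lambda G\<^esub> \<longrightarrow> W1 G = {})) \<and>
    (b1 G \<ge> 1 \<and> \<Delta> \<noteq> \<zero>\<^bsub>Lambda G\<^esub> \<longrightarrow>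
       (b1 G > 1 \<longrightarrow> W1 G = zero_locus G \<Delta>) \<and>
       (b1 G = 1 \<longrightarrow> W1 G = zero_locus G \<Delta> \<union> {trivial_char G} \<and>
                     zero_locus G \<Delta> \<inter> {trivial_char G} = {})) \<and>
    (b1 G \<ge> 2 \<longrightarrow> (W1 G = {} \<longleftrightarrow> const_up_to_units (abf G) \<Delta>))"
proof -
  interpret fg_group G using assms(1,2) by (simp add: fg_group_def fg_group_axioms_def)
  note * = alexander_polynomial_W1[OF assms(3)]
  show ?thesis unfolding zero_group_ring
    by (intro conjI impI; (elim conjE)?) ((fact * | rule *; assumption)+)
qed

end
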